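(* Let scalars $\{\alpha_i\}_{i=1}^\beta\subset\mathbb R$ be given, and let the system data (no input delays), the functions $g_i(\cdot)=[\phi_i^\top\ \varphi_i^\top\ f_i^\top]^\top$ and matrices $M_i$, $\widehat A_i,\widehat C_i$ ($i\in\mathbb N_\nu$), the matrices $\Gamma_i,\mathfrak H_i,\mathfrak E_i,\mathfrak F_i$ and their Cholesky factors, and the supply rate function $\mathsf s$ with parameters $\widetilde J,J_1,J_2,J_3$ be given as described in the context. Suppose there exist $\acute P_1,X\in\mathbb S^n$, $\acute P_2\in\mathbb R^{n\times dn}$, $\acute P_3\in\mathbb S^{dn}$, $\acute Q_i,\acute R_i\in\mathbb S^n$ ($i\in\mathbb N_\nu$), $V_0\in\mathbb R^{p\times n}$, $V_i\in\mathbb R^{p\times n}$ and $\mathcal V_i\in\mathbb R^{p\times\kappa_in}$ ($i\in\mathbb N_\nu$) such that $$\begin{bmatrix}\acute P_1&\acute P_2\\ *&\acute P_3\end{bmatrix}+\Big[\mathsf O_n\oplus\big(\mathrm{diag}_{i=1}^\nu\, I_{d_i}\otimes\acute Q_i\big)\Big]\succ0,$$ $$\acute{\mathbf Q}=\mathrm{diag}_{i=1}^\nu\acute Q_i\succ0,\qquad\acute{\mathbf R}=\mathrm{diag}_{i=1}^\nu\acute R_i\succ0,$$ $$\mathrm{Sy}\left(\begin{bmatrix}I_n\\ \mathrm{Col}_{i=1}^\beta\,\alpha_iI_n\\ \mathsf O_{(q+m),n}\end{bmatrix}\big[-X\ \ \acute{\boldsymbol\Pi}\big]\right)+\begin{bmatrix}\mathsf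 O_n&\acute{\mathbf P}\\ *&\acute{\boldsymbol\Phi}\end{bmatrix}\prec0,$$ where $$\acute{\mathbf P}=\big[\acute P_1\ \ \mathsf O_{n,\nu n}\ \ \acute P_2\widehat I\ \ \mathsf O_{n,(\mu n+q+m)}\big],\qquad \acute{\boldsymbol\Pi}=\big[\mathbf A[(I_\beta\otimes X)\oplus I_q]+B_0\boldsymbol V\ \ \ \mathsf O_{n,m}\big],$$ $$\acute{\boldsymbol\Sigma}=\mathbf C[(I_\beta\otimes X)\oplus I_q]+\mathfrak B_0\boldsymbol V,\qquad \acute{\boldsymbol\Phi}=\boldsymbol\Phi(\acute P_2,\acute P_3,\acute{\mathbf Q},\acute{\mathbf R},\acute{\boldsymbol\Sigma}),$$ $$\boldsymbol V=\big[\mathrm{Row}_{i=0}^\nu V_i\ \ \mathrm{Row}_{i=1}^\nu\mathcal V_i(T_i\otimes I_n)\ \ \mathrm{Row}_{i=1}^\nu\mathcal V_i(\widetilde T_i\otimes I_n)\ \ \mathsf O_{p,q}\big],$$ with $\widehat I$ and the map $\boldsymbol\Phi$ defined in the context. Then, with controller gains $K_0=V_0X^{-1}$, $K_i=V_iX^{-1}$ and $\mathcal K_i=\mathcal V_i(I_{\kappa_i}\otimes X^{-1})$ for $i\in\mathbb N_\nu$, the closed-loop system (defined in the context) with supply rate $\mathsf s$ is dissipative and the trivial solution of the closed-loop system with $w(t)\equiv\mathbf 0_q$ is exponentially stable. Moreover, the number of scalar unknowns in these conditions is $(0.5d^2+d+\nu+1)n^2+(0.5d+\nu+1+\beta p)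n$.
   Context: **Notation.** $\mathbb N_\nu=\{1,\dots,\nu\}$; $\mathbb S^n$: real symmetric $n\times n$ matrices; $\mathrm{Sy}(X)=X+X^\top$; $X\oplus Y$ is the block-diagonal matrix with blocks $X,Y$ and $\mathrm{diag}_{i=1}^\nu X_i=X_1\oplus\dots\oplus X_\nu$ (blocks may be rectangular); $\otimes$ is the Kronecker product; $\mathrm{Row}_{i=a}^{b}X_i=[X_a\cdots X_b]$ and $\mathrm{Col}_{i=a}^{b}X_i=[X_a^\top\cdots X_b^\top]^\top$; $*$ denotes a block determined by symmetry; $\mathsf O_{n,m}$ is the $n\times m$ zero matrix, $\mathsf O_n=\mathsf O_{n,n}$, $\mathbf 0_n$ the $n\times1$ zero vector. Matrix products bind tighter than $\otimes$, which binds tighter than $\oplus,\mathrm{diag}$. Empty matrices (zero rows or columns) are allowed, with the usual conventions; blocks of zero size are absent. $L^2(\mathcal X;\cdot)$ is the space of measurable square-integrable functions; $W^{1,2}(\mathcal X;\mathbb R^d)$ is the space of $L^2$ functions with weak derivative in $L^2$ (evaluated pointwise via the continuous representative). **Data.** $n,m,p,q,\nu\in\mathbb N$; $0=r_0<r_1<\dots<r_\nu=r$; $\mathcal J=[-r,0]$; $\mathcal I_i=[-r_i,-r_{i-1}]$; $t_0\in\mathbb R$. Constant matrices $A_i\in\mathbb R^{n\times n}$, $C_i\in\mathbb R^{m\times n}$ ($i=0,\dots,\nu$), $B_0\in\mathbb R^{n\times p}$, $\mathfrak B_0\in\mathbb R^{m\times p}$, $D_1\in\mathbb R^{n\times q}$,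 $D_2\in\mathbb R^{m\times q}$, and kernels $\widetilde A_i\in L^2(\mathcal I_i;\mathbb R^{n\times n})$, $\widetilde C_i\in L^2(\mathcal I_i;\mathbb R^{m\times n})$ ($i\in\mathbb N_\nu$). The open-loop system (no input delays) is, for almost all $t\ge t_0$, $\dot x(t)=\sum_{i=0}^\nu A_ix(t-r_i)+\sum_{i=1}^\nu\int_{\mathcal I_i}\widetilde A_i(\tau)x(t+\tau)\mathrm d\tau+B_0u(t)+D_1w(t)$, $z(t)=\sum_{i=0}^\nu C_ix(t-r_i)+\sum_{i=1}^\nu\int_{\mathcal I_i}\widetilde C_i(\tau)x(t+\tau)\mathrm d\tau+\mathfrak B_0u(t)+D_2w(t)$. **Kernel decomposition.** For each $i\in\mathbb N_\nu$ let $d_i\in\mathbb N$, $\delta_i,\mu_i\in\mathbb N\cup\{0\}$, $\varkappa_i=d_i+\delta_i$, $\kappa_i=d_i+\delta_i+\mu_i$, and $f_i\in W^{1,2}(\mathcal I_i;\mathbb R^{d_i})$, $\varphi_i\in L^2(\mathcal I_i;\mathbb R^{\delta_i})$, $\phi_i\in L^2(\mathcal I_i;\mathbb R^{\mu_i})$, $h_i=\begin{bmatrix}\varphi_i\\ f_i\end{bmatrix}$, $g_i=\begin{bmatrix}\phi_i\\ h_i\end{bmatrix}$, $M_i\in\mathbb R^{d_i\times\varkappa_i}$ satisfy $\frac{\mathrm d f_i(\tau)}{\mathrm d\tau}=M_ih_i(\tau)$ (weak derivative) and $\int_{\mathcal I_i}g_i(\tau)g_i^\top(\tau)\,\mathrm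 d\tau\succ0$, and let $\widehat A_i\in\mathbb R^{n\times\kappa_in}$, $\widehat C_i\in\mathbb R^{m\times\kappa_in}$ satisfy on $\mathcal I_i$: $\widetilde A_i(\tau)=\widehat A_i(g_i(\tau)\otimes I_n)$, $\widetilde C_i(\tau)=\widehat C_i(g_i(\tau)\otimes I_n)$. Put $\mathfrak F_i=\int_{\mathcal I_i}f_if_i^\top\mathrm d\tau$, $\mathfrak H_i=\int_{\mathcal I_i}h_ih_i^\top\mathrm d\tau$, $\Gamma_i=\int_{\mathcal I_i}\phi_ih_i^\top\mathrm d\tau$, $\varepsilon_i(\tau)=\phi_i(\tau)-\Gamma_i\mathfrak H_i^{-1}h_i(\tau)$, $\mathfrak E_i=\int_{\mathcal I_i}\varepsilon_i\varepsilon_i^\top\mathrm d\tau$; these Gram matrices are positive definite, with lower-triangular Cholesky factorizations $\mathfrak F_i=\mathfrak L_{f_i}\mathfrak L_{f_i}^\top$, $\mathfrak H_i=\mathfrak L_{h_i}\mathfrak L_{h_i}^\top$, $\mathfrak E_i=\mathfrak L_{\varepsilon_i}\mathfrak L_{\varepsilon_i}^\top$. Put $T_i=\begin{bmatrix}\Gamma_i\mathfrak H_i^{-1}\\ I_{\varkappa_i}\end{bmatrix}\mathfrak L_{h_i}$, $\widetilde T_i=\begin{bmatrix}I_{\mu_i}\\ \mathsf O_{\varkappa_i,\mu_i}\end{bmatrix}\mathfrak L_{\varepsilon_i}$. Let $d=\sum_i d_i$, $\varkappa=\sum_i\varkappa_i$, $\mu=\sum_i\mu_i$, $\kappa=\sum_i\kappa_i$,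 $\beta=1+\nu+\kappa$. **Closed-loop system with controller parameters $K_0,K_i\in\mathbb R^{p\times n}$, $\mathcal K_i\in\mathbb R^{p\times\kappa_in}$.** The controller is $u(t)=\sum_{i=0}^\nu K_ix(t-r_i)+\sum_{i=1}^\nu\int_{\mathcal I_i}\widetilde K_i(\tau)x(t+\tau)\mathrm d\tau$ with $\widetilde K_i(\tau)=\mathcal K_i(g_i(\tau)\otimes I_n)$. The closed loop is, equivalently, $\dot x(t)=(\mathbf A+B_0\boldsymbol K)\vartheta(t)$, $z(t)=(\mathbf C+\mathfrak B_0\boldsymbol K)\vartheta(t)$ for almost all $t\ge t_0$, with $x(t_0+\theta)=\psi(\theta)$ for $\theta\in\mathcal J$, $\psi\in C(\mathcal J;\mathbb R^n)$, disturbance $w\in L^2(\mathbb R_{\ge t_0};\mathbb R^q)$, solutions absolutely continuous for $t\ge t_0$ (Carathéodory sense), where $\mathbf A=[\mathrm{Row}_{i=0}^\nu A_i\ \ \mathrm{Row}_{i=1}^\nu\widehat A_i(T_i\otimes I_n)\ \ \mathrm{Row}_{i=1}^\nu\widehat A_i(\widetilde T_i\otimes I_n)\ \ D_1]$, $\mathbf C=[\mathrm{Row}_{i=0}^\nu C_i\ \ \mathrm{Row}_{i=1}^\nu\widehat C_i(T_i\otimes I_n)\ \ \mathrm{Row}_{i=1}^\nu\widehat C_i(\widetilde T_i\otimes I_n)\ \ D_2]$, $\boldsymbol K=[\mathrm{Row}_{i=0}^\nu K_i\ \ \mathrm{Row}_{i=1}^\nu\mathcal K_i(T_i\otimes I_n)\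 \ \mathrm{Row}_{i=1}^\nu\mathcal K_i(\widetilde T_i\otimes I_n)\ \ \mathsf O_{p,q}]$, $\vartheta(t)=\mathrm{Col}\big(\mathrm{Col}_{i=0}^\nu x(t-r_i),\ \mathrm{Col}_{i=1}^\nu\int_{\mathcal I_i}(\mathfrak L_{h_i}^{-1}h_i(\tau)\otimes I_n)x(t+\tau)\mathrm d\tau,\ \mathrm{Col}_{i=1}^\nu\int_{\mathcal I_i}(\mathfrak L_{\varepsilon_i}^{-1}\varepsilon_i(\tau)\otimes I_n)x(t+\tau)\mathrm d\tau,\ w(t)\big)$. **Supply rate.** $\mathsf s(z,w)=\begin{bmatrix}z\\ w\end{bmatrix}^\top\begin{bmatrix}\widetilde J^\top J_1^{-1}\widetilde J&J_2\\ *&J_3\end{bmatrix}\begin{bmatrix}z\\ w\end{bmatrix}$ with $\widetilde J\in\mathbb R^{m\times m}$, $J_1\in\mathbb S^m$, $J_1^{-1}\prec0$, $\widetilde J^\top J_1^{-1}\widetilde J\preceq 0$, $J_2\in\mathbb R^{m\times q}$, $J_3\in\mathbb S^q$. **Auxiliary matrices.** $\widehat I=\big(\mathrm{diag}_{i=1}^\nu \mathfrak L_{f_i}^{-1}[\mathsf O_{d_i,\delta_i}\ \ I_{d_i}]\,\mathfrak L_{h_i}\big)\otimes I_n$; $\Lambda=\mathrm{diag}_{i=1}^\nu (r_i-r_{i-1})I_n$; $\mathbf M=\big[\mathrm{diag}_{i=1}^\nu\mathfrak L_{f_i}^{-1}f_i(-r_{i-1})\ \ \mathbf 0_d\ \ \mathsf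 O_{d,\varkappa}\big]-\big[\mathbf 0_d\ \ \mathrm{diag}_{i=1}^\nu\mathfrak L_{f_i}^{-1}f_i(-r_i)\ \ \mathrm{diag}_{i=1}^\nu\mathfrak L_{f_i}^{-1}M_i\mathfrak L_{h_i}\big]$. For $P_2\in\mathbb R^{n\times dn}$, $P_3\in\mathbb S^{dn}$, $\mathbf Q=\mathrm{diag}_{i=1}^\nu Q_i$, $\mathbf R=\mathrm{diag}_{i=1}^\nu R_i$ with $Q_i,R_i\in\mathbb S^n$, and $\boldsymbol\Sigma\in\mathbb R^{m\times(\beta n+q)}$, $$\Xi(\mathbf Q,\mathbf R)=\big[(\mathbf Q+\mathbf R\Lambda)\oplus\mathsf O_n\oplus\mathsf O_{\kappa n}\oplus\mathsf O_q\big]-\big[\mathsf O_n\oplus\mathbf Q\oplus(\mathrm{diag}_{i=1}^\nu I_{\varkappa_i}\otimes R_i)\oplus(\mathrm{diag}_{i=1}^\nu I_{\mu_i}\otimes R_i)\oplus J_3\big],$$ $$\boldsymbol\Phi(P_2,P_3,\mathbf Q,\mathbf R,\boldsymbol\Sigma)=\mathrm{Sy}\left(\begin{bmatrix}P_2\\ \mathsf O_{\nu n,dn}\\ \widehat I^\top P_3\\ \mathsf O_{(\mu n+q+m),dn}\end{bmatrix}\big[\mathbf M\otimes I_n\ \ \mathsf O_{dn,(\mu n+q+m)}\big]+\begin{bmatrix}\mathsf O_{(\beta n),m}\\ -J_2^\top\\ \widetilde J\end{bmatrix}\big[\boldsymbol\Sigma\ \ \mathsf O_m\big]\right)+[\Xi(\mathbf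 Q,\mathbf R)\oplus J_1].$$ **Dissipativity.** The closed-loop system with supply rate $\mathsf s$ is dissipative if there is $\mathsf v\in C^1(C(\mathcal J;\mathbb R^n);\mathbb R)$ such that $\frac{\mathrm d}{\mathrm dt}\mathsf v(\mathsf x_t(\cdot))-\mathsf s(z(t),w(t))\le0$ for almost all $t\ge t_0$ along its trajectories, where $\mathsf x_t(\theta)=x(t+\theta)$, $\theta\in\mathcal J$. **Exponential stability** of the trivial solution has its usual meaning for functional differential equations, with initial functions in $C(\mathcal J;\mathbb R^n)$ and the sup norm. *)

theory Defs
  imports "HOL-Analysis.Analysis"
    "Jordan_Normal_Form.VS_Connect"
    "Jordan_Normal_Form.Gauss_Jordan_Elimination"
begin

hide_type (open) Finite_Cartesian_Product.vec
hide_const (open) Finite_Cartesian_Product.vec Finite_Cartesian_Product.mat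
  Finite_Cartesian_Product.row Finite_Cartesian_Product.rows
unbundle no vec_syntax
unbundle no inner_syntax

section \<open>Matrices\<close>

definition sym_mats :: "nat \<Rightarrow> real mat set" where
  "sym_mats k = {A \<in> carrier_mat k k. A\<^sup>T = A}"

definition pos_def :: "real mat \<Rightarrow> bool" where
  "pos_def A \<longleftrightarrow> A \<in> sym_mats (dim_row A) \<and>
     (\<forall>v \<in> carrier_vec (dim_row A). v \<noteq> 0\<^sub>v (dim_row A) \<longrightarrow> v \<bullet> (A *\<^sub>v v) > 0)"

definition neg_def :: "real mat \<Rightarrow> bool" where
  "neg_def A \<longleftrightarrow> A \<in> sym_mats (dim_row A) \<and>
     (\<forall>v \<in> carrier_vec (dim_row A). v \<noteq> 0\<^sub>v (dim_row A) \<longrightarrow> v \<bullet> (A *\<^sub>v v) < 0)"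

definition neg_semidef :: "real mat \<Rightarrow> bool" where
  "neg_semidef A \<longleftrightarrow> A \<in> sym_mats (dim_row A) \<and>
     (\<forall>v \<in> carrier_vec (dim_row A). v \<bullet> (A *\<^sub>v v) \<le> 0)"

definition Sy :: "real mat \<Rightarrow> real mat" where
  "Sy A = A + A\<^sup>T"

text \<open>The value is meaningful for invertible matrices only; the empty matrix is invertible.\<close>

definition minv :: "real mat \<Rightarrow> real mat" where
  "minv A = the (mat_inverse A)"

definition kron :: "real mat \<Rightarrow> real mat \<Rightarrow> real mat" (infixl \<open>\<otimes>\<^sub>k\<close> 70) where
  "A \<otimes>\<^sub>k B = mat (dim_row A * dim_row B) (dim_col A * dim_col B)
     (\<lambda>(i, j). A $$ (i div dim_row B, j div dim_col B) * B $$ (i mod dim_row B, j mod dim_col B))"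

text \<open>Horizontal and vertical concatenation of a nonempty list of blocks. The row count of
  \<^term>\<open>row_blk As\<close> and the column count of \<^term>\<open>col_blk As\<close> are those of the first block, so
  blocks with no columns (resp. no rows) are allowed.\<close>

definition row_blk :: "real mat list \<Rightarrow> real mat" where
  "row_blk As =
     foldr (\<lambda>A B. four_block_mat A B (0\<^sub>m 0 (dim_col A)) (0\<^sub>m 0 (dim_col B))) As (0\<^sub>m 0 0)"

definition col_blk :: "real mat list \<Rightarrow> real mat" where
  "col_blk As = foldr (@\<^sub>r) As (0\<^sub>m 0 0)"

definition col_mat :: "real vec \<Rightarrow> real mat" where
  "col_mat v = mat_of_cols (dim_vec v) [v]"

definition is_cholesky :: "real mat \<Rightarrow> real mat \<Rightarrow> bool" where
  "is_cholesky A L \<longleftrightarrow> L \<in> carrier_mat (dim_row A) (dim_row A) \<and> upper_triangular L\<^sup>T \<and>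
     (\<forall>j < dim_row A. L $$ (j, j) > 0) \<and> A = L * L\<^sup>T"

section \<open>Function spaces\<close>

definition L2_scalar :: "real set \<Rightarrow> (real \<Rightarrow> real) \<Rightarrow> bool" where
  "L2_scalar I F \<longleftrightarrow> F \<in> borel_measurable (lebesgue_on I) \<and>
     integrable (lebesgue_on I) (\<lambda>t. (F t)\<^sup>2)"

definition L2_vec :: "real set \<Rightarrow> nat \<Rightarrow> (real \<Rightarrow> real vec) \<Rightarrow> bool" where
  "L2_vec I k F \<longleftrightarrow> (\<forall>t\<in>I. F t \<in> carrier_vec k) \<and> (\<forall>j<k. L2_scalar I (\<lambda>t. F t $ j))"

definition L2_mat :: "real set \<Rightarrow> nat \<Rightarrow> nat \<Rightarrow> (real \<Rightarrow> real mat) \<Rightarrow> bool" where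
  "L2_mat I k l F \<longleftrightarrow> (\<forall>t\<in>I. F t \<in> carrier_mat k l) \<and>
     (\<forall>i<k. \<forall>j<l. L2_scalar I (\<lambda>t. F t $$ (i, j)))"

definition vec_int :: "real set \<Rightarrow> nat \<Rightarrow> (real \<Rightarrow> real vec) \<Rightarrow> real vec" where
  "vec_int I k F = vec k (\<lambda>j. LINT t|lebesgue_on I. F t $ j)"

definition mat_int :: "real set \<Rightarrow> nat \<Rightarrow> nat \<Rightarrow> (real \<Rightarrow> real mat) \<Rightarrow> real mat" where
  "mat_int I k l F = mat k l (\<lambda>ij. LINT t|lebesgue_on I. F t $$ ij)"

text \<open>Weak derivative on the interval from \<open>a\<close> to \<open>b\<close>; the test functions are the continuously
  differentiable functions whose support is a compact subset of the open interval.\<close>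

definition weak_deriv :: "real \<Rightarrow> real \<Rightarrow> (real \<Rightarrow> real) \<Rightarrow> (real \<Rightarrow> real) \<Rightarrow> bool" where
  "weak_deriv a b F G \<longleftrightarrow>
     (\<forall>\<eta> \<eta>'. (\<forall>t. (\<eta> has_real_derivative \<eta>' t) (at t)) \<longrightarrow> continuous_on UNIV \<eta>' \<longrightarrow>
        (\<exists>c e. a < c \<and> c \<le> e \<and> e < b \<and> (\<forall>t. t \<notin> {c..e} \<longrightarrow> \<eta> t = 0)) \<longrightarrow>
        (LINT t|lebesgue_on {a..b}. F t * \<eta>' t) = - (LINT t|lebesgue_on {a..b}. G t * \<eta> t))"

definition weak_deriv_vec ::
  "real \<Rightarrow> real \<Rightarrow> nat \<Rightarrow> (real \<Rightarrow> real vec) \<Rightarrow> (real \<Rightarrow> real vec) \<Rightarrow> bool" where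
  "weak_deriv_vec a b k F G \<longleftrightarrow> (\<forall>j<k. weak_deriv a b (\<lambda>t. F t $ j) (\<lambda>t. G t $ j))"

text \<open>The continuity clause says that \<open>F\<close> itself is the continuous representative of its class,
  so that its values at the endpoints make sense.\<close>

definition W12_vec :: "real \<Rightarrow> real \<Rightarrow> nat \<Rightarrow> (real \<Rightarrow> real vec) \<Rightarrow> bool" where
  "W12_vec a b k F \<longleftrightarrow> L2_vec {a..b} k F \<and> (\<forall>j<k. continuous_on {a..b} (\<lambda>t. F t $ j)) \<and>
     (\<exists>G. L2_vec {a..b} k G \<and> weak_deriv_vec a b k F G)"

definition abs_cont_on :: "real \<Rightarrow> real \<Rightarrow> (real \<Rightarrow> real) \<Rightarrow> bool" where
  "abs_cont_on a b F \<longleftrightarrow>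
     (\<forall>\<epsilon>>0. \<exists>\<delta>>0. \<forall>D. finite D \<longrightarrow> (\<forall>(c, e)\<in>D. a \<le> c \<and> c \<le> e \<and> e \<le> b) \<longrightarrow>
        pairwise (\<lambda>(c, e) (c', e'). {c<..<e} \<inter> {c'<..<e'} = {}) D \<longrightarrow>
        (\<Sum>(c, e)\<in>D. e - c) < \<delta> \<longrightarrow> (\<Sum>(c, e)\<in>D. \<bar>F e - F c\<bar>) < \<epsilon>)"

definition vnorm :: "real vec \<Rightarrow> real" where
  "vnorm v = sqrt (v \<bullet> v)"

text \<open>The Banach space of continuous functions from \<open>[-r, 0]\<close> to \<open>k\<close>-vectors with the sup norm.
  Its elements are extensional functions, so that a functional on it cannot see values
  outside of \<open>[-r, 0]\<close>.\<close>

definition hist :: "real \<Rightarrow> nat \<Rightarrow> (real \<Rightarrow> real vec) set" where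
  "hist r k = {\<chi> \<in> {-r..0} \<rightarrow>\<^sub>E carrier_vec k. \<forall>j<k. continuous_on {-r..0} (\<lambda>\<theta>. \<chi> \<theta> $ j)}"

definition hist_norm :: "real \<Rightarrow> (real \<Rightarrow> real vec) \<Rightarrow> real" where
  "hist_norm r \<chi> = (SUP \<theta>\<in>{-r..0}. vnorm (\<chi> \<theta>))"

definition hist_add ::
  "real \<Rightarrow> (real \<Rightarrow> real vec) \<Rightarrow> (real \<Rightarrow> real vec) \<Rightarrow> real \<Rightarrow> real vec" where
  "hist_add r \<chi> \<xi> = (\<lambda>\<theta>\<in>{-r..0}. \<chi> \<theta> + \<xi> \<theta>)"

definition hist_smult :: "real \<Rightarrow> real \<Rightarrow> (real \<Rightarrow> real vec) \<Rightarrow> real \<Rightarrow> real vec" where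
  "hist_smult r c \<chi> = (\<lambda>\<theta>\<in>{-r..0}. c \<cdot>\<^sub>v \<chi> \<theta>)"

definition bounded_functional ::
  "real \<Rightarrow> nat \<Rightarrow> ((real \<Rightarrow> real vec) \<Rightarrow> real) \<Rightarrow> bool" where
  "bounded_functional r k L \<longleftrightarrow>
     (\<forall>\<chi>\<in>hist r k. \<forall>\<xi>\<in>hist r k. L (hist_add r \<chi> \<xi>) = L \<chi> + L \<xi>) \<and>
     (\<forall>c. \<forall>\<chi>\<in>hist r k. L (hist_smult r c \<chi>) = c * L \<chi>) \<and>
     (\<exists>B. \<forall>\<chi>\<in>hist r k. \<bar>L \<chi>\<bar> \<le> B * hist_norm r \<chi>)"

text \<open>Continuously Frechet differentiable functionals; the derivative is continuous with
  respect to the operator norm.\<close>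

definition C1_functional ::
  "real \<Rightarrow> nat \<Rightarrow> ((real \<Rightarrow> real vec) \<Rightarrow> real) \<Rightarrow> bool" where
  "C1_functional r k v \<longleftrightarrow>
     (\<exists>Dv. (\<forall>\<chi>\<in>hist r k. bounded_functional r k (Dv \<chi>)) \<and>
       (\<forall>\<chi>\<in>hist r k. \<forall>\<epsilon>>0. \<exists>\<delta>>0. \<forall>\<xi>\<in>hist r k. hist_norm r \<xi> < \<delta> \<longrightarrow>
          \<bar>v (hist_add r \<chi> \<xi>) - v \<chi> - Dv \<chi> \<xi>\<bar> \<le> \<epsilon> * hist_norm r \<xi>) \<and>
       (\<forall>\<chi>\<in>hist r k. \<forall>\<epsilon>>0. \<exists>\<delta>>0. \<forall>\<omega>\<in>hist r k. hist_norm r \<omega> < \<delta> \<longrightarrow>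
          (\<forall>\<xi>\<in>hist r k. \<bar>Dv (hist_add r \<chi> \<omega>) \<xi> - Dv \<chi> \<xi>\<bar> \<le> \<epsilon> * hist_norm r \<xi>)))"

section \<open>System data\<close>

text \<open>Sequences indexed from \<open>1\<close> (or from \<open>0\<close>, for \<open>r\<close>, \<open>A\<close>, \<open>C\<close>) to the number of delays are
  functions on \<^typ>\<open>nat\<close> whose other values are irrelevant.\<close>

record delay_data =
  dim_x :: nat
  dim_z :: nat
  dim_u :: nat
  dim_w :: nat
  num_delays :: nat
  delay :: "nat \<Rightarrow> real"
  t_init :: real
  A_mat :: "nat \<Rightarrow> real mat"
  C_mat :: "nat \<Rightarrow> real mat"
  Bx_mat :: "real mat"
  Bz_mat :: "real mat"
  D1_mat :: "real mat"
  D2_mat :: "real mat"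
  A_ker :: "nat \<Rightarrow> real \<Rightarrow> real mat"
  C_ker :: "nat \<Rightarrow> real \<Rightarrow> real mat"
  f_dim :: "nat \<Rightarrow> nat"
  varphi_dim :: "nat \<Rightarrow> nat"
  phi_dim :: "nat \<Rightarrow> nat"
  f_fun :: "nat \<Rightarrow> real \<Rightarrow> real vec"
  varphi_fun :: "nat \<Rightarrow> real \<Rightarrow> real vec"
  phi_fun :: "nat \<Rightarrow> real \<Rightarrow> real vec"
  M_mat :: "nat \<Rightarrow> real mat"
  A_hat :: "nat \<Rightarrow> real mat"
  C_hat :: "nat \<Rightarrow> real mat"
  chol_f :: "nat \<Rightarrow> real mat"
  chol_h :: "nat \<Rightarrow> real mat"
  chol_e :: "nat \<Rightarrow> real mat"
  J_tilde :: "real mat"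
  J1_mat :: "real mat"
  J2_mat :: "real mat"
  J3_mat :: "real mat"

context
  fixes S :: delay_data
begin

private abbreviation (input) n where "n \<equiv> dim_x S"
private abbreviation (input) m where "m \<equiv> dim_z S"
private abbreviation (input) p where "p \<equiv> dim_u S"
private abbreviation (input) q where "q \<equiv> dim_w S"
private abbreviation (input) \<nu> where "\<nu> \<equiv> num_delays S"
private abbreviation (input) r where "r \<equiv> delay S"
private abbreviation (input) t\<^sub>0 where "t\<^sub>0 \<equiv> t_init S"
private abbreviation (input) d where "d \<equiv> f_dim S"
private abbreviation (input) \<delta> where "\<delta> \<equiv> varphi_dim S"
private abbreviation (input) \<mu> where "\<mu> \<equiv> phi_dim S"
private abbreviation (input) f where "f \<equiv> f_fun S"
private abbreviation (input) \<phi> where "\<phi> \<equiv> phi_fun S"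
private abbreviation (input) L\<^sub>f where "L\<^sub>f \<equiv> chol_f S"
private abbreviation (input) L\<^sub>h where "L\<^sub>h \<equiv> chol_h S"
private abbreviation (input) L\<^sub>e where "L\<^sub>e \<equiv> chol_e S"

definition Ivl :: "nat \<Rightarrow> real set" where
  "Ivl i = {- r i .. - r (i - 1)}"

definition h_dim :: "nat \<Rightarrow> nat" where
  "h_dim i = d i + \<delta> i"

definition g_dim :: "nat \<Rightarrow> nat" where
  "g_dim i = d i + \<delta> i + \<mu> i"

definition h_fun :: "nat \<Rightarrow> real \<Rightarrow> real vec" where
  "h_fun i \<tau> = varphi_fun S i \<tau> @\<^sub>v f i \<tau>"

definition g_fun :: "nat \<Rightarrow> real \<Rightarrow> real vec" where
  "g_fun i \<tau> = \<phi> i \<tau> @\<^sub>v h_fun i \<tau>"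

definition d_tot :: nat where "d_tot = (\<Sum>i=1..\<nu>. d i)"
definition h_tot :: nat where "h_tot = (\<Sum>i=1..\<nu>. h_dim i)"
definition mu_tot :: nat where "mu_tot = (\<Sum>i=1..\<nu>. \<mu> i)"
definition g_tot :: nat where "g_tot = (\<Sum>i=1..\<nu>. g_dim i)"
definition \<beta> :: nat where "\<beta> = 1 + \<nu> + g_tot"

definition Gram_f :: "nat \<Rightarrow> real mat" where
  "Gram_f i = mat_int (Ivl i) (d i) (d i) (\<lambda>\<tau>. col_mat (f i \<tau>) * (col_mat (f i \<tau>))\<^sup>T)"

definition Gram_h :: "nat \<Rightarrow> real mat" where
  "Gram_h i = mat_int (Ivl i) (h_dim i) (h_dim i)
     (\<lambda>\<tau>. col_mat (h_fun i \<tau>) * (col_mat (h_fun i \<tau>))\<^sup>T)"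

definition Gram_g :: "nat \<Rightarrow> real mat" where
  "Gram_g i = mat_int (Ivl i) (g_dim i) (g_dim i)
     (\<lambda>\<tau>. col_mat (g_fun i \<tau>) * (col_mat (g_fun i \<tau>))\<^sup>T)"

definition \<Gamma> :: "nat \<Rightarrow> real mat" where
  "\<Gamma> i = mat_int (Ivl i) (\<mu> i) (h_dim i) (\<lambda>\<tau>. col_mat (\<phi> i \<tau>) * (col_mat (h_fun i \<tau>))\<^sup>T)"

definition e_fun :: "nat \<Rightarrow> real \<Rightarrow> real vec" where
  "e_fun i \<tau> = \<phi> i \<tau> - (\<Gamma> i * minv (Gram_h i)) *\<^sub>v h_fun i \<tau>"

definition Gram_e :: "nat \<Rightarrow> real mat" where
  "Gram_e i = mat_int (Ivl i) (\<mu> i) (\<mu> i) (\<lambda>\<tau>. col_mat (e_fun i \<tau>) * (col_mat (e_fun i \<tau>))\<^sup>T)"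

definition system_matrices :: bool where
  "system_matrices \<longleftrightarrow>
     1 \<le> n \<and> 1 \<le> m \<and> 1 \<le> p \<and> 1 \<le> q \<and> 1 \<le> \<nu> \<and>
     r 0 = 0 \<and> (\<forall>i<\<nu>. r i < r (Suc i)) \<and>
     (\<forall>i\<in>{0..\<nu>}. A_mat S i \<in> carrier_mat n n \<and> C_mat S i \<in> carrier_mat m n) \<and>
     Bx_mat S \<in> carrier_mat n p \<and> Bz_mat S \<in> carrier_mat m p \<and>
     D1_mat S \<in> carrier_mat n q \<and> D2_mat S \<in> carrier_mat m q \<and>
     (\<forall>i\<in>{1..\<nu>}. L2_mat (Ivl i) n n (A_ker S i) \<and> L2_mat (Ivl i) m n (C_ker S i))"

definition kernel_decomposition :: bool where
  "kernel_decomposition \<longleftrightarrow>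
     (\<forall>i\<in>{1..\<nu>}.
        1 \<le> d i \<and>
        W12_vec (- r i) (- r (i - 1)) (d i) (f i) \<and>
        L2_vec (Ivl i) (\<delta> i) (varphi_fun S i) \<and>
        L2_vec (Ivl i) (\<mu> i) (\<phi> i) \<and>
        M_mat S i \<in> carrier_mat (d i) (h_dim i) \<and>
        weak_deriv_vec (- r i) (- r (i - 1)) (d i) (f i) (\<lambda>\<tau>. M_mat S i *\<^sub>v h_fun i \<tau>) \<and>
        pos_def (Gram_g i) \<and>
        A_hat S i \<in> carrier_mat n (g_dim i * n) \<and>
        C_hat S i \<in> carrier_mat m (g_dim i * n) \<and>
        (AE \<tau> in lebesgue_on (Ivl i).
           A_ker S i \<tau> = A_hat S i * (col_mat (g_fun i \<tau>) \<otimes>\<^sub>k 1\<^sub>m n) \<and>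
           C_ker S i \<tau> = C_hat S i * (col_mat (g_fun i \<tau>) \<otimes>\<^sub>k 1\<^sub>m n)))"

definition cholesky_factors :: bool where
  "cholesky_factors \<longleftrightarrow>
     (\<forall>i\<in>{1..\<nu>}. is_cholesky (Gram_f i) (L\<^sub>f i) \<and> is_cholesky (Gram_h i) (L\<^sub>h i) \<and>
        is_cholesky (Gram_e i) (L\<^sub>e i))"

definition supply_parameters :: bool where
  "supply_parameters \<longleftrightarrow>
     J_tilde S \<in> carrier_mat m m \<and> J1_mat S \<in> sym_mats m \<and> invertible_mat (J1_mat S) \<and>
     neg_def (minv (J1_mat S)) \<and> neg_semidef ((J_tilde S)\<^sup>T * minv (J1_mat S) * J_tilde S) \<and>
     J2_mat S \<in> carrier_mat m q \<and> J3_mat S \<in> sym_mats q"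

definition supply_rate :: "real vec \<Rightarrow> real vec \<Rightarrow> real" where
  "supply_rate z w = (z @\<^sub>v w) \<bullet>
     (four_block_mat ((J_tilde S)\<^sup>T * minv (J1_mat S) * J_tilde S) (J2_mat S)
        (J2_mat S)\<^sup>T (J3_mat S) *\<^sub>v (z @\<^sub>v w))"

section \<open>The closed loop\<close>

text \<open>Below, \<open>K i\<close> (\<open>0 \<le> i \<le> \<nu>\<close>) and \<open>Kd i\<close> (\<open>1 \<le> i \<le> \<nu>\<close>) are the gains of the controller for the
  pointwise and the distributed delays. The closed loop is the open-loop system with this
  controller as its input.\<close>

definition K_ker :: "(nat \<Rightarrow> real mat) \<Rightarrow> nat \<Rightarrow> real \<Rightarrow> real mat" where
  "K_ker Kd i \<tau> = Kd i * (col_mat (g_fun i \<tau>) \<otimes>\<^sub>k 1\<^sub>m n)"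

definition delay_term ::
  "nat \<Rightarrow> (nat \<Rightarrow> real mat) \<Rightarrow> (nat \<Rightarrow> real \<Rightarrow> real mat) \<Rightarrow> (real \<Rightarrow> real vec) \<Rightarrow> real \<Rightarrow> real vec"
where
  "delay_term k F G x t =
     finsum_vec TYPE(real) k (\<lambda>i. F i *\<^sub>v x (t - r i)) {0..\<nu>} +
     finsum_vec TYPE(real) k (\<lambda>i. vec_int (Ivl i) k (\<lambda>\<tau>. G i \<tau> *\<^sub>v x (t + \<tau>))) {1..\<nu>}"

definition control ::
  "(nat \<Rightarrow> real mat) \<Rightarrow> (nat \<Rightarrow> real mat) \<Rightarrow> (real \<Rightarrow> real vec) \<Rightarrow> real \<Rightarrow> real vec" where
  "control K Kd x t = delay_term p K (K_ker Kd) x t"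

definition state_rhs ::
  "(nat \<Rightarrow> real mat) \<Rightarrow> (nat \<Rightarrow> real mat) \<Rightarrow> (real \<Rightarrow> real vec) \<Rightarrow> (real \<Rightarrow> real vec) \<Rightarrow>
   real \<Rightarrow> real vec" where
  "state_rhs K Kd w x t =
     delay_term n (A_mat S) (A_ker S) x t + Bx_mat S *\<^sub>v control K Kd x t + D1_mat S *\<^sub>v w t"

definition output_rhs ::
  "(nat \<Rightarrow> real mat) \<Rightarrow> (nat \<Rightarrow> real mat) \<Rightarrow> (real \<Rightarrow> real vec) \<Rightarrow> (real \<Rightarrow> real vec) \<Rightarrow>
   real \<Rightarrow> real vec" where
  "output_rhs K Kd w x t =
     delay_term m (C_mat S) (C_ker S) x t + Bz_mat S *\<^sub>v control K Kd x t + D2_mat S *\<^sub>v w t"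

definition trajectory ::
  "(nat \<Rightarrow> real mat) \<Rightarrow> (nat \<Rightarrow> real mat) \<Rightarrow> (real \<Rightarrow> real vec) \<Rightarrow> (real \<Rightarrow> real vec) \<Rightarrow>
   (real \<Rightarrow> real vec) \<Rightarrow> (real \<Rightarrow> real vec) \<Rightarrow> bool" where
  "trajectory K Kd \<psi> w x z \<longleftrightarrow>
     \<psi> \<in> hist (r \<nu>) n \<and> L2_vec {t\<^sub>0..} q w \<and>
     (\<forall>t \<ge> t\<^sub>0 - r \<nu>. x t \<in> carrier_vec n) \<and>
     (\<forall>\<theta>\<in>{- r \<nu>..0}. x (t\<^sub>0 + \<theta>) = \<psi> \<theta>) \<and>
     (\<forall>T\<ge>t\<^sub>0. \<forall>k<n. abs_cont_on t\<^sub>0 T (\<lambda>t. x t $ k)) \<and>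
     (AE t in lebesgue_on {t\<^sub>0..}. \<forall>k<n.
        ((\<lambda>s. x s $ k) has_real_derivative state_rhs K Kd w x t $ k) (at t)) \<and>
     (AE t in lebesgue_on {t\<^sub>0..}. z t = output_rhs K Kd w x t)"

definition dissipative :: "(nat \<Rightarrow> real mat) \<Rightarrow> (nat \<Rightarrow> real mat) \<Rightarrow> bool" where
  "dissipative K Kd \<longleftrightarrow>
     (\<exists>v. C1_functional (r \<nu>) n v \<and>
       (\<forall>\<psi> w x z. trajectory K Kd \<psi> w x z \<longrightarrow>
          (AE t in lebesgue_on {t\<^sub>0..}.
             \<exists>D. ((\<lambda>s. v (\<lambda>\<theta>\<in>{- r \<nu>..0}. x (s + \<theta>))) has_real_derivative D) (at t) \<and>
                 D - supply_rate (z t) (w t) \<le> 0)))"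

definition exp_stable :: "(nat \<Rightarrow> real mat) \<Rightarrow> (nat \<Rightarrow> real mat) \<Rightarrow> bool" where
  "exp_stable K Kd \<longleftrightarrow>
     (\<exists>c>0. \<exists>\<gamma>>0. \<forall>\<psi> x z. trajectory K Kd \<psi> (\<lambda>_. 0\<^sub>v q) x z \<longrightarrow>
        (\<forall>t\<ge>t\<^sub>0. vnorm (x t) \<le> c * exp (- \<gamma> * (t - t\<^sub>0)) * hist_norm (r \<nu>) \<psi>))"

section \<open>Matrices of the synthesis condition\<close>

definition Tm :: "nat \<Rightarrow> real mat" where
  "Tm i = col_blk [\<Gamma> i * minv (Gram_h i), 1\<^sub>m (h_dim i)] * L\<^sub>h i"

definition Tm_tilde :: "nat \<Rightarrow> real mat" where
  "Tm_tilde i = col_blk [1\<^sub>m (\<mu> i), 0\<^sub>m (h_dim i) (\<mu> i)] * L\<^sub>e i"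

definition aug_row :: "(nat \<Rightarrow> real mat) \<Rightarrow> (nat \<Rightarrow> real mat) \<Rightarrow> real mat \<Rightarrow> real mat" where
  "aug_row F G D = row_blk (map F [0..<Suc \<nu>]
      @ map (\<lambda>i. G i * (Tm i \<otimes>\<^sub>k 1\<^sub>m n)) [1..<Suc \<nu>]
      @ map (\<lambda>i. G i * (Tm_tilde i \<otimes>\<^sub>k 1\<^sub>m n)) [1..<Suc \<nu>]
      @ [D])"

definition A_bold :: "real mat" where
  "A_bold = aug_row (A_mat S) (A_hat S) (D1_mat S)"

definition C_bold :: "real mat" where
  "C_bold = aug_row (C_mat S) (C_hat S) (D2_mat S)"

definition V_bold :: "(nat \<Rightarrow> real mat) \<Rightarrow> (nat \<Rightarrow> real mat) \<Rightarrow> real mat" where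
  "V_bold V W = aug_row V W (0\<^sub>m p q)"

definition bdiag :: "(nat \<Rightarrow> real mat) \<Rightarrow> real mat" where
  "bdiag F = diag_block_mat (map F [1..<Suc \<nu>])"

definition I_hat :: "real mat" where
  "I_hat = bdiag (\<lambda>i. minv (L\<^sub>f i) * row_blk [0\<^sub>m (d i) (\<delta> i), 1\<^sub>m (d i)] * L\<^sub>h i) \<otimes>\<^sub>k 1\<^sub>m n"

definition \<Lambda> :: "real mat" where
  "\<Lambda> = bdiag (\<lambda>i. (r i - r (i - 1)) \<cdot>\<^sub>m 1\<^sub>m n)"

definition M_bold :: "real mat" where
  "M_bold =
     row_blk [bdiag (\<lambda>i. minv (L\<^sub>f i) * col_mat (f i (- r (i - 1)))),
              0\<^sub>m d_tot 1, 0\<^sub>m d_tot h_tot]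
   - row_blk [0\<^sub>m d_tot 1,
              bdiag (\<lambda>i. minv (L\<^sub>f i) * col_mat (f i (- r i))),
              bdiag (\<lambda>i. minv (L\<^sub>f i) * M_mat S i * L\<^sub>h i)]"

definition \<Xi> :: "(nat \<Rightarrow> real mat) \<Rightarrow> (nat \<Rightarrow> real mat) \<Rightarrow> real mat" where
  "\<Xi> Q R =
     diag_block_mat [bdiag Q + bdiag R * \<Lambda>, 0\<^sub>m n n, 0\<^sub>m (g_tot * n) (g_tot * n), 0\<^sub>m q q]
   - diag_block_mat [0\<^sub>m n n, bdiag Q, bdiag (\<lambda>i. 1\<^sub>m (h_dim i) \<otimes>\<^sub>k R i),
        bdiag (\<lambda>i. 1\<^sub>m (\<mu> i) \<otimes>\<^sub>k R i), J3_mat S]"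

definition \<Phi> ::
  "real mat \<Rightarrow> real mat \<Rightarrow> (nat \<Rightarrow> real mat) \<Rightarrow> (nat \<Rightarrow> real mat) \<Rightarrow> real mat \<Rightarrow> real mat" where
  "\<Phi> P2 P3 Q R \<Sigma> =
     Sy (col_blk [P2, 0\<^sub>m (\<nu> * n) (d_tot * n), I_hat\<^sup>T * P3,
                  0\<^sub>m (mu_tot * n + q + m) (d_tot * n)]
           * row_blk [M_bold \<otimes>\<^sub>k 1\<^sub>m n, 0\<^sub>m (d_tot * n) (mu_tot * n + q + m)]
         + col_blk [0\<^sub>m (\<beta> * n) m, - ((J2_mat S)\<^sup>T), J_tilde S] * row_blk [\<Sigma>, 0\<^sub>m m m])
     + diag_block_mat [\<Xi> Q R, J1_mat S]"

definition X_aug :: "real mat \<Rightarrow> real mat" where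
  "X_aug X = diag_block_mat [1\<^sub>m \<beta> \<otimes>\<^sub>k X, 1\<^sub>m q]"

definition P_bold :: "real mat \<Rightarrow> real mat \<Rightarrow> real mat" where
  "P_bold P1 P2 = row_blk [P1, 0\<^sub>m n (\<nu> * n), P2 * I_hat, 0\<^sub>m n (mu_tot * n + q + m)]"

definition Pi_bold ::
  "real mat \<Rightarrow> (nat \<Rightarrow> real mat) \<Rightarrow> (nat \<Rightarrow> real mat) \<Rightarrow> real mat" where
  "Pi_bold X V W = row_blk [A_bold * X_aug X + Bx_mat S * V_bold V W, 0\<^sub>m n m]"

definition Sigma_bold ::
  "real mat \<Rightarrow> (nat \<Rightarrow> real mat) \<Rightarrow> (nat \<Rightarrow> real mat) \<Rightarrow> real mat" where
  "Sigma_bold X V W = C_bold * X_aug X + Bz_mat S * V_bold V W"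

section \<open>The unknowns\<close>

text \<open>The real vector space of all tuples \<open>(P1, X, P2, P3, Q, R, V, W)\<close>, where \<open>V\<close> collects
  \<open>V\<^sub>0, \<dots>, V\<^sub>\<nu>\<close> and \<open>W\<close> the gains of the distributed part. Its dimension is the number of
  scalar unknowns. The fields \<^term>\<open>monoid.mult\<close> and \<^term>\<open>monoid.one\<close> play no role
  in a module.\<close>

definition unknowns ::
  "(real, real mat \<times> real mat \<times> real mat \<times> real mat \<times> (nat \<Rightarrow> real mat) \<times> (nat \<Rightarrow> real mat) \<times>
     (nat \<Rightarrow> real mat) \<times> (nat \<Rightarrow> real mat)) module" where
  "unknowns = \<lparr>
     carrier = sym_mats n \<times> sym_mats n \<times> carrier_mat n (d_tot * n) \<times> sym_mats (d_tot * n) \<times>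
       ({1..\<nu>} \<rightarrow>\<^sub>E sym_mats n) \<times> ({1..\<nu>} \<rightarrow>\<^sub>E sym_mats n) \<times>
       ({0..\<nu>} \<rightarrow>\<^sub>E carrier_mat p n) \<times> (\<Pi>\<^sub>E i\<in>{1..\<nu>}. carrier_mat p (g_dim i * n)),
     mult = undefined, one = undefined,
     zero = (0\<^sub>m n n, 0\<^sub>m n n, 0\<^sub>m n (d_tot * n), 0\<^sub>m (d_tot * n) (d_tot * n),
       \<lambda>i\<in>{1..\<nu>}. 0\<^sub>m n n, \<lambda>i\<in>{1..\<nu>}. 0\<^sub>m n n,
       \<lambda>i\<in>{0..\<nu>}. 0\<^sub>m p n, \<lambda>i\<in>{1..\<nu>}. 0\<^sub>m p (g_dim i * n)),
     add = (\<lambda>(P1, X, P2, P3, Q, R, V, W) (P1', X', P2', P3', Q', R', V', W').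
       (P1 + P1', X + X', P2 + P2', P3 + P3',
        \<lambda>i\<in>{1..\<nu>}. Q i + Q' i, \<lambda>i\<in>{1..\<nu>}. R i + R' i,
        \<lambda>i\<in>{0..\<nu>}. V i + V' i, \<lambda>i\<in>{1..\<nu>}. W i + W' i)),
     smult = (\<lambda>c (P1, X, P2, P3, Q, R, V, W).
       (c \<cdot>\<^sub>m P1, c \<cdot>\<^sub>m X, c \<cdot>\<^sub>m P2, c \<cdot>\<^sub>m P3,
        \<lambda>i\<in>{1..\<nu>}. c \<cdot>\<^sub>m Q i, \<lambda>i\<in>{1..\<nu>}. c \<cdot>\<^sub>m R i,
        \<lambda>i\<in>{0..\<nu>}. c \<cdot>\<^sub>m V i, \<lambda>i\<in>{1..\<nu>}. c \<cdot>\<^sub>m W i)) \<rparr>"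

definition num_scalar_unknowns :: nat where
  "num_scalar_unknowns = vectorspace.dim class_ring unknowns"

end

end

theory Submission
  imports Defs
begin

text \<open>The strict inequality forces \<open>X\<close> to be invertible. In the coordinates \<open>y = X\<^sup>-\<^sup>1 x\<close> its quadratic
  form, evaluated at the velocity of \<open>y\<close>, at the vector \<open>\<vartheta>(t)\<close> built from \<open>y\<close> and at
  \<open>- J\<^sub>1\<^sup>-\<^sup>1 J z(t)\<close>, loses the summand that contains the scalars \<open>\<alpha>\<^sub>i\<close>. By Bessel's inequality for
  the orthonormalised kernel functions, what remains bounds \<open>d/dt v - s\<close> from above, where
  \<open>v\<close> is the complete quadratic functional with the matrices \<open>P\<^sub>1, P\<^sub>2, P\<^sub>3\<close> acting on \<open>y(t)\<close> and the
  integrals of \<open>y\<close> against the \<open>f\<^sub>i\<close>, and with \<open>Q\<^sub>i + (\<tau> + r\<^sub>i) R\<^sub>i\<close> as the weight of the distributed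
  terms. This \<open>v\<close> is the diagonal of a bounded bilinear form on histories, hence continuously
  differentiable. For the stability claim, \<open>v\<close> is coercive, again by Bessel's inequality, and
  replacing \<open>R\<^sub>i\<close> by \<open>R\<^sub>i + \<eta> I\<close> makes the decay proportional to \<open>v\<close>.\<close>

section \<open>Block matrices and Kronecker products\<close>

text \<open>Before the initial time a trajectory is merely continuous, so the integrals of
  \<open>y\<close> against the \<open>f\<^sub>i\<close> cannot be differentiated through
  \<open>y\<close>. The derivative is put on the kernel instead: with an antiderivative of the curve
  and integration by parts against the weak derivative of \<open>f\<^sub>i\<close>, such an integral
  is differentiable at every time for every continuous curve. Weak derivatives are tested only with
  functions supported inside the interval, so the boundary terms, which are the delayed states, have
  to be recovered by cut-offs. Only the velocity of \<open>y(t)\<close> itself is restricted to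
  almost every time; decay therefore rests on absolute continuity and not on a sign at every point.

  The last block \<open>- J\<^sub>1\<^sup>-\<^sup>1 J z\<close> is the stationary point of the part
  of the form that contains it, and the value there is minus the output part of the supply rate: a
  Schur complement taken at a single vector.

  Strictness gives a margin proportional to the squared length of the vector. One half pays for the
  boundary terms caused by \<eta>, the other half yields decay in \<open>y(t)\<close>; the energy of
  the history decays through the added \<eta> itself.\<close>

lemma scalar_prod_lessThan: "u \<bullet> v = (\<Sum>i<dim_vec v. u $ i * v $ i)" for v :: "real vec"
  by (simp add: scalar_prod_def lessThan_atLeast0)

lemma scalar_prod_append_dim:
  "dim_vec u = dim_vec u' \<Longrightarrow> dim_vec v = dim_vec v' \<Longrightarrow>
    (u @\<^sub>v v) \<bullet> (u' @\<^sub>v v') = u \<bullet> u' + v \<bullet> (v' :: real vec)"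
  by (rule scalar_prod_append) (auto intro: carrier_vecI)

text \<open>Stacked columns are kept as vectors rather than one-column matrices, so that products
  with \<open>row_blk\<close>, \<open>col_blk\<close> and \<open>diag_block_mat\<close> reduce to
  products of a block with a vector.\<close>

definition vcat :: "real vec list \<Rightarrow> real vec" where
  "vcat us = foldr (@\<^sub>v) us (0\<^sub>v 0)"

lemma vcat_Nil [simp]: "vcat [] = 0\<^sub>v 0"
  and vcat_Cons [simp]: "vcat (u # us) = u @\<^sub>v vcat us"
  by (simp_all add: vcat_def)

lemma dim_vec_vcat [simp]: "dim_vec (vcat us) = sum_list (map dim_vec us)"
  by (induction us) auto

lemma append_vec_vNil [simp]: "u @\<^sub>v vNil = u" "vNil @\<^sub>v u = u"
  by (auto intro!: eq_vecI simp flip: zero_vec_zero)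

lemma append_vec_assoc [simp]: "(u @\<^sub>v v) @\<^sub>v w = u @\<^sub>v (v @\<^sub>v w)"
  by (rule eq_vecI) auto

lemma vcat_append [simp]: "vcat (us @ vs) = vcat us @\<^sub>v vcat vs"
  by (induction us) auto

lemma vcat_scalar_prod:
  "list_all2 (\<lambda>u v. dim_vec u = dim_vec v) us vs \<Longrightarrow>
    vcat us \<bullet> vcat vs = (\<Sum>(u, v)\<leftarrow>zip us vs. u \<bullet> v)"
proof (induction rule: list_all2_induct)
  case (Cons u us v vs)
  then have "dim_vec (vcat us) = dim_vec (vcat vs)"
    by (simp add: list_all2_conv_all_nth) (metis nth_map nth_equalityI length_map)
  with Cons show ?case by (simp add: scalar_prod_append_dim)
qed simp

lemma vcat_map_scalar_prod:
  "(\<And>i. i \<in> set is \<Longrightarrow> dim_vec (u i) = dim_vec (v i)) \<Longrightarrow>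
    vcat (map u is) \<bullet> vcat (map v is) = (\<Sum>i\<leftarrow>is. u i \<bullet> v i)"
  by (subst vcat_scalar_prod) (auto simp: list_all2_conv_all_nth zip_map_map zip_same_conv_map o_def)

text \<open>Block rows are evaluated only against test vectors in
  \<open>row_blk_scalar_prod\<close>; this turns an identity for all test vectors back into an
  equation.\<close>

lemma scalar_prod_eqI:
  assumes "u \<in> carrier_vec k" "v \<in> carrier_vec k"
    and "\<And>c. c \<in> carrier_vec k \<Longrightarrow> c \<bullet> u = c \<bullet> (v :: real vec)"
  shows "u = v"
proof (rule eq_vecI)
  fix j assume "j < dim_vec v"
  then have "j < k" using assms(2) by simp
  then show "u $ j = v $ j"
    using assms(3)[OF unit_vec_carrier] assms(1,2) by (metis scalar_prod_left_unit)
qed (use assms in auto)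

lemma dim_row_blk:
  "As \<noteq> [] \<Longrightarrow> dim_row (row_blk As) = dim_row (hd As)"
  "dim_col (row_blk As) = sum_list (map dim_col As)"
  by (induction As) (auto simp: row_blk_def)

lemma dim_col_blk:
  "As \<noteq> [] \<Longrightarrow> dim_col (col_blk As) = dim_col (hd As)"
  "dim_row (col_blk As) = sum_list (map dim_row As)"
  by (induction As) (auto simp: col_blk_def append_rows_def)

lemma row_blk_single [simp]: "row_blk [A] = A"
  by (rule eq_matI) (auto simp: row_blk_def)

lemma col_blk_single [simp]: "col_blk [A] = A"
  by (rule eq_matI) (auto simp: col_blk_def append_rows_def)

lemma row_blk_Cons:
  "row_blk (A # As) = four_block_mat A (row_blk As) (0\<^sub>m 0 (dim_col A)) (0\<^sub>m 0 (dim_col (row_blk As)))"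
  by (simp add: row_blk_def)

lemma row_blk_carrier:
  "As \<noteq> [] \<Longrightarrow> (\<And>A. A \<in> set As \<Longrightarrow> dim_row A = k) \<Longrightarrow> sum_list (map dim_col As) = l \<Longrightarrow>
    row_blk As \<in> carrier_mat k l"
  by (intro carrier_matI) (auto simp: dim_row_blk)

lemma col_blk_carrier:
  "As \<noteq> [] \<Longrightarrow> (\<And>A. A \<in> set As \<Longrightarrow> dim_col A = l) \<Longrightarrow> sum_list (map dim_row As) = k \<Longrightarrow>
    col_blk As \<in> carrier_mat k l"
  by (intro carrier_matI) (auto simp: dim_col_blk)

lemma diag_block_carrier:
  "sum_list (map dim_row As) = k \<Longrightarrow> sum_list (map dim_col As) = l \<Longrightarrow>
    diag_block_mat As \<in> carrier_mat k l"
  by (intro carrier_matI) (auto simp: dim_diag_block_mat)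

text \<open>Pairing with \<open>c\<close> replaces a sum of vectors, whose lengths have to be
  tracked, by a sum of reals over a list.\<close>

lemma row_blk_scalar_prod:
  assumes "list_all2 (\<lambda>A u. A \<in> carrier_mat k (dim_vec u)) As us" "As \<noteq> []" "c \<in> carrier_vec k"
  shows "c \<bullet> (row_blk As *\<^sub>v vcat us) = (\<Sum>(A, u)\<leftarrow>zip As us. c \<bullet> (A *\<^sub>v u))"
  using assms
proof (induction As us rule: list_all2_induct)
  case (Cons A As u us)
  show ?case
  proof (cases "As = []")
    case True
    with Cons show ?thesis by simp
  next
    case False
    have ds: "map dim_col As = map dim_vec us"
      using Cons.hyps(2) by (auto simp: list_all2_conv_all_nth intro!: nth_equalityI)
    have R: "row_blk As \<in> carrier_mat k (dim_vec (vcat us))"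
      using False Cons.hyps(2) ds
      by (intro row_blk_carrier) (auto simp: list_all2_conv_all_nth in_set_conv_nth)
    have "row_blk (A # As) *\<^sub>v vcat (u # us) = (A *\<^sub>v u + row_blk As *\<^sub>v vcat us) @\<^sub>v 0\<^sub>v 0"
      unfolding row_blk_Cons vcat_Cons using Cons.hyps(1) R
      by (subst four_block_mat_mult_vec[where ?nr2.0=0]) (auto intro: carrier_vecI intro!: eq_vecI)
    moreover have "A *\<^sub>v u \<in> carrier_vec k" "row_blk As *\<^sub>v vcat us \<in> carrier_vec k"
      using Cons.hyps(1) R by (auto intro: carrier_vecI)
    ultimately show ?thesis using Cons False
      by (simp add: scalar_prod_add_distrib[of c k])
  qed
next
  case Nil
  then show ?case by simp
qed

lemma col_blk_mult:
  assumes "As \<noteq> []" "\<And>A. A \<in> set As \<Longrightarrow> dim_col A = dim_vec v"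
  shows "col_blk As *\<^sub>v v = vcat (map (\<lambda>A. A *\<^sub>v v) As)"
  using assms
proof (induction As rule: list_nonempty_induct)
  case (cons A As)
  have "col_blk (A # As) = A @\<^sub>r col_blk As"
    by (simp add: col_blk_def)
  moreover have "col_blk As \<in> carrier_mat (sum_list (map dim_row As)) (dim_vec v)"
    using cons by (intro col_blk_carrier) auto
  ultimately have "col_blk (A # As) *\<^sub>v v = A *\<^sub>v v @\<^sub>v col_blk As *\<^sub>v v"
    using cons.prems by (auto intro!: mat_mult_append carrier_vecI carrier_matI)
  with cons show ?case by simp
qed simp

lemma zero_mat_mult_vec [simp]: "dim_vec v = b \<Longrightarrow> 0\<^sub>m a b *\<^sub>v v = (0\<^sub>v a :: real vec)"
  by (rule eq_vecI) (auto simp: scalar_prod_lessThan)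

lemma diag_block_mult:
  assumes "list_all2 (\<lambda>A u. dim_col A = dim_vec u) As us"
  shows "diag_block_mat As *\<^sub>v vcat us = vcat (map (\<lambda>(A, u). A *\<^sub>v u) (zip As us))"
  using assms
proof (induction As us rule: list_all2_induct)
  case Nil
  show ?case by (auto intro!: eq_vecI)
next
  case (Cons A As u us)
  have "map dim_col As = map dim_vec us"
    using Cons.hyps(2) by (auto simp: list_all2_conv_all_nth intro!: nth_equalityI)
  then have "diag_block_mat (A # As) *\<^sub>v (u @\<^sub>v vcat us)
      = (A *\<^sub>v u + 0\<^sub>m (dim_row A) (dim_vec (vcat us)) *\<^sub>v vcat us)
        @\<^sub>v (0\<^sub>m (dim_row (diag_block_mat As)) (dim_vec u) *\<^sub>v u + diag_block_mat As *\<^sub>v vcat us)"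
    unfolding diag_block_mat.simps Let_def using Cons.hyps(1)
    by (subst four_block_mat_mult_vec[of _ "dim_row A" "dim_vec u" _ "dim_vec (vcat us)"
          _ "dim_row (diag_block_mat As)"])
      (auto intro!: carrier_vecI carrier_matI simp: dim_diag_block_mat)
  moreover have "A *\<^sub>v u + 0\<^sub>v (dim_row A) = A *\<^sub>v u"
    "0\<^sub>v (dim_row (diag_block_mat As)) + diag_block_mat As *\<^sub>v vcat us = diag_block_mat As *\<^sub>v vcat us"
    by (auto intro!: eq_vecI)
  ultimately show ?case using Cons
    by (simp del: diag_block_mat.simps)
qed

lemma diag_block_map_mult:
  "(\<And>i. i \<in> set is \<Longrightarrow> dim_col (A i) = dim_vec (u i)) \<Longrightarrow>
    diag_block_mat (map A is) *\<^sub>v vcat (map u is) = vcat (map (\<lambda>i. A i *\<^sub>v u i) is)"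
  by (subst diag_block_mult) (auto simp: list_all2_conv_all_nth zip_map_map zip_same_conv_map o_def)

subsection \<open>Kronecker products\<close>

lemma dim_kron [simp]:
  "dim_row (A \<otimes>\<^sub>k B) = dim_row A * dim_row B" "dim_col (A \<otimes>\<^sub>k B) = dim_col A * dim_col B"
  by (simp_all add: kron_def)

lemma kron_index:
  "i < dim_row A * dim_row B \<Longrightarrow> j < dim_col A * dim_col B \<Longrightarrow> (A \<otimes>\<^sub>k B) $$ (i, j) =
    A $$ (i div dim_row B, j div dim_col B) * B $$ (i mod dim_row B, j mod dim_col B)"
  by (simp add: kron_def)

lemma div_less_of_less_mult: "i < a * (b::nat) \<Longrightarrow> i div b < a"
  by (simp add: less_mult_imp_div_less)

lemma mod_less_of_less_mult: "i < a * (b::nat) \<Longrightarrow> i mod b < b"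
  by (cases "b = 0") auto

text \<open>The block boundary \<open>dim_row A * dim_row E\<close> is a multiple of
  \<open>dim_row E\<close>. Division by \<open>dim_row E\<close> therefore decides on which side of
  it an index lies, and subtracting the boundary shifts the quotient and keeps the
  remainder.\<close>

lemma kron_four_block:
  assumes "dim_row B = dim_row A" "dim_col C = dim_col A" "dim_row C = dim_row D" "dim_col B = dim_col D"
  shows "four_block_mat A B C D \<otimes>\<^sub>k E =
    four_block_mat (A \<otimes>\<^sub>k E) (B \<otimes>\<^sub>k E) (C \<otimes>\<^sub>k E) (D \<otimes>\<^sub>k E)"
proof (rule eq_matI)
  fix i j
  assume "i < dim_row (four_block_mat (A \<otimes>\<^sub>k E) (B \<otimes>\<^sub>k E) (C \<otimes>\<^sub>k E) (D \<otimes>\<^sub>k E))"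
    "j < dim_col (four_block_mat (A \<otimes>\<^sub>k E) (B \<otimes>\<^sub>k E) (C \<otimes>\<^sub>k E) (D \<otimes>\<^sub>k E))"
  then have i: "i < (dim_row A + dim_row D) * dim_row E" and j: "j < (dim_col A + dim_col D) * dim_col E"
    by (auto simp: algebra_simps)
  have E: "dim_row E > 0" "dim_col E > 0"
    using i j by (auto intro!: Nat.gr0I)
  have less: "k div e < a \<longleftrightarrow> k < a * e" if "e > 0" for k e a :: nat
    using that by (simp add: div_less_iff_less_mult)
  have sub: "(k - a * e) div e = k div e - a" "(k - a * e) mod e = k mod e"
    if "\<not> k < a * e" "e > 0" for k e a :: nat
  proof -
    define l where "l = k - a * e"
    then have l: "k = a * e + l" using that(1) by simp
    have "(a * e + l) div e = a + l div e" "(a * e + l) mod e = l mod e"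
      using that(2) div_mult_self3[of e a l] mod_mult_self3[of a e l] by blast+
    with l show "(k - a * e) div e = k div e - a" "(k - a * e) mod e = k mod e"
      by (metis diff_add_inverse)+
  qed
  show "(four_block_mat A B C D \<otimes>\<^sub>k E) $$ (i, j) =
      four_block_mat (A \<otimes>\<^sub>k E) (B \<otimes>\<^sub>k E) (C \<otimes>\<^sub>k E) (D \<otimes>\<^sub>k E) $$ (i, j)"
  proof (cases "i < dim_row A * dim_row E"; cases "j < dim_col A * dim_col E")
  qed (use assms i j E in \<open>simp_all add: kron_index less sub div_less_of_less_mult distrib_right\<close>)
qed (use assms in \<open>auto simp: algebra_simps\<close>)

lemma kron_zero [simp]: "0\<^sub>m a b \<otimes>\<^sub>k E = 0\<^sub>m (a * dim_row E) (b * dim_col E)"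
  by (rule eq_matI) (auto simp: kron_index div_less_of_less_mult)

lemma kron_row_blk: "row_blk As \<otimes>\<^sub>k E = row_blk (map (\<lambda>A. A \<otimes>\<^sub>k E) As)"
  if "\<And>A. A \<in> set As \<Longrightarrow> dim_row A = k"
  using that
proof (induction As)
  case Nil
  show ?case by (simp add: row_blk_def)
next
  case (Cons A As)
  show ?case
  proof (cases "As = []")
    case False
    then have "dim_row (row_blk As) = dim_row A"
      using Cons.prems by (auto simp: dim_row_blk)
    with Cons show ?thesis
      by (simp add: row_blk_Cons kron_four_block dim_row_blk(2) o_def sum_list_mult_const)
  qed simp
qed

lemma kron_diag_block: "diag_block_mat As \<otimes>\<^sub>k E = diag_block_mat (map (\<lambda>A. A \<otimes>\<^sub>k E) As)"
  by (induction As) (auto simp: Let_def kron_four_block dim_diag_block_mat o_def sum_list_mult_const)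

lemma kron_minus_left:
  "dim_row A = dim_row B \<Longrightarrow> dim_col A = dim_col B \<Longrightarrow> (A - B) \<otimes>\<^sub>k E = A \<otimes>\<^sub>k E - B \<otimes>\<^sub>k E"
  by (rule eq_matI) (auto simp: kron_index div_less_of_less_mult algebra_simps)

lemma one_mat_add: "1\<^sub>m (a + b) = four_block_mat (1\<^sub>m a) (0\<^sub>m a b) (0\<^sub>m b a) (1\<^sub>m b :: real mat)"
  by (rule eq_matI) auto

text \<open>Cuts the identity of size \<beta> along the blocks of the stacked vector, so that
  \<open>1\<^sub>m \<beta> \<otimes>\<^sub>k X\<close> acts on each delayed state and each integral
  separately.\<close>

lemma kron_one_sum_list:
  "1\<^sub>m (sum_list ks) \<otimes>\<^sub>k E = diag_block_mat (map (\<lambda>k. 1\<^sub>m k \<otimes>\<^sub>k E) ks)"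
proof (induction ks)
  case Nil
  show ?case by (rule eq_matI) auto
next
  case (Cons k ks)
  have "dim_row (diag_block_mat (map (\<lambda>k. 1\<^sub>m k \<otimes>\<^sub>k E) ks)) = sum_list ks * dim_row E"
    "dim_col (diag_block_mat (map (\<lambda>k. 1\<^sub>m k \<otimes>\<^sub>k E) ks)) = sum_list ks * dim_col E"
    by (simp_all flip: Cons.IH)
  moreover have "1\<^sub>m (sum_list (k # ks)) \<otimes>\<^sub>k E = four_block_mat (1\<^sub>m k \<otimes>\<^sub>k E)
      (0\<^sub>m k (sum_list ks) \<otimes>\<^sub>k E) (0\<^sub>m (sum_list ks) k \<otimes>\<^sub>k E) (1\<^sub>m (sum_list ks) \<otimes>\<^sub>k E)"
    unfolding sum_list.Cons one_mat_add[of k "sum_list ks"] by (rule kron_four_block) auto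
  ultimately show ?case
    by (simp add: Cons.IH Let_def)
qed

lemma kron_one_one [simp]: "1\<^sub>m (Suc 0) \<otimes>\<^sub>k E = E"
  by (rule eq_matI) (auto simp: kron_index)

text \<open>The Kronecker product of two vectors, again as a vector. For \<open>v\<close> of length
  \<open>n\<close> it is \<open>(u \<otimes> I\<^sub>n) v\<close>, the integrand of the distributed
  delays.\<close>

definition vkron :: "real vec \<Rightarrow> real vec \<Rightarrow> real vec" where
  "vkron u v = vec (dim_vec u * dim_vec v) (\<lambda>i. u $ (i div dim_vec v) * v $ (i mod dim_vec v))"

lemma dim_vkron [simp]: "dim_vec (vkron u v) = dim_vec u * dim_vec v"
  by (simp add: vkron_def)

lemma mult_add_less: "k < a \<Longrightarrow> l < b \<Longrightarrow> k * b + l < a * (b::nat)"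
  using mult_le_mono1[of "Suc k" a b] by simp

text \<open>The bijection \<open>j \<mapsto> (j div b, j mod b)\<close> undoes the index arithmetic
  of the Kronecker product.\<close>

lemma sum_div_mod: "(\<Sum>j<a * b. F (j div b) (j mod b)) = (\<Sum>k<a. \<Sum>l<b. F k l :: real)" for a b :: nat
proof (cases "b = 0")
  case False
  have "(\<Sum>j<a * b. F (j div b) (j mod b)) = (\<Sum>(k, l)\<in>{..<a} \<times> {..<b}. F k l)"
    using False
    by (intro sum.reindex_bij_witness[where i="\<lambda>(k, l). k * b + l" and j="\<lambda>j. (j div b, j mod b)"])
      (auto simp: div_less_of_less_mult mult_add_less)
  then show ?thesis by (simp add: sum.cartesian_product)
qed simp

lemma scalar_prod_vkron:
  assumes "dim_vec a = dim_vec u" "dim_vec b = dim_vec v"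
  shows "vkron a b \<bullet> vkron u v = (a \<bullet> u) * (b \<bullet> v)"
proof -
  have "vkron a b \<bullet> vkron u v
      = (\<Sum>j<dim_vec u * dim_vec v. (\<lambda>k l. (a $ k * u $ k) * (b $ l * v $ l)) (j div dim_vec v) (j mod dim_vec v))"
    using assms by (simp add: scalar_prod_lessThan vkron_def ac_simps)
  also have "\<dots> = (a \<bullet> u) * (b \<bullet> v)"
    by (subst sum_div_mod) (simp add: scalar_prod_lessThan sum_product)
  finally show ?thesis .
qed

text \<open>The mixed-product rule: a row of \<open>A \<otimes>\<^sub>k B\<close> is itself a
  \<open>vkron\<close> of rows, and its pairing with \<open>vkron u v\<close> factors.\<close>

lemma kron_mult_vkron:
  assumes "dim_col A = dim_vec u" "dim_col B = dim_vec v"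
  shows "(A \<otimes>\<^sub>k B) *\<^sub>v vkron u v = vkron (A *\<^sub>v u) (B *\<^sub>v v)"
proof (rule eq_vecI)
  fix i assume "i < dim_vec (vkron (A *\<^sub>v u) (B *\<^sub>v v))"
  then have i: "i < dim_row A * dim_row B" by simp
  have "row (A \<otimes>\<^sub>k B) i = vkron (row A (i div dim_row B)) (row B (i mod dim_row B))"
    using i by (intro eq_vecI)
      (auto simp: vkron_def kron_index div_less_of_less_mult mod_less_of_less_mult)
  then show "((A \<otimes>\<^sub>k B) *\<^sub>v vkron u v) $ i = vkron (A *\<^sub>v u) (B *\<^sub>v v) $ i"
    using i assms
    by (simp add: scalar_prod_vkron vkron_def[of "A *\<^sub>v u"] div_less_of_less_mult mod_less_of_less_mult)
qed simp

lemma dim_col_mat [simp]: "dim_row (col_mat v) = dim_vec v" "dim_col (col_mat v) = 1"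
  by (auto simp: col_mat_def)

lemma col_mat_index: "i < dim_vec v \<Longrightarrow> col_mat v $$ (i, 0) = v $ i"
  by (simp add: col_mat_def mat_of_cols_index)

lemma kron_col_mat_one:
  "dim_vec x = k \<Longrightarrow> (col_mat v \<otimes>\<^sub>k 1\<^sub>m k) *\<^sub>v x = vkron v x"
proof (rule eq_vecI)
  fix i assume k: "dim_vec x = k" and "i < dim_vec (vkron v x)"
  then have i: "i < dim_vec v * k" by simp
  have "((col_mat v \<otimes>\<^sub>k 1\<^sub>m k) *\<^sub>v x) $ i
      = (\<Sum>j<k. v $ (i div k) * (if i mod k = j then 1 else 0) * x $ j)"
    using i k
    by (simp add: scalar_prod_lessThan kron_index col_mat_index div_less_of_less_mult
        mod_less_of_less_mult)
  also have "\<dots> = (\<Sum>j<k. if i mod k = j then v $ (i div k) * x $ j else 0)"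
    by (intro sum.cong) auto
  finally show "((col_mat v \<otimes>\<^sub>k 1\<^sub>m k) *\<^sub>v x) $ i = vkron v x $ i"
    using i k by (simp add: vkron_def mod_less_of_less_mult)
qed auto

lemma mult_col_mat: "dim_col A = dim_vec v \<Longrightarrow> A * col_mat v = col_mat (A *\<^sub>v v)"
  by (rule eq_matI) (auto simp: col_mat_def mat_of_cols_def intro!: arg_cong2[where f="(\<bullet>)"])

subsection \<open>Quadratic forms\<close>

lemma scalar_prod_Sy:
  assumes A: "A \<in> carrier_mat k k" and v: "v \<in> carrier_vec k"
  shows "v \<bullet> (Sy A *\<^sub>v v) = 2 * (v \<bullet> (A *\<^sub>v v))"
proof -
  have "v \<bullet> (A\<^sup>T *\<^sub>v v) = v \<bullet> (A *\<^sub>v v)"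
    using transpose_vec_mult_scalar[OF A v v] comm_scalar_prod[OF v, of "A\<^sup>T *\<^sub>v v"] A v
    by simp
  then show ?thesis
    unfolding Sy_def using A v
    by (simp add: add_mult_distrib_mat_vec[where nr=k and nc=k]
        scalar_prod_add_distrib[where n=k])
qed

lemma scalar_prod_four_block_sym:
  fixes A B D :: "real mat"
  assumes "A \<in> carrier_mat k k" "B \<in> carrier_mat k l" "D \<in> carrier_mat l l"
    "u \<in> carrier_vec k" "v \<in> carrier_vec l"
  shows "(u @\<^sub>v v) \<bullet> (four_block_mat A B B\<^sup>T D *\<^sub>v (u @\<^sub>v v)) =
    u \<bullet> (A *\<^sub>v u) + 2 * (u \<bullet> (B *\<^sub>v v)) + v \<bullet> (D *\<^sub>v v)"
proof -
  have "v \<bullet> (B\<^sup>T *\<^sub>v u) = u \<bullet> (B *\<^sub>v v)"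
    using transpose_vec_mult_scalar[OF assms(2) assms(5,4)]
      comm_scalar_prod[OF assms(5), of "B\<^sup>T *\<^sub>v u"] assms
    by simp
  moreover have "four_block_mat A B B\<^sup>T D *\<^sub>v (u @\<^sub>v v) = (A *\<^sub>v u + B *\<^sub>v v) @\<^sub>v (B\<^sup>T *\<^sub>v u + D *\<^sub>v v)"
    using assms by (intro four_block_mat_mult_vec) auto
  ultimately show ?thesis
    using assms
    by (simp add: scalar_prod_append[where ?n1.0=k and ?n2.0=l] scalar_prod_add_distrib[where n=k]
        scalar_prod_add_distrib[where n=l] mult_mat_vec_carrier[where nr=k] mult_mat_vec_carrier[where nr=l])
qed

lemma sym_matsD: "A \<in> sym_mats k \<Longrightarrow> A \<in> carrier_mat k k" "A \<in> sym_mats k \<Longrightarrow> A\<^sup>T = A"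
  by (auto simp: sym_mats_def)

lemma sym_mats_scalar_prod:
  assumes "A \<in> sym_mats k" "u \<in> carrier_vec k" "v \<in> carrier_vec k"
  shows "u \<bullet> (A *\<^sub>v v) = v \<bullet> (A *\<^sub>v u)"
proof -
  have A: "A \<in> carrier_mat k k" "A\<^sup>T = A" using assms(1) by (auto simp: sym_mats_def)
  show ?thesis
    using transpose_vec_mult_scalar[OF A(1) assms(3,2)] comm_scalar_prod[OF assms(3), of "A *\<^sub>v u"]
      mult_mat_vec_carrier[OF A(1) assms(2)] A(2) by simp
qed

text \<open>\<open>mat_inverse\<close> yields \<open>None\<close> only for a matrix that is not a
  unit of the matrix ring. A nonzero determinant excludes this, so the \<open>the\<close> in
  \<open>minv\<close> is well defined.\<close>

lemma minv_inverts:
  assumes A: "A \<in> carrier_mat k k" and "det A \<noteq> 0"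
  shows "minv A \<in> carrier_mat k k" "A * minv A = 1\<^sub>m k" "minv A * A = 1\<^sub>m k"
proof -
  have "mat_inverse A \<noteq> None"
    using mat_inverse(1)[OF A, of "()"] det_non_zero_imp_unit[OF A assms(2), of "()"] by auto
  then show "minv A \<in> carrier_mat k k" "A * minv A = 1\<^sub>m k" "minv A * A = 1\<^sub>m k"
    using mat_inverse(2)[OF A] by (auto simp: minv_def)
qed

lemma minv_mult_vec:
  assumes "A \<in> carrier_mat k k" "det A \<noteq> 0" "v \<in> carrier_vec k"
  shows "minv A *\<^sub>v (A *\<^sub>v v) = v" "A *\<^sub>v (minv A *\<^sub>v v) = v"
  using assoc_mult_mat_vec[OF minv_inverts(1)[OF assms(1,2)] assms(1) assms(3)]
    assoc_mult_mat_vec[OF assms(1) minv_inverts(1)[OF assms(1,2)] assms(3)]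
    minv_inverts(2,3)[OF assms(1,2)] assms(3)
  by simp_all

lemma pos_def_det:
  assumes "pos_def A" "dim_row A = k"
  shows "det A \<noteq> 0"
proof
  assume "det A = 0"
  moreover have A: "A \<in> carrier_mat k k"
    using assms by (auto simp: pos_def_def sym_mats_def)
  ultimately obtain v where "v \<in> carrier_vec k" "v \<noteq> 0\<^sub>v k" "A *\<^sub>v v = 0\<^sub>v k"
    using det_0_iff_vec_prod_zero[OF A] by auto
  then show False using assms by (auto simp: pos_def_def)
qed

lemma pos_def_nonneg:
  assumes "pos_def A" "dim_row A = k" "v \<in> carrier_vec k"
  shows "v \<bullet> (A *\<^sub>v v) \<ge> 0"
proof (cases "v = 0\<^sub>v k")
  case True
  have "A *\<^sub>v v \<in> carrier_vec k"
    using assms(2) by (intro carrier_vecI) simp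
  with True show ?thesis by simp
qed (use assms in \<open>auto simp: pos_def_def less_imp_le\<close>)

text \<open>Cauchy--Schwarz for the inner product of \<open>A\<close>, applied to \<open>v\<close> and a solution \<open>u\<close> of
  \<open>A u = e\<^sub>j\<close>; this replaces the compactness of the unit sphere.\<close>

lemma pos_def_coord_bound:
  assumes A: "pos_def A" and k: "dim_row A = k" and j: "j < k"
  shows "\<exists>c>0. \<forall>v\<in>carrier_vec k. (v $ j)\<^sup>2 \<le> c * (v \<bullet> (A *\<^sub>v v))"
proof -
  have As: "A \<in> sym_mats k" and Ac: "A \<in> carrier_mat k k"
    using A k by (auto simp: pos_def_def sym_mats_def)
  define u where "u = minv A *\<^sub>v unit_vec k j"
  have u: "u \<in> carrier_vec k" "A *\<^sub>v u = unit_vec k j"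
    using minv_inverts[OF Ac pos_def_det[OF A k]] minv_mult_vec(2)[OF Ac pos_def_det[OF A k]]
    by (auto simp: u_def)
  have "u \<noteq> 0\<^sub>v k"
  proof
    assume "u = 0\<^sub>v k"
    then have "(A *\<^sub>v u) $ j = 0"
      using Ac j by (simp add: scalar_prod_lessThan)
    with u j show False by simp
  qed
  then have pos: "u \<bullet> (A *\<^sub>v u) > 0"
    using A k u by (auto simp: pos_def_def)
  have "(v $ j)\<^sup>2 \<le> (u \<bullet> (A *\<^sub>v u)) * (v \<bullet> (A *\<^sub>v v))" if v: "v \<in> carrier_vec k" for v
  proof -
    let ?s = "u \<bullet> (A *\<^sub>v u)"
    have vj: "v \<bullet> (A *\<^sub>v u) = v $ j" "u \<bullet> (A *\<^sub>v v) = v $ j"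
      using u v j sym_mats_scalar_prod[OF As v u(1)] by auto
    define w where "w = ?s \<cdot>\<^sub>v v - (v $ j) \<cdot>\<^sub>v u"
    have w: "w \<in> carrier_vec k" using u v by (auto simp: w_def)
    have "0 \<le> w \<bullet> (A *\<^sub>v w)" using pos_def_nonneg[OF A k w] .
    also have "A *\<^sub>v w = ?s \<cdot>\<^sub>v (A *\<^sub>v v) - (v $ j) \<cdot>\<^sub>v (A *\<^sub>v u)"
      unfolding w_def using u v Ac
      by (simp add: mult_minus_distrib_mat_vec[OF Ac] mult_mat_vec[OF Ac])
    also have "w \<bullet> \<dots> = ?s * (?s * (v \<bullet> (A *\<^sub>v v)) - (v $ j)\<^sup>2)"
    proof -
      have "A *\<^sub>v v \<in> carrier_vec k" "A *\<^sub>v u \<in> carrier_vec k" using Ac by (auto intro: carrier_vecI)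
      then show ?thesis
        unfolding w_def using u(1) v vj
        by (simp add: minus_scalar_prod_distrib[of _ k] scalar_prod_minus_distrib[of _ k])
          (simp add: power2_eq_square field_simps)
    qed
    finally show ?thesis using pos by (simp add: zero_le_mult_iff)
  qed
  with pos show ?thesis by blast
qed

text \<open>Adding up the coordinate bounds gives a uniform lower bound of the form without
  eigenvalues. The summand 1 keeps the constant positive for \<open>k = 0\<close>.\<close>

lemma pos_def_bound:
  assumes A: "pos_def A" and k: "dim_row A = k"
  shows "\<exists>c>0. \<forall>v\<in>carrier_vec k. v \<bullet> v \<le> c * (v \<bullet> (A *\<^sub>v v))"
proof -
  obtain c where c: "\<And>j. j < k \<Longrightarrow> c j > 0 \<and> (\<forall>v\<in>carrier_vec k. (v $ j)\<^sup>2 \<le> c j * (v \<bullet> (A *\<^sub>v v)))"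
    using pos_def_coord_bound[OF A k] by metis
  have "v \<bullet> v \<le> (1 + (\<Sum>j<k. c j)) * (v \<bullet> (A *\<^sub>v v))" if v: "v \<in> carrier_vec k" for v
  proof -
    have "v \<bullet> v = (\<Sum>j<k. (v $ j)\<^sup>2)"
      using v by (simp add: scalar_prod_lessThan power2_eq_square)
    also have "\<dots> \<le> (\<Sum>j<k. c j * (v \<bullet> (A *\<^sub>v v)))"
      using c v by (intro sum_mono) auto
    also have "\<dots> \<le> (1 + (\<Sum>j<k. c j)) * (v \<bullet> (A *\<^sub>v v))"
      using pos_def_nonneg[OF A k v] by (simp add: sum_distrib_right distrib_right)
    finally show ?thesis .
  qed
  moreover have "1 + (\<Sum>j<k. c j) > 0"
    using c by (intro add_pos_nonneg sum_nonneg) (auto intro: less_imp_le)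
  ultimately show ?thesis by blast
qed

lemma neg_def_iff_pos_def:
  assumes "A \<in> carrier_mat k k"
  shows "neg_def A \<longleftrightarrow> pos_def (- A)"
proof -
  have "v \<bullet> (- A *\<^sub>v v) = - (v \<bullet> (A *\<^sub>v v))" if "v \<in> carrier_vec k" for v
    using assms that by (simp add: uminus_mult_mat_vec)
  moreover have "- A \<in> sym_mats k \<longleftrightarrow> A \<in> sym_mats k"
    using assms by (auto simp: sym_mats_def transpose_uminus)
  ultimately show ?thesis using assms by (auto simp: pos_def_def neg_def_def)
qed

section \<open>Square-integrable functions on a compact interval\<close>

lemma L2_scalar_mult_integrable:
  assumes "L2_scalar I F" "L2_scalar I G"
  shows "integrable (lebesgue_on I) (\<lambda>t. F t * G t)"
proof (rule Bochner_Integration.integrable_bound)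
  show "integrable (lebesgue_on I) (\<lambda>t. (F t)\<^sup>2 + (G t)\<^sup>2)"
    using assms by (auto simp: L2_scalar_def)
  show "(\<lambda>t. F t * G t) \<in> borel_measurable (lebesgue_on I)"
    using assms by (auto simp: L2_scalar_def)
  have "\<bar>x * y\<bar> \<le> x\<^sup>2 + y\<^sup>2" for x y :: real
  proof -
    have "2 * \<bar>x * y\<bar> \<le> x\<^sup>2 + y\<^sup>2"
      using sum_squares_bound[of "\<bar>x\<bar>" "\<bar>y\<bar>"] by (simp add: abs_mult)
    then show ?thesis using abs_ge_zero[of "x * y"] by linarith
  qed
  then show "AE t in lebesgue_on I. norm (F t * G t) \<le> norm ((F t)\<^sup>2 + (G t)\<^sup>2)"
    by simp
qed

lemma continuous_on_Icc_bounded: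
  fixes F :: "real \<Rightarrow> real"
  assumes "continuous_on {a..b} F"
  shows "\<exists>B. \<forall>t\<in>{a..b}. \<bar>F t\<bar> \<le> B"
  using compact_imp_bounded[OF compact_continuous_image[OF assms compact_Icc]]
  by (auto simp: bounded_iff)

lemma continuous_integrable_on_Icc:
  fixes F :: "real \<Rightarrow> real"
  assumes "continuous_on {a..b} F"
  shows "integrable (lebesgue_on {a..b}) F"
proof -
  obtain B where B: "\<And>t. t \<in> {a..b} \<Longrightarrow> \<bar>F t\<bar> \<le> B"
    using continuous_on_Icc_bounded[OF assms] by blast
  have "F \<in> borel_measurable (lebesgue_on {a..b})"
    using assms by (intro continuous_imp_measurable_on_sets_lebesgue) auto
  moreover have "integrable (lebesgue_on {a..b}) (\<lambda>_. B)"
    by (intro finite_measure.integrable_const finite_measure_lebesgue_on) auto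
  moreover have "AE t in lebesgue_on {a..b}. norm (F t) \<le> norm B"
    using order_trans[OF B abs_ge_self] by (intro AE_I2) (simp add: space_restrict_space)
  ultimately show ?thesis
    using Bochner_Integration.integrable_bound by blast
qed

lemma continuous_L2_scalar:
  assumes "continuous_on {a..b} F"
  shows "L2_scalar {a..b} F"
  unfolding L2_scalar_def
  using assms by (auto intro!: continuous_integrable_on_Icc continuous_imp_measurable_on_sets_lebesgue continuous_intros)

lemma L2_scalar_integrable: "L2_scalar {a..b} F \<Longrightarrow> integrable (lebesgue_on {a..b}) F"
  using L2_scalar_mult_integrable[of "{a..b}" F "\<lambda>_. 1"] continuous_L2_scalar[of a b "\<lambda>_. 1"] by simp

lemma L2_scalar_cmult: "L2_scalar I F \<Longrightarrow> L2_scalar I (\<lambda>t. c * F t)"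
  by (auto simp: L2_scalar_def power_mult_distrib)

lemma L2_scalar_add:
  assumes "L2_scalar I F" "L2_scalar I G"
  shows "L2_scalar I (\<lambda>t. F t + G t)"
proof -
  have "integrable (lebesgue_on I) (\<lambda>t. (F t)\<^sup>2 + (G t)\<^sup>2 + 2 * (F t * G t))"
    using assms L2_scalar_mult_integrable[OF assms] by (auto simp: L2_scalar_def)
  then show ?thesis
    using assms by (auto simp: L2_scalar_def power2_sum algebra_simps)
qed

lemma L2_scalar_zero: "L2_scalar I (\<lambda>_. 0)"
  by (simp add: L2_scalar_def)

lemma L2_scalar_sum: "(\<And>k. k \<in> A \<Longrightarrow> L2_scalar I (F k)) \<Longrightarrow> L2_scalar I (\<lambda>t. \<Sum>k\<in>A. F k t)"
  by (induction A rule: infinite_finite_induct) (auto intro: L2_scalar_add L2_scalar_zero)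

lemma L2_scalar_cong: "(\<And>t. t \<in> I \<Longrightarrow> F t = G t) \<Longrightarrow> I \<in> sets lebesgue \<Longrightarrow> L2_scalar I F = L2_scalar I G"
  unfolding L2_scalar_def
  by (intro conj_cong measurable_cong Bochner_Integration.integrable_cong) (auto simp: space_restrict_space)

lemma LINT_derivative:
  assumes "a \<le> b" "\<And>t. (F has_real_derivative g t) (at t)" "continuous_on {a..b} g"
  shows "(LINT t|lebesgue_on {a..b}. g t) = F b - F a"
proof -
  have "(g has_integral (F b - F a)) {a..b}"
    using assms(2) by (intro fundamental_theorem_of_calculus[OF assms(1)])
      (auto simp: has_real_derivative_iff_has_vector_derivative[symmetric] intro: DERIV_subset)
  then show ?thesis
    using lebesgue_integral_eq_integral[OF continuous_integrable_on_Icc[OF assms(3)]]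
    by (simp add: integral_unique)
qed

section \<open>Integration by parts against a weak derivative\<close>

text \<open>Squaring removes the kink of \<open>max 0\<close>: at \<open>u = c\<close> the
  difference quotient is at most \<open>\<bar>u - c\<bar>\<close> in absolute value.\<close>

lemma pos_part_square_deriv:
  "((\<lambda>u. (max 0 (u - c))\<^sup>2) has_real_derivative 2 * max 0 (u - c)) (at u)" for u c :: real
proof -
  consider "u < c" | "u = c" | "u > c" by linarith
  then show ?thesis
  proof cases
    case 1
    have "((\<lambda>u. 0) has_real_derivative 2 * max 0 (u - c)) (at u)" using 1 by simp
    then show ?thesis
      by (rule DERIV_cong_ev[OF refl _ refl, THEN iffD1, rotated])
        (use 1 in \<open>auto intro!: eventually_mono[OF order_tendstoD(2)[OF tendsto_ident_at, of u c UNIV]]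
          simp: eventually_at_filter eventually_nhds intro!: exI[of _ "{..<c}"]\<close>)
  next
    case 3
    have "((\<lambda>u. (u - c)\<^sup>2) has_real_derivative 2 * max 0 (u - c)) (at u)"
      using 3 by (auto intro!: derivative_eq_intros)
    then show ?thesis
      by (rule DERIV_cong_ev[OF refl _ refl, THEN iffD1, rotated])
        (use 3 in \<open>auto simp: eventually_nhds intro!: exI[of _ "{c<..}"]\<close>)
  next
    case 2
    have "((\<lambda>u. (max 0 (u - c))\<^sup>2 / (u - c)) \<longlongrightarrow> 0) (at c)"
    proof (rule tendsto_rabs_zero_cancel, rule tendsto_sandwich)
      show "\<forall>\<^sub>F u in at c. 0 \<le> \<bar>(max 0 (u - c))\<^sup>2 / (u - c)\<bar>" by simp
      have "\<bar>(max 0 (u - c))\<^sup>2 / (u - c)\<bar> \<le> \<bar>u - c\<bar>" if "u \<noteq> c" for u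
        using that by (cases "u < c") (auto simp: max_def power2_eq_square)
      then show "\<forall>\<^sub>F u in at c. \<bar>(max 0 (u - c))\<^sup>2 / (u - c)\<bar> \<le> \<bar>u - c\<bar>"
        by (simp add: eventually_at_filter)
      have "((\<lambda>u. \<bar>u - c\<bar>) \<longlongrightarrow> \<bar>c - c\<bar>) (at c)" by (intro tendsto_intros)
      then show "((\<lambda>u. \<bar>u - c\<bar>) \<longlongrightarrow> 0) (at c)" by simp
    qed simp
    then show ?thesis
      using 2 by (simp add: has_field_derivative_iff)
  qed
qed

text \<open>A continuously differentiable step from 0 (left of 0) to 1 (right of 1), made of parabolas.\<close>

definition smooth_step :: "real \<Rightarrow> real" where
  "smooth_step u = 2 * (max 0 (u - 0))\<^sup>2 - 4 * (max 0 (u - 1/2))\<^sup>2 + 2 * (max 0 (u - 1))\<^sup>2"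

definition smooth_step' :: "real \<Rightarrow> real" where
  "smooth_step' u = 4 * max 0 (u - 0) - 8 * max 0 (u - 1/2) + 4 * max 0 (u - 1)"

lemma smooth_step_deriv: "(smooth_step has_real_derivative smooth_step' u) (at u)"
proof -
  have "((\<lambda>u. 2 * (max 0 (u - 0))\<^sup>2 - 4 * (max 0 (u - 1/2))\<^sup>2 + 2 * (max 0 (u - 1))\<^sup>2)
      has_real_derivative 2 * (2 * max 0 (u - 0)) - 4 * (2 * max 0 (u - 1/2)) + 2 * (2 * max 0 (u - 1))) (at u)"
    by (intro DERIV_add DERIV_diff DERIV_cmult pos_part_square_deriv)
  then show ?thesis by (simp add: smooth_step_def[abs_def] smooth_step'_def)
qed

lemma smooth_step'_props:
  "smooth_step' u \<ge> 0" "u \<le> 0 \<Longrightarrow> smooth_step' u = 0" "u \<ge> 1 \<Longrightarrow> smooth_step' u = 0"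
  "continuous_on A smooth_step'"
proof -
  show "continuous_on A smooth_step'" unfolding smooth_step'_def by (intro continuous_intros)
qed (auto simp: smooth_step'_def max_def)

text \<open>To the right of 1 the three parabolas cancel to the constant 1. The bounds 0 and 1
  follow from monotonicity, by comparison with points where the value is known.\<close>

lemma smooth_step_props:
  "u \<le> 0 \<Longrightarrow> smooth_step u = 0" "u \<ge> 1 \<Longrightarrow> smooth_step u = 1" "0 \<le> smooth_step u" "smooth_step u \<le> 1"
proof -
  show 0: "smooth_step u = 0" if "u \<le> 0" for u
    using that by (simp add: smooth_step_def max_def)
  show 1: "smooth_step u = 1" if "u \<ge> 1" for u
    using that by (simp add: smooth_step_def max_def power2_eq_square algebra_simps)
  have mono: "smooth_step x \<le> smooth_step y" if "x \<le> y" for x y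
    using DERIV_nonneg_imp_nondecreasing[OF that] smooth_step_deriv smooth_step'_props(1) by blast
  show "0 \<le> smooth_step u" using mono[of "min u 0" u] 0[of "min u 0"] by simp
  show "smooth_step u \<le> 1" using mono[of u "max u 1"] 1[of "max u 1"] by simp
qed

text \<open>Applied at the two end points of the interval, where the derivatives of the cut-offs
  concentrate.\<close>

lemma approximate_identity:
  fixes P :: "real \<Rightarrow> real" and D :: "nat \<Rightarrow> real \<Rightarrow> real"
  assumes P: "continuous_on {a..b} P" and c: "c \<in> {a..b}"
    and D: "\<And>k. continuous_on {a..b} (D k)" "\<And>k t. D k t \<ge> 0" "\<And>k. (LINT t|lebesgue_on {a..b}. D k t) = 1"
    and conc: "\<And>\<delta>. \<delta> > 0 \<Longrightarrow> \<forall>\<^sub>F k in sequentially. \<forall>t\<in>{a..b}. \<bar>t - c\<bar> \<ge> \<delta> \<longrightarrow> D k t = 0"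
  shows "(\<lambda>k. LINT t|lebesgue_on {a..b}. P t * D k t) \<longlonglongrightarrow> P c"
proof (rule LIMSEQ_I)
  fix e :: real assume e: "e > 0"
  obtain \<delta> where \<delta>: "\<delta> > 0" "\<And>t. t \<in> {a..b} \<Longrightarrow> \<bar>t - c\<bar> < \<delta> \<Longrightarrow> \<bar>P t - P c\<bar> < e / 2"
    using P c e unfolding continuous_on_iff dist_real_def
    by (metis half_gt_zero)
  obtain k0 where k0: "\<And>k t. k \<ge> k0 \<Longrightarrow> t \<in> {a..b} \<Longrightarrow> \<bar>t - c\<bar> \<ge> \<delta> \<Longrightarrow> D k t = 0"
    using conc[OF \<delta>(1)] unfolding eventually_sequentially by blast
  have "norm ((LINT t|lebesgue_on {a..b}. P t * D k t) - P c) < e" if "k \<ge> k0" for k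
  proof -
    have i1: "integrable (lebesgue_on {a..b}) (\<lambda>t. P t * D k t)"
      and i2: "integrable (lebesgue_on {a..b}) (\<lambda>t. P c * D k t)"
      and i3: "integrable (lebesgue_on {a..b}) (\<lambda>t. (P t - P c) * D k t)"
      and i4: "integrable (lebesgue_on {a..b}) (\<lambda>t. e / 2 * D k t)"
      using P D(1) by (auto intro!: continuous_integrable_on_Icc continuous_intros)
    have "(LINT t|lebesgue_on {a..b}. P t * D k t) - P c
        = (LINT t|lebesgue_on {a..b}. P t * D k t) - (LINT t|lebesgue_on {a..b}. P c * D k t)"
      by (simp add: D(3))
    also have "\<dots> = (LINT t|lebesgue_on {a..b}. (P t - P c) * D k t)"
      using i1 i2 by (simp add: left_diff_distrib)
    also have "norm \<dots> \<le> (LINT t|lebesgue_on {a..b}. e / 2 * D k t)"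
    proof (rule Bochner_Integration.integral_norm_bound_integral[OF i3 i4])
      fix t assume "t \<in> space (lebesgue_on {a..b})"
      then have t: "t \<in> {a..b}" by (simp add: space_restrict_space)
      show "norm ((P t - P c) * D k t) \<le> e / 2 * D k t"
      proof (cases "\<bar>t - c\<bar> < \<delta>")
        case True
        then have "\<bar>P t - P c\<bar> * D k t \<le> e / 2 * D k t"
          using \<delta>(2)[OF t] D(2)[of k t] by (intro mult_right_mono) auto
        then show ?thesis using D(2)[of k t] by (simp only: real_norm_def abs_mult abs_of_nonneg)
      qed (use k0[OF that t] in auto)
    qed
    also have "\<dots> = e / 2" by (simp add: D(3))
    finally show ?thesis using e by simp
  qed
  then show "\<exists>no. \<forall>n\<ge>no. norm ((LINT t|lebesgue_on {a..b}. P t * D n t) - P c) < e" by blast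
qed

lemma AE_lebesgue_on_not_endpoint: "AE t in lebesgue_on {a..b}. t \<noteq> a \<and> t \<noteq> (b::real)"
proof -
  have "AE t in lebesgue. t \<noteq> a \<and> t \<noteq> b"
    using AE_completion[OF AE_lborel_singleton[of a]] AE_completion[OF AE_lborel_singleton[of b]]
    by eventually_elim auto
  then show ?thesis by (auto simp: AE_restrict_space_iff elim: eventually_mono)
qed

text \<open>\<open>X\<close> times a cut-off that vanishes near both end points is an admissible
  test function. As the cut-offs tend to 1, the derivative of \<open>X\<close> survives in the
  limit, and the derivative of the cut-off becomes a point mass at each end, which produces the
  boundary terms.\<close>

lemma weak_deriv_by_parts:
  fixes F G X x :: "real \<Rightarrow> real"
  assumes wd: "weak_deriv a b F G" and ab: "a < b" and F: "continuous_on {a..b} F"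
    and G: "integrable (lebesgue_on {a..b}) G"
    and X: "\<And>t. (X has_real_derivative x t) (at t)" and x: "continuous_on UNIV x"
  shows "(LINT t|lebesgue_on {a..b}. F t * x t) = F b * X b - F a * X a - (LINT t|lebesgue_on {a..b}. G t * X t)"
proof -
  \<comment> \<open>The summand \<open>4 / (b - a)\<close> keeps the two ramps, which lie within
    \<open>2 / K k\<close> of the end points, from overlapping.\<close>
  define K where "K k = real k + 4 / (b - a)" for k
  have K: "K k > 0" "K k * (b - a) \<ge> 4" for k
  proof -
    show "K k > 0" unfolding K_def using ab by (intro add_nonneg_pos) auto
    have "4 / L * L = 4" if "L > 0" for L :: real using that by simp
    from this[of "b - a"] have "K k * (b - a) = real k * (b - a) + 4"
      unfolding K_def using ab by (simp only: distrib_right)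
    then show "K k * (b - a) \<ge> 4" using ab by simp
  qed
  have Kinf: "filterlim K at_top sequentially"
    by (rule filterlim_at_top_mono[OF filterlim_real_sequentially]) (use ab in \<open>auto simp: K_def\<close>)
  let ?s = smooth_step and ?s' = smooth_step'
  \<comment> \<open>The shift by 1 makes the cut-off vanish within \<open>1 / K k\<close> of each
    end point, so that its support is a compact subset of the open interval; at distance
    \<open>2 / K k\<close> or more from both ends it equals 1.\<close>
  define c where "c k t = ?s (K k * (t - a) - 1) * ?s (K k * (b - t) - 1)" for k t
  define D1 where "D1 k t = K k * ?s' (K k * (t - a) - 1)" for k t
  define D2 where "D2 k t = K k * ?s' (K k * (b - t) - 1)" for k t
  have XC: "continuous_on A X" for A
    using X by (meson DERIV_isCont continuous_at_imp_continuous_on)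
  have xC: "continuous_on A x" for A using x continuous_on_subset by blast
  have sC: "continuous_on A ?s" for A
    using smooth_step_deriv by (meson DERIV_isCont continuous_at_imp_continuous_on)
  have s1: "((\<lambda>t. ?s (K k * (t - a) - 1)) has_real_derivative D1 k t) (at t)" for k t
    unfolding D1_def by (rule DERIV_cong[OF DERIV_chain2[OF smooth_step_deriv]]) (auto intro!: derivative_eq_intros)
  have s2: "((\<lambda>t. ?s (K k * (b - t) - 1)) has_real_derivative - D2 k t) (at t)" for k t
    unfolding D2_def by (rule DERIV_cong[OF DERIV_chain2[OF smooth_step_deriv]]) (auto intro!: derivative_eq_intros)
  \<comment> \<open>The two arguments add up to at least 2, so at every point one of them is at
    least 1. Where one ramp has nonzero slope, the other factor is therefore 1.\<close>
  have near: "D1 k t * ?s (K k * (b - t) - 1) = D1 k t" "D2 k t * ?s (K k * (t - a) - 1) = D2 k t" for k t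
  proof -
    have sum: "(K k * (t - a) - 1) + (K k * (b - t) - 1) \<ge> 2" using K(2)[of k] by (simp add: algebra_simps)
    show "D1 k t * ?s (K k * (b - t) - 1) = D1 k t"
      using sum smooth_step'_props(3)[of "K k * (t - a) - 1"] smooth_step_props(2)[of "K k * (b - t) - 1"]
      by (cases "K k * (t - a) - 1 \<ge> 1") (auto simp: D1_def)
    show "D2 k t * ?s (K k * (t - a) - 1) = D2 k t"
      using sum smooth_step'_props(3)[of "K k * (b - t) - 1"] smooth_step_props(2)[of "K k * (t - a) - 1"]
      by (cases "K k * (b - t) - 1 \<ge> 1") (auto simp: D2_def)
  qed
  have cd: "(c k has_real_derivative D1 k t - D2 k t) (at t)" for k t
    using DERIV_mult[OF s1[of k t] s2[of k t]] unfolding c_def[abs_def]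
    by (simp only: near mult_minus_left add_uminus_conv_diff)
  have DC: "continuous_on A (D1 k)" "continuous_on A (D2 k)" for k A
    unfolding D1_def D2_def
    by (auto intro!: continuous_intros continuous_on_compose2[OF smooth_step'_props(4)[of UNIV]])
  have cC: "continuous_on A (c k)" for k A
    unfolding c_def by (auto intro!: continuous_intros continuous_on_compose2[OF sC[of UNIV]])
  have c01: "\<bar>c k t\<bar> \<le> 1" for k t
    unfolding c_def abs_mult using smooth_step_props(3,4) by (auto intro!: mult_le_one)
  have c1: "(\<lambda>k. c k t) \<longlonglongrightarrow> 1" if "a < t" "t < b" for t
  proof (rule tendsto_eventually)
    have "\<forall>\<^sub>F k in sequentially. K k \<ge> max (2 / (t - a)) (2 / (b - t))"
      using Kinf unfolding filterlim_at_top by blast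
    then show "\<forall>\<^sub>F k in sequentially. c k t = 1"
    proof eventually_elim
      case (elim k)
      then have "K k * (t - a) \<ge> 2" "K k * (b - t) \<ge> 2" using that by (auto simp: field_simps)
      then show ?case by (simp add: c_def smooth_step_props)
    qed
  qed
  have lim: "(\<lambda>k. LINT t|lebesgue_on {a..b}. g t * c k t) \<longlonglongrightarrow> (LINT t|lebesgue_on {a..b}. g t)"
    if g: "integrable (lebesgue_on {a..b}) g" for g :: "real \<Rightarrow> real"
  proof (rule integral_dominated_convergence[where w="\<lambda>t. \<bar>g t\<bar>"])
    show "(\<lambda>t. g t * c k t) \<in> borel_measurable (lebesgue_on {a..b})" for k
      by (intro borel_measurable_times borel_measurable_integrable[OF g] continuous_imp_measurable_on_sets_lebesgue[OF cC]) simp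
    show "AE t in lebesgue_on {a..b}. (\<lambda>k. g t * c k t) \<longlonglongrightarrow> g t"
      using AE_lebesgue_on_not_endpoint[of a b] AE_space
    proof eventually_elim
      case (elim t)
      then have "(\<lambda>k. g t * c k t) \<longlonglongrightarrow> g t * 1" 
        by (intro tendsto_mult tendsto_const c1) (auto simp: space_restrict_space less_le)
      then show ?case by simp
    qed
    show "AE t in lebesgue_on {a..b}. norm (g t * c k t) \<le> \<bar>g t\<bar>" for k
      using c01 by (auto simp: abs_mult intro!: mult_left_le)
  qed (use g in auto)
  have eq: "(LINT t|lebesgue_on {a..b}. F t * x t * c k t)
      = - (LINT t|lebesgue_on {a..b}. G t * X t * c k t)
        - (LINT t|lebesgue_on {a..b}. F t * X t * D1 k t) + (LINT t|lebesgue_on {a..b}. F t * X t * D2 k t)" for k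
  proof -
    let ?\<eta>' = "\<lambda>t. x t * c k t + (D1 k t - D2 k t) * X t"
    have "(LINT t|lebesgue_on {a..b}. F t * ?\<eta>' t) = - (LINT t|lebesgue_on {a..b}. G t * (X t * c k t))"
    proof (rule wd[unfolded weak_deriv_def, rule_format])
      show "((\<lambda>t. X t * c k t) has_real_derivative ?\<eta>' t) (at t)" for t
        by (rule DERIV_mult[OF X cd])
      show "continuous_on UNIV ?\<eta>'"
        using xC XC cC DC by (intro continuous_intros)
      have "2 / K k < b - a" using K[of k] by (simp add: field_simps)
      moreover have "2 / K k = 1 / K k + 1 / K k" "1 / K k > 0" using K(1)[of k] by simp_all
      ultimately have "a < a + 1 / K k" "a + 1 / K k \<le> b - 1 / K k" "b - 1 / K k < b" by linarith+
      moreover have "X t * c k t = 0" if "t \<notin> {a + 1 / K k..b - 1 / K k}" for t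
      proof -
        have "K k * (t - a) - 1 \<le> 0 \<or> K k * (b - t) - 1 \<le> 0"
          using that K(1)[of k] by (auto simp: field_simps)
        then show ?thesis by (auto simp: c_def smooth_step_props)
      qed
      ultimately show "\<exists>c' e. a < c' \<and> c' \<le> e \<and> e < b \<and> (\<forall>t. t \<notin> {c'..e} \<longrightarrow> X t * c k t = 0)"
        by blast
    qed
    moreover have "(LINT t|lebesgue_on {a..b}. F t * ?\<eta>' t) = (LINT t|lebesgue_on {a..b}. F t * x t * c k t)
        + (LINT t|lebesgue_on {a..b}. F t * X t * D1 k t) - (LINT t|lebesgue_on {a..b}. F t * X t * D2 k t)"
    proof -
      have i: "integrable (lebesgue_on {a..b}) (\<lambda>t. F t * x t * c k t)"
        "integrable (lebesgue_on {a..b}) (\<lambda>t. F t * X t * D1 k t)"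
        "integrable (lebesgue_on {a..b}) (\<lambda>t. F t * X t * D2 k t)"
        using F xC XC cC DC by (auto intro!: continuous_integrable_on_Icc continuous_intros)
      have "(LINT t|lebesgue_on {a..b}. F t * ?\<eta>' t)
          = (LINT t|lebesgue_on {a..b}. F t * x t * c k t + F t * X t * D1 k t - F t * X t * D2 k t)"
        by (intro Bochner_Integration.integral_cong) (auto simp: algebra_simps)
      then show ?thesis using i by simp
    qed
    ultimately show ?thesis by (simp add: mult.assoc)
  qed
  have conc: "\<forall>\<^sub>F k in sequentially. \<forall>t. t \<ge> \<delta> \<longrightarrow> ?s' (K k * t - 1) = 0" if "\<delta> > 0" for \<delta>
  proof -
    have "\<forall>\<^sub>F k in sequentially. K k \<ge> 2 / \<delta>" using Kinf unfolding filterlim_at_top by blast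
    then show ?thesis
    proof eventually_elim
      case (elim k)
      have "K k * t \<ge> 2" if "t \<ge> \<delta>" for t
      proof -
        have "2 \<le> K k * \<delta>" using elim \<open>\<delta> > 0\<close> by (simp add: field_simps)
        also have "\<dots> \<le> K k * t" using that K(1)[of k] by simp
        finally show ?thesis .
      qed
      then show ?case by (auto intro!: smooth_step'_props(3))
    qed
  qed
  have FX: "continuous_on {a..b} (\<lambda>t. F t * X t)" using F XC by (intro continuous_intros)
  have l1: "(\<lambda>k. LINT t|lebesgue_on {a..b}. F t * X t * D1 k t) \<longlonglongrightarrow> F a * X a"
  proof (rule approximate_identity[OF FX])
    show "(LINT t|lebesgue_on {a..b}. D1 k t) = 1" for k
      using LINT_derivative[OF _ s1 DC(1), of a b k] ab K(2)[of k] by (simp add: smooth_step_props)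
    show "D1 k t \<ge> 0" for k t using K(1)[of k] smooth_step'_props(1) by (simp add: D1_def)
    show "\<forall>\<^sub>F k in sequentially. \<forall>t\<in>{a..b}. \<delta> \<le> \<bar>t - a\<bar> \<longrightarrow> D1 k t = 0" if "\<delta> > 0" for \<delta>
      using conc[OF that] by eventually_elim (auto simp: D1_def)
  qed (use ab DC in auto)
  have l2: "(\<lambda>k. LINT t|lebesgue_on {a..b}. F t * X t * D2 k t) \<longlonglongrightarrow> F b * X b"
  proof (rule approximate_identity[OF FX])
    have "((\<lambda>t. - ?s (K k * (b - t) - 1)) has_real_derivative D2 k t) (at t)" for k t
      using DERIV_minus[OF s2[of k t]] by simp
    from LINT_derivative[OF _ this DC(2), of a b] show "(LINT t|lebesgue_on {a..b}. D2 k t) = 1" for k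
      using ab K(2)[of k] by (simp add: smooth_step_props)
    show "D2 k t \<ge> 0" for k t using K(1)[of k] smooth_step'_props(1) by (simp add: D2_def)
    show "\<forall>\<^sub>F k in sequentially. \<forall>t\<in>{a..b}. \<delta> \<le> \<bar>t - b\<bar> \<longrightarrow> D2 k t = 0" if "\<delta> > 0" for \<delta>
      using conc[OF that] by eventually_elim (auto simp: D2_def)
  qed (use ab DC in auto)
  have GX: "integrable (lebesgue_on {a..b}) (\<lambda>t. G t * X t)"
  proof -
    obtain B where B: "\<And>t. t \<in> {a..b} \<Longrightarrow> \<bar>X t\<bar> \<le> B"
      using continuous_on_Icc_bounded[OF XC] by blast
    show ?thesis
    proof (rule Bochner_Integration.integrable_bound[of _ "\<lambda>t. B * G t"])
      show "(\<lambda>t. G t * X t) \<in> borel_measurable (lebesgue_on {a..b})"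
        by (intro borel_measurable_times borel_measurable_integrable[OF G] continuous_imp_measurable_on_sets_lebesgue[OF XC]) simp
      show "AE t in lebesgue_on {a..b}. norm (G t * X t) \<le> norm (B * G t)"
      proof (rule AE_I2)
        fix t assume "t \<in> space (lebesgue_on {a..b})"
        then have "\<bar>X t\<bar> \<le> \<bar>B\<bar>" using order_trans[OF B abs_ge_self] by (simp add: space_restrict_space)
        then show "norm (G t * X t) \<le> norm (B * G t)"
          by (simp add: abs_mult mult.commute[of "\<bar>B\<bar>"] mult_left_mono)
      qed
    qed (use G in auto)
  qed
  have "(\<lambda>k. LINT t|lebesgue_on {a..b}. F t * x t * c k t) \<longlonglongrightarrow> (LINT t|lebesgue_on {a..b}. F t * x t)"
    using F xC by (intro lim continuous_integrable_on_Icc continuous_intros)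
  moreover have "(\<lambda>k. LINT t|lebesgue_on {a..b}. F t * x t * c k t)
      \<longlonglongrightarrow> - (LINT t|lebesgue_on {a..b}. G t * X t) - F a * X a + F b * X b"
    unfolding eq by (intro tendsto_intros lim GX l1 l2)
  ultimately show ?thesis using LIMSEQ_unique by fastforce
qed

lemma integrable_mult_continuous:
  fixes G X :: "real \<Rightarrow> real"
  assumes G: "integrable (lebesgue_on {a..b}) G" and X: "continuous_on {a..b} X"
  shows "integrable (lebesgue_on {a..b}) (\<lambda>t. G t * X t)"
proof -
  obtain B where B: "\<And>t. t \<in> {a..b} \<Longrightarrow> \<bar>X t\<bar> \<le> B"
    using continuous_on_Icc_bounded[OF X] by blast
  show ?thesis
  proof (rule Bochner_Integration.integrable_bound[of _ "\<lambda>t. B * G t"])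
    show "(\<lambda>t. G t * X t) \<in> borel_measurable (lebesgue_on {a..b})"
      by (intro borel_measurable_times borel_measurable_integrable[OF G] continuous_imp_measurable_on_sets_lebesgue[OF X]) simp
    show "AE t in lebesgue_on {a..b}. norm (G t * X t) \<le> norm (B * G t)"
    proof (rule AE_I2)
      fix t assume "t \<in> space (lebesgue_on {a..b})"
      then have "\<bar>X t\<bar> \<le> \<bar>B\<bar>" using order_trans[OF B abs_ge_self] by (simp add: space_restrict_space)
      then show "norm (G t * X t) \<le> norm (B * G t)"
        by (simp add: abs_mult mult.commute[of "\<bar>B\<bar>"] mult_left_mono)
    qed
  qed (use G in auto)
qed

section \<open>Differentiating integrals of a kernel against a shifted curve\<close>

lemma continuous_antiderivative:
  fixes \<phi> :: "real \<Rightarrow> real"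
  assumes "continuous_on UNIV \<phi>"
  obtains \<Phi> where "\<And>t. (\<Phi> has_real_derivative \<phi> t) (at t)"
proof -
  have "\<exists>F. \<forall>x :: real. - \<infinity> < ereal x \<longrightarrow> ereal x < \<infinity> \<longrightarrow> (F has_vector_derivative \<phi> x) (at x)"
    using assms by (intro einterval_antiderivative) (auto simp: continuous_on_eq_continuous_at)
  then show ?thesis
    using that by (auto simp: has_real_derivative_iff_has_vector_derivative)
qed

text \<open>Differentiation under the integral sign, along sequences tending to 0. The mean value
  bound for \<Phi> on a compact interval containing all shifted arguments dominates the difference
  quotients by a multiple of \<open>\<bar>G \<tau>\<bar>\<close>.\<close>

lemma deriv_integral_shift:
  fixes G \<phi> \<Phi> :: "real \<Rightarrow> real"
  assumes G: "integrable (lebesgue_on {a..b}) G"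
    and \<Phi>: "\<And>t. (\<Phi> has_real_derivative \<phi> t) (at t)" and \<phi>: "continuous_on UNIV \<phi>"
  shows "((\<lambda>t. LINT \<tau>|lebesgue_on {a..b}. G \<tau> * \<Phi> (t + \<tau>)) has_real_derivative
    (LINT \<tau>|lebesgue_on {a..b}. G \<tau> * \<phi> (t + \<tau>))) (at t)"
  unfolding DERIV_def tendsto_at_iff_sequentially
proof (intro allI impI)
  fix h :: "nat \<Rightarrow> real"
  assume h: "\<forall>i. h i \<in> UNIV - {0}" "h \<longlonglongrightarrow> 0"
  then have h0: "h i \<noteq> 0" for i by auto
  obtain M where M: "\<And>i. \<bar>h i\<bar> \<le> M"
    using convergent_imp_Bseq[OF convergentI[OF h(2)]] by (auto simp: Bseq_def)
  have \<Phi>C: "continuous_on A \<Phi>" for A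
    using \<Phi> by (meson DERIV_isCont continuous_at_imp_continuous_on)
  have shiftC: "continuous_on {a..b} (\<lambda>\<tau>. \<Phi> (s + \<tau>))" "continuous_on {a..b} (\<lambda>\<tau>. \<phi> (s + \<tau>))" for s
    by (rule continuous_on_compose2[OF \<Phi>C[of UNIV]] continuous_on_compose2[OF \<phi>]; auto intro!: continuous_intros)+
  obtain B where B: "\<And>s. s \<in> {t + a - M..t + b + M} \<Longrightarrow> \<bar>\<phi> s\<bar> \<le> B"
    using continuous_on_Icc_bounded[OF continuous_on_subset[OF \<phi> subset_UNIV]] by blast
  let ?q = "\<lambda>i \<tau>. G \<tau> * ((\<Phi> (t + h i + \<tau>) - \<Phi> (t + \<tau>)) / h i)"
  have "((LINT \<tau>|lebesgue_on {a..b}. G \<tau> * \<Phi> (t + h i + \<tau>)) - (LINT \<tau>|lebesgue_on {a..b}. G \<tau> * \<Phi> (t + \<tau>))) / h i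
      = (LINT \<tau>|lebesgue_on {a..b}. ?q i \<tau>)" for i
  proof -
    have "(LINT \<tau>|lebesgue_on {a..b}. ?q i \<tau>)
        = (LINT \<tau>|lebesgue_on {a..b}. (G \<tau> * \<Phi> (t + h i + \<tau>) - G \<tau> * \<Phi> (t + \<tau>)) / h i)"
      by (intro Bochner_Integration.integral_cong) (auto simp: algebra_simps)
    also have "\<dots> = (LINT \<tau>|lebesgue_on {a..b}. G \<tau> * \<Phi> (t + h i + \<tau>) - G \<tau> * \<Phi> (t + \<tau>)) / h i"
      by simp
    also have "(LINT \<tau>|lebesgue_on {a..b}. G \<tau> * \<Phi> (t + h i + \<tau>) - G \<tau> * \<Phi> (t + \<tau>))
      = (LINT \<tau>|lebesgue_on {a..b}. G \<tau> * \<Phi> (t + h i + \<tau>)) - (LINT \<tau>|lebesgue_on {a..b}. G \<tau> * \<Phi> (t + \<tau>))"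
      by (intro Bochner_Integration.integral_diff integrable_mult_continuous[OF G] shiftC)
    finally show ?thesis by (rule sym)
  qed
  moreover have "(\<lambda>i. LINT \<tau>|lebesgue_on {a..b}. ?q i \<tau>) \<longlonglongrightarrow> (LINT \<tau>|lebesgue_on {a..b}. G \<tau> * \<phi> (t + \<tau>))"
  proof (rule integral_dominated_convergence[where w="\<lambda>\<tau>. B * \<bar>G \<tau>\<bar>"])
    show "(\<lambda>\<tau>. G \<tau> * \<phi> (t + \<tau>)) \<in> borel_measurable (lebesgue_on {a..b})"
      by (intro borel_measurable_integrable integrable_mult_continuous[OF G] shiftC)
    show "?q i \<in> borel_measurable (lebesgue_on {a..b})" for i
      using h0[of i] by (intro borel_measurable_integrable integrable_mult_continuous[OF G] continuous_intros shiftC) auto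
    show "integrable (lebesgue_on {a..b}) (\<lambda>\<tau>. B * \<bar>G \<tau>\<bar>)" using G by auto
    show "AE \<tau> in lebesgue_on {a..b}. (\<lambda>i. ?q i \<tau>) \<longlonglongrightarrow> G \<tau> * \<phi> (t + \<tau>)"
    proof (rule AE_I2)
      fix \<tau>
      have "((\<lambda>x. (\<Phi> (t + \<tau> + x) - \<Phi> (t + \<tau>)) / x) \<longlongrightarrow> \<phi> (t + \<tau>)) (at 0)"
        using \<Phi>[of "t + \<tau>"] by (simp add: DERIV_def)
      then have "(\<lambda>i. (\<Phi> (t + \<tau> + h i) - \<Phi> (t + \<tau>)) / h i) \<longlonglongrightarrow> \<phi> (t + \<tau>)"
        using h unfolding tendsto_at_iff_sequentially o_def by blast
      then have "(\<lambda>i. G \<tau> * ((\<Phi> (t + \<tau> + h i) - \<Phi> (t + \<tau>)) / h i)) \<longlonglongrightarrow> G \<tau> * \<phi> (t + \<tau>)"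
        by (intro tendsto_mult tendsto_const)
      then show "(\<lambda>i. ?q i \<tau>) \<longlonglongrightarrow> G \<tau> * \<phi> (t + \<tau>)" by (simp add: ac_simps)
    qed
    show "AE \<tau> in lebesgue_on {a..b}. norm (?q i \<tau>) \<le> B * \<bar>G \<tau>\<bar>" for i
    proof (rule AE_I2)
      fix \<tau> assume "\<tau> \<in> space (lebesgue_on {a..b})"
      then have \<tau>: "a \<le> \<tau>" "\<tau> \<le> b" by (auto simp: space_restrict_space)
      have "norm (\<Phi> (t + h i + \<tau>) - \<Phi> (t + \<tau>)) \<le> B * norm (t + h i + \<tau> - (t + \<tau>))"
      proof (rule field_differentiable_bound[where S="{t + a - M..t + b + M}"])
        show "(\<Phi> has_field_derivative \<phi> z) (at z within {t + a - M..t + b + M})" for z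
          using \<Phi> by (rule has_field_derivative_at_within)
      qed (use B \<tau> M[of i] in \<open>auto simp: abs_le_iff\<close>)
      then have "\<bar>(\<Phi> (t + h i + \<tau>) - \<Phi> (t + \<tau>)) / h i\<bar> \<le> B"
        using h0[of i] by (simp add: field_simps)
      then show "norm (?q i \<tau>) \<le> B * \<bar>G \<tau>\<bar>"
        unfolding real_norm_def abs_mult[of "G \<tau>"] mult.commute[of B] by (rule mult_left_mono) simp
    qed
  qed
  ultimately show "((\<lambda>x. ((LINT \<tau>|lebesgue_on {a..b}. G \<tau> * \<Phi> (t + x + \<tau>)) - (LINT \<tau>|lebesgue_on {a..b}. G \<tau> * \<Phi> (t + \<tau>))) / x) \<circ> h)
      \<longlonglongrightarrow> (LINT \<tau>|lebesgue_on {a..b}. G \<tau> * \<phi> (t + \<tau>))"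
    unfolding o_def by (simp only:)
qed

text \<open>\<phi> is only continuous and cannot be differentiated under the integral. Integration
  by parts against an antiderivative \<Phi> writes the function as boundary values of \<Phi> minus
  an integral of \<open>G\<close> against \<Phi>, and both are differentiable in
  \<open>t\<close>.\<close>

lemma weak_deriv_shift:
  fixes F G \<phi> :: "real \<Rightarrow> real"
  assumes wd: "weak_deriv a b F G" and ab: "a < b" and F: "continuous_on {a..b} F"
    and G: "integrable (lebesgue_on {a..b}) G" and \<phi>: "continuous_on UNIV \<phi>"
  shows "((\<lambda>t. LINT \<tau>|lebesgue_on {a..b}. F \<tau> * \<phi> (t + \<tau>)) has_real_derivative
    F b * \<phi> (t + b) - F a * \<phi> (t + a) - (LINT \<tau>|lebesgue_on {a..b}. G \<tau> * \<phi> (t + \<tau>))) (at t)"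
proof -
  obtain \<Phi> where \<Phi>: "\<And>t. (\<Phi> has_real_derivative \<phi> t) (at t)"
    using continuous_antiderivative[OF \<phi>] by blast
  have s: "((\<lambda>t. \<Phi> (t + c)) has_real_derivative \<phi> (t + c)) (at t)" for t c
    using \<Phi>[of "t + c"] by (simp only: DERIV_shift)
  have s2: "((\<lambda>t. \<Phi> (c + t)) has_real_derivative \<phi> (c + t)) (at t)" for t c
    unfolding add.commute[of c] by (rule s)
  have c: "continuous_on UNIV (\<lambda>\<tau>. \<phi> (t + \<tau>))" for t
    by (rule continuous_on_compose2[OF \<phi>]) (auto intro!: continuous_intros)
  have "(\<lambda>t. LINT \<tau>|lebesgue_on {a..b}. F \<tau> * \<phi> (t + \<tau>))
      = (\<lambda>t. F b * \<Phi> (t + b) - F a * \<Phi> (t + a) - (LINT \<tau>|lebesgue_on {a..b}. G \<tau> * \<Phi> (t + \<tau>)))"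
    by (rule ext) (rule weak_deriv_by_parts[OF wd ab F G s2 c])
  then show ?thesis
    by (auto intro!: DERIV_diff DERIV_cmult s deriv_integral_shift[OF G \<Phi> \<phi>])
qed

section \<open>Absolutely continuous functions\<close>

text \<open>A comparison principle: increments of \<open>H\<close> bounded by those of
  \<open>F\<close> and \<open>G\<close> inherit the smallness. Sums and products are
  instances.\<close>

lemma abs_cont_onI_dominated:
  assumes F: "abs_cont_on a b F" and G: "abs_cont_on a b G" and L: "L > 0"
    and H: "\<And>c e. a \<le> c \<Longrightarrow> c \<le> e \<Longrightarrow> e \<le> b \<Longrightarrow> \<bar>H e - H c\<bar> \<le> L * (\<bar>F e - F c\<bar> + \<bar>G e - G c\<bar>)"
  shows "abs_cont_on a b H"
  unfolding abs_cont_on_def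
proof (intro allI impI)
  fix \<epsilon> :: real assume "\<epsilon> > 0"
  then have e: "\<epsilon> / (2 * L) > 0" using L by simp
  obtain d1 where d1: "d1 > 0" "\<And>D. finite D \<Longrightarrow> (\<forall>(c, e)\<in>D. a \<le> c \<and> c \<le> e \<and> e \<le> b) \<Longrightarrow>
      pairwise (\<lambda>(c, e) (c', e'). {c<..<e} \<inter> {c'<..<e'} = {}) D \<Longrightarrow>
      (\<Sum>(c, e)\<in>D. e - c) < d1 \<Longrightarrow> (\<Sum>(c, e)\<in>D. \<bar>F e - F c\<bar>) < \<epsilon> / (2 * L)"
    using F e unfolding abs_cont_on_def by blast
  obtain d2 where d2: "d2 > 0" "\<And>D. finite D \<Longrightarrow> (\<forall>(c, e)\<in>D. a \<le> c \<and> c \<le> e \<and> e \<le> b) \<Longrightarrow>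
      pairwise (\<lambda>(c, e) (c', e'). {c<..<e} \<inter> {c'<..<e'} = {}) D \<Longrightarrow>
      (\<Sum>(c, e)\<in>D. e - c) < d2 \<Longrightarrow> (\<Sum>(c, e)\<in>D. \<bar>G e - G c\<bar>) < \<epsilon> / (2 * L)"
    using G e unfolding abs_cont_on_def by blast
  show "\<exists>\<delta>>0. \<forall>D. finite D \<longrightarrow> (\<forall>(c, e)\<in>D. a \<le> c \<and> c \<le> e \<and> e \<le> b) \<longrightarrow>
      pairwise (\<lambda>(c, e) (c', e'). {c<..<e} \<inter> {c'<..<e'} = {}) D \<longrightarrow>
      (\<Sum>(c, e)\<in>D. e - c) < \<delta> \<longrightarrow> (\<Sum>(c, e)\<in>D. \<bar>H e - H c\<bar>) < \<epsilon>"
  proof (intro exI[of _ "min d1 d2"] conjI allI impI)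
    fix D :: "(real \<times> real) set"
    assume D: "finite D" "\<forall>(c, e)\<in>D. a \<le> c \<and> c \<le> e \<and> e \<le> b"
      "pairwise (\<lambda>(c, e) (c', e'). {c<..<e} \<inter> {c'<..<e'} = {}) D" "(\<Sum>(c, e)\<in>D. e - c) < min d1 d2"
    have "(\<Sum>(c, e)\<in>D. \<bar>H e - H c\<bar>) \<le> (\<Sum>(c, e)\<in>D. L * (\<bar>F e - F c\<bar> + \<bar>G e - G c\<bar>))"
      using D(2) by (intro sum_mono) (auto intro!: H)
    also have "\<dots> = L * ((\<Sum>(c, e)\<in>D. \<bar>F e - F c\<bar>) + (\<Sum>(c, e)\<in>D. \<bar>G e - G c\<bar>))"
      by (simp add: split_def sum_distrib_left sum.distrib distrib_left)
    also have "\<dots> < L * (\<epsilon> / (2 * L) + \<epsilon> / (2 * L))"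
      using d1(2)[OF D(1-3)] d2(2)[OF D(1-3)] D(4) L by (intro mult_strict_left_mono add_strict_mono) auto
    also have "\<dots> = \<epsilon>" using L by simp
    finally show "(\<Sum>(c, e)\<in>D. \<bar>H e - H c\<bar>) < \<epsilon>" .
  qed (use d1 d2 in auto)
qed

lemma abs_cont_on_lipschitz:
  assumes "\<And>c e. a \<le> c \<Longrightarrow> c \<le> e \<Longrightarrow> e \<le> b \<Longrightarrow> \<bar>F e - F c\<bar> \<le> L * (e - c)"
  shows "abs_cont_on a b F"
  unfolding abs_cont_on_def
proof (intro allI impI)
  fix \<epsilon> :: real assume e: "\<epsilon> > 0"
  show "\<exists>\<delta>>0. \<forall>D. finite D \<longrightarrow> (\<forall>(c, e)\<in>D. a \<le> c \<and> c \<le> e \<and> e \<le> b) \<longrightarrow>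
      pairwise (\<lambda>(c, e) (c', e'). {c<..<e} \<inter> {c'<..<e'} = {}) D \<longrightarrow>
      (\<Sum>(c, e)\<in>D. e - c) < \<delta> \<longrightarrow> (\<Sum>(c, e)\<in>D. \<bar>F e - F c\<bar>) < \<epsilon>"
  \<comment> \<open>\<open>\<bar>L\<bar> + 1\<close> stands in for \<open>L\<close>, which may be
    zero or negative.\<close>
  proof (intro exI[of _ "\<epsilon> / (\<bar>L\<bar> + 1)"] conjI allI impI)
    fix D :: "(real \<times> real) set"
    assume D: "finite D" "\<forall>(c, e)\<in>D. a \<le> c \<and> c \<le> e \<and> e \<le> b"
      and s: "(\<Sum>(c, e)\<in>D. e - c) < \<epsilon> / (\<bar>L\<bar> + 1)"
    have "\<bar>F e - F c\<bar> \<le> (\<bar>L\<bar> + 1) * (e - c)" if "a \<le> c" "c \<le> e" "e \<le> b" for c e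
    proof -
      have "L * (e - c) \<le> (\<bar>L\<bar> + 1) * (e - c)" using that by (intro mult_right_mono) auto
      with assms[OF that] show ?thesis by linarith
    qed
    then have "(\<Sum>(c, e)\<in>D. \<bar>F e - F c\<bar>) \<le> (\<Sum>(c, e)\<in>D. (\<bar>L\<bar> + 1) * (e - c))"
      using D(2) by (intro sum_mono) auto
    also have "\<dots> = (\<bar>L\<bar> + 1) * (\<Sum>(c, e)\<in>D. e - c)" by (simp add: split_def sum_distrib_left)
    also have "\<dots> < (\<bar>L\<bar> + 1) * (\<epsilon> / (\<bar>L\<bar> + 1))" using s by (intro mult_strict_left_mono) auto
    also have "\<dots> = \<epsilon>" by (simp add: abs_add_one_gt_zero[THEN less_imp_neq, THEN not_sym])
    finally show "(\<Sum>(c, e)\<in>D. \<bar>F e - F c\<bar>) < \<epsilon>" .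
  qed (use e in \<open>auto intro!: divide_pos_pos\<close>)
qed

lemma abs_cont_on_const: "abs_cont_on a b (\<lambda>_. c)"
  by (rule abs_cont_on_lipschitz[of _ _ _ 0]) auto

lemma abs_cont_on_continuous:
  assumes "abs_cont_on a b F"
  shows "continuous_on {a..b} F"
  unfolding continuous_on_iff dist_real_def
proof (intro ballI allI impI)
  fix x \<epsilon> :: real assume x: "x \<in> {a..b}" and e: "\<epsilon> > 0"
  obtain \<delta> where d: "\<delta> > 0" "\<And>D. finite D \<Longrightarrow> (\<forall>(c, e)\<in>D. a \<le> c \<and> c \<le> e \<and> e \<le> b) \<Longrightarrow>
      pairwise (\<lambda>(c, e) (c', e'). {c<..<e} \<inter> {c'<..<e'} = {}) D \<Longrightarrow>
      (\<Sum>(c, e)\<in>D. e - c) < \<delta> \<Longrightarrow> (\<Sum>(c, e)\<in>D. \<bar>F e - F c\<bar>) < \<epsilon>"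
    using assms e unfolding abs_cont_on_def by blast
  have "\<bar>F y - F x\<bar> < \<epsilon>" if y: "y \<in> {a..b}" "\<bar>y - x\<bar> < \<delta>" for y
    using d(2)[of "{(x, y)}"] d(2)[of "{(y, x)}"] x y
    by (cases "x \<le> y") (auto simp: abs_minus_commute[of "F y"])
  then show "\<exists>d>0. \<forall>x'\<in>{a..b}. \<bar>x' - x\<bar> < d \<longrightarrow> \<bar>F x' - F x\<bar> < \<epsilon>" using d(1) by blast
qed

lemma abs_cont_on_add: "abs_cont_on a b F \<Longrightarrow> abs_cont_on a b G \<Longrightarrow> abs_cont_on a b (\<lambda>t. F t + G t)"
  by (erule (1) abs_cont_onI_dominated[of _ _ _ _ 1]) auto

lemma abs_cont_on_mult:
  assumes "abs_cont_on a b F" "abs_cont_on a b G"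
  shows "abs_cont_on a b (\<lambda>t. F t * G t)"
proof -
  obtain A where A: "\<And>t. t \<in> {a..b} \<Longrightarrow> \<bar>F t\<bar> \<le> A"
    using continuous_on_Icc_bounded[OF abs_cont_on_continuous[OF assms(1)]] by blast
  obtain B where B: "\<And>t. t \<in> {a..b} \<Longrightarrow> \<bar>G t\<bar> \<le> B"
    using continuous_on_Icc_bounded[OF abs_cont_on_continuous[OF assms(2)]] by blast
  show ?thesis
  proof (rule abs_cont_onI_dominated[OF assms, of "\<bar>A\<bar> + \<bar>B\<bar> + 1"])
    fix c e assume ce: "a \<le> c" "c \<le> e" "e \<le> b"
    have "F e * G e - F c * G c = G e * (F e - F c) + F c * (G e - G c)" by (simp add: algebra_simps)
    then have "\<bar>F e * G e - F c * G c\<bar> \<le> \<bar>G e\<bar> * \<bar>F e - F c\<bar> + \<bar>F c\<bar> * \<bar>G e - G c\<bar>"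
      by (metis abs_mult abs_triangle_ineq)
    also have "\<dots> \<le> (\<bar>A\<bar> + \<bar>B\<bar> + 1) * \<bar>F e - F c\<bar> + (\<bar>A\<bar> + \<bar>B\<bar> + 1) * \<bar>G e - G c\<bar>"
      using A[of c] B[of e] ce by (intro add_mono mult_right_mono) auto
    finally show "\<bar>F e * G e - F c * G c\<bar> \<le> (\<bar>A\<bar> + \<bar>B\<bar> + 1) * (\<bar>F e - F c\<bar> + \<bar>G e - G c\<bar>)"
      by (simp add: distrib_left)
  qed auto
qed

lemma abs_cont_on_sum: "(\<And>k. k \<in> A \<Longrightarrow> abs_cont_on a b (F k)) \<Longrightarrow> abs_cont_on a b (\<lambda>t. \<Sum>k\<in>A. F k t)"
  by (induction A rule: infinite_finite_induct) (auto intro: abs_cont_on_add abs_cont_on_const)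

lemma abs_cont_on_cmult: "abs_cont_on a b F \<Longrightarrow> abs_cont_on a b (\<lambda>t. c * F t)"
  by (intro abs_cont_on_mult abs_cont_on_const)

lemma abs_cont_on_deriv:
  assumes F: "\<And>t. (F has_real_derivative F' t) (at t)" and B: "\<And>t. t \<in> {a..b} \<Longrightarrow> \<bar>F' t\<bar> \<le> B"
  shows "abs_cont_on a b F"
proof (rule abs_cont_on_lipschitz)
  fix c e assume ce: "a \<le> c" "c \<le> e" "e \<le> b"
  have "norm (F e - F c) \<le> B * norm (e - c)"
  proof (rule field_differentiable_bound[where S="{a..b}"])
    show "(F has_field_derivative F' z) (at z within {a..b})" for z
      using F by (rule has_field_derivative_at_within)
  qed (use B ce in auto)
  then show "\<bar>F e - F c\<bar> \<le> B * (e - c)" using ce by simp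
qed

text \<open>Off an exceptional null set the increment over a fine interval is controlled by the derivative;
  on the exceptional set, covered by an open set of small measure, by absolute continuity.\<close>

lemma abs_cont_on_nonincreasing:
  fixes F :: "real \<Rightarrow> real"
  assumes ab: "a \<le> b" and ac: "abs_cont_on a b F"
    and ae: "AE t in lebesgue_on {a..b}. \<exists>D\<le>0. (F has_real_derivative D) (at t)"
  shows "F b \<le> F a"
proof (rule field_le_epsilon)
  fix \<epsilon>0 :: real assume e0: "\<epsilon>0 > 0"
  \<comment> \<open>Tags outside the null set contribute at most
    \<open>\<epsilon> * (b - a)\<close>, tags inside it at most \<epsilon>; the denominator makes
    the total equal to the prescribed error.\<close>
  define \<epsilon> where "\<epsilon> = \<epsilon>0 / (b - a + 1)"
  have e: "\<epsilon> > 0" "\<epsilon> * (b - a) + \<epsilon> = \<epsilon>0" using e0 ab by (auto simp: \<epsilon>_def field_simps add_divide_distrib[symmetric])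
  obtain \<delta> where d: "\<delta> > 0" "\<And>D. finite D \<Longrightarrow> (\<forall>(c, e)\<in>D. a \<le> c \<and> c \<le> e \<and> e \<le> b) \<Longrightarrow>
      pairwise (\<lambda>(c, e) (c', e'). {c<..<e} \<inter> {c'<..<e'} = {}) D \<Longrightarrow>
      (\<Sum>(c, e)\<in>D. e - c) < \<delta> \<Longrightarrow> (\<Sum>(c, e)\<in>D. \<bar>F e - F c\<bar>) < \<epsilon>"
    using ac e(1) unfolding abs_cont_on_def by blast
  obtain N where N: "{t \<in> space (lebesgue_on {a..b}). \<not> (\<exists>D\<le>0. (F has_real_derivative D) (at t))} \<subseteq> N"
    "emeasure (lebesgue_on {a..b}) N = 0" "N \<in> sets (lebesgue_on {a..b})"
    using AE_E[OF ae] by blast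
  have Ns: "N \<in> sets lebesgue" using N(3) by (auto simp: sets_restrict_space)
  have "N \<subseteq> {a..b}" using sets.sets_into_space[OF N(3)] by (simp add: space_restrict_space)
  then have N0: "emeasure lebesgue N = 0" using N(2) by (simp add: emeasure_restrict_space)
  \<comment> \<open>An open cover of the null set with measure below the threshold \<delta> of
    absolute continuity: intervals tagged in \<open>N\<close> will lie inside \<open>T\<close> and
    have total length below \<delta>.\<close>
  obtain T where T: "open T" "N \<subseteq> T" "(T - N) \<in> lmeasurable" "emeasure lebesgue (T - N) < ennreal \<delta>"
    using sets_lebesgue_outer_open[OF Ns d(1)] by blast
  have Tm: "T \<in> sets lebesgue" using T(1) by auto
  have "emeasure lebesgue T \<le> emeasure lebesgue N + emeasure lebesgue (T - N)"
    using emeasure_subadditive[of N lebesgue "T - N"] Ns Tm T(2) by (simp add: Un_absorb1)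
  then have Te: "emeasure lebesgue T < ennreal \<delta>" using T(4) N0 by simp
  \<comment> \<open>Both ends of the interval are compared with the tag between them. The errors add
    up to at most \<open>\<epsilon> * (v - u)\<close>, and the linear part
    \<open>D * (v - u)\<close> is nonpositive.\<close>
  have good: "\<exists>s>0. \<forall>u v. u \<le> t \<longrightarrow> t \<le> v \<longrightarrow> {u..v} \<subseteq> ball t s \<longrightarrow> F v - F u \<le> \<epsilon> * (v - u)"
    if t: "t \<in> {a..b}" "t \<notin> N" for t
  proof -
    obtain D where D: "D \<le> 0" "(F has_real_derivative D) (at t)"
      using t N(1) by (auto simp: space_restrict_space)
    then obtain s where s: "s > 0" "\<And>y. norm (y - t) < s \<Longrightarrow> norm (F y - F t - D * (y - t)) \<le> \<epsilon> * norm (y - t)"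
      using e(1) unfolding has_field_derivative_def has_derivative_at_alt by blast
    have "F v - F u \<le> \<epsilon> * (v - u)" if uv: "u \<le> t" "t \<le> v" "{u..v} \<subseteq> ball t s" for u v
    proof -
      have "u \<in> {u..v}" "v \<in> {u..v}" using uv by auto
      then have "u \<in> ball t s" "v \<in> ball t s" using uv(3) by blast+
      then have "\<bar>F v - F t - D * (v - t)\<bar> \<le> \<epsilon> * \<bar>v - t\<bar>" "\<bar>F u - F t - D * (u - t)\<bar> \<le> \<epsilon> * \<bar>u - t\<bar>"
        using s(2)[of v] s(2)[of u] by (auto simp: dist_real_def abs_minus_commute)
      moreover have "D * (v - t) \<le> 0" "0 \<le> D * (u - t)"
        using D(1) uv by (auto simp: mult_nonpos_nonneg mult_nonpos_nonpos)
      ultimately show ?thesis using uv by (simp add: algebra_simps abs_le_iff)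
    qed
    with s(1) show ?thesis by blast
  qed
  have badE: "\<exists>s>0. ball t s \<subseteq> T" if "t \<in> N" for t
    using T(1,2) that openE by blast
  have "\<forall>t. \<exists>s>0. (t \<in> N \<longrightarrow> ball t s \<subseteq> T) \<and> (t \<in> {a..b} \<and> t \<notin> N \<longrightarrow>
      (\<forall>u v. u \<le> t \<longrightarrow> t \<le> v \<longrightarrow> {u..v} \<subseteq> ball t s \<longrightarrow> F v - F u \<le> \<epsilon> * (v - u)))"
  proof
    fix t
    consider "t \<in> N" | "t \<notin> N" "t \<in> {a..b}" | "t \<notin> N" "t \<notin> {a..b}" by blast
    then show "\<exists>s>0. (t \<in> N \<longrightarrow> ball t s \<subseteq> T) \<and> (t \<in> {a..b} \<and> t \<notin> N \<longrightarrow>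
        (\<forall>u v. u \<le> t \<longrightarrow> t \<le> v \<longrightarrow> {u..v} \<subseteq> ball t s \<longrightarrow> F v - F u \<le> \<epsilon> * (v - u)))"
    proof cases
      case 1
      from badE[OF this] obtain s where "s > 0" "ball t s \<subseteq> T" by (elim exE conjE)
      with 1 show ?thesis by (intro exI[of _ s]) simp
    next
      case 2
      from good[OF 2(2,1)] obtain s where "s > 0"
        "\<forall>u v. u \<le> t \<longrightarrow> t \<le> v \<longrightarrow> {u..v} \<subseteq> ball t s \<longrightarrow> F v - F u \<le> \<epsilon> * (v - u)" by (elim exE conjE)
      with 2 show ?thesis by (intro exI[of _ s]) simp
    next
      case 3
      then show ?thesis by (intro exI[of _ 1]) auto
    qed
  qed
  from choice[OF this] obtain s where s: "\<forall>t. s t > 0 \<and> (t \<in> N \<longrightarrow> ball t (s t) \<subseteq> T) \<and> (t \<in> {a..b} \<and> t \<notin> N \<longrightarrow>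
      (\<forall>u v. u \<le> t \<longrightarrow> t \<le> v \<longrightarrow> {u..v} \<subseteq> ball t (s t) \<longrightarrow> F v - F u \<le> \<epsilon> * (v - u)))" ..
  then have s0: "s t > 0" and sN: "t \<in> N \<Longrightarrow> ball t (s t) \<subseteq> T" for t by simp_all
  have sG: "F v - F u \<le> \<epsilon> * (v - u)"
    if "t \<in> {a..b}" "t \<notin> N" "u \<le> t" "t \<le> v" "{u..v} \<subseteq> ball t (s t)" for t u v
    using s[rule_format, of t] that by simp
  have "gauge (\<lambda>t. ball t (s t))"
    by (rule gauge_ball_dependent) (use s0 in blast)
  then obtain p where p: "p tagged_division_of {a..b}" "(\<lambda>t. ball t (s t)) fine p"
    using fine_division_exists_real by blast
  note tp = tagged_division_ofD[OF p(1)]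
  have K: "\<exists>u v. K = {u..v} \<and> u \<le> t \<and> t \<le> v \<and> a \<le> u \<and> v \<le> b \<and> Inf K = u \<and> Sup K = v \<and> {u..v} \<subseteq> ball t (s t)"
    if tK: "(t, K) \<in> p" for t K
  proof -
    obtain u v where uv: "K = {u..v}" using tp(4)[OF tK] by auto
    moreover have "t \<in> K" "K \<subseteq> {a..b}" using tp(2,3)[OF tK] by auto
    moreover have "K \<subseteq> ball t (s t)" using p(2) tK by (auto simp: fine_def)
    ultimately show ?thesis by auto
  qed
  let ?inc = "\<lambda>(t :: real, K). F (Sup K) - F (Inf K)"
  define p1 where "p1 = {z \<in> p. fst z \<notin> N}"
  define p2 where "p2 = {z \<in> p. fst z \<in> N \<and> Inf (snd z) < Sup (snd z)}"
  \<comment> \<open>Degenerate intervals are split off: they contribute nothing, and only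
    nondegenerate ones are determined by their end points.\<close>
  define p3 where "p3 = {z \<in> p. fst z \<in> N \<and> \<not> Inf (snd z) < Sup (snd z)}"
  have fin: "finite p1" "finite p2" "finite p3" and pU: "p = p1 \<union> (p2 \<union> p3)" "p1 \<inter> (p2 \<union> p3) = {}" "p2 \<inter> p3 = {}"
    using tp(1) by (auto simp: p1_def p2_def p3_def)
  have "F b - F a = sum ?inc p"
    using additive_tagged_division_1[OF ab p(1), of F] by simp
  also have "\<dots> = sum ?inc p1 + (sum ?inc p2 + sum ?inc p3)"
    using fin pU by (simp add: sum.union_disjoint)
  also have "sum ?inc p3 = 0"
  proof (rule sum.neutral, rule ballI)
    fix z assume "z \<in> p3"
    then obtain t K' where z: "z = (t, K')" "(t, K') \<in> p" "\<not> Inf K' < Sup K'" by (cases z) (auto simp: p3_def)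
    from K[OF z(2)] z(3) have "Sup K' = Inf K'" by auto
    then show "?inc z = 0" using z(1) by simp
  qed
  also have "sum ?inc p1 \<le> \<epsilon> * (b - a)"
  proof -
    have "sum ?inc p1 \<le> (\<Sum>(t, K)\<in>p1. \<epsilon> * (Sup K - Inf K))"
    proof (rule sum_mono)
      fix z assume "z \<in> p1"
      then obtain t K' where z: "z = (t, K')" "(t, K') \<in> p" "t \<notin> N" by (cases z) (auto simp: p1_def)
      from K[OF z(2)] obtain u v where uv: "u \<le> t" "t \<le> v" "a \<le> u" "v \<le> b" "Inf K' = u" "Sup K' = v" "{u..v} \<subseteq> ball t (s t)"
        by blast
      then have "t \<in> {a..b}" by auto
      then show "?inc z \<le> (case z of (t, K) \<Rightarrow> \<epsilon> * (Sup K - Inf K))"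
        using sG[of t] z uv by auto
    qed
    also have "\<dots> \<le> (\<Sum>(t, K)\<in>p. \<epsilon> * (Sup K - Inf K))"
    proof (rule sum_mono2)
      show "\<And>z. z \<in> p - p1 \<Longrightarrow> 0 \<le> (case z of (t, K) \<Rightarrow> \<epsilon> * (Sup K - Inf K))"
        using e(1) by (auto dest!: K)
    qed (use tp(1) pU in auto)
    also have "\<dots> = \<epsilon> * (\<Sum>(t, K)\<in>p. Sup K - Inf K)" by (simp add: split_def sum_distrib_left)
    also have "(\<Sum>(t, K)\<in>p. Sup K - Inf K) = b - a"
      using additive_tagged_division_1[OF ab p(1), of "\<lambda>x. x"] by simp
    finally show ?thesis .
  qed
  also have "sum ?inc p2 \<le> \<epsilon>"
  proof -
    let ?f = "\<lambda>(t :: real, K :: real set). (Inf K, Sup K)"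
    have p2K: "\<exists>u v. K = {u..v} \<and> u < v \<and> a \<le> u \<and> v \<le> b \<and> Inf K = u \<and> Sup K = v \<and> {u..v} \<subseteq> T"
      if "(t, K) \<in> p2" for t K
    proof -
      have "(t, K) \<in> p" "t \<in> N" "Inf K < Sup K" using that by (auto simp: p2_def)
      with K[of t K] sN[of t] show ?thesis by fastforce
    qed
    have disj: "{Inf K<..<Sup K} \<inter> {Inf K'<..<Sup K'} = {}"
      if "(t, K) \<in> p2" "(t', K') \<in> p2" "(t, K) \<noteq> (t', K')" for t K t' K'
    proof -
      have "interior K \<inter> interior K' = {}"
        using tp(5)[of t K t' K'] that by (auto simp: p2_def)
      moreover have "interior K = {Inf K<..<Sup K}" "interior K' = {Inf K'<..<Sup K'}"
        using p2K[OF that(1)] p2K[OF that(2)] interior_atLeastAtMost_real by metis+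
      ultimately show ?thesis by (simp only:)
    qed
    \<comment> \<open>Distinct members have disjoint nonempty interiors and hence cannot share both
      end points.\<close>
    have inj: "inj_on ?f p2"
    proof (rule inj_onI, clarsimp)
      fix t K t' K' assume A: "(t, K) \<in> p2" "(t', K') \<in> p2" "Inf K = Inf K'" "Sup K = Sup K'"
      show "t = t' \<and> K = K'"
        using disj[OF A(1,2)] p2K[OF A(1)] A(3,4) dense[of "Inf K" "Sup K"] by fastforce
    qed
    have "(\<Sum>(c, e)\<in>?f ` p2. e - c) = (\<Sum>(t, K)\<in>p2. Sup K - Inf K)"
      by (subst sum.reindex[OF inj]) (auto intro!: sum.cong)
    also have "\<dots> = (\<Sum>z\<in>p2. measure lebesgue (case z of (t, K) \<Rightarrow> {Inf K<..<Sup K}))"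
      by (intro sum.cong) (auto simp: p2_def split: prod.splits)
    also have "\<dots> = measure lebesgue (\<Union>z\<in>p2. case z of (t, K) \<Rightarrow> {Inf K<..<Sup K})"
    proof (rule measure_finite_Union[symmetric])
      show "disjoint_family_on (\<lambda>z. case z of (t, K) \<Rightarrow> {Inf K<..<Sup K}) p2"
        unfolding disjoint_family_on_def
      proof (intro ballI impI)
        fix z z' assume "z \<in> p2" "z' \<in> p2" "z \<noteq> z'"
        then show "(case z of (t, K) \<Rightarrow> {Inf K<..<Sup K}) \<inter> (case z' of (t, K) \<Rightarrow> {Inf K<..<Sup K}) = {}"
          using disj[of "fst z" "snd z" "fst z'" "snd z'"] by (cases z; cases z') (simp only: fst_conv snd_conv split_conv)
      qed
      show "emeasure lebesgue (case z of (t, K) \<Rightarrow> {Inf K<..<Sup K}) \<noteq> \<infinity>" if "z \<in> p2" for z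
        using that by (cases z) (auto simp: p2_def emeasure_lborel_Ioo less_imp_le)
    qed (use fin in \<open>auto split: prod.splits\<close>)
    also have "\<dots> < \<delta>"
    proof -
      have "(\<Union>z\<in>p2. case z of (t, K) \<Rightarrow> {Inf K<..<Sup K}) \<subseteq> T"
        using p2K by fastforce
      then have "emeasure lebesgue (\<Union>z\<in>p2. case z of (t, K) \<Rightarrow> {Inf K<..<Sup K}) \<le> emeasure lebesgue T"
        by (rule emeasure_mono[OF _ Tm])
      from le_less_trans[OF this Te]
      have less: "emeasure lebesgue (\<Union>z\<in>p2. case z of (t, K) \<Rightarrow> {Inf K<..<Sup K}) < ennreal \<delta>" .
      then have "emeasure lebesgue (\<Union>z\<in>p2. case z of (t, K) \<Rightarrow> {Inf K<..<Sup K}) \<noteq> top_class.top"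
        using less_trans[OF less ennreal_less_top] by auto
      from less[unfolded emeasure_eq_ennreal_measure[OF this[unfolded infinity_ennreal_def]]] show ?thesis
        by (simp only: ennreal_less_iff[OF measure_nonneg])
    qed
    finally have small: "(\<Sum>(c, e)\<in>?f ` p2. e - c) < \<delta>" .
    have "sum ?inc p2 \<le> (\<Sum>z\<in>p2. \<bar>?inc z\<bar>)" by (intro sum_mono) auto
    also have "\<dots> = (\<Sum>(c, e)\<in>?f ` p2. \<bar>F e - F c\<bar>)"
      by (subst sum.reindex[OF inj]) (auto intro!: sum.cong)
    also have "\<dots> < \<epsilon>"
    proof (rule d(2)[OF _ _ _ small])
      show "\<forall>(c, e)\<in>?f ` p2. a \<le> c \<and> c \<le> e \<and> e \<le> b" using p2K by fastforce
      show "pairwise (\<lambda>(c, e) (c', e'). {c<..<e} \<inter> {c'<..<e'} = {}) (?f ` p2)"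
        unfolding pairwise_def
      proof (intro ballI impI)
        fix y y' assume "y \<in> ?f ` p2" "y' \<in> ?f ` p2" "y \<noteq> y'"
        then obtain z z' where z: "y = ?f z" "y' = ?f z'" "z \<in> p2" "z' \<in> p2" "z \<noteq> z'" by blast
        then show "(case y of (c, e) \<Rightarrow> \<lambda>(c', e'). {c<..<e} \<inter> {c'<..<e'} = {}) y'"
          using disj[of "fst z" "snd z" "fst z'" "snd z'"] by (cases z; cases z') (simp only: fst_conv snd_conv split_conv)
      qed
    qed (use fin in auto)
    finally show ?thesis by simp
  qed
  finally show "F b \<le> F a + \<epsilon>0" using e(2) by simp
qed

section \<open>Vector-valued integrals and Bessel's inequality\<close>

lemma space_lebesgue_on_Icc [simp]: "space (lebesgue_on {a..b::real}) = {a..b}"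
  by (simp add: space_restrict_space)

lemma dim_vec_int [simp]: "dim_vec (vec_int I k F) = k"
  by (simp add: vec_int_def)

lemma vec_int_index: "j < k \<Longrightarrow> vec_int I k F $ j = (LINT t|lebesgue_on I. F t $ j)"
  by (simp add: vec_int_def)

lemma vec_int_cong:
  "(\<And>t. t \<in> {a..b} \<Longrightarrow> F t = G t) \<Longrightarrow> vec_int {a..b} k F = vec_int {a..b} k G"
  by (auto simp: vec_int_def intro!: eq_vecI Bochner_Integration.integral_cong)

lemma LINT_double_sum:
  fixes f :: "'i \<Rightarrow> 'j \<Rightarrow> 'a \<Rightarrow> real"
  assumes "\<And>i j. i \<in> A \<Longrightarrow> j \<in> B \<Longrightarrow> integrable M (f i j)"
  shows "(LINT t|M. (\<Sum>i\<in>A. \<Sum>j\<in>B. f i j t)) = (\<Sum>i\<in>A. \<Sum>j\<in>B. (LINT t|M. f i j t))"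
proof -
  have "(LINT t|M. (\<Sum>i\<in>A. \<Sum>j\<in>B. f i j t)) = (\<Sum>i\<in>A. (LINT t|M. (\<Sum>j\<in>B. f i j t)))"
    using assms by (intro Bochner_Integration.integral_sum Bochner_Integration.integrable_sum)
  also have "\<dots> = (\<Sum>i\<in>A. \<Sum>j\<in>B. (LINT t|M. f i j t))"
    using assms by (intro sum.cong refl Bochner_Integration.integral_sum)
  finally show ?thesis .
qed

lemma scalar_prod_LINT:
  assumes "dim_vec v = k" "\<And>t. t \<in> {a..b} \<Longrightarrow> dim_vec (F t) = k"
    and "\<And>j. j < k \<Longrightarrow> integrable (lebesgue_on {a..b}) (\<lambda>t. F t $ j)"
  shows "v \<bullet> vec_int {a..b} k F = (LINT t|lebesgue_on {a..b}. v \<bullet> F t)"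
proof -
  have "v \<bullet> vec_int {a..b} k F = (\<Sum>j<k. (LINT t|lebesgue_on {a..b}. v $ j * F t $ j))"
    by (simp add: scalar_prod_lessThan vec_int_index)
  also have "\<dots> = (LINT t|lebesgue_on {a..b}. (\<Sum>j<k. v $ j * F t $ j))"
    using assms(3) by (intro Bochner_Integration.integral_sum[symmetric] integrable_mult_right) auto
  also have "\<dots> = (LINT t|lebesgue_on {a..b}. v \<bullet> F t)"
    using assms(2) by (intro Bochner_Integration.integral_cong) (auto simp: scalar_prod_lessThan)
  finally show ?thesis .
qed

lemma mult_vec_int:
  assumes "A \<in> carrier_mat k' k" "\<And>t. t \<in> {a..b} \<Longrightarrow> dim_vec (F t) = k"
    and "\<And>j. j < k \<Longrightarrow> integrable (lebesgue_on {a..b}) (\<lambda>t. F t $ j)"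
  shows "A *\<^sub>v vec_int {a..b} k F = vec_int {a..b} k' (\<lambda>t. A *\<^sub>v F t)"
proof (rule eq_vecI)
  fix i assume "i < dim_vec (vec_int {a..b} k' (\<lambda>t. A *\<^sub>v F t))"
  with assms show "(A *\<^sub>v vec_int {a..b} k F) $ i = vec_int {a..b} k' (\<lambda>t. A *\<^sub>v F t) $ i"
    using scalar_prod_LINT[OF _ assms(2,3), of "row A i"] by (simp add: vec_int_index)
qed (use assms in simp)

lemma vec_int_add:
  assumes "\<And>t. t \<in> {a..b} \<Longrightarrow> dim_vec (F t) = k" "\<And>t. t \<in> {a..b} \<Longrightarrow> dim_vec (G t) = k"
    and "\<And>j. j < k \<Longrightarrow> integrable (lebesgue_on {a..b}) (\<lambda>t. F t $ j)"
    and "\<And>j. j < k \<Longrightarrow> integrable (lebesgue_on {a..b}) (\<lambda>t. G t $ j)"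
  shows "vec_int {a..b} k F + vec_int {a..b} k G = vec_int {a..b} k (\<lambda>t. F t + G t)"
proof (rule eq_vecI)
  fix j assume "j < dim_vec (vec_int {a..b} k (\<lambda>t. F t + G t))"
  then have j: "j < k" by simp
  have "(LINT t|lebesgue_on {a..b}. (F t + G t) $ j) = (LINT t|lebesgue_on {a..b}. F t $ j + G t $ j)"
    using assms(1,2) j by (intro Bochner_Integration.integral_cong) auto
  with j assms show "(vec_int {a..b} k F + vec_int {a..b} k G) $ j = vec_int {a..b} k (\<lambda>t. F t + G t) $ j"
    by (simp add: vec_int_index)
qed simp

lemma L2_vecD: "L2_vec I k F \<Longrightarrow> t \<in> I \<Longrightarrow> dim_vec (F t) = k" "L2_vec I k F \<Longrightarrow> j < k \<Longrightarrow> L2_scalar I (\<lambda>t. F t $ j)"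
  by (auto simp: L2_vec_def)

lemma L2_scalar_scalar_prod:
  assumes "L2_vec {a..b} k F" "dim_vec v = k"
  shows "L2_scalar {a..b} (\<lambda>t. v \<bullet> F t)"
proof -
  have "L2_scalar {a..b} (\<lambda>t. \<Sum>j<k. v $ j * F t $ j)"
    using assms by (intro L2_scalar_sum L2_scalar_cmult L2_vecD(2)) auto
  then show ?thesis
    by (subst L2_scalar_cong[of _ _ "\<lambda>t. \<Sum>j<k. v $ j * F t $ j"])
      (auto simp: scalar_prod_lessThan L2_vecD(1)[OF assms(1)])
qed

lemma L2_vec_mult_mat:
  assumes "L2_vec {a..b} k F" "A \<in> carrier_mat k' k"
  shows "L2_vec {a..b} k' (\<lambda>t. A *\<^sub>v F t)"
  using assms unfolding L2_vec_def
  by (auto intro!: carrier_vecI L2_scalar_scalar_prod[OF assms(1)])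

lemma L2_vec_append:
  assumes "L2_vec {a..b} k F" "L2_vec {a..b} l G"
  shows "L2_vec {a..b} (k + l) (\<lambda>t. F t @\<^sub>v G t)"
  unfolding L2_vec_def
proof (intro conjI ballI allI impI)
  fix j assume j: "j < k + l"
  show "L2_scalar {a..b} (\<lambda>t. (F t @\<^sub>v G t) $ j)"
  proof (cases "j < k")
    case True
    then show ?thesis
      using L2_vecD[OF assms(1)] L2_vecD(1)[OF assms(2)]
      by (subst L2_scalar_cong[of _ _ "\<lambda>t. F t $ j"]) auto
  next
    case False
    then show ?thesis
      using L2_vecD(1)[OF assms(1)] L2_vecD(1)[OF assms(2)] L2_vecD(2)[OF assms(2), of "j - k"] j
      by (subst L2_scalar_cong[of _ _ "\<lambda>t. G t $ (j - k)"]) auto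
  qed
qed (use assms in \<open>auto simp: L2_vec_def\<close>)

lemma L2_vec_minus:
  assumes "L2_vec {a..b} k F" "L2_vec {a..b} k G"
  shows "L2_vec {a..b} k (\<lambda>t. F t - G t)"
  unfolding L2_vec_def
proof (intro conjI ballI allI impI)
  fix j assume j: "j < k"
  have "L2_scalar {a..b} (\<lambda>t. F t $ j + (-1) * G t $ j)"
    using assms j by (intro L2_scalar_add L2_scalar_cmult) (auto dest: L2_vecD)
  with assms j show "L2_scalar {a..b} (\<lambda>t. (F t - G t) $ j)"
    by (subst L2_scalar_cong[of _ _ "\<lambda>t. F t $ j + (-1) * G t $ j"]) (auto dest: L2_vecD)
qed (use assms in \<open>auto simp: L2_vec_def\<close>)

lemma scalar_prod_mult_mat:
  "A \<in> carrier_mat k l \<Longrightarrow> dim_vec u = k \<Longrightarrow> dim_vec v = l \<Longrightarrow>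
    u \<bullet> (A *\<^sub>v v) = (\<Sum>i<k. \<Sum>j<l. A $$ (i, j) * (u $ i * v $ j))" for A :: "real mat"
  by (auto simp: scalar_prod_lessThan sum_distrib_left ac_simps intro!: sum.cong)

lemma outer_product_index:
  "i < dim_vec u \<Longrightarrow> j < dim_vec v \<Longrightarrow> (col_mat u * (col_mat v)\<^sup>T) $$ (i, j) = u $ i * v $ j"
  by (simp add: scalar_prod_lessThan col_mat_index)

text \<open>A Gram matrix represents the bilinear form
  \<open>\<integral> (u \<bullet> F) (v \<bullet> G)\<close>; the orthogonality relations below are
  read off from this formula.\<close>

lemma gram_form:
  assumes F: "L2_vec {a..b} k F" and G: "L2_vec {a..b} l G" and "dim_vec u = k" "dim_vec v = l"
  shows "(LINT t|lebesgue_on {a..b}. (u \<bullet> F t) * (v \<bullet> G t)) =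
    u \<bullet> (mat_int {a..b} k l (\<lambda>t. col_mat (F t) * (col_mat (G t))\<^sup>T) *\<^sub>v v)"
proof -
  let ?M = "mat_int {a..b} k l (\<lambda>t. col_mat (F t) * (col_mat (G t))\<^sup>T)"
  have M: "?M \<in> carrier_mat k l" by (simp add: mat_int_def)
  have Mi: "?M $$ (i, j) = (LINT t|lebesgue_on {a..b}. F t $ i * G t $ j)" if "i < k" "j < l" for i j
    unfolding mat_int_def using that
    by (subst index_mat) (auto simp del: index_mult_mat(1) simp: outer_product_index L2_vecD(1)[OF F] L2_vecD(1)[OF G]
        intro!: Bochner_Integration.integral_cong)
  have int: "integrable (lebesgue_on {a..b}) (\<lambda>t. F t $ i * G t $ j)" if "i < k" "j < l" for i j
    using that F G by (intro L2_scalar_mult_integrable L2_vecD(2))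
  have "u \<bullet> (?M *\<^sub>v v) = (\<Sum>i<k. \<Sum>j<l. (LINT t|lebesgue_on {a..b}. F t $ i * G t $ j) * (u $ i * v $ j))"
    using scalar_prod_mult_mat[OF M assms(3,4)] Mi by simp
  also have "\<dots> = (LINT t|lebesgue_on {a..b}. (\<Sum>i<k. \<Sum>j<l. F t $ i * G t $ j * (u $ i * v $ j)))"
    using int by (subst LINT_double_sum) auto
  also have "\<dots> = (LINT t|lebesgue_on {a..b}. (u \<bullet> F t) * (v \<bullet> G t))"
    using F G by (intro Bochner_Integration.integral_cong)
      (auto simp: scalar_prod_lessThan L2_vecD(1) sum_product ac_simps)
  finally show ?thesis ..
qed

text \<open>If \<open>F\<close> has Gram matrix \<open>L L\<^sup>T\<close>, then
  \<open>L\<^sup>-\<^sup>1 F\<close> has Gram matrix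
  \<open>L\<^sup>-\<^sup>1 (L L\<^sup>T) L\<^sup>-\<^sup>T = I\<close>.\<close>

lemma cholesky_orthonormal:
  assumes F: "L2_vec {a..b} k F" and L: "L \<in> carrier_mat k k" "det L \<noteq> 0"
    and G: "mat_int {a..b} k k (\<lambda>t. col_mat (F t) * (col_mat (F t))\<^sup>T) = L * L\<^sup>T"
    and ij: "i < k" "j < k"
  shows "(LINT t|lebesgue_on {a..b}. (minv L *\<^sub>v F t) $ i * (minv L *\<^sub>v F t) $ j) = (if i = j then 1 else 0)"
proof -
  note m = minv_inverts[OF L]
  have LT: "L\<^sup>T * (minv L)\<^sup>T = 1\<^sub>m k"
    using m(3) L m(1) by (metis transpose_mult transpose_one)
  have row: "row (minv L) l = (minv L)\<^sup>T *\<^sub>v unit_vec k l" if "l < k" for l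
    using m(1) that by (intro eq_vecI) auto
  have "(LINT t|lebesgue_on {a..b}. (minv L *\<^sub>v F t) $ i * (minv L *\<^sub>v F t) $ j)
      = (LINT t|lebesgue_on {a..b}. (row (minv L) i \<bullet> F t) * (row (minv L) j \<bullet> F t))"
    using m(1) ij by (intro Bochner_Integration.integral_cong) auto
  also have "\<dots> = row (minv L) i \<bullet> (L * L\<^sup>T *\<^sub>v row (minv L) j)"
    using m(1) by (subst gram_form[OF F F]) (auto simp: G)
  also have "L * L\<^sup>T *\<^sub>v row (minv L) j = L *\<^sub>v (L\<^sup>T *\<^sub>v ((minv L)\<^sup>T *\<^sub>v unit_vec k j))"
    unfolding row[OF ij(2)] using L m(1) by (intro assoc_mult_mat_vec) auto
  also have "L\<^sup>T *\<^sub>v ((minv L)\<^sup>T *\<^sub>v unit_vec k j) = unit_vec k j"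
    using assoc_mult_mat_vec[of "L\<^sup>T" k k "(minv L)\<^sup>T" k "unit_vec k j"] L m(1) LT by simp
  also have "row (minv L) i \<bullet> (L *\<^sub>v unit_vec k j) = (minv L * L *\<^sub>v unit_vec k j) $ i"
    using assoc_mult_mat_vec[OF m(1) L(1), of "unit_vec k j"] m(1) ij by simp
  also have "\<dots> = (if i = j then 1 else 0)"
    unfolding m(3) using ij by simp
  finally show ?thesis .
qed

text \<open>Polarised for two functions \<open>x\<close> and \<open>y\<close>, because a matrix
  weight couples different coordinates of a vector-valued function. Each of the two cross terms
  subtracts the sum of products, and orthonormality lets the double sum restore one of them.\<close>

lemma LINT_residual:
  assumes A: "finite A" and e: "\<And>k. k \<in> A \<Longrightarrow> L2_scalar {a..b} (e k)"
    and on: "\<And>k l. k \<in> A \<Longrightarrow> l \<in> A \<Longrightarrow> (LINT t|lebesgue_on {a..b}. e k t * e l t) = (if k = l then 1 else 0)"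
    and x: "L2_scalar {a..b} x" and y: "L2_scalar {a..b} y"
  defines "p \<equiv> \<lambda>k. LINT t|lebesgue_on {a..b}. e k t * x t"
    and "q \<equiv> \<lambda>k. LINT t|lebesgue_on {a..b}. e k t * y t"
  shows "integrable (lebesgue_on {a..b}) (\<lambda>t. (x t - (\<Sum>k\<in>A. p k * e k t)) * (y t - (\<Sum>k\<in>A. q k * e k t)))"
    and "(LINT t|lebesgue_on {a..b}. (x t - (\<Sum>k\<in>A. p k * e k t)) * (y t - (\<Sum>k\<in>A. q k * e k t)))
      = (LINT t|lebesgue_on {a..b}. x t * y t) - (\<Sum>k\<in>A. p k * q k)"
proof -
  have ie: "integrable (lebesgue_on {a..b}) (\<lambda>t. e k t * e l t)" if "k \<in> A" "l \<in> A" for k l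
    using that e by (intro L2_scalar_mult_integrable)
  have ix: "integrable (lebesgue_on {a..b}) (\<lambda>t. e k t * x t)" "integrable (lebesgue_on {a..b}) (\<lambda>t. e k t * y t)"
    if "k \<in> A" for k
    using that e x y by (auto intro: L2_scalar_mult_integrable)
  have ixy: "integrable (lebesgue_on {a..b}) (\<lambda>t. x t * y t)"
    using x y by (rule L2_scalar_mult_integrable)
  have exp: "(x t - (\<Sum>k\<in>A. p k * e k t)) * (y t - (\<Sum>k\<in>A. q k * e k t))
      = x t * y t - (\<Sum>k\<in>A. q k * (e k t * x t)) - (\<Sum>k\<in>A. p k * (e k t * y t))
        + (\<Sum>k\<in>A. \<Sum>l\<in>A. p k * q l * (e k t * e l t))" for t
  proof -
    have "x t * (\<Sum>k\<in>A. q k * e k t) = (\<Sum>k\<in>A. q k * (e k t * x t))"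
      "(\<Sum>k\<in>A. p k * e k t) * y t = (\<Sum>k\<in>A. p k * (e k t * y t))"
      by (simp_all add: sum_distrib_left sum_distrib_right ac_simps)
    moreover have "(\<Sum>k\<in>A. p k * e k t) * (\<Sum>k\<in>A. q k * e k t) = (\<Sum>k\<in>A. \<Sum>l\<in>A. p k * q l * (e k t * e l t))"
      by (simp add: sum_product ac_simps)
    moreover have "(x t - u) * (y t - v) = x t * y t - x t * v - u * y t + u * v" for u v
      by (simp add: algebra_simps)
    ultimately show ?thesis by simp
  qed
  show "integrable (lebesgue_on {a..b}) (\<lambda>t. (x t - (\<Sum>k\<in>A. p k * e k t)) * (y t - (\<Sum>k\<in>A. q k * e k t)))"
    unfolding exp using ie ix ixy
    by (intro Bochner_Integration.integrable_add Bochner_Integration.integrable_diff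
        Bochner_Integration.integrable_sum integrable_mult_right) auto
  have "(LINT t|lebesgue_on {a..b}. (x t - (\<Sum>k\<in>A. p k * e k t)) * (y t - (\<Sum>k\<in>A. q k * e k t)))
      = (LINT t|lebesgue_on {a..b}. x t * y t) - (\<Sum>k\<in>A. q k * p k) - (\<Sum>k\<in>A. p k * q k)
        + (\<Sum>k\<in>A. \<Sum>l\<in>A. p k * q l * (if k = l then 1 else 0))"
  proof -
    have pq: "(LINT t|lebesgue_on {a..b}. e k t * x t) = p k" "(LINT t|lebesgue_on {a..b}. e k t * y t) = q k" for k
      by (simp_all add: p_def q_def)
    show ?thesis
      unfolding exp using ie ix ixy
      by (simp add: Bochner_Integration.integral_sum on pq LINT_double_sum
          Bochner_Integration.integrable_sum Bochner_Integration.integrable_diff)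
  qed
  also have "(\<Sum>k\<in>A. \<Sum>l\<in>A. p k * q l * (if k = l then 1 else 0)) = (\<Sum>k\<in>A. p k * q k)"
    using A by (simp add: if_distrib[of "\<lambda>z. _ * z"] cong: if_cong)
  finally show "(LINT t|lebesgue_on {a..b}. (x t - (\<Sum>k\<in>A. p k * e k t)) * (y t - (\<Sum>k\<in>A. q k * e k t)))
      = (LINT t|lebesgue_on {a..b}. x t * y t) - (\<Sum>k\<in>A. p k * q k)"
    by (simp add: mult.commute)
qed

text \<open>The weighted form of the residual after projection onto the \<open>e k\<close> has a
  nonnegative integral; expanding it coordinatewise gives the estimate. The index type is arbitrary,
  so that two orthonormal families can be joined as a disjoint sum.\<close>

lemma bessel_form:
  assumes A: "finite A" and e: "\<And>k. k \<in> A \<Longrightarrow> L2_scalar {a..b} (e k)"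
    and on: "\<And>k l. k \<in> A \<Longrightarrow> l \<in> A \<Longrightarrow> (LINT t|lebesgue_on {a..b}. e k t * e l t) = (if k = l then 1 else 0)"
    and x: "L2_vec {a..b} n x" and R: "R \<in> carrier_mat n n"
    and psd: "\<And>v. v \<in> carrier_vec n \<Longrightarrow> v \<bullet> (R *\<^sub>v v) \<ge> 0"
  defines "p \<equiv> \<lambda>k. vec n (\<lambda>j. LINT t|lebesgue_on {a..b}. e k t * x t $ j)"
  shows "(\<Sum>k\<in>A. p k \<bullet> (R *\<^sub>v p k)) \<le> (LINT t|lebesgue_on {a..b}. x t \<bullet> (R *\<^sub>v x t))"
proof -
  let ?u = "\<lambda>t. vec n (\<lambda>j. x t $ j - (\<Sum>k\<in>A. p k $ j * e k t))"
  have xj: "L2_scalar {a..b} (\<lambda>t. x t $ j)" if "j < n" for j using x that by (rule L2_vecD)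
  have pj: "p k $ j = (LINT t|lebesgue_on {a..b}. e k t * x t $ j)" if "j < n" for k j
    using that by (simp add: p_def)
  have i: "integrable (lebesgue_on {a..b}) (\<lambda>t. (x t $ j - (\<Sum>k\<in>A. p k $ j * e k t)) * (x t $ l - (\<Sum>k\<in>A. p k $ l * e k t)))"
    and I: "(LINT t|lebesgue_on {a..b}. (x t $ j - (\<Sum>k\<in>A. p k $ j * e k t)) * (x t $ l - (\<Sum>k\<in>A. p k $ l * e k t)))
      = (LINT t|lebesgue_on {a..b}. x t $ j * x t $ l) - (\<Sum>k\<in>A. p k $ j * p k $ l)" if "j < n" "l < n" for j l
    using LINT_residual[OF A e on xj[OF that(1)] xj[OF that(2)]] that by (simp_all add: pj)
  have ix: "integrable (lebesgue_on {a..b}) (\<lambda>t. x t $ j * x t $ l)" if "j < n" "l < n" for j l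
    using that xj by (intro L2_scalar_mult_integrable)
  have "0 \<le> (LINT t|lebesgue_on {a..b}. ?u t \<bullet> (R *\<^sub>v ?u t))"
    using psd by (intro Bochner_Integration.integral_nonneg_AE AE_I2) auto
  also have "\<dots> = (LINT t|lebesgue_on {a..b}. (\<Sum>j<n. \<Sum>l<n. R $$ (j, l) *
      ((x t $ j - (\<Sum>k\<in>A. p k $ j * e k t)) * (x t $ l - (\<Sum>k\<in>A. p k $ l * e k t)))))"
    using R by (subst scalar_prod_mult_mat[OF R]) auto
  also have "\<dots> = (\<Sum>j<n. \<Sum>l<n. R $$ (j, l) *
      ((LINT t|lebesgue_on {a..b}. x t $ j * x t $ l) - (\<Sum>k\<in>A. p k $ j * p k $ l)))"
    using i I by (subst LINT_double_sum) auto
  also have "\<dots> = (\<Sum>j<n. \<Sum>l<n. R $$ (j, l) * (LINT t|lebesgue_on {a..b}. x t $ j * x t $ l))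
      - (\<Sum>j<n. \<Sum>l<n. \<Sum>k\<in>A. R $$ (j, l) * (p k $ j * p k $ l))"
    by (simp add: right_diff_distrib sum_subtractf sum_distrib_left)
  also have "(\<Sum>j<n. \<Sum>l<n. R $$ (j, l) * (LINT t|lebesgue_on {a..b}. x t $ j * x t $ l))
      = (LINT t|lebesgue_on {a..b}. (\<Sum>j<n. \<Sum>l<n. R $$ (j, l) * (x t $ j * x t $ l)))"
    using ix by (subst LINT_double_sum) auto
  also have "\<dots> = (LINT t|lebesgue_on {a..b}. x t \<bullet> (R *\<^sub>v x t))"
    using x by (intro Bochner_Integration.integral_cong) (auto simp: scalar_prod_mult_mat[OF R] L2_vecD(1))
  also have "(\<Sum>j<n. \<Sum>l<n. \<Sum>k\<in>A. R $$ (j, l) * (p k $ j * p k $ l)) = (\<Sum>k\<in>A. \<Sum>j<n. \<Sum>l<n. R $$ (j, l) * (p k $ j * p k $ l))"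
  proof -
    have "(\<Sum>j<n. \<Sum>l<n. \<Sum>k\<in>A. R $$ (j, l) * (p k $ j * p k $ l)) = (\<Sum>j<n. \<Sum>k\<in>A. \<Sum>l<n. R $$ (j, l) * (p k $ j * p k $ l))"
      by (rule sum.cong[OF refl], rule sum.swap)
    also have "\<dots> = (\<Sum>k\<in>A. \<Sum>j<n. \<Sum>l<n. R $$ (j, l) * (p k $ j * p k $ l))" by (rule sum.swap)
    finally show ?thesis .
  qed
  also have "\<dots> = (\<Sum>k\<in>A. p k \<bullet> (R *\<^sub>v p k))"
    by (intro sum.cong refl scalar_prod_mult_mat[OF R, symmetric]) (auto simp: p_def)
  finally show ?thesis by simp
qed

lemma sum_div_mod2:
  fixes F :: "nat \<Rightarrow> nat \<Rightarrow> nat \<Rightarrow> nat \<Rightarrow> real"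
  shows "(\<Sum>i<a * b. \<Sum>j<c * d. F (i div b) (i mod b) (j div d) (j mod d))
    = (\<Sum>k<a. \<Sum>l<b. \<Sum>k'<c. \<Sum>l'<d. F k l k' l')"
proof -
  have "(\<Sum>j<c * d. F u v (j div d) (j mod d)) = (\<Sum>k'<c. \<Sum>l'<d. F u v k' l')" for u v
    by (rule sum_div_mod)
  then show ?thesis
    by (simp only: sum_div_mod[of "\<lambda>k l. \<Sum>k'<c. \<Sum>l'<d. F k l k' l'"])
qed

text \<open>Reads \<open>I\<^sub>k \<otimes> R\<close> as a sum over consecutive blocks of length
  \<open>n\<close>, the shape in which Bessel's inequality delivers it.\<close>

lemma kron_one_form:
  assumes H: "dim_vec H = k * n" and R: "R \<in> carrier_mat n n"
  shows "H \<bullet> ((1\<^sub>m k \<otimes>\<^sub>k R) *\<^sub>v H) =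
    (\<Sum>i<k. vec n (\<lambda>j. H $ (i * n + j)) \<bullet> (R *\<^sub>v vec n (\<lambda>j. H $ (i * n + j))))"
proof (cases "n = 0")
  case True
  then show ?thesis using H by (simp add: scalar_prod_lessThan)
next
  case False
  let ?h = "\<lambda>i j. H $ (i * n + j)"
  have K: "1\<^sub>m k \<otimes>\<^sub>k R \<in> carrier_mat (k * n) (k * n)" using R by auto
  have "H \<bullet> ((1\<^sub>m k \<otimes>\<^sub>k R) *\<^sub>v H) = (\<Sum>i<k * n. \<Sum>j<k * n. (1\<^sub>m k \<otimes>\<^sub>k R) $$ (i, j) * (H $ i * H $ j))"
    by (rule scalar_prod_mult_mat[OF K H H])
  also have "\<dots> = (\<Sum>i<k * n. \<Sum>j<k * n. (\<lambda>a b c d. (if a = c then 1 else 0) * R $$ (b, d) * (?h a b * ?h c d))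
      (i div n) (i mod n) (j div n) (j mod n))"
    using R by (intro sum.cong refl) (auto simp: kron_index div_less_of_less_mult)
  also have "\<dots> = (\<Sum>a<k. \<Sum>b<n. \<Sum>c<k. \<Sum>d<n. (if a = c then 1 else 0) * R $$ (b, d) * (?h a b * ?h c d))"
    by (rule sum_div_mod2)
  also have "\<dots> = (\<Sum>a<k. \<Sum>b<n. \<Sum>d<n. R $$ (b, d) * (?h a b * ?h a d))"
  proof (rule sum.cong[OF refl], rule sum.cong[OF refl])
    fix a b assume "a \<in> {..<k}"
    then show "(\<Sum>c<k. \<Sum>d<n. (if a = c then 1 else 0) * R $$ (b, d) * (?h a b * ?h c d)) = (\<Sum>d<n. R $$ (b, d) * (?h a b * ?h a d))"
      by (subst sum.remove[of _ a]) (auto intro!: sum.neutral)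
  qed
  also have "\<dots> = (\<Sum>i<k. vec n (\<lambda>j. H $ (i * n + j)) \<bullet> (R *\<^sub>v vec n (\<lambda>j. H $ (i * n + j))))"
    by (intro sum.cong refl) (auto simp: scalar_prod_mult_mat[OF R] intro!: sum.cong)
  finally show ?thesis .
qed

section \<open>Weak derivatives: linearity and the classical case\<close>

text \<open>Gives the weights 1 and \<open>\<tau> + r\<^sub>i\<close> of the quadratic integrals
  access to the same shift lemma as the kernel functions.\<close>

lemma weak_deriv_classical:
  assumes F: "\<And>t. (F has_real_derivative F' t) (at t)" and F': "continuous_on UNIV F'"
  shows "weak_deriv a b F F'"
  unfolding weak_deriv_def
proof (intro allI impI)
  fix \<eta> \<eta>' :: "real \<Rightarrow> real"
  assume \<eta>: "\<forall>t. (\<eta> has_real_derivative \<eta>' t) (at t)" and \<eta>': "continuous_on UNIV \<eta>'"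
    and "\<exists>c e. a < c \<and> c \<le> e \<and> e < b \<and> (\<forall>t. t \<notin> {c..e} \<longrightarrow> \<eta> t = 0)"
  then obtain c e where ce: "a < c" "c \<le> e" "e < b" "\<And>t. t \<notin> {c..e} \<Longrightarrow> \<eta> t = 0" by blast
  have C: "continuous_on A F" "continuous_on A \<eta>" "continuous_on A F'" "continuous_on A \<eta>'" for A
    using F \<eta> F' \<eta>' by (meson DERIV_isCont continuous_at_imp_continuous_on continuous_on_subset subset_UNIV)+
  have "(LINT t|lebesgue_on {a..b}. F' t * \<eta> t + \<eta>' t * F t) = F b * \<eta> b - F a * \<eta> a"
    using ce \<eta> C by (intro LINT_derivative DERIV_mult[OF F] continuous_intros) auto
  moreover have "\<eta> a = 0" "\<eta> b = 0" using ce by auto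
  moreover have "integrable (lebesgue_on {a..b}) (\<lambda>t. F' t * \<eta> t)" "integrable (lebesgue_on {a..b}) (\<lambda>t. \<eta>' t * F t)"
    using C by (auto intro!: continuous_integrable_on_Icc continuous_intros)
  ultimately show "(LINT t|lebesgue_on {a..b}. F t * \<eta>' t) = - (LINT t|lebesgue_on {a..b}. F' t * \<eta> t)"
    by (simp add: mult.commute[of "F _"])
qed

lemma weak_deriv_sum:
  assumes "\<And>k. k \<in> A \<Longrightarrow> weak_deriv a b (F k) (G k)"
    and "\<And>k. k \<in> A \<Longrightarrow> integrable (lebesgue_on {a..b}) (F k)" "\<And>k. k \<in> A \<Longrightarrow> integrable (lebesgue_on {a..b}) (G k)"
  shows "weak_deriv a b (\<lambda>t. \<Sum>k\<in>A. c k * F k t) (\<lambda>t. \<Sum>k\<in>A. c k * G k t)"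
  unfolding weak_deriv_def
proof (intro allI impI)
  fix \<eta> \<eta>' :: "real \<Rightarrow> real"
  assume \<eta>: "\<forall>t. (\<eta> has_real_derivative \<eta>' t) (at t)" "continuous_on UNIV \<eta>'"
    "\<exists>c e. a < c \<and> c \<le> e \<and> e < b \<and> (\<forall>t. t \<notin> {c..e} \<longrightarrow> \<eta> t = 0)"
  have C: "continuous_on {a..b} \<eta>" "continuous_on {a..b} \<eta>'"
    using \<eta>(1,2) by (meson DERIV_isCont continuous_at_imp_continuous_on continuous_on_subset subset_UNIV)+
  have "(LINT t|lebesgue_on {a..b}. F k t * \<eta>' t) = - (LINT t|lebesgue_on {a..b}. G k t * \<eta> t)" if "k \<in> A" for k
    using assms(1)[OF that] \<eta> unfolding weak_deriv_def by blast
  moreover have "integrable (lebesgue_on {a..b}) (\<lambda>t. F k t * \<eta>' t)" "integrable (lebesgue_on {a..b}) (\<lambda>t. G k t * \<eta> t)"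
    if "k \<in> A" for k
    using assms(2,3)[OF that] C by (auto intro: integrable_mult_continuous)
  ultimately show "(LINT t|lebesgue_on {a..b}. (\<Sum>k\<in>A. c k * F k t) * \<eta>' t)
      = - (LINT t|lebesgue_on {a..b}. (\<Sum>k\<in>A. c k * G k t) * \<eta> t)"
    by (simp add: sum_distrib_right mult.assoc Bochner_Integration.integral_sum sum_negf)
qed

text \<open>The derivative supplied by \<open>weak_deriv_shift\<close> is bounded on compact time
  intervals, so the function is Lipschitz there.\<close>

lemma abs_cont_on_shift:
  fixes F G \<phi> :: "real \<Rightarrow> real"
  assumes wd: "weak_deriv a b F G" and ab: "a < b" and F: "continuous_on {a..b} F"
    and G: "integrable (lebesgue_on {a..b}) G" and \<phi>: "continuous_on UNIV \<phi>"
  shows "abs_cont_on t0 t1 (\<lambda>t. LINT \<tau>|lebesgue_on {a..b}. F \<tau> * \<phi> (t + \<tau>))"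
proof -
  obtain B where B: "\<And>s. s \<in> {t0 + a..t1 + b} \<Longrightarrow> \<bar>\<phi> s\<bar> \<le> B"
    using continuous_on_Icc_bounded[OF continuous_on_subset[OF \<phi> subset_UNIV]] by blast
  have "\<bar>F b * \<phi> (t + b) - F a * \<phi> (t + a) - (LINT \<tau>|lebesgue_on {a..b}. G \<tau> * \<phi> (t + \<tau>))\<bar>
      \<le> \<bar>F b\<bar> * B + \<bar>F a\<bar> * B + (LINT \<tau>|lebesgue_on {a..b}. \<bar>G \<tau>\<bar> * B)" if t: "t \<in> {t0..t1}" for t
  proof -
  have c: "continuous_on {a..b} (\<lambda>\<tau>. \<phi> (t + \<tau>))"
    by (rule continuous_on_compose2[OF \<phi>]) (auto intro!: continuous_intros)
  have "norm (LINT \<tau>|lebesgue_on {a..b}. G \<tau> * \<phi> (t + \<tau>)) \<le> (LINT \<tau>|lebesgue_on {a..b}. \<bar>G \<tau>\<bar> * B)"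
  proof (rule Bochner_Integration.integral_norm_bound_integral)
    show "norm (G \<tau> * \<phi> (t + \<tau>)) \<le> \<bar>G \<tau>\<bar> * B" if "\<tau> \<in> space (lebesgue_on {a..b})" for \<tau>
      using that t B[of "t + \<tau>"] by (auto simp: abs_mult intro!: mult_left_mono)
  qed (use G integrable_mult_continuous[OF G c] in auto)
  moreover have "\<bar>F b * \<phi> (t + b)\<bar> \<le> \<bar>F b\<bar> * B" "\<bar>F a * \<phi> (t + a)\<bar> \<le> \<bar>F a\<bar> * B"
    using t ab B[of "t + b"] B[of "t + a"] by (auto simp: abs_mult intro!: mult_left_mono)
  ultimately show ?thesis by simp
  qed
  from abs_cont_on_deriv[OF weak_deriv_shift[OF assms] this] show ?thesis .
qed

declare upt_Suc [simp del] One_nat_def [simp del] atLeastLessThanSuc_atLeastAtMost [simp]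

section \<open>Arithmetic of stacked vectors, short block rows, Cholesky factors\<close>

lemma append_vec_add:
  "dim_vec u = dim_vec u' \<Longrightarrow> dim_vec v = dim_vec v' \<Longrightarrow>
    (u @\<^sub>v v) + (u' @\<^sub>v v') = (u + u') @\<^sub>v (v + (v' :: real vec))"
  by (rule eq_vecI) auto

lemma append_vec_minus:
  "dim_vec u = dim_vec u' \<Longrightarrow> dim_vec v = dim_vec v' \<Longrightarrow>
    (u @\<^sub>v v) - (u' @\<^sub>v v') = (u - u') @\<^sub>v (v - (v' :: real vec))"
  by (rule eq_vecI) auto

lemma vcat_map_minus:
  "(\<And>i. i \<in> set is \<Longrightarrow> dim_vec (u i) = dim_vec (v i)) \<Longrightarrow>
    vcat (map u is) - vcat (map v is) = vcat (map (\<lambda>i. u i - v i) is)"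
proof (induction "is")
  case (Cons a "is")
  then have "sum_list (map (\<lambda>i. dim_vec (u i)) is) = sum_list (map (\<lambda>i. dim_vec (v i)) is)"
    by (intro arg_cong[where f=sum_list]) auto
  with Cons show ?case by (subst (1 2 3) list.map, subst (1 2 3) vcat_Cons, subst append_vec_minus) (auto simp: o_def)
qed (auto intro!: eq_vecI)

lemma row_blk_Cons_mult:
  assumes "A \<in> carrier_mat k (dim_vec u)" "As \<noteq> []" "row_blk As \<in> carrier_mat k (dim_vec v)"
  shows "row_blk (A # As) *\<^sub>v (u @\<^sub>v v) = A *\<^sub>v u + row_blk As *\<^sub>v v"
proof -
  have "row_blk (A # As) *\<^sub>v (u @\<^sub>v v) = (A *\<^sub>v u + row_blk As *\<^sub>v v) @\<^sub>v 0\<^sub>v 0"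
    unfolding row_blk_Cons using assms
    by (subst four_block_mat_mult_vec[where ?nr2.0=0]) (auto intro: carrier_vecI intro!: eq_vecI)
  then show ?thesis by simp
qed

lemma row_blk2_mult:
  assumes "A \<in> carrier_mat k (dim_vec u)" "B \<in> carrier_mat k (dim_vec v)"
  shows "row_blk [A, B] *\<^sub>v (u @\<^sub>v v) = A *\<^sub>v u + B *\<^sub>v v"
  using assms by (simp add: row_blk_Cons_mult)

lemma row_blk3_mult:
  assumes "A \<in> carrier_mat k (dim_vec u)" "B \<in> carrier_mat k (dim_vec v)" "C \<in> carrier_mat k (dim_vec w)"
  shows "row_blk [A, B, C] *\<^sub>v (u @\<^sub>v v @\<^sub>v w) = A *\<^sub>v u + (B *\<^sub>v v + C *\<^sub>v w)"
proof -
  have "row_blk [B, C] \<in> carrier_mat k (dim_vec (v @\<^sub>v w))"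
    using assms by (intro row_blk_carrier) auto
  with assms show ?thesis by (subst row_blk_Cons_mult) (auto simp: row_blk2_mult)
qed

lemma sum_list_upt: "sum_list (map F [1..<Suc k]) = sum F {1..k}" for F :: "nat \<Rightarrow> 'a :: comm_monoid_add"
  by (simp add: interv_sum_list_conv_sum_set_nat atLeastLessThanSuc_atLeastAtMost)

lemma sum_list_upt0: "sum_list (map F [0..<Suc k]) = sum F {0..k}" for F :: "nat \<Rightarrow> 'a :: comm_monoid_add"
  by (simp add: interv_sum_list_conv_sum_set_nat atLeastLessThanSuc_atLeastAtMost)

text \<open>\<open>L\<^sup>T\<close> is upper triangular, so \<open>det L\<close> is the product of
  the positive diagonal entries of \<open>L\<close>.\<close>

lemma cholesky_det:
  assumes "is_cholesky A L" "dim_row A = k"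
  shows "L \<in> carrier_mat k k" "det L \<noteq> 0" "A = L * L\<^sup>T" "det A \<noteq> 0" "A \<in> carrier_mat k k"
proof -
  show L: "L \<in> carrier_mat k k" and A: "A = L * L\<^sup>T"
    using assms(1) unfolding is_cholesky_def assms(2) by blast+
  have "upper_triangular L\<^sup>T" "\<forall>j<k. L $$ (j, j) > 0"
    using assms(1) unfolding is_cholesky_def assms(2) by blast+
  then have "det L\<^sup>T = prod_list (diag_mat L\<^sup>T)"
    using L by (intro det_upper_triangular[of _ k]) auto
  also have "\<dots> = (\<Prod>j<k. L $$ (j, j))"
    using L by (simp add: diag_mat_def prod.list_conv_set_nth lessThan_atLeast0)
  finally have "det L\<^sup>T = (\<Prod>j<k. L $$ (j, j))" .
  moreover have "L $$ (j, j) \<noteq> 0" if "j < k" for j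
    using \<open>\<forall>j<k. L $$ (j, j) > 0\<close> that by fastforce
  ultimately show "det L \<noteq> 0" using L by (simp add: det_transpose)
  then show "det A \<noteq> 0" unfolding A using L by (simp add: det_mult det_transpose)
  show "A \<in> carrier_mat k k" unfolding A using L by auto
qed

section \<open>The linear matrix inequality as a quadratic form\<close>

text \<open>Only the structural hypotheses on the data. Everything about the block matrices and
  about integrals along curves is developed before the unknowns of the matrix inequality are
  fixed.\<close>

locale delay_system =
  fixes S :: delay_data
  assumes sys: "system_matrices S"
    and ker: "kernel_decomposition S"
    and chol: "cholesky_factors S"
    and sup: "supply_parameters S"
begin

abbreviation "n \<equiv> dim_x S"
abbreviation "m \<equiv> dim_z S"
abbreviation "p \<equiv> dim_u S"
abbreviation "q \<equiv> dim_w S"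
abbreviation "\<nu> \<equiv> num_delays S"
abbreviation "r \<equiv> delay S"
abbreviation "d \<equiv> f_dim S"
abbreviation "\<mu> \<equiv> phi_dim S"
abbreviation "hdim \<equiv> h_dim S"
abbreviation "Lf \<equiv> chol_f S"
abbreviation "Lh \<equiv> chol_h S"
abbreviation "Le \<equiv> chol_e S"
abbreviation "ix \<equiv> [1..<Suc \<nu>]"

lemma sysD:
  "1 \<le> n" "1 \<le> m" "1 \<le> p" "1 \<le> q" "1 \<le> \<nu>" "r 0 = 0" "\<And>i. i < \<nu> \<Longrightarrow> r i < r (Suc i)"
  "\<And>i. i \<le> \<nu> \<Longrightarrow> A_mat S i \<in> carrier_mat n n" "\<And>i. i \<le> \<nu> \<Longrightarrow> C_mat S i \<in> carrier_mat m n"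
  "Bx_mat S \<in> carrier_mat n p" "Bz_mat S \<in> carrier_mat m p"
  "D1_mat S \<in> carrier_mat n q" "D2_mat S \<in> carrier_mat m q"
  using sys by (auto simp: system_matrices_def)

lemma kerD:
  assumes "i \<in> {1..\<nu>}"
  shows "W12_vec (- r i) (- r (i - 1)) (d i) (f_fun S i)" "L2_vec (Ivl S i) (varphi_dim S i) (varphi_fun S i)"
    "L2_vec (Ivl S i) (\<mu> i) (phi_fun S i)" "M_mat S i \<in> carrier_mat (d i) (hdim i)"
    "weak_deriv_vec (- r i) (- r (i - 1)) (d i) (f_fun S i) (\<lambda>\<tau>. M_mat S i *\<^sub>v h_fun S i \<tau>)"
    "A_hat S i \<in> carrier_mat n (g_dim S i * n)" "C_hat S i \<in> carrier_mat m (g_dim S i * n)"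
    "AE \<tau> in lebesgue_on (Ivl S i).
       A_ker S i \<tau> = A_hat S i * (col_mat (g_fun S i \<tau>) \<otimes>\<^sub>k 1\<^sub>m n) \<and>
       C_ker S i \<tau> = C_hat S i * (col_mat (g_fun S i \<tau>) \<otimes>\<^sub>k 1\<^sub>m n)"
  using ker assms unfolding kernel_decomposition_def by blast+

lemma supD:
  "J_tilde S \<in> carrier_mat m m" "J1_mat S \<in> sym_mats m" "J1_mat S \<in> carrier_mat m m"
  "neg_semidef ((J_tilde S)\<^sup>T * minv (J1_mat S) * J_tilde S)"
  "J2_mat S \<in> carrier_mat m q" "J3_mat S \<in> sym_mats q" "J3_mat S \<in> carrier_mat q q"
  using sup by (auto simp: supply_parameters_def sym_mats_def)

lemma cholD:
  assumes "i \<in> {1..\<nu>}"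
  shows "Lf i \<in> carrier_mat (d i) (d i)" "det (Lf i) \<noteq> 0" "Gram_f S i = Lf i * (Lf i)\<^sup>T"
    "Lh i \<in> carrier_mat (hdim i) (hdim i)" "det (Lh i) \<noteq> 0" "Gram_h S i = Lh i * (Lh i)\<^sup>T"
    "Le i \<in> carrier_mat (\<mu> i) (\<mu> i)" "det (Le i) \<noteq> 0" "Gram_e S i = Le i * (Le i)\<^sup>T"
    "Gram_h S i \<in> carrier_mat (hdim i) (hdim i)" "det (Gram_h S i) \<noteq> 0"
proof -
  have c: "is_cholesky (Gram_f S i) (Lf i)" "is_cholesky (Gram_h S i) (Lh i)" "is_cholesky (Gram_e S i) (Le i)"
    using chol assms unfolding cholesky_factors_def by blast+
  have "dim_row (Gram_f S i) = d i" "dim_row (Gram_h S i) = hdim i" "dim_row (Gram_e S i) = \<mu> i"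
    by (simp_all add: Gram_f_def Gram_h_def Gram_e_def mat_int_def)
  note cholesky_det[OF c(1) this(1)] cholesky_det[OF c(2) this(2)] cholesky_det[OF c(3) this(3)]
  then show "Lf i \<in> carrier_mat (d i) (d i)" "det (Lf i) \<noteq> 0" "Gram_f S i = Lf i * (Lf i)\<^sup>T"
    "Lh i \<in> carrier_mat (hdim i) (hdim i)" "det (Lh i) \<noteq> 0" "Gram_h S i = Lh i * (Lh i)\<^sup>T"
    "Le i \<in> carrier_mat (\<mu> i) (\<mu> i)" "det (Le i) \<noteq> 0" "Gram_e S i = Le i * (Le i)\<^sup>T"
    "Gram_h S i \<in> carrier_mat (hdim i) (hdim i)" "det (Gram_h S i) \<noteq> 0"
    by blast+
qed

lemma minv_carrier:
  assumes "i \<in> {1..\<nu>}"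
  shows "minv (Lf i) \<in> carrier_mat (d i) (d i)" "minv (Lh i) \<in> carrier_mat (hdim i) (hdim i)"
    "minv (Le i) \<in> carrier_mat (\<mu> i) (\<mu> i)" "minv (Gram_h S i) \<in> carrier_mat (hdim i) (hdim i)"
  using cholD[OF assms] minv_inverts(1) by blast+

lemma dims_tot:
  "sum_list (map d ix) = d_tot S" "sum_list (map hdim ix) = h_tot S" "sum_list (map \<mu> ix) = mu_tot S"
  "\<beta> S = Suc \<nu> + h_tot S + mu_tot S" "g_tot S = h_tot S + mu_tot S"
proof -
  show "sum_list (map d ix) = d_tot S" "sum_list (map hdim ix) = h_tot S" "sum_list (map \<mu> ix) = mu_tot S"
    unfolding d_tot_def h_tot_def mu_tot_def by (rule sum_list_upt)+
  show "g_tot S = h_tot S + mu_tot S"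
    by (simp add: g_tot_def h_tot_def mu_tot_def g_dim_def h_dim_def sum.distrib)
  then show "\<beta> S = Suc \<nu> + h_tot S + mu_tot S"
    by (simp add: \<beta>_def)
qed

text \<open>The vector \<open>\<vartheta>(t)\<close> of the closed loop is \<open>stack x H E w\<close> for \<open>x i = x(t - r\<^sub>i)\<close> and the two
  families \<open>H\<close>, \<open>E\<close> of integrals.\<close>

definition stack ::
  "(nat \<Rightarrow> real vec) \<Rightarrow> (nat \<Rightarrow> real vec) \<Rightarrow> (nat \<Rightarrow> real vec) \<Rightarrow> real vec \<Rightarrow> real vec" where
  "stack x H E w = vcat (map x [0..<Suc \<nu>] @ map H ix @ map E ix @ [w])"

text \<open>The lengths are fixed for all indices and not only up to \<nu>. Values of curves and the
  kernel integrals have them everywhere, and rewriting then meets no index conditions.\<close>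

definition stack_dims where
  "stack_dims x H E w \<longleftrightarrow> (\<forall>i. dim_vec (x i) = n) \<and> (\<forall>i. dim_vec (H i) = hdim i * n) \<and>
    (\<forall>i. dim_vec (E i) = \<mu> i * n) \<and> dim_vec w = q"

lemma dim_vcat_blocks:
  assumes "stack_dims x H E w"
  shows "sum_list (map (\<lambda>i. dim_vec (x i)) [0..<Suc \<nu>]) = Suc \<nu> * n"
    "sum_list (map (\<lambda>i. dim_vec (x i)) ix) = \<nu> * n"
    "sum_list (map (\<lambda>i. dim_vec (x (i - 1))) ix) = \<nu> * n"
    "sum_list (map (\<lambda>i. dim_vec (H i)) ix) = h_tot S * n"
    "sum_list (map (\<lambda>i. dim_vec (E i)) ix) = mu_tot S * n"
  using assms unfolding sum_list_upt sum_list_upt0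
  by (simp_all add: stack_dims_def h_tot_def mu_tot_def sum_distrib_right)

lemma stack_carrier:
  assumes "stack_dims x H E w"
  shows "stack x H E w \<in> carrier_vec (\<beta> S * n + q)"
proof (rule carrier_vecI)
  have "dim_vec (stack x H E w) = Suc \<nu> * n + (h_tot S * n + (mu_tot S * n + q))"
    using assms dim_vcat_blocks[OF assms] by (simp add: stack_def o_def stack_dims_def del: mult_Suc)
  then show "dim_vec (stack x H E w) = \<beta> S * n + q"
    by (simp add: dims_tot algebra_simps)
qed

lemma vcat_shift: "vcat (map x [0..<Suc \<nu>]) = vcat (map (\<lambda>i. x (i - 1)) ix) @\<^sub>v x \<nu>"
proof -
  have "map (\<lambda>i. x (i - 1)) ix = map x [0..<\<nu>]"
    by (simp add: map_Suc_upt[symmetric] o_def One_nat_def)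
  then show ?thesis by (simp add: upt_Suc)
qed

lemma vcat_split0: "vcat (map x [0..<Suc \<nu>]) = x 0 @\<^sub>v vcat (map x ix)"
  by (subst upt_conv_Cons) (auto simp: One_nat_def)

text \<open>The value of \<open>(M_bold \<otimes> I) \<vartheta>\<close>. Along a curve it is the
  time derivative of the integrals against the orthonormalised \<open>f\<^sub>i\<close>: two
  boundary terms, then the term of the weak derivative.\<close>

definition Yd where
  "Yd x H = vcat (map (\<lambda>i. vkron (minv (Lf i) *\<^sub>v f_fun S i (- r (i - 1))) (x (i - 1))
      - vkron (minv (Lf i) *\<^sub>v f_fun S i (- r i)) (x i)
      - ((minv (Lf i) * M_mat S i * Lh i) \<otimes>\<^sub>k 1\<^sub>m n) *\<^sub>v H i) ix)"

text \<open>The image of the \<open>h\<close>-integrals under \<open>I_hat\<close>. The factor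
  \<open>[0 I]\<close> selects \<open>f\<^sub>i\<close> from \<open>h\<^sub>i\<close>, so along a
  curve these are the integrals against the orthonormalised \<open>f\<^sub>i\<close>.\<close>

definition Yp where
  "Yp H = vcat (map (\<lambda>i. ((minv (Lf i) * row_blk [0\<^sub>m (d i) (varphi_dim S i), 1\<^sub>m (d i)] * Lh i) \<otimes>\<^sub>k 1\<^sub>m n) *\<^sub>v H i) ix)"

lemma endpoint_in: "i \<in> {1..\<nu>} \<Longrightarrow> - r i \<in> Ivl S i \<and> - r (i - 1) \<in> Ivl S i"
  using sysD(7)[of "i - 1"] by (force simp: Ivl_def)

lemma f_carrier: "i \<in> {1..\<nu>} \<Longrightarrow> \<tau> \<in> Ivl S i \<Longrightarrow> f_fun S i \<tau> \<in> carrier_vec (d i)"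
  using kerD(1)[of i] by (auto simp: W12_vec_def L2_vec_def Ivl_def)

lemma bdiag_kron: "bdiag S F \<otimes>\<^sub>k B = diag_block_mat (map (\<lambda>i. F i \<otimes>\<^sub>k B) ix)"
  unfolding bdiag_def by (simp only: kron_diag_block map_map o_def)

lemma bdiag_carrier:
  assumes "\<And>i. i \<in> {1..\<nu>} \<Longrightarrow> F i \<in> carrier_mat (a i) (b i)"
  shows "bdiag S F \<in> carrier_mat (\<Sum>i=1..\<nu>. a i) (\<Sum>i=1..\<nu>. b i)"
  unfolding bdiag_def map_map o_def
  by (rule diag_block_carrier) (auto simp only: map_map o_def sum_list_upt intro!: sum.cong dest: assms)

lemma I_hat_mult:
  assumes "stack_dims x H E w"
  shows "I_hat S *\<^sub>v vcat (map H ix) = Yp H"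
  unfolding I_hat_def bdiag_kron Yp_def
  using assms carrier_matD(2)[OF cholD(4)] by (subst diag_block_map_mult) (auto simp: stack_dims_def)

lemma Yp_carrier: "Yp H \<in> carrier_vec (d_tot S * n)"
proof (rule carrier_vecI)
  have "dim_vec (Yp H) = (\<Sum>i=1..\<nu>. dim_row (minv (Lf i)) * n)"
    by (simp add: Yp_def o_def sum_list_upt)
  also have "\<dots> = (\<Sum>i=1..\<nu>. d i * n)"
    using carrier_matD(1)[OF minv_carrier(1)] by (intro sum.cong) auto
  finally show "dim_vec (Yp H) = d_tot S * n" by (simp add: d_tot_def sum_distrib_right)
qed

lemma Yd_carrier: "Yd x H \<in> carrier_vec (d_tot S * n)"
proof (rule carrier_vecI)
  have "dim_vec (Yd x H) = (\<Sum>i=1..\<nu>. dim_row (minv (Lf i)) * n)"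
    by (simp add: Yd_def o_def sum_list_upt)
  also have "\<dots> = (\<Sum>i=1..\<nu>. d i * n)"
    using carrier_matD(1)[OF minv_carrier(1)] by (intro sum.cong) auto
  finally show "dim_vec (Yd x H) = d_tot S * n" by (simp add: d_tot_def sum_distrib_right)
qed

text \<open>The same list of delayed states is split in two ways: dropping the last state for the
  values at \<open>- r (i - 1)\<close>, dropping the current one for those at \<open>- r i\<close>.
  This is the offset between the two block rows whose difference is \<open>M_bold\<close>.\<close>

lemma M_bold_mult:
  assumes "stack_dims x H E w"
  shows "(M_bold S \<otimes>\<^sub>k 1\<^sub>m n) *\<^sub>v (vcat (map x [0..<Suc \<nu>]) @\<^sub>v vcat (map H ix)) = Yd x H"
proof -
  let ?u = "\<lambda>i. minv (Lf i) *\<^sub>v f_fun S i (- r (i - 1))" and ?v = "\<lambda>i. minv (Lf i) *\<^sub>v f_fun S i (- r i)"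
  let ?B1 = "bdiag S (\<lambda>i. minv (Lf i) * col_mat (f_fun S i (- r (i - 1))))"
  let ?B2 = "bdiag S (\<lambda>i. minv (Lf i) * col_mat (f_fun S i (- r i)))"
  let ?B3 = "bdiag S (\<lambda>i. minv (Lf i) * M_mat S i * Lh i)"
  note D = dim_vcat_blocks[OF assms]
  note fc = endpoint_in f_carrier minv_carrier
  have dx [simp]: "\<And>i. dim_vec (x i) = n" "\<And>i. dim_vec (H i) = hdim i * n"
    using assms by (auto simp: stack_dims_def)
  have "?B1 \<in> carrier_mat (\<Sum>i=1..\<nu>. d i) (\<Sum>i=1..\<nu>. 1)" "?B2 \<in> carrier_mat (\<Sum>i=1..\<nu>. d i) (\<Sum>i=1..\<nu>. 1)"
    using fc by (intro bdiag_carrier; intro carrier_matI; fastforce)+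
  then have B1: "?B1 \<in> carrier_mat (d_tot S) \<nu>" and B2: "?B2 \<in> carrier_mat (d_tot S) \<nu>"
    by (simp_all add: d_tot_def)
  have B3: "?B3 \<in> carrier_mat (d_tot S) (h_tot S)"
    unfolding d_tot_def h_tot_def using fc(3) kerD(4) cholD(4)
    by (intro bdiag_carrier mult_carrier_mat)
  have M: "M_bold S \<otimes>\<^sub>k 1\<^sub>m n = row_blk [?B1 \<otimes>\<^sub>k 1\<^sub>m n, 0\<^sub>m (d_tot S * n) n, 0\<^sub>m (d_tot S * n) (h_tot S * n)]
      - row_blk [0\<^sub>m (d_tot S * n) n, ?B2 \<otimes>\<^sub>k 1\<^sub>m n, ?B3 \<otimes>\<^sub>k 1\<^sub>m n]" (is "_ = ?R1 - ?R2")
  proof -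
    have "row_blk [?B1, 0\<^sub>m (d_tot S) 1, 0\<^sub>m (d_tot S) (h_tot S)] \<otimes>\<^sub>k 1\<^sub>m n = ?R1"
      "row_blk [0\<^sub>m (d_tot S) 1, ?B2, ?B3] \<otimes>\<^sub>k 1\<^sub>m n = ?R2"
      using B1 B2 B3 by (subst kron_row_blk[where k="d_tot S"]; auto)+
    moreover have "dim_row ?B1 = d_tot S" "dim_col ?B1 = \<nu>" "dim_col ?B2 = \<nu>" "dim_col ?B3 = h_tot S"
      using B1 B2 B3 by auto
    ultimately show ?thesis unfolding M_bold_def
      by (subst kron_minus_left) (simp_all add: dim_row_blk)
  qed
  let ?x = "vcat (map x [0..<Suc \<nu>]) @\<^sub>v vcat (map H ix)"
  have R: "?R1 \<in> carrier_mat (d_tot S * n) (Suc \<nu> * n + h_tot S * n)"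
    "?R2 \<in> carrier_mat (d_tot S * n) (Suc \<nu> * n + h_tot S * n)"
    using B1 B2 B3 by (auto intro!: row_blk_carrier)
  have x: "?x \<in> carrier_vec (Suc \<nu> * n + h_tot S * n)"
    using D by (intro carrier_vecI) (simp add: o_def del: mult_Suc)
  have k: "dim_col A = dim_vec u \<Longrightarrow> dim_vec y = n \<Longrightarrow>
    ((A * col_mat u) \<otimes>\<^sub>k 1\<^sub>m n) *\<^sub>v y = vkron (A *\<^sub>v u) y" for A u y
    by (simp add: mult_col_mat kron_col_mat_one)
  have fd: "dim_col (minv (Lf i)) = dim_vec (f_fun S i (- r i))"
    "dim_col (minv (Lf i)) = dim_vec (f_fun S i (- r (i - 1)))" if "i \<in> set ix" for i
    using that carrier_matD(2)[OF minv_carrier(1), of i] endpoint_in[of i]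
      carrier_vecD[OF f_carrier, of i] by simp_all
  have dims: "dim_vec (vcat (map (\<lambda>i. x (i - 1)) ix)) = \<nu> * n" "dim_vec (vcat (map x ix)) = \<nu> * n"
    "dim_vec (vcat (map H ix)) = h_tot S * n"
    using D(2-4) by (simp_all only: dim_vec_vcat map_map o_def)
  have Bk: "?B1 \<otimes>\<^sub>k 1\<^sub>m n \<in> carrier_mat (d_tot S * n) (\<nu> * n)"
    "?B2 \<otimes>\<^sub>k 1\<^sub>m n \<in> carrier_mat (d_tot S * n) (\<nu> * n)"
    "?B3 \<otimes>\<^sub>k 1\<^sub>m n \<in> carrier_mat (d_tot S * n) (h_tot S * n)"
    using B1 B2 B3 by auto
  have "?R1 *\<^sub>v ?x = (?B1 \<otimes>\<^sub>k 1\<^sub>m n) *\<^sub>v vcat (map (\<lambda>i. x (i - 1)) ix)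
      + (0\<^sub>m (d_tot S * n) n *\<^sub>v x \<nu> + 0\<^sub>m (d_tot S * n) (h_tot S * n) *\<^sub>v vcat (map H ix))"
    unfolding vcat_shift append_vec_assoc
    by (rule row_blk3_mult[where k="d_tot S * n"]) (unfold dims dx, rule Bk, auto)
  also have "0\<^sub>m (d_tot S * n) n *\<^sub>v x \<nu> = 0\<^sub>v (d_tot S * n)"
    by simp
  also have "0\<^sub>m (d_tot S * n) (h_tot S * n) *\<^sub>v vcat (map H ix) = 0\<^sub>v (d_tot S * n)"
    by (rule zero_mat_mult_vec) (rule dims)
  also have "(?B1 \<otimes>\<^sub>k 1\<^sub>m n) *\<^sub>v vcat (map (\<lambda>i. x (i - 1)) ix) = vcat (map (\<lambda>i. vkron (?u i) (x (i - 1))) ix)"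
    unfolding bdiag_kron
    by (subst diag_block_map_mult) (simp, intro arg_cong[where f=vcat] map_cong refl k fd dx)
  finally have 1: "?R1 *\<^sub>v ?x = vcat (map (\<lambda>i. vkron (?u i) (x (i - 1))) ix) + 0\<^sub>v (d_tot S * n)"
    by simp
  have "?R2 *\<^sub>v ?x = 0\<^sub>m (d_tot S * n) n *\<^sub>v x 0 + ((?B2 \<otimes>\<^sub>k 1\<^sub>m n) *\<^sub>v vcat (map x ix)
      + (?B3 \<otimes>\<^sub>k 1\<^sub>m n) *\<^sub>v vcat (map H ix))"
    unfolding vcat_split0 append_vec_assoc
    by (rule row_blk3_mult[where k="d_tot S * n"]) (unfold dims dx, auto intro: Bk)
  also have "0\<^sub>m (d_tot S * n) n *\<^sub>v x 0 = 0\<^sub>v (d_tot S * n)"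
    by simp
  also have "(?B2 \<otimes>\<^sub>k 1\<^sub>m n) *\<^sub>v vcat (map x ix) = vcat (map (\<lambda>i. vkron (?v i) (x i)) ix)"
    unfolding bdiag_kron
    by (subst diag_block_map_mult) (simp, intro arg_cong[where f=vcat] map_cong refl k fd dx)
  also have "(?B3 \<otimes>\<^sub>k 1\<^sub>m n) *\<^sub>v vcat (map H ix)
      = vcat (map (\<lambda>i. ((minv (Lf i) * M_mat S i * Lh i) \<otimes>\<^sub>k 1\<^sub>m n) *\<^sub>v H i) ix)"
    unfolding bdiag_kron using carrier_matD(2)[OF cholD(4)]
    by (subst diag_block_map_mult) auto
  finally have 2: "?R2 *\<^sub>v ?x = 0\<^sub>v (d_tot S * n) + (vcat (map (\<lambda>i. vkron (?v i) (x i)) ix)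
      + vcat (map (\<lambda>i. ((minv (Lf i) * M_mat S i * Lh i) \<otimes>\<^sub>k 1\<^sub>m n) *\<^sub>v H i) ix))" .
  have "(M_bold S \<otimes>\<^sub>k 1\<^sub>m n) *\<^sub>v ?x = ?R1 *\<^sub>v ?x - ?R2 *\<^sub>v ?x"
    unfolding M using R x by (intro minus_mult_distrib_mat_vec)
  also have "\<dots> = vcat (map (\<lambda>i. vkron (?u i) (x (i - 1))) ix) - vcat (map (\<lambda>i. vkron (?v i) (x i)) ix)
      - vcat (map (\<lambda>i. ((minv (Lf i) * M_mat S i * Lh i) \<otimes>\<^sub>k 1\<^sub>m n) *\<^sub>v H i) ix)"
  proof -
    have [simp]: "(\<Sum>i\<leftarrow>ix. dim_row (minv (Lf i)) * n) = d_tot S * n"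
      unfolding sum_list_upt d_tot_def sum_distrib_right
      using carrier_matD(1)[OF minv_carrier(1)] by (intro sum.cong) auto
    show ?thesis unfolding 1 2 by (rule eq_vecI) (auto simp: o_def)
  qed
  also have "\<dots> = Yd x H"
    unfolding Yd_def by (simp add: vcat_map_minus)
  finally show ?thesis .
qed

end

section \<open>Values of the block matrices on stacked vectors\<close>

context delay_system begin

lemma bdiag_mult:
  assumes "\<And>i. i \<in> {1..\<nu>} \<Longrightarrow> dim_col (F i) = dim_vec (u i)"
  shows "bdiag S F *\<^sub>v vcat (map u ix) = vcat (map (\<lambda>i. F i *\<^sub>v u i) ix)"
  unfolding bdiag_def using assms by (subst diag_block_map_mult) auto

lemma bdiag_form:
  assumes "\<And>i. i \<in> {1..\<nu>} \<Longrightarrow> F i \<in> carrier_mat (dim_vec (u i)) (dim_vec (v i))"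
  shows "vcat (map u ix) \<bullet> (bdiag S F *\<^sub>v vcat (map v ix)) = (\<Sum>i=1..\<nu>. u i \<bullet> (F i *\<^sub>v v i))"
proof -
  have "bdiag S F *\<^sub>v vcat (map v ix) = vcat (map (\<lambda>i. F i *\<^sub>v v i) ix)"
    using assms carrier_matD(2) by (intro bdiag_mult) blast
  moreover have "dim_vec (u i) = dim_vec (F i *\<^sub>v v i)" if "i \<in> set ix" for i
    using carrier_matD(1)[OF assms, of i] that by simp
  ultimately show ?thesis
    by (simp only: vcat_map_scalar_prod sum_list_upt)
qed

lemma diag_block4_form:
  fixes A B C D :: "real mat"
  assumes "A \<in> carrier_mat (dim_vec a) (dim_vec a)" "B \<in> carrier_mat (dim_vec b) (dim_vec b)"
    "C \<in> carrier_mat (dim_vec c) (dim_vec c)" "D \<in> carrier_mat (dim_vec e) (dim_vec e)"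
  shows "(a @\<^sub>v b @\<^sub>v c @\<^sub>v e) \<bullet> (diag_block_mat [A, B, C, D] *\<^sub>v (a @\<^sub>v b @\<^sub>v c @\<^sub>v e)) =
    a \<bullet> (A *\<^sub>v a) + b \<bullet> (B *\<^sub>v b) + c \<bullet> (C *\<^sub>v c) + e \<bullet> (D *\<^sub>v e)"
proof -
  have "diag_block_mat [A, B, C, D] *\<^sub>v vcat [a, b, c, e] = vcat [A *\<^sub>v a, B *\<^sub>v b, C *\<^sub>v c, D *\<^sub>v e]"
    using assms by (subst diag_block_mult) (auto simp del: diag_block_mat.simps)
  then have "vcat [a, b, c, e] \<bullet> (diag_block_mat [A, B, C, D] *\<^sub>v vcat [a, b, c, e]) =
      (\<Sum>(u, v)\<leftarrow>zip [a, b, c, e] [A *\<^sub>v a, B *\<^sub>v b, C *\<^sub>v c, D *\<^sub>v e]. u \<bullet> v)"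
    using assms by (simp only:, subst vcat_scalar_prod) auto
  then show ?thesis by (simp del: diag_block_mat.simps)
qed

lemma diag_block5_form:
  fixes A B C D F :: "real mat"
  assumes "A \<in> carrier_mat (dim_vec a) (dim_vec a)" "B \<in> carrier_mat (dim_vec b) (dim_vec b)"
    "C \<in> carrier_mat (dim_vec c) (dim_vec c)" "D \<in> carrier_mat (dim_vec e) (dim_vec e)"
    "F \<in> carrier_mat (dim_vec f) (dim_vec f)"
  shows "(a @\<^sub>v b @\<^sub>v c @\<^sub>v e @\<^sub>v f) \<bullet> (diag_block_mat [A, B, C, D, F] *\<^sub>v (a @\<^sub>v b @\<^sub>v c @\<^sub>v e @\<^sub>v f)) =
    a \<bullet> (A *\<^sub>v a) + b \<bullet> (B *\<^sub>v b) + c \<bullet> (C *\<^sub>v c) + e \<bullet> (D *\<^sub>v e) + f \<bullet> (F *\<^sub>v f)"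
proof -
  have "diag_block_mat [A, B, C, D, F] *\<^sub>v vcat [a, b, c, e, f]
      = vcat [A *\<^sub>v a, B *\<^sub>v b, C *\<^sub>v c, D *\<^sub>v e, F *\<^sub>v f]"
    using assms by (subst diag_block_mult) (auto simp del: diag_block_mat.simps)
  then have "vcat [a, b, c, e, f] \<bullet> (diag_block_mat [A, B, C, D, F] *\<^sub>v vcat [a, b, c, e, f]) =
      (\<Sum>(u, v)\<leftarrow>zip [a, b, c, e, f] [A *\<^sub>v a, B *\<^sub>v b, C *\<^sub>v c, D *\<^sub>v e, F *\<^sub>v f]. u \<bullet> v)"
    using assms by (simp only:, subst vcat_scalar_prod) auto
  then show ?thesis by (simp del: diag_block_mat.simps)
qed

text \<open>The first two groupings fit the two parts of \<Xi>, the third the block row with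
  \<open>M_bold\<close>, the fourth the block column with \<open>J2_mat\<close>.\<close>

lemma stack_unfold:
  "stack x H E w = vcat (map (\<lambda>i. x (i - 1)) ix) @\<^sub>v x \<nu> @\<^sub>v (vcat (map H ix) @\<^sub>v vcat (map E ix)) @\<^sub>v w"
  "stack x H E w = x 0 @\<^sub>v vcat (map x ix) @\<^sub>v vcat (map H ix) @\<^sub>v vcat (map E ix) @\<^sub>v w"
  "stack x H E w = (vcat (map x [0..<Suc \<nu>]) @\<^sub>v vcat (map H ix)) @\<^sub>v (vcat (map E ix) @\<^sub>v w)"
  "stack x H E w = (vcat (map x [0..<Suc \<nu>]) @\<^sub>v vcat (map H ix) @\<^sub>v vcat (map E ix)) @\<^sub>v w"
proof -
  have *: "stack x H E w = vcat (map x [0..<Suc \<nu>]) @\<^sub>v vcat (map H ix) @\<^sub>v vcat (map E ix) @\<^sub>v w"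
    by (simp only: stack_def vcat_append vcat_Cons vcat_Nil zero_vec_zero append_vec_vNil append_vec_assoc)
  show "stack x H E w = vcat (map (\<lambda>i. x (i - 1)) ix) @\<^sub>v x \<nu> @\<^sub>v (vcat (map H ix) @\<^sub>v vcat (map E ix)) @\<^sub>v w"
    unfolding * vcat_shift append_vec_assoc ..
  show "stack x H E w = x 0 @\<^sub>v vcat (map x ix) @\<^sub>v vcat (map H ix) @\<^sub>v vcat (map E ix) @\<^sub>v w"
    unfolding * vcat_split0 append_vec_assoc ..
  show "stack x H E w = (vcat (map x [0..<Suc \<nu>]) @\<^sub>v vcat (map H ix)) @\<^sub>v (vcat (map E ix) @\<^sub>v w)"
    "stack x H E w = (vcat (map x [0..<Suc \<nu>]) @\<^sub>v vcat (map H ix) @\<^sub>v vcat (map E ix)) @\<^sub>v w"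
    unfolding * append_vec_assoc by (rule refl)+
qed

lemma dim_vcat_map:
  assumes "stack_dims x H E w"
  shows "dim_vec (vcat (map x [0..<Suc \<nu>])) = Suc \<nu> * n" "dim_vec (vcat (map x ix)) = \<nu> * n"
    "dim_vec (vcat (map (\<lambda>i. x (i - 1)) ix)) = \<nu> * n" "dim_vec (vcat (map H ix)) = h_tot S * n"
    "dim_vec (vcat (map E ix)) = mu_tot S * n"
    "dim_vec (x i) = n" "dim_vec (H i) = hdim i * n" "dim_vec (E i) = \<mu> i * n" "dim_vec w = q"
  using dim_vcat_blocks[OF assms] assms
  by (simp_all only: dim_vec_vcat map_map o_def) (auto simp: stack_dims_def)

lemma bdiag_square:
  "(\<And>i. i \<in> {1..\<nu>} \<Longrightarrow> F i \<in> carrier_mat (a i) (a i)) \<Longrightarrow> (\<Sum>i=1..\<nu>. a i) = k \<Longrightarrow>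
    bdiag S F \<in> carrier_mat k k"
  using bdiag_carrier by blast

text \<open>The two block-diagonal parts of \<Xi> follow different patterns. The first separates the
  oldest delayed state from the others, the second the current state; each is evaluated on its own
  grouping of the stack.\<close>

lemma Xi_form:
  assumes sd: "stack_dims x H E w"
    and Q: "\<And>i. i \<in> {1..\<nu>} \<Longrightarrow> Q i \<in> carrier_mat n n" and R: "\<And>i. i \<in> {1..\<nu>} \<Longrightarrow> R i \<in> carrier_mat n n"
  shows "\<Xi> S Q R \<in> carrier_mat (\<beta> S * n + q) (\<beta> S * n + q)"
    and "stack x H E w \<bullet> (\<Xi> S Q R *\<^sub>v stack x H E w) =
    (\<Sum>i=1..\<nu>. x (i - 1) \<bullet> (Q i *\<^sub>v x (i - 1)) + (r i - r (i - 1)) * (x (i - 1) \<bullet> (R i *\<^sub>v x (i - 1))))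
    - (\<Sum>i=1..\<nu>. x i \<bullet> (Q i *\<^sub>v x i))
    - (\<Sum>i=1..\<nu>. H i \<bullet> ((1\<^sub>m (hdim i) \<otimes>\<^sub>k R i) *\<^sub>v H i))
    - (\<Sum>i=1..\<nu>. E i \<bullet> ((1\<^sub>m (\<mu> i) \<otimes>\<^sub>k R i) *\<^sub>v E i)) - w \<bullet> (J3_mat S *\<^sub>v w)"
proof -
  note dm = dim_vcat_map[OF sd]
  let ?\<theta> = "stack x H E w" and ?N = "\<beta> S * n + q"
  let ?hs = "vcat (map H ix)" and ?es = "vcat (map E ix)"
  let ?QR = "bdiag S Q + bdiag S R * \<Lambda> S"
  let ?D1 = "diag_block_mat [?QR, 0\<^sub>m n n, 0\<^sub>m (g_tot S * n) (g_tot S * n), 0\<^sub>m q q]"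
  let ?BH = "bdiag S (\<lambda>i. 1\<^sub>m (hdim i) \<otimes>\<^sub>k R i)" and ?BE = "bdiag S (\<lambda>i. 1\<^sub>m (\<mu> i) \<otimes>\<^sub>k R i)"
  let ?D2 = "diag_block_mat [0\<^sub>m n n, bdiag S Q, ?BH, ?BE, J3_mat S]"
  have BQ: "bdiag S Q \<in> carrier_mat (\<nu> * n) (\<nu> * n)" and BR: "bdiag S R \<in> carrier_mat (\<nu> * n) (\<nu> * n)"
    using Q R by (intro bdiag_square[where a="\<lambda>_. n"]; simp)+
  have La: "\<Lambda> S \<in> carrier_mat (\<nu> * n) (\<nu> * n)"
    unfolding \<Lambda>_def by (intro bdiag_square[where a="\<lambda>_. n"]) simp_all
  have BH: "?BH \<in> carrier_mat (h_tot S * n) (h_tot S * n)"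
  proof (rule bdiag_square[where a="\<lambda>i. hdim i * n"])
    fix i assume "i \<in> {1..\<nu>}"
    from R[OF this] show "1\<^sub>m (hdim i) \<otimes>\<^sub>k R i \<in> carrier_mat (hdim i * n) (hdim i * n)" by auto
  qed (simp add: h_tot_def sum_distrib_right)
  have BE: "?BE \<in> carrier_mat (mu_tot S * n) (mu_tot S * n)"
  proof (rule bdiag_square[where a="\<lambda>i. \<mu> i * n"])
    fix i assume "i \<in> {1..\<nu>}"
    from R[OF this] show "1\<^sub>m (\<mu> i) \<otimes>\<^sub>k R i \<in> carrier_mat (\<mu> i * n) (\<mu> i * n)" by auto
  qed (simp add: mu_tot_def sum_distrib_right)
  have QR: "?QR \<in> carrier_mat (\<nu> * n) (\<nu> * n)" using BQ BR La by auto
  have N: "?N = \<nu> * n + (n + (g_tot S * n + q))" "?N = n + (\<nu> * n + (h_tot S * n + (mu_tot S * n + q)))"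
    by (simp_all add: dims_tot algebra_simps)
  have D1: "?D1 \<in> carrier_mat ?N ?N"
    unfolding N(1) using QR by (intro diag_block_carrier) auto
  have D2: "?D2 \<in> carrier_mat ?N ?N"
    unfolding N(2) using BQ BH BE supD(7) by (intro diag_block_carrier) auto
  have th: "?\<theta> \<in> carrier_vec ?N" by (rule stack_carrier[OF sd])
  show "\<Xi> S Q R \<in> carrier_mat ?N ?N" unfolding \<Xi>_def by (rule minus_carrier_mat[OF D2])
  have dg: "dim_vec (?hs @\<^sub>v ?es) = g_tot S * n"
    using dm by (simp add: dims_tot algebra_simps del: dim_vec_vcat)
  have 1: "?\<theta> \<bullet> (?D1 *\<^sub>v ?\<theta>) = vcat (map (\<lambda>i. x (i - 1)) ix) \<bullet> (?QR *\<^sub>v vcat (map (\<lambda>i. x (i - 1)) ix))"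
    unfolding stack_unfold(1)
    by (subst diag_block4_form) (simp_all only: dm dg QR zero_carrier_mat zero_mat_mult_vec
        scalar_prod_right_zero[OF carrier_vecI, OF refl] scalar_prod_right_zero[OF carrier_vecI] add_0_right)
  let ?xp = "vcat (map (\<lambda>i. x (i - 1)) ix)"
  have xp: "?xp \<in> carrier_vec (\<nu> * n)" using dm(3) by (rule carrier_vecI)
  have Lx: "\<Lambda> S *\<^sub>v ?xp = vcat (map (\<lambda>i. (r i - r (i - 1)) \<cdot>\<^sub>v x (i - 1)) ix)"
  proof -
    have "(c \<cdot>\<^sub>m 1\<^sub>m n) *\<^sub>v u = c \<cdot>\<^sub>v u" if "dim_vec u = n" for c :: real and u
      using that by (intro eq_vecI) (auto simp: scalar_prod_left_unit[OF carrier_vecI])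
    then show ?thesis unfolding \<Lambda>_def using dm(6) by (subst bdiag_mult) auto
  qed
  have 2: "?xp \<bullet> (?QR *\<^sub>v ?xp) = (\<Sum>i=1..\<nu>. x (i - 1) \<bullet> (Q i *\<^sub>v x (i - 1)))
      + (\<Sum>i=1..\<nu>. (r i - r (i - 1)) * (x (i - 1) \<bullet> (R i *\<^sub>v x (i - 1))))"
  proof -
    have "?QR *\<^sub>v ?xp = bdiag S Q *\<^sub>v ?xp + bdiag S R *\<^sub>v (\<Lambda> S *\<^sub>v ?xp)"
      using BQ BR La xp by (simp add: add_mult_distrib_mat_vec[where nr="\<nu> * n" and nc="\<nu> * n"])
    moreover have "bdiag S Q *\<^sub>v ?xp \<in> carrier_vec (\<nu> * n)" "bdiag S R *\<^sub>v (\<Lambda> S *\<^sub>v ?xp) \<in> carrier_vec (\<nu> * n)"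
      using BQ BR by (auto intro!: carrier_vecI)
    ultimately have "?xp \<bullet> (?QR *\<^sub>v ?xp) = ?xp \<bullet> (bdiag S Q *\<^sub>v ?xp) + ?xp \<bullet> (bdiag S R *\<^sub>v (\<Lambda> S *\<^sub>v ?xp))"
      using xp by (simp add: scalar_prod_add_distrib[where n="\<nu> * n"])
    also have "?xp \<bullet> (bdiag S Q *\<^sub>v ?xp) = (\<Sum>i=1..\<nu>. x (i - 1) \<bullet> (Q i *\<^sub>v x (i - 1)))"
      using Q dm(6) by (intro bdiag_form) simp
    also have "?xp \<bullet> (bdiag S R *\<^sub>v (\<Lambda> S *\<^sub>v ?xp)) = (\<Sum>i=1..\<nu>. x (i - 1) \<bullet> (R i *\<^sub>v ((r i - r (i - 1)) \<cdot>\<^sub>v x (i - 1))))"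
      unfolding Lx using R dm(6) by (intro bdiag_form) simp
    also have "\<dots> = (\<Sum>i=1..\<nu>. (r i - r (i - 1)) * (x (i - 1) \<bullet> (R i *\<^sub>v x (i - 1))))"
    proof (intro sum.cong refl)
      fix i assume "i \<in> {1..\<nu>}"
      from R[OF this] dm(6) show "x (i - 1) \<bullet> (R i *\<^sub>v ((r i - r (i - 1)) \<cdot>\<^sub>v x (i - 1))) =
          (r i - r (i - 1)) * (x (i - 1) \<bullet> (R i *\<^sub>v x (i - 1)))"
        by (subst mult_mat_vec) (auto intro: carrier_vecI)
    qed
    finally show ?thesis .
  qed
  have 3: "?\<theta> \<bullet> (?D2 *\<^sub>v ?\<theta>) = (\<Sum>i=1..\<nu>. x i \<bullet> (Q i *\<^sub>v x i))
    + (\<Sum>i=1..\<nu>. H i \<bullet> ((1\<^sub>m (hdim i) \<otimes>\<^sub>k R i) *\<^sub>v H i))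
    + (\<Sum>i=1..\<nu>. E i \<bullet> ((1\<^sub>m (\<mu> i) \<otimes>\<^sub>k R i) *\<^sub>v E i)) + w \<bullet> (J3_mat S *\<^sub>v w)"
  proof -
    have "?\<theta> \<bullet> (?D2 *\<^sub>v ?\<theta>) = x 0 \<bullet> (0\<^sub>m n n *\<^sub>v x 0) + vcat (map x ix) \<bullet> (bdiag S Q *\<^sub>v vcat (map x ix))
        + ?hs \<bullet> (?BH *\<^sub>v ?hs) + ?es \<bullet> (?BE *\<^sub>v ?es) + w \<bullet> (J3_mat S *\<^sub>v w)"
      unfolding stack_unfold(2)
      by (subst diag_block5_form) (simp_all only: dm BQ BH BE supD(7) zero_carrier_mat)
    also have "vcat (map x ix) \<bullet> (bdiag S Q *\<^sub>v vcat (map x ix)) = (\<Sum>i=1..\<nu>. x i \<bullet> (Q i *\<^sub>v x i))"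
      using Q dm(6) by (intro bdiag_form) simp
    also have "?hs \<bullet> (?BH *\<^sub>v ?hs) = (\<Sum>i=1..\<nu>. H i \<bullet> ((1\<^sub>m (hdim i) \<otimes>\<^sub>k R i) *\<^sub>v H i))"
      using R[THEN carrier_matD(1)] R[THEN carrier_matD(2)] dm(7)
      by (intro bdiag_form carrier_matI) simp_all
    also have "?es \<bullet> (?BE *\<^sub>v ?es) = (\<Sum>i=1..\<nu>. E i \<bullet> ((1\<^sub>m (\<mu> i) \<otimes>\<^sub>k R i) *\<^sub>v E i))"
      using R[THEN carrier_matD(1)] R[THEN carrier_matD(2)] dm(8)
      by (intro bdiag_form carrier_matI) simp_all
    also have "x 0 \<bullet> (0\<^sub>m n n *\<^sub>v x 0) = 0"
      unfolding zero_mat_mult_vec[OF dm(6)] by (rule scalar_prod_right_zero) (rule carrier_vecI[OF dm(6)])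
    finally show ?thesis by (simp only: add_0_left)
  qed
  have "\<Xi> S Q R *\<^sub>v ?\<theta> = ?D1 *\<^sub>v ?\<theta> - ?D2 *\<^sub>v ?\<theta>"
    unfolding \<Xi>_def using D1 D2 th by (rule minus_mult_distrib_mat_vec)
  then have "?\<theta> \<bullet> (\<Xi> S Q R *\<^sub>v ?\<theta>) = ?\<theta> \<bullet> (?D1 *\<^sub>v ?\<theta>) - ?\<theta> \<bullet> (?D2 *\<^sub>v ?\<theta>)"
    using D1 D2 th
    by (simp add: scalar_prod_minus_distrib[OF th] mult_mat_vec_carrier[OF D1 th] mult_mat_vec_carrier[OF D2 th]
        del: diag_block_mat.simps)
  then show "?\<theta> \<bullet> (\<Xi> S Q R *\<^sub>v ?\<theta>) =
    (\<Sum>i=1..\<nu>. x (i - 1) \<bullet> (Q i *\<^sub>v x (i - 1)) + (r i - r (i - 1)) * (x (i - 1) \<bullet> (R i *\<^sub>v x (i - 1))))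
    - (\<Sum>i=1..\<nu>. x i \<bullet> (Q i *\<^sub>v x i))
    - (\<Sum>i=1..\<nu>. H i \<bullet> ((1\<^sub>m (hdim i) \<otimes>\<^sub>k R i) *\<^sub>v H i))
    - (\<Sum>i=1..\<nu>. E i \<bullet> ((1\<^sub>m (\<mu> i) \<otimes>\<^sub>k R i) *\<^sub>v E i)) - w \<bullet> (J3_mat S *\<^sub>v w)"
    unfolding 1 2 3 by (simp add: sum.distrib)
qed

lemma col_blk_form:
  "As \<noteq> [] \<Longrightarrow> list_all2 (\<lambda>A u. A \<in> carrier_mat (dim_vec u) (dim_vec v)) As us \<Longrightarrow>
    vcat us \<bullet> (col_blk As *\<^sub>v v) = (\<Sum>(u, A)\<leftarrow>zip us As. u \<bullet> (A *\<^sub>v v))"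
proof -
  assume a: "As \<noteq> []" "list_all2 (\<lambda>A u. A \<in> carrier_mat (dim_vec u) (dim_vec v)) As us"
  then have "col_blk As *\<^sub>v v = vcat (map (\<lambda>A. A *\<^sub>v v) As)"
    by (intro col_blk_mult) (auto simp: list_all2_conv_all_nth in_set_conv_nth)
  moreover have "list_all2 (\<lambda>u v. dim_vec u = dim_vec v) us (map (\<lambda>A. A *\<^sub>v v) As)"
    using a(2) by (auto simp: list_all2_conv_all_nth)
  ultimately show ?thesis by (simp add: vcat_scalar_prod zip_map2 o_def split_def)
qed

text \<open>With \<beta> cut into blocks of size 1 for the states, \<open>hdim i\<close> and
  \<open>\<mu> i\<close> for the integrals, the change of variables maps stacks to stacks.\<close>

lemma X_aug_mult:
  assumes sd: "stack_dims x H E w" and X: "X \<in> carrier_mat n n"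
  shows "X_aug S X \<in> carrier_mat (\<beta> S * n + q) (\<beta> S * n + q)"
    and "X_aug S X *\<^sub>v stack x H E w = stack (\<lambda>i. X *\<^sub>v x i) (\<lambda>i. (1\<^sub>m (hdim i) \<otimes>\<^sub>k X) *\<^sub>v H i)
      (\<lambda>i. (1\<^sub>m (\<mu> i) \<otimes>\<^sub>k X) *\<^sub>v E i) w"
proof -
  note dm = dim_vcat_map[OF sd]
  let ?ks = "map (\<lambda>_. 1) [0..<Suc \<nu>] @ map hdim ix @ map \<mu> ix"
  let ?us = "map x [0..<Suc \<nu>] @ map H ix @ map E ix"
  show c: "X_aug S X \<in> carrier_mat (\<beta> S * n + q) (\<beta> S * n + q)"
    unfolding X_aug_def using X by (intro diag_block_carrier) auto
  have "sum_list ?ks = \<beta> S"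
    by (simp add: dims_tot sum_list_upt0)
  then have k: "1\<^sub>m (\<beta> S) \<otimes>\<^sub>k X = diag_block_mat (map (\<lambda>k. 1\<^sub>m k \<otimes>\<^sub>k X) ?ks)"
    using kron_one_sum_list[of ?ks X] by simp
  have "(1\<^sub>m (\<beta> S) \<otimes>\<^sub>k X) *\<^sub>v vcat ?us = vcat (map (\<lambda>(A, u). A *\<^sub>v u) (zip (map (\<lambda>k. 1\<^sub>m k \<otimes>\<^sub>k X) ?ks) ?us))"
    unfolding k by (rule diag_block_mult)
      (use X dm in \<open>auto simp: list_all2_appendI list.rel_map list_all2_same intro!: list_all2_appendI\<close>)
  also have "\<dots> = vcat (map (\<lambda>i. X *\<^sub>v x i) [0..<Suc \<nu>] @ map (\<lambda>i. (1\<^sub>m (hdim i) \<otimes>\<^sub>k X) *\<^sub>v H i) ix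
      @ map (\<lambda>i. (1\<^sub>m (\<mu> i) \<otimes>\<^sub>k X) *\<^sub>v E i) ix)"
  proof -
    have "1\<^sub>m 1 \<otimes>\<^sub>k X = X" using kron_one_one by (simp add: One_nat_def)
    then show ?thesis
      by (simp add: zip_append zip_map_map zip_same_conv_map o_def del: vcat_append)
  qed
  finally have "(1\<^sub>m (\<beta> S) \<otimes>\<^sub>k X) *\<^sub>v vcat ?us = \<dots>" .
  moreover have "X_aug S X *\<^sub>v vcat [vcat ?us, w] = vcat [(1\<^sub>m (\<beta> S) \<otimes>\<^sub>k X) *\<^sub>v vcat ?us, 1\<^sub>m q *\<^sub>v w]"
    unfolding X_aug_def using dm X
    by (subst diag_block_mult) (auto simp: dims_tot algebra_simps simp del: diag_block_mat.simps dim_vec_vcat)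
  moreover have "1\<^sub>m q *\<^sub>v w = w" using dm(9) by (intro one_mult_mat_vec carrier_vecI)
  ultimately show "X_aug S X *\<^sub>v stack x H E w = stack (\<lambda>i. X *\<^sub>v x i) (\<lambda>i. (1\<^sub>m (hdim i) \<otimes>\<^sub>k X) *\<^sub>v H i)
      (\<lambda>i. (1\<^sub>m (\<mu> i) \<otimes>\<^sub>k X) *\<^sub>v E i) w"
    by (simp add: stack_def)
qed

lemma Tm_carrier:
  assumes "i \<in> {1..\<nu>}"
  shows "Tm S i \<in> carrier_mat (g_dim S i) (hdim i)" "Tm_tilde S i \<in> carrier_mat (g_dim S i) (\<mu> i)"
proof -
  have "\<Gamma> S i * minv (Gram_h S i) \<in> carrier_mat (\<mu> i) (hdim i)"
    using minv_carrier(4)[OF assms] by (auto simp: \<Gamma>_def mat_int_def)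
  then have "col_blk [\<Gamma> S i * minv (Gram_h S i), 1\<^sub>m (hdim i)] \<in> carrier_mat (g_dim S i) (hdim i)"
    by (intro col_blk_carrier) (auto simp: g_dim_def h_dim_def)
  then show "Tm S i \<in> carrier_mat (g_dim S i) (hdim i)"
    unfolding Tm_def using cholD(4)[OF assms] by auto
  have "col_blk [1\<^sub>m (\<mu> i), 0\<^sub>m (hdim i) (\<mu> i)] \<in> carrier_mat (g_dim S i) (\<mu> i)"
    by (intro col_blk_carrier) (auto simp: g_dim_def h_dim_def)
  then show "Tm_tilde S i \<in> carrier_mat (g_dim S i) (\<mu> i)"
    unfolding Tm_tilde_def using cholD(7)[OF assms] by auto
qed

text \<open>The contributions of \<open>Tm\<close> and \<open>Tm_tilde\<close> are collected under
  one factor \<open>G i\<close>; along a curve their sum is the integral against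
  \<open>g\<^sub>i\<close> itself.\<close>

lemma aug_row_form:
  assumes sd: "stack_dims x H E w"
    and F: "\<And>i. i \<in> {0..\<nu>} \<Longrightarrow> F i \<in> carrier_mat k n"
    and G: "\<And>i. i \<in> {1..\<nu>} \<Longrightarrow> G i \<in> carrier_mat k (g_dim S i * n)" and D: "D \<in> carrier_mat k q"
  shows "aug_row S F G D \<in> carrier_mat k (\<beta> S * n + q)"
    and "c \<in> carrier_vec k \<Longrightarrow> c \<bullet> (aug_row S F G D *\<^sub>v stack x H E w) =
      (\<Sum>i=0..\<nu>. c \<bullet> (F i *\<^sub>v x i))
      + (\<Sum>i=1..\<nu>. c \<bullet> (G i *\<^sub>v ((Tm S i \<otimes>\<^sub>k 1\<^sub>m n) *\<^sub>v H i + (Tm_tilde S i \<otimes>\<^sub>k 1\<^sub>m n) *\<^sub>v E i)))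
      + c \<bullet> (D *\<^sub>v w)"
proof -
  note dm = dim_vcat_map[OF sd]
  let ?As = "map F [0..<Suc \<nu>] @ map (\<lambda>i. G i * (Tm S i \<otimes>\<^sub>k 1\<^sub>m n)) ix
      @ map (\<lambda>i. G i * (Tm_tilde S i \<otimes>\<^sub>k 1\<^sub>m n)) ix @ [D]"
  have T: "Tm S i \<otimes>\<^sub>k 1\<^sub>m n \<in> carrier_mat (g_dim S i * n) (hdim i * n)"
    "Tm_tilde S i \<otimes>\<^sub>k 1\<^sub>m n \<in> carrier_mat (g_dim S i * n) (\<mu> i * n)" if "i \<in> {1..\<nu>}" for i
    using Tm_carrier[OF that] by auto
  have GT: "G i * (Tm S i \<otimes>\<^sub>k 1\<^sub>m n) \<in> carrier_mat k (hdim i * n)"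
    "G i * (Tm_tilde S i \<otimes>\<^sub>k 1\<^sub>m n) \<in> carrier_mat k (\<mu> i * n)" if "i \<in> {1..\<nu>}" for i
    using T[OF that] G[OF that] by auto
  have la: "list_all2 (\<lambda>A u. A \<in> carrier_mat k (dim_vec u)) ?As (map x [0..<Suc \<nu>] @ map H ix @ map E ix @ [w])"
    using F GT D by (intro list_all2_appendI) (auto simp: list.rel_map list_all2_same dm)
  have cols: "(\<Sum>i=0..\<nu>. dim_col (F i)) = Suc \<nu> * n"
    "(\<Sum>i=1..\<nu>. dim_col (Tm S i) * n) = h_tot S * n" "(\<Sum>i=1..\<nu>. dim_col (Tm_tilde S i) * n) = mu_tot S * n"
    using carrier_matD(2)[OF F] carrier_matD(2)[OF Tm_carrier(1)] carrier_matD(2)[OF Tm_carrier(2)]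
    by (simp_all add: h_tot_def mu_tot_def sum_distrib_right)
  show "aug_row S F G D \<in> carrier_mat k (\<beta> S * n + q)"
    unfolding aug_row_def
  proof (rule row_blk_carrier)
    show "dim_row A = k" if "A \<in> set ?As" for A
      using that carrier_matD(1)[OF F] carrier_matD(1)[OF G] D by auto
    show "sum_list (map dim_col ?As) = \<beta> S * n + q"
      using D cols by (simp add: o_def sum_list_upt sum_list_upt0 dims_tot algebra_simps del: mult_Suc)
  qed simp
  assume c: "c \<in> carrier_vec k"
  have "c \<bullet> (aug_row S F G D *\<^sub>v stack x H E w) =
      (\<Sum>(A, u)\<leftarrow>zip ?As (map x [0..<Suc \<nu>] @ map H ix @ map E ix @ [w]). c \<bullet> (A *\<^sub>v u))"
    unfolding aug_row_def stack_def using c la by (intro row_blk_scalar_prod) auto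
  also have "\<dots> = (\<Sum>i=0..\<nu>. c \<bullet> (F i *\<^sub>v x i)) + ((\<Sum>i=1..\<nu>. c \<bullet> (G i * (Tm S i \<otimes>\<^sub>k 1\<^sub>m n) *\<^sub>v H i))
      + ((\<Sum>i=1..\<nu>. c \<bullet> (G i * (Tm_tilde S i \<otimes>\<^sub>k 1\<^sub>m n) *\<^sub>v E i)) + c \<bullet> (D *\<^sub>v w)))"
    by (simp add: zip_append zip_map_map zip_same_conv_map o_def sum_list_upt sum_list_upt0)
  also have "(\<Sum>i=1..\<nu>. c \<bullet> (G i * (Tm S i \<otimes>\<^sub>k 1\<^sub>m n) *\<^sub>v H i))
      + ((\<Sum>i=1..\<nu>. c \<bullet> (G i * (Tm_tilde S i \<otimes>\<^sub>k 1\<^sub>m n) *\<^sub>v E i)) + c \<bullet> (D *\<^sub>v w))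
      = (\<Sum>i=1..\<nu>. c \<bullet> (G i * (Tm S i \<otimes>\<^sub>k 1\<^sub>m n) *\<^sub>v H i) + c \<bullet> (G i * (Tm_tilde S i \<otimes>\<^sub>k 1\<^sub>m n) *\<^sub>v E i))
        + c \<bullet> (D *\<^sub>v w)"
    by (simp add: sum.distrib)
  also have "(\<Sum>i=1..\<nu>. c \<bullet> (G i * (Tm S i \<otimes>\<^sub>k 1\<^sub>m n) *\<^sub>v H i) + c \<bullet> (G i * (Tm_tilde S i \<otimes>\<^sub>k 1\<^sub>m n) *\<^sub>v E i))
      = (\<Sum>i=1..\<nu>. c \<bullet> (G i *\<^sub>v ((Tm S i \<otimes>\<^sub>k 1\<^sub>m n) *\<^sub>v H i + (Tm_tilde S i \<otimes>\<^sub>k 1\<^sub>m n) *\<^sub>v E i)))"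
  proof (intro sum.cong refl)
    fix i assume i: "i \<in> {1..\<nu>}"
    have h: "H i \<in> carrier_vec (hdim i * n)" "E i \<in> carrier_vec (\<mu> i * n)"
      using dm by (auto intro: carrier_vecI)
    have v: "(Tm S i \<otimes>\<^sub>k 1\<^sub>m n) *\<^sub>v H i \<in> carrier_vec (g_dim S i * n)"
      "(Tm_tilde S i \<otimes>\<^sub>k 1\<^sub>m n) *\<^sub>v E i \<in> carrier_vec (g_dim S i * n)"
      using T[OF i] h by (meson mult_mat_vec_carrier)+
    have gv: "G i *\<^sub>v ((Tm S i \<otimes>\<^sub>k 1\<^sub>m n) *\<^sub>v H i) \<in> carrier_vec k"
      "G i *\<^sub>v ((Tm_tilde S i \<otimes>\<^sub>k 1\<^sub>m n) *\<^sub>v E i) \<in> carrier_vec k"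
      using G[OF i] v by (meson mult_mat_vec_carrier)+
    show "c \<bullet> (G i * (Tm S i \<otimes>\<^sub>k 1\<^sub>m n) *\<^sub>v H i) + c \<bullet> (G i * (Tm_tilde S i \<otimes>\<^sub>k 1\<^sub>m n) *\<^sub>v E i)
      = c \<bullet> (G i *\<^sub>v ((Tm S i \<otimes>\<^sub>k 1\<^sub>m n) *\<^sub>v H i + (Tm_tilde S i \<otimes>\<^sub>k 1\<^sub>m n) *\<^sub>v E i))"
      unfolding assoc_mult_mat_vec[OF G[OF i] T(1)[OF i] h(1)] assoc_mult_mat_vec[OF G[OF i] T(2)[OF i] h(2)]
        mult_add_distrib_mat_vec[OF G[OF i] v] scalar_prod_add_distrib[OF c gv] ..
  qed
  finally show "c \<bullet> (aug_row S F G D *\<^sub>v stack x H E w) = (\<Sum>i=0..\<nu>. c \<bullet> (F i *\<^sub>v x i))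
      + (\<Sum>i=1..\<nu>. c \<bullet> (G i *\<^sub>v ((Tm S i \<otimes>\<^sub>k 1\<^sub>m n) *\<^sub>v H i + (Tm_tilde S i \<otimes>\<^sub>k 1\<^sub>m n) *\<^sub>v E i)))
      + c \<bullet> (D *\<^sub>v w)" by (simp only: add.assoc)
qed

end

section \<open>The form of \<Phi> and the off-diagonal block\<close>

context delay_system begin

lemma I_hat_carrier: "I_hat S \<in> carrier_mat (d_tot S * n) (h_tot S * n)"
proof -
  have "bdiag S (\<lambda>i. minv (Lf i) * row_blk [0\<^sub>m (d i) (varphi_dim S i), 1\<^sub>m (d i)] * Lh i)
      \<in> carrier_mat (d_tot S) (h_tot S)"
    unfolding d_tot_def h_tot_def
  proof (rule bdiag_carrier)
    fix i assume i: "i \<in> {1..\<nu>}"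
    have "row_blk [0\<^sub>m (d i) (varphi_dim S i), 1\<^sub>m (d i)] \<in> carrier_mat (d i) (hdim i)"
      by (intro row_blk_carrier) (auto simp: h_dim_def)
    then show "minv (Lf i) * row_blk [0\<^sub>m (d i) (varphi_dim S i), 1\<^sub>m (d i)] * Lh i \<in> carrier_mat (d i) (hdim i)"
      using minv_carrier(1)[OF i] cholD(4)[OF i] by (intro mult_carrier_mat)
  qed
  then show ?thesis unfolding I_hat_def by auto
qed

lemma MI_carrier: "row_blk [M_bold S \<otimes>\<^sub>k 1\<^sub>m n, 0\<^sub>m (d_tot S * n) (mu_tot S * n + q + m)]
    \<in> carrier_mat (d_tot S * n) (\<beta> S * n + q + m)"
  and M_bold_carrier: "M_bold S \<in> carrier_mat (d_tot S) (Suc \<nu> + h_tot S)"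
proof -
  have "bdiag S (\<lambda>i. minv (Lf i) * col_mat (f_fun S i (- r i))) \<in> carrier_mat (\<Sum>i=1..\<nu>. d i) (\<Sum>i=1..\<nu>. 1)"
    using minv_carrier(1) by (intro bdiag_carrier carrier_matI) (auto simp: carrier_matD)
  moreover have "bdiag S (\<lambda>i. minv (Lf i) * M_mat S i * Lh i) \<in> carrier_mat (d_tot S) (h_tot S)"
    unfolding d_tot_def h_tot_def
  proof (rule bdiag_carrier)
    fix i assume i: "i \<in> {1..\<nu>}"
    show "minv (Lf i) * M_mat S i * Lh i \<in> carrier_mat (d i) (hdim i)"
      using minv_carrier(1)[OF i] kerD(4)[OF i] cholD(4)[OF i] by (intro mult_carrier_mat)
  qed
  ultimately show M: "M_bold S \<in> carrier_mat (d_tot S) (Suc \<nu> + h_tot S)"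
    unfolding M_bold_def by (intro minus_carrier_mat row_blk_carrier) (auto simp: d_tot_def)
  then have "M_bold S \<otimes>\<^sub>k 1\<^sub>m n \<in> carrier_mat (d_tot S * n) ((Suc \<nu> + h_tot S) * n)" by auto
  then show "row_blk [M_bold S \<otimes>\<^sub>k 1\<^sub>m n, 0\<^sub>m (d_tot S * n) (mu_tot S * n + q + m)]
      \<in> carrier_mat (d_tot S * n) (\<beta> S * n + q + m)"
    by (intro row_blk_carrier) (auto simp: dims_tot algebra_simps)
qed

text \<open>Inside \<open>Sy\<close> each summand is a block column times a block row. The rows
  evaluate to \<open>Yd x H\<close> and to the output \<open>Sg \<vartheta>\<close>; the columns
  pair these with the matching blocks of the vector.\<close>

lemma Phi_form:
  assumes sd: "stack_dims x H E w" and y: "y \<in> carrier_vec m"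
    and Q: "\<And>i. i \<in> {1..\<nu>} \<Longrightarrow> Q i \<in> carrier_mat n n" and R: "\<And>i. i \<in> {1..\<nu>} \<Longrightarrow> R i \<in> carrier_mat n n"
    and P2: "P2 \<in> carrier_mat n (d_tot S * n)" and P3: "P3 \<in> carrier_mat (d_tot S * n) (d_tot S * n)"
    and Sg: "Sg \<in> carrier_mat m (\<beta> S * n + q)"
  shows "\<Phi> S P2 P3 Q R Sg \<in> carrier_mat (\<beta> S * n + q + m) (\<beta> S * n + q + m)"
    and "(stack x H E w @\<^sub>v y) \<bullet> (\<Phi> S P2 P3 Q R Sg *\<^sub>v (stack x H E w @\<^sub>v y)) =
      2 * (x 0 \<bullet> (P2 *\<^sub>v Yd x H) + Yp H \<bullet> (P3 *\<^sub>v Yd x H)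
        - w \<bullet> ((J2_mat S)\<^sup>T *\<^sub>v (Sg *\<^sub>v stack x H E w)) + y \<bullet> (J_tilde S *\<^sub>v (Sg *\<^sub>v stack x H E w)))
      + stack x H E w \<bullet> (\<Xi> S Q R *\<^sub>v stack x H E w) + y \<bullet> (J1_mat S *\<^sub>v y)"
proof -
  note dm = dim_vcat_map[OF sd]
  let ?\<theta> = "stack x H E w" and ?N = "\<beta> S * n + q" and ?dn = "d_tot S * n"
  let ?hs = "vcat (map H ix)" and ?es = "vcat (map E ix)"
  let ?C2 = "col_blk [P2, 0\<^sub>m (\<nu> * n) ?dn, (I_hat S)\<^sup>T * P3, 0\<^sub>m (mu_tot S * n + q + m) ?dn]"
  let ?R2 = "row_blk [M_bold S \<otimes>\<^sub>k 1\<^sub>m n, 0\<^sub>m ?dn (mu_tot S * n + q + m)]"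
  let ?C3 = "col_blk [0\<^sub>m (\<beta> S * n) m, - ((J2_mat S)\<^sup>T), J_tilde S]"
  let ?R3 = "row_blk [Sg, 0\<^sub>m m m]"
  let ?D = "diag_block_mat [\<Xi> S Q R, J1_mat S]"
  let ?b = "?\<theta> @\<^sub>v y"
  note Ih = I_hat_carrier
  have IP: "(I_hat S)\<^sup>T * P3 \<in> carrier_mat (h_tot S * n) ?dn" using Ih P3 by auto
  have C2: "?C2 \<in> carrier_mat (?N + m) ?dn"
    using P2 IP by (intro col_blk_carrier) (auto simp: dims_tot algebra_simps)
  have R2: "?R2 \<in> carrier_mat ?dn (?N + m)" by (rule MI_carrier)
  have C3: "?C3 \<in> carrier_mat (?N + m) m"
    using supD(1,5) by (intro col_blk_carrier) auto
  have R3: "?R3 \<in> carrier_mat m (?N + m)"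
    using Sg by (intro row_blk_carrier) auto
  have Xi: "\<Xi> S Q R \<in> carrier_mat ?N ?N" by (rule Xi_form(1)[OF sd Q R])
  have D: "?D \<in> carrier_mat (?N + m) (?N + m)"
    using Xi supD(3) by (intro diag_block_carrier) auto
  have CR: "?C2 * ?R2 \<in> carrier_mat (?N + m) (?N + m)" "?C3 * ?R3 \<in> carrier_mat (?N + m) (?N + m)"
    using C2 R2 C3 R3 by (meson mult_carrier_mat)+
  then have CR': "?C2 * ?R2 + ?C3 * ?R3 \<in> carrier_mat (?N + m) (?N + m)" by (meson add_carrier_mat)
  have Sc: "Sy (?C2 * ?R2 + ?C3 * ?R3) \<in> carrier_mat (?N + m) (?N + m)"
    unfolding Sy_def using CR' by (meson add_carrier_mat transpose_carrier_mat)
  show "\<Phi> S P2 P3 Q R Sg \<in> carrier_mat (?N + m) (?N + m)"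
    unfolding \<Phi>_def using Sc D by (meson add_carrier_mat)
  have th: "?\<theta> \<in> carrier_vec ?N" by (rule stack_carrier[OF sd])
  then have b: "?b \<in> carrier_vec (?N + m)" using y by simp
  have R2b: "?R2 *\<^sub>v ?b = Yd x H"
  proof -
    let ?v = "?es @\<^sub>v w @\<^sub>v y"
    have v: "dim_vec ?v = mu_tot S * n + q + m"
      using dm(5,9) y by (simp del: dim_vec_vcat)
    have u: "dim_vec (vcat (map x [0..<Suc \<nu>]) @\<^sub>v ?hs) = (Suc \<nu> + h_tot S) * n"
      by (simp only: index_append_vec dm) (simp add: algebra_simps)
    have "?R2 *\<^sub>v ((vcat (map x [0..<Suc \<nu>]) @\<^sub>v ?hs) @\<^sub>v ?v) =
        (M_bold S \<otimes>\<^sub>k 1\<^sub>m n) *\<^sub>v (vcat (map x [0..<Suc \<nu>]) @\<^sub>v ?hs) + 0\<^sub>m ?dn (mu_tot S * n + q + m) *\<^sub>v ?v"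
      by (rule row_blk2_mult[where k="?dn"]) (unfold u v, use M_bold_carrier in auto)
    also have "0\<^sub>m ?dn (mu_tot S * n + q + m) *\<^sub>v ?v = 0\<^sub>v ?dn" using v by (rule zero_mat_mult_vec)
    also have "(M_bold S \<otimes>\<^sub>k 1\<^sub>m n) *\<^sub>v (vcat (map x [0..<Suc \<nu>]) @\<^sub>v ?hs) = Yd x H"
      by (rule M_bold_mult[OF sd])
    finally show ?thesis
      unfolding stack_unfold(3) append_vec_assoc using Yd_carrier[of x H] by simp
  qed
  have R3b: "?R3 *\<^sub>v ?b = Sg *\<^sub>v ?\<theta>"
  proof -
    have "?R3 *\<^sub>v ?b = Sg *\<^sub>v ?\<theta> + 0\<^sub>m m m *\<^sub>v y"
      by (rule row_blk2_mult[where k=m]) (unfold carrier_vecD[OF th] carrier_vecD[OF y], use Sg in auto)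
    moreover have "Sg *\<^sub>v ?\<theta> \<in> carrier_vec m" using Sg th by (rule mult_mat_vec_carrier)
    ultimately show ?thesis using y by simp
  qed
  have Y: "Yd x H \<in> carrier_vec ?dn" by (rule Yd_carrier)
  have z: "Sg *\<^sub>v ?\<theta> \<in> carrier_vec m" using Sg th by (rule mult_mat_vec_carrier)
  have 2: "?b \<bullet> (?C2 *\<^sub>v Yd x H) = x 0 \<bullet> (P2 *\<^sub>v Yd x H) + Yp H \<bullet> (P3 *\<^sub>v Yd x H)"
  proof -
    let ?us = "[x 0, vcat (map x ix), ?hs, ?es @\<^sub>v w @\<^sub>v y]"
    have v: "dim_vec (?es @\<^sub>v w @\<^sub>v y) = mu_tot S * n + q + m"
      using dm(5,9) y by (simp del: dim_vec_vcat)
    have "vcat ?us \<bullet> (?C2 *\<^sub>v Yd x H)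
        = (\<Sum>(u, A)\<leftarrow>zip ?us [P2, 0\<^sub>m (\<nu> * n) ?dn, (I_hat S)\<^sup>T * P3, 0\<^sub>m (mu_tot S * n + q + m) ?dn]. u \<bullet> (A *\<^sub>v Yd x H))"
      by (rule col_blk_form) (simp_all only: list_all2_Cons list_all2_Nil dm v carrier_vecD[OF Y] P2 IP
        zero_carrier_mat simp_thms list.simps)
    also have "\<dots> = x 0 \<bullet> (P2 *\<^sub>v Yd x H) + ?hs \<bullet> ((I_hat S)\<^sup>T *\<^sub>v (P3 *\<^sub>v Yd x H))"
      using Y dm v
      by (simp add: assoc_mult_mat_vec[OF transpose_carrier_mat[THEN iffD2, OF Ih] P3 Y]
          scalar_prod_right_zero[OF carrier_vecI] del: dim_vec_vcat)
    also have "?hs \<bullet> ((I_hat S)\<^sup>T *\<^sub>v (P3 *\<^sub>v Yd x H)) = Yp H \<bullet> (P3 *\<^sub>v Yd x H)"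
    proof -
      have h: "?hs \<in> carrier_vec (h_tot S * n)" using dm(4) by (rule carrier_vecI)
      have P: "P3 *\<^sub>v Yd x H \<in> carrier_vec ?dn" using P3 Y by (rule mult_mat_vec_carrier)
      have IPc: "(I_hat S)\<^sup>T *\<^sub>v (P3 *\<^sub>v Yd x H) \<in> carrier_vec (h_tot S * n)"
        using Ih P by (meson mult_mat_vec_carrier transpose_carrier_mat)
      show ?thesis
        using transpose_vec_mult_scalar[OF Ih h P] comm_scalar_prod[OF h IPc]
          comm_scalar_prod[OF P Yp_carrier[of H]] I_hat_mult[OF sd] by simp
    qed
    finally show ?thesis unfolding stack_unfold(2) append_vec_assoc by simp
  qed
  have 3: "?b \<bullet> (?C3 *\<^sub>v (Sg *\<^sub>v ?\<theta>)) = - (w \<bullet> ((J2_mat S)\<^sup>T *\<^sub>v (Sg *\<^sub>v ?\<theta>))) + y \<bullet> (J_tilde S *\<^sub>v (Sg *\<^sub>v ?\<theta>))"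
  proof -
    let ?t = "vcat (map x [0..<Suc \<nu>]) @\<^sub>v ?hs @\<^sub>v ?es" and ?z = "Sg *\<^sub>v ?\<theta>"
    have t: "dim_vec ?t = \<beta> S * n"
      by (simp only: index_append_vec dm) (simp add: dims_tot algebra_simps)
    have "vcat [?t, w, y] \<bullet> (?C3 *\<^sub>v ?z)
        = (\<Sum>(u, A)\<leftarrow>zip [?t, w, y] [0\<^sub>m (\<beta> S * n) m, - ((J2_mat S)\<^sup>T), J_tilde S]. u \<bullet> (A *\<^sub>v ?z))"
      by (rule col_blk_form) (simp_all only: list_all2_Cons list_all2_Nil dm t carrier_vecD[OF z] carrier_vecD[OF y]
        uminus_carrier_iff_mat transpose_carrier_mat supD zero_carrier_mat simp_thms list.simps)
    also have "\<dots> = ?t \<bullet> 0\<^sub>v (\<beta> S * n) + w \<bullet> (- ((J2_mat S)\<^sup>T) *\<^sub>v ?z) + y \<bullet> (J_tilde S *\<^sub>v ?z)"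
      using z by (simp only: list.map zip_Cons_Cons zip_Nil prod.case sum_list.Cons sum_list.Nil
          zero_mat_mult_vec[OF carrier_vecD] add_0_right add.assoc)
    also have "?t \<bullet> 0\<^sub>v (\<beta> S * n) = 0" using t by (intro scalar_prod_right_zero carrier_vecI)
    also have "w \<bullet> (- ((J2_mat S)\<^sup>T) *\<^sub>v ?z) = - (w \<bullet> ((J2_mat S)\<^sup>T *\<^sub>v ?z))"
    proof -
      have "- ((J2_mat S)\<^sup>T) *\<^sub>v ?z = - ((J2_mat S)\<^sup>T *\<^sub>v ?z)"
        using carrier_vecD[OF z] supD(5) by (intro uminus_mult_mat_vec) simp
      then show ?thesis using dm(9) supD(5) by simp
    qed
    finally show ?thesis unfolding stack_unfold(4) append_vec_assoc by (simp del: dim_vec_vcat)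
  qed
  have 4: "?b \<bullet> (?D *\<^sub>v ?b) = ?\<theta> \<bullet> (\<Xi> S Q R *\<^sub>v ?\<theta>) + y \<bullet> (J1_mat S *\<^sub>v y)"
  proof -
    have "?D *\<^sub>v vcat [?\<theta>, y] = vcat [\<Xi> S Q R *\<^sub>v ?\<theta>, J1_mat S *\<^sub>v y]"
      using Xi supD(3) th y by (subst diag_block_mult) (auto simp del: diag_block_mat.simps)
    then have "?D *\<^sub>v ?b = \<Xi> S Q R *\<^sub>v ?\<theta> @\<^sub>v J1_mat S *\<^sub>v y" by (simp del: diag_block_mat.simps)
    then show ?thesis
      using mult_mat_vec_carrier[OF Xi th] mult_mat_vec_carrier[OF supD(3) y] th y
      by (simp del: diag_block_mat.simps add: scalar_prod_append)
  qed
  have "?b \<bullet> (\<Phi> S P2 P3 Q R Sg *\<^sub>v ?b) = ?b \<bullet> (Sy (?C2 * ?R2 + ?C3 * ?R3) *\<^sub>v ?b) + ?b \<bullet> (?D *\<^sub>v ?b)"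
    unfolding \<Phi>_def add_mult_distrib_mat_vec[OF Sc D b]
    by (rule scalar_prod_add_distrib[OF b mult_mat_vec_carrier[OF Sc b] mult_mat_vec_carrier[OF D b]])
  also have "?b \<bullet> (Sy (?C2 * ?R2 + ?C3 * ?R3) *\<^sub>v ?b)
      = 2 * (?b \<bullet> (?C2 *\<^sub>v (?R2 *\<^sub>v ?b)) + ?b \<bullet> (?C3 *\<^sub>v (?R3 *\<^sub>v ?b)))"
    unfolding scalar_prod_Sy[OF CR' b] add_mult_distrib_mat_vec[OF CR b]
      scalar_prod_add_distrib[OF b mult_mat_vec_carrier[OF CR(1) b] mult_mat_vec_carrier[OF CR(2) b]]
    unfolding assoc_mult_mat_vec[OF C2 R2 b] assoc_mult_mat_vec[OF C3 R3 b] ..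
  finally show "?b \<bullet> (\<Phi> S P2 P3 Q R Sg *\<^sub>v ?b) =
      2 * (x 0 \<bullet> (P2 *\<^sub>v Yd x H) + Yp H \<bullet> (P3 *\<^sub>v Yd x H)
        - w \<bullet> ((J2_mat S)\<^sup>T *\<^sub>v (Sg *\<^sub>v ?\<theta>)) + y \<bullet> (J_tilde S *\<^sub>v (Sg *\<^sub>v ?\<theta>)))
      + ?\<theta> \<bullet> (\<Xi> S Q R *\<^sub>v ?\<theta>) + y \<bullet> (J1_mat S *\<^sub>v y)"
    unfolding R2b R3b 2 3 4 by simp
qed

lemma P_bold_form:
  assumes sd: "stack_dims x H E w" and y: "y \<in> carrier_vec m" and a: "a \<in> carrier_vec n"
    and P1: "P1 \<in> carrier_mat n n" and P2: "P2 \<in> carrier_mat n (d_tot S * n)"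
  shows "P_bold S P1 P2 \<in> carrier_mat n (\<beta> S * n + q + m)"
    and "a \<bullet> (P_bold S P1 P2 *\<^sub>v (stack x H E w @\<^sub>v y)) = a \<bullet> (P1 *\<^sub>v x 0) + a \<bullet> (P2 *\<^sub>v Yp H)"
proof -
  note dm = dim_vcat_map[OF sd]
  let ?hs = "vcat (map H ix)" and ?es = "vcat (map E ix)"
  note Ih = I_hat_carrier
  have PI: "P2 * I_hat S \<in> carrier_mat n (h_tot S * n)" using P2 Ih by auto
  show "P_bold S P1 P2 \<in> carrier_mat n (\<beta> S * n + q + m)"
    unfolding P_bold_def using P1 PI by (intro row_blk_carrier) (auto simp: dims_tot algebra_simps)
  have v: "dim_vec (?es @\<^sub>v w @\<^sub>v y) = mu_tot S * n + q + m"
    using dm(5,9) y by (simp del: dim_vec_vcat)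
  have "a \<bullet> (P_bold S P1 P2 *\<^sub>v vcat [x 0, vcat (map x ix), ?hs, ?es @\<^sub>v w @\<^sub>v y]) =
      (\<Sum>(A, u)\<leftarrow>zip [P1, 0\<^sub>m n (\<nu> * n), P2 * I_hat S, 0\<^sub>m n (mu_tot S * n + q + m)]
        [x 0, vcat (map x ix), ?hs, ?es @\<^sub>v w @\<^sub>v y]. a \<bullet> (A *\<^sub>v u))"
    unfolding P_bold_def
    by (rule row_blk_scalar_prod[where k=n]) (simp_all only: list_all2_Cons list_all2_Nil dm v P1 PI a
        zero_carrier_mat simp_thms list.simps)
  also have "\<dots> = a \<bullet> (P1 *\<^sub>v x 0) + a \<bullet> ((P2 * I_hat S) *\<^sub>v ?hs)"
    using a dm v by (simp del: dim_vec_vcat)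
  also have "(P2 * I_hat S) *\<^sub>v ?hs = P2 *\<^sub>v Yp H"
    using I_hat_mult[OF sd] assoc_mult_mat_vec[OF P2 Ih carrier_vecI[OF dm(4)]] by simp
  finally show "a \<bullet> (P_bold S P1 P2 *\<^sub>v (stack x H E w @\<^sub>v y)) = a \<bullet> (P1 *\<^sub>v x 0) + a \<bullet> (P2 *\<^sub>v Yp H)"
    unfolding stack_unfold(2) append_vec_assoc by simp
qed

end

section \<open>Consequences of the strict matrix inequality\<close>

locale synthesis = delay_system +
  fixes \<alpha> :: "nat \<Rightarrow> real" and P1 X P2 P3 :: "real mat" and Q R V W :: "nat \<Rightarrow> real mat"
  assumes un: "(P1, X, P2, P3, Q, R, V, W) \<in> carrier (unknowns S)"
    and posP: "pos_def (four_block_mat P1 P2 P2\<^sup>T P3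
          + diag_block_mat [0\<^sub>m (dim_x S) (dim_x S), bdiag S (\<lambda>i. 1\<^sub>m (f_dim S i) \<otimes>\<^sub>k Q i)])"
    and posQ: "pos_def (bdiag S Q)"
    and posR: "pos_def (bdiag S R)"
    and lmi: "neg_def (Sy (col_blk ([1\<^sub>m (dim_x S)] @ map (\<lambda>i. \<alpha> i \<cdot>\<^sub>m 1\<^sub>m (dim_x S)) [1..<Suc (\<beta> S)]
                        @ [0\<^sub>m (dim_w S + dim_z S) (dim_x S)])
                     * row_blk [- X, Pi_bold S X V W])
          + four_block_mat (0\<^sub>m (dim_x S) (dim_x S)) (P_bold S P1 P2) (P_bold S P1 P2)\<^sup>T
              (\<Phi> S P2 P3 Q R (Sigma_bold S X V W)))"
begin

lemma unD:
  "P1 \<in> sym_mats n" "X \<in> sym_mats n" "P2 \<in> carrier_mat n (d_tot S * n)" "P3 \<in> sym_mats (d_tot S * n)"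
  "\<And>i. i \<in> {1..\<nu>} \<Longrightarrow> Q i \<in> sym_mats n" "\<And>i. i \<in> {1..\<nu>} \<Longrightarrow> R i \<in> sym_mats n"
  "\<And>i. i \<in> {0..\<nu>} \<Longrightarrow> V i \<in> carrier_mat p n" "\<And>i. i \<in> {1..\<nu>} \<Longrightarrow> W i \<in> carrier_mat p (g_dim S i * n)"
  using un by (auto simp: unknowns_def)

lemma unD_carrier:
  "P1 \<in> carrier_mat n n" "X \<in> carrier_mat n n" "P3 \<in> carrier_mat (d_tot S * n) (d_tot S * n)"
  "\<And>i. i \<in> {1..\<nu>} \<Longrightarrow> Q i \<in> carrier_mat n n" "\<And>i. i \<in> {1..\<nu>} \<Longrightarrow> R i \<in> carrier_mat n n"
  using unD by (auto intro: sym_matsD)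

definition lmi_mat :: "real mat" where
  "lmi_mat = Sy (col_blk ([1\<^sub>m (dim_x S)] @ map (\<lambda>i. \<alpha> i \<cdot>\<^sub>m 1\<^sub>m (dim_x S)) [1..<Suc (\<beta> S)]
                        @ [0\<^sub>m (dim_w S + dim_z S) (dim_x S)])
                     * row_blk [- X, Pi_bold S X V W])
          + four_block_mat (0\<^sub>m (dim_x S) (dim_x S)) (P_bold S P1 P2) (P_bold S P1 P2)\<^sup>T
              (\<Phi> S P2 P3 Q R (Sigma_bold S X V W))"

abbreviation "N \<equiv> \<beta> S * n + q"

definition "Pi0 = A_bold S * X_aug S X + Bx_mat S * V_bold S V W"

text \<open>The lemmas on forms also yield carriers, but are stated for a given stack; the zero
  stack instantiates them when only the size of a matrix is wanted.\<close>

lemma zero_stack: "stack_dims (\<lambda>i. 0\<^sub>v n) (\<lambda>i. 0\<^sub>v (hdim i * n)) (\<lambda>i. 0\<^sub>v (\<mu> i * n)) (0\<^sub>v q)"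
  by (simp add: stack_dims_def)

lemma bold_carrier:
  "A_bold S \<in> carrier_mat n N" "C_bold S \<in> carrier_mat m N" "V_bold S V W \<in> carrier_mat p N"
  unfolding A_bold_def C_bold_def V_bold_def
  by (rule aug_row_form(1)[OF zero_stack]; use sysD kerD unD in auto)+

lemma Sigma_carrier: "Sigma_bold S X V W \<in> carrier_mat m N" and Pi0_carrier: "Pi0 \<in> carrier_mat n N"
  unfolding Sigma_bold_def Pi0_def
  using X_aug_mult(1)[OF zero_stack unD_carrier(2)] bold_carrier sysD(10,11)
  by (meson add_carrier_mat mult_carrier_mat)+

text \<open>The scalars \<alpha> occur only in the left factor \<open>C\<close> of
  \<open>Sy (C * R)\<close>. The premise says that the right factor \<open>R\<close> annihilates
  \<open>(a, b)\<close>, so this summand contributes nothing to the form there.\<close>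

lemma lmi_mat_form:
  assumes a: "a \<in> carrier_vec n" and b: "b \<in> carrier_vec (N + m)"
    and z: "- X *\<^sub>v a + Pi_bold S X V W *\<^sub>v b = 0\<^sub>v n"
  shows "lmi_mat \<in> carrier_mat (n + (N + m)) (n + (N + m))"
    and "(a @\<^sub>v b) \<bullet> (lmi_mat *\<^sub>v (a @\<^sub>v b)) =
      2 * (a \<bullet> (P_bold S P1 P2 *\<^sub>v b)) + b \<bullet> (\<Phi> S P2 P3 Q R (Sigma_bold S X V W) *\<^sub>v b)"
proof -
  let ?C = "col_blk ([1\<^sub>m n] @ map (\<lambda>i. \<alpha> i \<cdot>\<^sub>m 1\<^sub>m n) [1..<Suc (\<beta> S)] @ [0\<^sub>m (q + m) n])"
  let ?R = "row_blk [- X, Pi_bold S X V W]"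
  let ?P = "P_bold S P1 P2" and ?Phi = "\<Phi> S P2 P3 Q R (Sigma_bold S X V W)"
  have Pi: "Pi_bold S X V W \<in> carrier_mat n (N + m)"
    unfolding Pi_bold_def using Pi0_carrier[unfolded Pi0_def] by (intro row_blk_carrier) auto
  have C: "?C \<in> carrier_mat (n + (N + m)) n"
    by (intro col_blk_carrier) (auto simp: o_def sum_list_upt)
  have R: "?R \<in> carrier_mat n (n + (N + m))"
    using Pi unD_carrier(2) by (intro row_blk_carrier) auto
  have CR: "?C * ?R \<in> carrier_mat (n + (N + m)) (n + (N + m))"
    using C R by (rule mult_carrier_mat)
  have ab: "a @\<^sub>v b \<in> carrier_vec (n + (N + m))" using a b by simp
  have Sc: "Sy (?C * ?R) \<in> carrier_mat (n + (N + m)) (n + (N + m))"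
    unfolding Sy_def using CR by (meson add_carrier_mat transpose_carrier_mat)
  have P: "?P \<in> carrier_mat n (N + m)"
    by (rule P_bold_form(1)[OF zero_stack zero_carrier_vec zero_carrier_vec unD_carrier(1) unD(3)])
  have Phi: "?Phi \<in> carrier_mat (N + m) (N + m)"
    using unD unD_carrier Sigma_carrier by (intro Phi_form(1)[OF zero_stack zero_carrier_vec])
  let ?F = "four_block_mat (0\<^sub>m n n) ?P ?P\<^sup>T ?Phi"
  have F: "?F \<in> carrier_mat (n + (N + m)) (n + (N + m))"
    using Phi by (intro four_block_carrier_mat) auto
  show L: "lmi_mat \<in> carrier_mat (n + (N + m)) (n + (N + m))"
    unfolding lmi_mat_def using F by (rule add_carrier_mat)
  have "?R *\<^sub>v (a @\<^sub>v b) = - X *\<^sub>v a + Pi_bold S X V W *\<^sub>v b"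
    using Pi unD_carrier(2) a b by (intro row_blk2_mult[where k=n]) auto
  then have "?C * ?R *\<^sub>v (a @\<^sub>v b) = ?C *\<^sub>v 0\<^sub>v n"
    using assoc_mult_mat_vec[OF C R ab] z by simp
  also have "\<dots> = 0\<^sub>v (n + (N + m))"
    using C by (intro eq_vecI) (auto simp: scalar_prod_lessThan)
  finally have "(a @\<^sub>v b) \<bullet> (Sy (?C * ?R) *\<^sub>v (a @\<^sub>v b)) = 0"
    unfolding scalar_prod_Sy[OF CR ab] using scalar_prod_right_zero[OF ab] by simp
  moreover have "(a @\<^sub>v b) \<bullet> (?F *\<^sub>v (a @\<^sub>v b)) = 2 * (a \<bullet> (?P *\<^sub>v b)) + b \<bullet> (?Phi *\<^sub>v b)"
    using a scalar_prod_four_block_sym[OF zero_carrier_mat P Phi a b] by simp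
  moreover have "lmi_mat *\<^sub>v (a @\<^sub>v b) = Sy (?C * ?R) *\<^sub>v (a @\<^sub>v b) + ?F *\<^sub>v (a @\<^sub>v b)"
    unfolding lmi_mat_def by (rule add_mult_distrib_mat_vec[OF Sc F ab])
  ultimately show "(a @\<^sub>v b) \<bullet> (lmi_mat *\<^sub>v (a @\<^sub>v b)) =
      2 * (a \<bullet> (?P *\<^sub>v b)) + b \<bullet> (?Phi *\<^sub>v b)"
    using scalar_prod_add_distrib[OF ab mult_mat_vec_carrier[OF Sc ab] mult_mat_vec_carrier[OF F ab]]
    by simp
qed

lemma lmi_mat_zero: "- X *\<^sub>v 0\<^sub>v n + Pi_bold S X V W *\<^sub>v 0\<^sub>v (N + m) = 0\<^sub>v n"
proof -
  have "Pi_bold S X V W \<in> carrier_mat n (N + m)"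
    unfolding Pi_bold_def using Pi0_carrier[unfolded Pi0_def] by (intro row_blk_carrier) auto
  then show ?thesis
    using unD_carrier(2) by (intro eq_vecI) (auto simp: scalar_prod_lessThan)
qed

lemmas lmi_mat_carrier = lmi_mat_form(1)[OF zero_carrier_vec zero_carrier_vec lmi_mat_zero]

text \<open>In finite dimension strict negativity comes with a uniform margin, the source of all
  decay constants below.\<close>

lemma lmi_bound: "\<exists>e>0. \<forall>v\<in>carrier_vec (n + (N + m)). v \<bullet> (lmi_mat *\<^sub>v v) \<le> - e * (v \<bullet> v)"
proof -
  have pd: "pos_def (- lmi_mat)"
    using lmi neg_def_iff_pos_def[OF lmi_mat_carrier] by (simp add: lmi_mat_def)
  have "dim_row (- lmi_mat) = n + (N + m)"
    using lmi_mat_carrier by simp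
  from pos_def_bound[OF pd this] obtain c where c: "c > 0"
    "\<And>v. v \<in> carrier_vec (n + (N + m)) \<Longrightarrow> v \<bullet> v \<le> c * (v \<bullet> (- lmi_mat *\<^sub>v v))" by auto
  have "v \<bullet> (lmi_mat *\<^sub>v v) \<le> - (1 / c) * (v \<bullet> v)" if v: "v \<in> carrier_vec (n + (N + m))" for v
  proof -
    have "v \<bullet> (- lmi_mat *\<^sub>v v) = - (v \<bullet> (lmi_mat *\<^sub>v v))"
      using lmi_mat_carrier v by (simp add: uminus_mult_mat_vec)
    then show ?thesis using c(1) c(2)[OF v] by (simp add: field_simps)
  qed
  then show ?thesis using c(1) by (intro exI[of _ "1 / c"]) auto
qed

text \<open>A kernel vector \<open>a\<close> of \<open>X\<close> together with \<open>b = 0\<close>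
  meets the premise of \<open>lmi_mat_form\<close>. All remaining terms contain \<open>b\<close>, so
  the form vanishes at the nonzero vector \<open>(a, 0)\<close>, against strict negativity.\<close>

lemma X_det: "det X \<noteq> 0"
proof
  assume "det X = 0"
  then obtain a where a: "a \<in> carrier_vec n" "a \<noteq> 0\<^sub>v n" "X *\<^sub>v a = 0\<^sub>v n"
    using det_0_iff_vec_prod_zero[OF unD_carrier(2)] by auto
  let ?b = "0\<^sub>v (N + m) :: real vec"
  have Pi: "Pi_bold S X V W \<in> carrier_mat n (N + m)"
    unfolding Pi_bold_def using Pi0_carrier[unfolded Pi0_def] by (intro row_blk_carrier) auto
  have z: "- X *\<^sub>v a + Pi_bold S X V W *\<^sub>v ?b = 0\<^sub>v n"
    using a unD_carrier(2) Pi uminus_mult_mat_vec[of a X]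
    by (intro eq_vecI) (auto simp: scalar_prod_lessThan)
  have P: "P_bold S P1 P2 \<in> carrier_mat n (N + m)"
    by (rule P_bold_form(1)[OF zero_stack zero_carrier_vec zero_carrier_vec unD_carrier(1) unD(3)])
  have "P_bold S P1 P2 *\<^sub>v ?b = 0\<^sub>v n"
    using P by (intro eq_vecI) (auto simp: scalar_prod_lessThan)
  moreover have "?b \<bullet> (\<Phi> S P2 P3 Q R (Sigma_bold S X V W) *\<^sub>v ?b) = 0"
  proof -
    have "\<Phi> S P2 P3 Q R (Sigma_bold S X V W) \<in> carrier_mat (N + m) (N + m)"
      using unD unD_carrier Sigma_carrier by (intro Phi_form(1)[OF zero_stack zero_carrier_vec])
    from mult_mat_vec_carrier[OF this zero_carrier_vec] show ?thesis by (rule scalar_prod_left_zero)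
  qed
  ultimately have "(a @\<^sub>v ?b) \<bullet> (lmi_mat *\<^sub>v (a @\<^sub>v ?b)) = 0"
    using lmi_mat_form(2)[OF a(1) zero_carrier_vec z] a(1) by simp
  moreover have "(a @\<^sub>v ?b) \<bullet> (lmi_mat *\<^sub>v (a @\<^sub>v ?b)) < 0"
  proof -
    have "a @\<^sub>v ?b \<noteq> 0\<^sub>v (n + (N + m))"
    proof
      assume *: "a @\<^sub>v ?b = 0\<^sub>v (n + (N + m))"
      have "a $ i = 0" if "i < n" for i
        using arg_cong[OF *, of "\<lambda>v. v $ i"] that a(1) by simp
      then show False using a by (auto intro!: eq_vecI)
    qed
    then show ?thesis
      using lmi lmi_mat_carrier a(1) unfolding lmi_mat_def[symmetric] neg_def_def by auto
  qed
  ultimately show False by simp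
qed

definition "Y0 = minv X"

lemma Y0: "Y0 \<in> carrier_mat n n" "\<And>v. v \<in> carrier_vec n \<Longrightarrow> X *\<^sub>v (Y0 *\<^sub>v v) = v"
  "\<And>v. v \<in> carrier_vec n \<Longrightarrow> Y0 *\<^sub>v (X *\<^sub>v v) = v" "Y0 * X = 1\<^sub>m n" "X * Y0 = 1\<^sub>m n"
  using minv_inverts[OF unD_carrier(2) X_det] minv_mult_vec[OF unD_carrier(2) X_det]
  by (auto simp: Y0_def)

text \<open>The quadratic form of the matrix inequality at \<open>(a, \<vartheta>, y)\<close>: the first summand vanishes there
  because \<open>X a\<close> is the right-hand side of the closed loop.\<close>

lemma lmi_form:
  assumes sd: "stack_dims x H E w" and a: "a \<in> carrier_vec n" and y: "y \<in> carrier_vec m"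
    and Xa: "X *\<^sub>v a = Pi0 *\<^sub>v stack x H E w"
  shows "(a @\<^sub>v (stack x H E w @\<^sub>v y)) \<bullet> (lmi_mat *\<^sub>v (a @\<^sub>v (stack x H E w @\<^sub>v y))) =
    2 * (a \<bullet> (P1 *\<^sub>v x 0) + a \<bullet> (P2 *\<^sub>v Yp H) + x 0 \<bullet> (P2 *\<^sub>v Yd x H) + Yp H \<bullet> (P3 *\<^sub>v Yd x H)
        - w \<bullet> ((J2_mat S)\<^sup>T *\<^sub>v (Sigma_bold S X V W *\<^sub>v stack x H E w))
        + y \<bullet> (J_tilde S *\<^sub>v (Sigma_bold S X V W *\<^sub>v stack x H E w)))
    + (\<Sum>i=1..\<nu>. x (i - 1) \<bullet> (Q i *\<^sub>v x (i - 1)) + (r i - r (i - 1)) * (x (i - 1) \<bullet> (R i *\<^sub>v x (i - 1))))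
    - (\<Sum>i=1..\<nu>. x i \<bullet> (Q i *\<^sub>v x i))
    - (\<Sum>i=1..\<nu>. H i \<bullet> ((1\<^sub>m (hdim i) \<otimes>\<^sub>k R i) *\<^sub>v H i))
    - (\<Sum>i=1..\<nu>. E i \<bullet> ((1\<^sub>m (\<mu> i) \<otimes>\<^sub>k R i) *\<^sub>v E i)) - w \<bullet> (J3_mat S *\<^sub>v w)
    + y \<bullet> (J1_mat S *\<^sub>v y)"
proof -
  let ?\<theta> = "stack x H E w"
  have th: "?\<theta> \<in> carrier_vec N" by (rule stack_carrier[OF sd])
  have Pi: "Pi_bold S X V W *\<^sub>v (?\<theta> @\<^sub>v y) = Pi0 *\<^sub>v ?\<theta>"
  proof -
    have "Pi_bold S X V W *\<^sub>v (?\<theta> @\<^sub>v y) = Pi0 *\<^sub>v ?\<theta> + 0\<^sub>m n m *\<^sub>v y"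
      unfolding Pi_bold_def Pi0_def[symmetric]
      by (rule row_blk2_mult[where k=n]) (unfold carrier_vecD[OF th] carrier_vecD[OF y], use Pi0_carrier in auto)
    then show ?thesis using y mult_mat_vec_carrier[OF Pi0_carrier th] by simp
  qed
  have "- X *\<^sub>v a + Pi_bold S X V W *\<^sub>v (?\<theta> @\<^sub>v y) = 0\<^sub>v n"
  proof -
    have "- X *\<^sub>v a = - (X *\<^sub>v a)"
      using a unD_carrier(2) by (intro uminus_mult_mat_vec) simp
    then show ?thesis unfolding Pi using Xa mult_mat_vec_carrier[OF Pi0_carrier th]
      by (intro eq_vecI) auto
  qed
  note lmi_mat_form(2)[OF a append_carrier_vec[OF th y] this]
    P_bold_form(2)[OF sd y a unD_carrier(1) unD(3)]
    Phi_form(2)[OF sd y unD_carrier(4,5) unD(3) unD_carrier(3) Sigma_carrier]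
    Xi_form(2)[OF sd unD_carrier(4,5)]
  then show ?thesis by simp
qed

end

section \<open>Integrals along a curve\<close>

context delay_system begin

lemma r_mono: "i \<le> j \<Longrightarrow> j \<le> \<nu> \<Longrightarrow> r i \<le> r j"
proof (induction j rule: nat_induct)
  case (Suc j)
  then show ?case using sysD(7)[of j] by (cases "i = Suc j") auto
qed simp

lemma Ivl_eq: "Ivl S i = {- r i..- r (i - 1)}"
  by (simp add: Ivl_def)

lemma Ivl_less: "i \<in> {1..\<nu>} \<Longrightarrow> - r i < - r (i - 1)"
  using sysD(7)[of "i - 1"] by auto

lemma Ivl_subset:
  assumes "i \<in> {1..\<nu>}" "\<tau> \<in> Ivl S i"
  shows "\<tau> \<in> {- r \<nu>..0}"
proof -
  have "i \<le> \<nu>" "i - 1 \<le> \<nu>" using assms(1) by auto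
  then show ?thesis
    using r_mono[of i \<nu>] r_mono[of 0 "i - 1"] sysD(6) assms(2) by (simp add: Ivl_def)
qed

text \<open>Normalised by the Cholesky factors, these families are orthonormal, so that Bessel's
  inequality comes with the weights \<open>I \<otimes> R\<close> that occur in \<Xi>.\<close>

definition "hh i \<tau> = minv (Lh i) *\<^sub>v h_fun S i \<tau>"
definition "ee i \<tau> = minv (Le i) *\<^sub>v e_fun S i \<tau>"
definition "ff i \<tau> = minv (Lf i) *\<^sub>v f_fun S i \<tau>"

lemma L2_funs:
  assumes i: "i \<in> {1..\<nu>}"
  shows "L2_vec (Ivl S i) (d i) (f_fun S i)" "L2_vec (Ivl S i) (hdim i) (h_fun S i)"
    "L2_vec (Ivl S i) (g_dim S i) (g_fun S i)" "L2_vec (Ivl S i) (\<mu> i) (e_fun S i)"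
    "L2_vec (Ivl S i) (hdim i) (hh i)" "L2_vec (Ivl S i) (\<mu> i) (ee i)" "L2_vec (Ivl S i) (d i) (ff i)"
proof -
  note k = kerD[OF i]
  show f: "L2_vec (Ivl S i) (d i) (f_fun S i)"
    using k(1) by (simp add: W12_vec_def Ivl_eq)
  show h: "L2_vec (Ivl S i) (hdim i) (h_fun S i)"
    using L2_vec_append[OF k(2)[unfolded Ivl_eq] f[unfolded Ivl_eq]]
    unfolding h_fun_def[abs_def] h_dim_def Ivl_eq by (simp add: add.commute)
  show "L2_vec (Ivl S i) (g_dim S i) (g_fun S i)"
    using L2_vec_append[OF k(3)[unfolded Ivl_eq] h[unfolded Ivl_eq]]
    unfolding g_fun_def[abs_def] g_dim_def Ivl_eq by (simp add: h_dim_def ac_simps)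
  have G: "\<Gamma> S i * minv (Gram_h S i) \<in> carrier_mat (\<mu> i) (hdim i)"
    using minv_carrier(4)[OF i] by (auto simp: \<Gamma>_def mat_int_def)
  show e: "L2_vec (Ivl S i) (\<mu> i) (e_fun S i)"
    using L2_vec_minus[OF k(3)[unfolded Ivl_eq] L2_vec_mult_mat[OF h[unfolded Ivl_eq] G]]
    unfolding e_fun_def[abs_def] Ivl_eq .
  show "L2_vec (Ivl S i) (hdim i) (hh i)" "L2_vec (Ivl S i) (\<mu> i) (ee i)" "L2_vec (Ivl S i) (d i) (ff i)"
    using L2_vec_mult_mat[OF h[unfolded Ivl_eq] minv_carrier(2)[OF i]]
      L2_vec_mult_mat[OF e[unfolded Ivl_eq] minv_carrier(3)[OF i]]
      L2_vec_mult_mat[OF f[unfolded Ivl_eq] minv_carrier(1)[OF i]]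
    unfolding hh_def[abs_def] ee_def[abs_def] ff_def[abs_def] Ivl_eq .
qed

text \<open>The definition of \<open>e_fun\<close> reads
  \<open>\<phi> = \<Gamma> H\<^sup>-\<^sup>1 h + \<epsilon>\<close>. The matrices \<open>Tm\<close>
  and \<open>Tm_tilde\<close> undo the normalisations and reassemble \<open>g\<close> from this
  decomposition.\<close>

lemma fun_relations:
  assumes i: "i \<in> {1..\<nu>}" and \<tau>: "\<tau> \<in> Ivl S i"
  shows "Lh i *\<^sub>v hh i \<tau> = h_fun S i \<tau>" "Le i *\<^sub>v ee i \<tau> = e_fun S i \<tau>"
    "row_blk [0\<^sub>m (d i) (varphi_dim S i), 1\<^sub>m (d i)] *\<^sub>v h_fun S i \<tau> = f_fun S i \<tau>"
    "g_fun S i \<tau> = Tm S i *\<^sub>v hh i \<tau> + Tm_tilde S i *\<^sub>v ee i \<tau>"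
proof -
  note L = L2_funs[OF i, THEN L2_vecD(1), OF \<tau>] and c = cholD[OF i]
  have v: "dim_vec (varphi_fun S i \<tau>) = varphi_dim S i" "dim_vec (phi_fun S i \<tau>) = \<mu> i"
    using L2_vecD(1)[OF kerD(2)[OF i] \<tau>] L2_vecD(1)[OF kerD(3)[OF i] \<tau>] by auto
  show h: "Lh i *\<^sub>v hh i \<tau> = h_fun S i \<tau>" and e: "Le i *\<^sub>v ee i \<tau> = e_fun S i \<tau>"
    unfolding hh_def ee_def
    by (rule minv_mult_vec(2)[OF c(4,5) carrier_vecI[OF L(2)]], rule minv_mult_vec(2)[OF c(7,8) carrier_vecI[OF L(4)]])
  show "row_blk [0\<^sub>m (d i) (varphi_dim S i), 1\<^sub>m (d i)] *\<^sub>v h_fun S i \<tau> = f_fun S i \<tau>"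
    unfolding h_fun_def using v(1) carrier_vecI[OF L(1)]
    by (subst row_blk2_mult[where k="d i"]) auto
  let ?G = "\<Gamma> S i * minv (Gram_h S i)"
  have G: "?G \<in> carrier_mat (\<mu> i) (hdim i)"
    using minv_carrier(4)[OF i] by (auto simp: \<Gamma>_def mat_int_def)
  have hc: "h_fun S i \<tau> \<in> carrier_vec (hdim i)" and ec: "e_fun S i \<tau> \<in> carrier_vec (\<mu> i)"
    and hhc: "hh i \<tau> \<in> carrier_vec (hdim i)" and eec: "ee i \<tau> \<in> carrier_vec (\<mu> i)"
    using L by (auto intro: carrier_vecI)
  have "Tm S i *\<^sub>v hh i \<tau> = col_blk [?G, 1\<^sub>m (hdim i)] *\<^sub>v h_fun S i \<tau>"
    unfolding Tm_def h[symmetric]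
    by (rule assoc_mult_mat_vec[OF _ c(4) hhc, where ?n\<^sub>1="\<mu> i + hdim i"]) (use G in \<open>auto intro!: col_blk_carrier\<close>)
  also have "\<dots> = (?G *\<^sub>v h_fun S i \<tau>) @\<^sub>v h_fun S i \<tau>"
    using G L(2) hc by (subst col_blk_mult) auto
  finally have 1: "Tm S i *\<^sub>v hh i \<tau> = (?G *\<^sub>v h_fun S i \<tau>) @\<^sub>v h_fun S i \<tau>" .
  have "Tm_tilde S i *\<^sub>v ee i \<tau> = col_blk [1\<^sub>m (\<mu> i), 0\<^sub>m (hdim i) (\<mu> i)] *\<^sub>v e_fun S i \<tau>"
    unfolding Tm_tilde_def e[symmetric]
    by (rule assoc_mult_mat_vec[OF _ c(7) eec, where ?n\<^sub>1="\<mu> i + hdim i"]) (auto intro!: col_blk_carrier)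
  also have "\<dots> = e_fun S i \<tau> @\<^sub>v 0\<^sub>v (hdim i)"
    using L(4) ec by (subst col_blk_mult) auto
  finally have 2: "Tm_tilde S i *\<^sub>v ee i \<tau> = e_fun S i \<tau> @\<^sub>v 0\<^sub>v (hdim i)" .
  show "g_fun S i \<tau> = Tm S i *\<^sub>v hh i \<tau> + Tm_tilde S i *\<^sub>v ee i \<tau>"
    unfolding 1 2 g_fun_def using G L(2,4) v(2)
    by (subst append_vec_add) (auto simp: e_fun_def intro!: arg_cong2[where f="(@\<^sub>v)"] eq_vecI)
qed

text \<open>The last relation holds because \<open>e_fun\<close> is \<open>\<phi>\<close> minus its
  orthogonal projection onto the components of \<open>h\<close>: \<open>\<integral> \<epsilon>
  h\<^sup>T = \<Gamma> - \<Gamma> H\<^sup>-\<^sup>1 H = 0\<close>.\<close>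

lemma orthonormal_hh_ee:
  assumes i: "i \<in> {1..\<nu>}"
  shows "a < hdim i \<Longrightarrow> b < hdim i \<Longrightarrow> (LINT \<tau>|lebesgue_on (Ivl S i). hh i \<tau> $ a * hh i \<tau> $ b) = (if a = b then 1 else 0)"
    and "a < \<mu> i \<Longrightarrow> b < \<mu> i \<Longrightarrow> (LINT \<tau>|lebesgue_on (Ivl S i). ee i \<tau> $ a * ee i \<tau> $ b) = (if a = b then 1 else 0)"
    and "a < d i \<Longrightarrow> b < d i \<Longrightarrow> (LINT \<tau>|lebesgue_on (Ivl S i). ff i \<tau> $ a * ff i \<tau> $ b) = (if a = b then 1 else 0)"
    and "a < hdim i \<Longrightarrow> b < \<mu> i \<Longrightarrow> (LINT \<tau>|lebesgue_on (Ivl S i). hh i \<tau> $ a * ee i \<tau> $ b) = 0"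
proof -
  note L = L2_funs[OF i, unfolded Ivl_eq] and c = cholD[OF i] and m = minv_carrier[OF i]
  show "a < hdim i \<Longrightarrow> b < hdim i \<Longrightarrow> (LINT \<tau>|lebesgue_on (Ivl S i). hh i \<tau> $ a * hh i \<tau> $ b) = (if a = b then 1 else 0)"
    unfolding hh_def Ivl_eq by (rule cholesky_orthonormal[OF L(2) c(4,5) c(6)[unfolded Gram_h_def Ivl_eq]])
  show "a < \<mu> i \<Longrightarrow> b < \<mu> i \<Longrightarrow> (LINT \<tau>|lebesgue_on (Ivl S i). ee i \<tau> $ a * ee i \<tau> $ b) = (if a = b then 1 else 0)"
    unfolding ee_def Ivl_eq by (rule cholesky_orthonormal[OF L(4) c(7,8) c(9)[unfolded Gram_e_def Ivl_eq]])
  show "a < d i \<Longrightarrow> b < d i \<Longrightarrow> (LINT \<tau>|lebesgue_on (Ivl S i). ff i \<tau> $ a * ff i \<tau> $ b) = (if a = b then 1 else 0)"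
    unfolding ff_def Ivl_eq by (rule cholesky_orthonormal[OF L(1) c(1,2) c(3)[unfolded Gram_f_def Ivl_eq]])
  assume a: "a < hdim i" and b: "b < \<mu> i"
  let ?I = "{- r i..- r (i - 1)}" and ?Hi = "minv (Gram_h S i)"
  have phi: "L2_vec ?I (\<mu> i) (phi_fun S i)" using kerD(3)[OF i] by (simp add: Ivl_eq)
  have Gc: "\<Gamma> S i \<in> carrier_mat (\<mu> i) (hdim i)" by (simp add: \<Gamma>_def mat_int_def)
  have GH: "\<Gamma> S i * ?Hi \<in> carrier_mat (\<mu> i) (hdim i)" using Gc m(4) by auto
  let ?u = "row (minv (Lh i)) a" and ?v = "row (minv (Le i)) b"
  \<comment> \<open>Moving \<open>\<Gamma> H\<^sup>-\<^sup>1\<close> to the other side of the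
    pairing turns the projected part into a functional of \<open>h\<close>, to which
    \<open>gram_form\<close> applies.\<close>
  let ?w = "(\<Gamma> S i * ?Hi)\<^sup>T *\<^sub>v ?v"
  have u: "?u \<in> carrier_vec (hdim i)" "dim_vec ?u = hdim i" and v: "?v \<in> carrier_vec (\<mu> i)" "dim_vec ?v = \<mu> i"
    using row_carrier_vec[OF a m(2)] row_carrier_vec[OF b m(3)] m(2,3) by auto
  have w: "?w \<in> carrier_vec (hdim i)"
    using mult_mat_vec_carrier[OF transpose_carrier_mat[THEN iffD2, OF GH] v(1)] .
  note w = carrier_vecD[OF w] w
  have uL: "L2_scalar ?I (\<lambda>\<tau>. ?u \<bullet> h_fun S i \<tau>)" "L2_scalar ?I (\<lambda>\<tau>. ?v \<bullet> phi_fun S i \<tau>)" "L2_scalar ?I (\<lambda>\<tau>. ?w \<bullet> h_fun S i \<tau>)"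
    using L2_scalar_scalar_prod[OF L(2) u(2)] L2_scalar_scalar_prod[OF phi v(2)] L2_scalar_scalar_prod[OF L(2) w(1)] .
  have eq: "hh i \<tau> $ a * ee i \<tau> $ b = (?v \<bullet> phi_fun S i \<tau>) * (?u \<bullet> h_fun S i \<tau>) - (?w \<bullet> h_fun S i \<tau>) * (?u \<bullet> h_fun S i \<tau>)"
    if \<tau>: "\<tau> \<in> ?I" for \<tau>
  proof -
    have h: "h_fun S i \<tau> \<in> carrier_vec (hdim i)" and p: "phi_fun S i \<tau> \<in> carrier_vec (\<mu> i)"
      using L2_vecD(1)[OF L(2) \<tau>] L2_vecD(1)[OF phi \<tau>] by (auto intro: carrier_vecI)
    have "?v \<bullet> e_fun S i \<tau> = ?v \<bullet> phi_fun S i \<tau> - ?v \<bullet> (\<Gamma> S i * ?Hi *\<^sub>v h_fun S i \<tau>)"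
      unfolding e_fun_def by (rule scalar_prod_minus_distrib[OF v(1) p mult_mat_vec_carrier[OF GH h]])
    also have "?v \<bullet> (\<Gamma> S i * ?Hi *\<^sub>v h_fun S i \<tau>) = ?w \<bullet> h_fun S i \<tau>"
      by (rule transpose_vec_mult_scalar[OF GH h v(1), symmetric])
    finally have ve: "?v \<bullet> e_fun S i \<tau> = ?v \<bullet> phi_fun S i \<tau> - ?w \<bullet> h_fun S i \<tau>" .
    have "hh i \<tau> $ a = ?u \<bullet> h_fun S i \<tau>" "ee i \<tau> $ b = ?v \<bullet> e_fun S i \<tau>"
      using a b m(2,3) by (simp_all add: hh_def ee_def)
    then show ?thesis
      unfolding ve by (simp only: left_diff_distrib mult.commute[of "?u \<bullet> h_fun S i \<tau>"])
  qed
  have "(LINT \<tau>|lebesgue_on (Ivl S i). hh i \<tau> $ a * ee i \<tau> $ b) = (LINT \<tau>|lebesgue_on ?I.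
      (?v \<bullet> phi_fun S i \<tau>) * (?u \<bullet> h_fun S i \<tau>) - (?w \<bullet> h_fun S i \<tau>) * (?u \<bullet> h_fun S i \<tau>))"
    unfolding Ivl_eq by (intro Bochner_Integration.integral_cong) (auto simp: eq)
  also have "\<dots> = (LINT \<tau>|lebesgue_on ?I. (?v \<bullet> phi_fun S i \<tau>) * (?u \<bullet> h_fun S i \<tau>))
      - (LINT \<tau>|lebesgue_on ?I. (?w \<bullet> h_fun S i \<tau>) * (?u \<bullet> h_fun S i \<tau>))"
    using uL by (intro Bochner_Integration.integral_diff L2_scalar_mult_integrable)
  also have "(LINT \<tau>|lebesgue_on ?I. (?v \<bullet> phi_fun S i \<tau>) * (?u \<bullet> h_fun S i \<tau>)) = ?v \<bullet> (\<Gamma> S i *\<^sub>v ?u)"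
    using gram_form[OF phi L(2) v(2) u(2)] by (simp add: \<Gamma>_def Ivl_eq)
  also have "(LINT \<tau>|lebesgue_on ?I. (?w \<bullet> h_fun S i \<tau>) * (?u \<bullet> h_fun S i \<tau>)) = ?w \<bullet> (Gram_h S i *\<^sub>v ?u)"
    using gram_form[OF L(2) L(2) w(1) u(2)] by (simp add: Gram_h_def Ivl_eq)
  also have "\<dots> = ?v \<bullet> (\<Gamma> S i * ?Hi *\<^sub>v (Gram_h S i *\<^sub>v ?u))"
    using c(10) u(1) by (intro transpose_vec_mult_scalar[OF GH _ v(1)]) auto
  also have "\<Gamma> S i * ?Hi *\<^sub>v (Gram_h S i *\<^sub>v ?u) = \<Gamma> S i *\<^sub>v ?u"
    using assoc_mult_mat_vec[OF Gc m(4) mult_mat_vec_carrier[OF c(10) u(1)]] minv_mult_vec(1)[OF c(10,11) u(1)]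
    by simp
  finally show "(LINT \<tau>|lebesgue_on (Ivl S i). hh i \<tau> $ a * ee i \<tau> $ b) = 0" by simp
qed

text \<open>Curves live on the whole line. Trajectories are extended to such curves, so that no
  domain conditions accompany the shifts \<open>t + \<tau>\<close>.\<close>

definition curve :: "(real \<Rightarrow> real vec) \<Rightarrow> bool" where
  "curve y \<longleftrightarrow> (\<forall>s. dim_vec (y s) = n) \<and> (\<forall>j<n. continuous_on UNIV (\<lambda>s. y s $ j))"

text \<open>This is \<open>\<integral> (e(\<tau>) \<otimes> I\<^sub>n) y(t + \<tau>)
  d\<tau>\<close>; the integrals in \<vartheta> are the cases \<open>e = hh i\<close> and
  \<open>e = ee i\<close>.\<close>

definition Kv :: "nat \<Rightarrow> nat \<Rightarrow> (real \<Rightarrow> real vec) \<Rightarrow> (real \<Rightarrow> real vec) \<Rightarrow> real \<Rightarrow> real vec" where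
  "Kv i k e y t = vec_int (Ivl S i) (k * n) (\<lambda>\<tau>. vkron (e \<tau>) (y (t + \<tau>)))"

lemma dim_Kv [simp]: "dim_vec (Kv i k e y t) = k * n"
  by (simp add: Kv_def)

lemma curveD: "curve y \<Longrightarrow> dim_vec (y s) = n" "curve y \<Longrightarrow> y s \<in> carrier_vec n"
  "curve y \<Longrightarrow> j < n \<Longrightarrow> continuous_on UNIV (\<lambda>s. y s $ j)"
  by (auto simp: curve_def intro: carrier_vecI)

lemma curve_shift: "curve y \<Longrightarrow> j < n \<Longrightarrow> continuous_on A (\<lambda>\<tau>. y (t + \<tau>) $ j)"
  by (rule continuous_on_compose2[OF curveD(3)]) (auto intro!: continuous_intros)

lemma curve_mult: "curve y \<Longrightarrow> B \<in> carrier_mat n n \<Longrightarrow> curve (\<lambda>s. B *\<^sub>v y s)"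
proof -
  assume y: "curve y" and B: "B \<in> carrier_mat n n"
  have "continuous_on UNIV (\<lambda>s. \<Sum>k<n. B $$ (j, k) * y s $ k)" for j
    by (intro continuous_intros curveD(3)[OF y]) simp
  then show "curve (\<lambda>s. B *\<^sub>v y s)"
    using B by (simp add: curve_def scalar_prod_lessThan curveD(1)[OF y])
qed

lemma Kv_integrable:
  assumes e: "L2_vec (Ivl S i) k e" and y: "curve y" and l: "l < k * n"
  shows "integrable (lebesgue_on (Ivl S i)) (\<lambda>\<tau>. vkron (e \<tau>) (y (t + \<tau>)) $ l)"
proof -
  have "integrable (lebesgue_on {- r i..- r (i - 1)}) (\<lambda>\<tau>. e \<tau> $ (l div n) * y (t + \<tau>) $ (l mod n))"
    using e y l by (intro L2_scalar_mult_integrable L2_vecD(2)[of _ k] continuous_L2_scalar curve_shift)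
      (auto simp: Ivl_eq div_less_of_less_mult mod_less_of_less_mult)
  then show ?thesis
    unfolding Ivl_eq
    by (rule Bochner_Integration.integrable_cong[THEN iffD1, OF refl, rotated])
      (use L2_vecD(1)[OF e] y l in \<open>auto simp: vkron_def Ivl_eq curveD\<close>)
qed

lemma Kv_index:
  assumes e: "L2_vec (Ivl S i) k e" and y: "curve y" and a: "a < k" and j: "j < n"
  shows "Kv i k e y t $ (a * n + j) = (LINT \<tau>|lebesgue_on (Ivl S i). e \<tau> $ a * y (t + \<tau>) $ j)"
  unfolding Kv_def using mult_add_less[OF a j] L2_vecD(1)[OF e] y j
  by (auto simp: vec_int_index vkron_def Ivl_eq curveD intro!: Bochner_Integration.integral_cong)

lemma Kv_mult:
  assumes e: "L2_vec (Ivl S i) k e" and y: "curve y" and A: "A \<in> carrier_mat k' (k * n)"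
  shows "A *\<^sub>v Kv i k e y t = vec_int (Ivl S i) k' (\<lambda>\<tau>. A *\<^sub>v vkron (e \<tau>) (y (t + \<tau>)))"
  unfolding Kv_def Ivl_eq using Kv_integrable[OF e y] L2_vecD(1)[OF e] curveD(1)[OF y]
  by (intro mult_vec_int[OF A]) (auto simp: Ivl_eq)

lemma Kv_left:
  assumes e: "L2_vec (Ivl S i) k e" and y: "curve y" and B: "B \<in> carrier_mat k' k"
  shows "(B \<otimes>\<^sub>k 1\<^sub>m n) *\<^sub>v Kv i k e y t = Kv i k' (\<lambda>\<tau>. B *\<^sub>v e \<tau>) y t"
proof -
  have "B \<otimes>\<^sub>k 1\<^sub>m n \<in> carrier_mat (k' * n) (k * n)" using B by auto
  from Kv_mult[OF e y this] show ?thesis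
    unfolding Kv_def Ivl_eq using B L2_vecD(1)[OF e] curveD(1)[OF y]
    by (auto simp: Ivl_eq kron_mult_vkron one_mult_mat_vec[OF curveD(2)[OF y]] intro!: vec_int_cong)
qed

text \<open>A matrix in the right Kronecker factor passes to the curve. This carries the change of
  variables through the distributed delays.\<close>

lemma Kv_right:
  assumes e: "L2_vec (Ivl S i) k e" and y: "curve y" and B: "B \<in> carrier_mat n n"
  shows "(1\<^sub>m k \<otimes>\<^sub>k B) *\<^sub>v Kv i k e y t = Kv i k e (\<lambda>s. B *\<^sub>v y s) t"
proof -
  have "1\<^sub>m k \<otimes>\<^sub>k B \<in> carrier_mat (k * n) (k * n)" using B by auto
  from Kv_mult[OF e y this] show ?thesis
    unfolding Kv_def Ivl_eq using B L2_vecD(1)[OF e] curveD(1)[OF y]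
    by (auto simp: Ivl_eq kron_mult_vkron one_mult_mat_vec[OF carrier_vecI] intro!: vec_int_cong)
qed

lemma Kv_cong: "(\<And>\<tau>. \<tau> \<in> Ivl S i \<Longrightarrow> e \<tau> = e' \<tau>) \<Longrightarrow> (\<And>\<tau>. \<tau> \<in> Ivl S i \<Longrightarrow> y (t + \<tau>) = y' (t' + \<tau>)) \<Longrightarrow>
    Kv i k e y t = Kv i k e' y' t'"
  unfolding Kv_def Ivl_eq by (intro vec_int_cong) auto

abbreviation "curve_stack y t w \<equiv> stack (\<lambda>i. y (t - r i)) (\<lambda>i. Kv i (hdim i) (hh i) y t) (\<lambda>i. Kv i (\<mu> i) (ee i) y t) w"

lemma curve_stack_dims:
  "curve y \<Longrightarrow> dim_vec w = q \<Longrightarrow>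
    stack_dims (\<lambda>i. y (t - r i)) (\<lambda>i. Kv i (hdim i) (hh i) y t) (\<lambda>i. Kv i (\<mu> i) (ee i) y t) w"
  by (simp add: stack_dims_def curveD)

lemma Kv_g:
  assumes i: "i \<in> {1..\<nu>}" and y: "curve y"
  shows "Kv i (g_dim S i) (g_fun S i) y t = (Tm S i \<otimes>\<^sub>k 1\<^sub>m n) *\<^sub>v Kv i (hdim i) (hh i) y t
    + (Tm_tilde S i \<otimes>\<^sub>k 1\<^sub>m n) *\<^sub>v Kv i (\<mu> i) (ee i) y t"
proof -
  note L = L2_funs[OF i] and T = Tm_carrier[OF i]
  have 1: "L2_vec (Ivl S i) (g_dim S i) (\<lambda>\<tau>. Tm S i *\<^sub>v hh i \<tau>)" "L2_vec (Ivl S i) (g_dim S i) (\<lambda>\<tau>. Tm_tilde S i *\<^sub>v ee i \<tau>)"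
    using L2_vec_mult_mat[OF L(5)[unfolded Ivl_eq] T(1)] L2_vec_mult_mat[OF L(6)[unfolded Ivl_eq] T(2)]
    by (simp_all add: Ivl_eq)
  have add: "vkron (u + u') v = vkron u v + vkron u' v" if "dim_vec u = dim_vec u'" for u u' v
    using that by (intro eq_vecI) (auto simp: vkron_def div_less_of_less_mult distrib_right)
  show ?thesis
    unfolding Kv_left[OF L(5) y T(1)] Kv_left[OF L(6) y T(2)] unfolding Kv_def Ivl_eq
    using Kv_integrable[OF 1(1) y] Kv_integrable[OF 1(2) y] L2_vecD(1)[OF 1(1)] L2_vecD(1)[OF 1(2)] curveD(1)[OF y]
    by (subst vec_int_add) (auto simp: Ivl_eq fun_relations(4)[OF i] add intro!: vec_int_cong)
qed

lemma kernel_mult: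
  assumes i: "i \<in> {1..\<nu>}" and y: "curve y" and G: "G \<in> carrier_mat k (g_dim S i * n)" and \<tau>: "\<tau> \<in> Ivl S i"
  shows "G * (col_mat (g_fun S i \<tau>) \<otimes>\<^sub>k 1\<^sub>m n) *\<^sub>v y (t + \<tau>) = G *\<^sub>v vkron (g_fun S i \<tau>) (y (t + \<tau>))"
proof -
  have "col_mat (g_fun S i \<tau>) \<otimes>\<^sub>k 1\<^sub>m n \<in> carrier_mat (g_dim S i * n) n"
    using L2_vecD(1)[OF L2_funs(3)[OF i] \<tau>] by (intro carrier_matI) simp_all
  from assoc_mult_mat_vec[OF G this curveD(2)[OF y]] show ?thesis
    using curveD(1)[OF y] by (simp add: kron_col_mat_one)
qed

lemma vec_int_kernel:
  assumes i: "i \<in> {1..\<nu>}" and y: "curve y" and G: "G \<in> carrier_mat k (g_dim S i * n)"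
  shows "vec_int (Ivl S i) k (\<lambda>\<tau>. G * (col_mat (g_fun S i \<tau>) \<otimes>\<^sub>k 1\<^sub>m n) *\<^sub>v y (t + \<tau>)) = G *\<^sub>v Kv i (g_dim S i) (g_fun S i) y t"
  unfolding Kv_mult[OF L2_funs(3)[OF i] y G] unfolding Ivl_eq
  by (rule vec_int_cong) (rule kernel_mult[OF i y G], simp add: Ivl_eq)

text \<open>The kernel decomposition holds only almost everywhere, which suffices under the
  integral. The measurability that this requires comes from the square integrability of
  \<open>A\<close> and of \<open>g_fun\<close>.\<close>

lemma vec_int_kernel_AE:
  assumes i: "i \<in> {1..\<nu>}" and y: "curve y" and G: "G \<in> carrier_mat k (g_dim S i * n)"
    and ker: "L2_mat (Ivl S i) k n A" and ae: "AE \<tau> in lebesgue_on (Ivl S i). A \<tau> = G * (col_mat (g_fun S i \<tau>) \<otimes>\<^sub>k 1\<^sub>m n)"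
  shows "vec_int (Ivl S i) k (\<lambda>\<tau>. A \<tau> *\<^sub>v y (t + \<tau>)) = G *\<^sub>v Kv i (g_dim S i) (g_fun S i) y t"
proof (rule eq_vecI)
  note L = L2_funs(3)[OF i]
  fix j assume "j < dim_vec (G *\<^sub>v Kv i (g_dim S i) (g_fun S i) y t)"
  then have j: "j < k" using G by simp
  have dg: "dim_vec (vkron (g_fun S i \<tau>) (y (t + \<tau>))) = g_dim S i * n" if "\<tau> \<in> {- r i..- r (i - 1)}" for \<tau>
    using L2_vecD(1)[OF L] that by (simp add: Ivl_eq curveD(1)[OF y])
  have Am: "\<And>l. l < n \<Longrightarrow> (\<lambda>\<tau>. A \<tau> $$ (j, l)) \<in> borel_measurable (lebesgue_on (Ivl S i))"
    and Ac: "\<And>\<tau>. \<tau> \<in> Ivl S i \<Longrightarrow> A \<tau> \<in> carrier_mat k n"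
    using ker j by (auto simp: L2_mat_def L2_scalar_def)
  have "(LINT \<tau>|lebesgue_on (Ivl S i). (A \<tau> *\<^sub>v y (t + \<tau>)) $ j)
      = (LINT \<tau>|lebesgue_on (Ivl S i). (G *\<^sub>v vkron (g_fun S i \<tau>) (y (t + \<tau>))) $ j)"
  proof (rule integral_cong_AE)
    have "(\<lambda>\<tau>. \<Sum>l<n. A \<tau> $$ (j, l) * y (t + \<tau>) $ l) \<in> borel_measurable (lebesgue_on (Ivl S i))"
    proof (intro borel_measurable_sum borel_measurable_times)
      fix l assume l: "l \<in> {..<n}"
      then show "(\<lambda>\<tau>. A \<tau> $$ (j, l)) \<in> borel_measurable (lebesgue_on (Ivl S i))" using Am by simp
      show "(\<lambda>\<tau>. y (t + \<tau>) $ l) \<in> borel_measurable (lebesgue_on (Ivl S i))"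
        using l unfolding Ivl_eq by (intro continuous_imp_measurable_on_sets_lebesgue curve_shift[OF y]) simp_all
    qed
    then show "(\<lambda>\<tau>. (A \<tau> *\<^sub>v y (t + \<tau>)) $ j) \<in> borel_measurable (lebesgue_on (Ivl S i))"
      by (rule measurable_cong[THEN iffD1, rotated])
        (use carrier_matD[OF Ac] j curveD(1)[OF y] in \<open>auto simp: Ivl_eq scalar_prod_lessThan intro!: sum.cong\<close>)
    have "(\<lambda>\<tau>. \<Sum>l<g_dim S i * n. G $$ (j, l) * vkron (g_fun S i \<tau>) (y (t + \<tau>)) $ l) \<in> borel_measurable (lebesgue_on (Ivl S i))"
      by (intro borel_measurable_sum borel_measurable_times borel_measurable_const borel_measurable_integrable Kv_integrable[OF L y]) simp
    then show "(\<lambda>\<tau>. (G *\<^sub>v vkron (g_fun S i \<tau>) (y (t + \<tau>))) $ j) \<in> borel_measurable (lebesgue_on (Ivl S i))"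
      by (rule measurable_cong[THEN iffD1, rotated])
        (use G j dg in \<open>auto simp del: dim_vkron simp: Ivl_eq scalar_prod_lessThan intro!: sum.cong\<close>)
    show "AE \<tau> in lebesgue_on (Ivl S i). (A \<tau> *\<^sub>v y (t + \<tau>)) $ j = (G *\<^sub>v vkron (g_fun S i \<tau>) (y (t + \<tau>))) $ j"
      using ae AE_space
    proof eventually_elim
      case (elim \<tau>)
      then have "\<tau> \<in> Ivl S i" by (simp add: Ivl_eq)
      from kernel_mult[OF i y G this] elim(1) show ?case by simp
    qed
  qed
  then show "vec_int (Ivl S i) k (\<lambda>\<tau>. A \<tau> *\<^sub>v y (t + \<tau>)) $ j = (G *\<^sub>v Kv i (g_dim S i) (g_fun S i) y t) $ j"
    unfolding Kv_mult[OF L y G] using j by (simp add: vec_int_index)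
qed (use G in simp)

text \<open>The identity for the distributed part is a premise, since plant kernels satisfy it
  through an almost-everywhere equation and controller kernels by their definition.\<close>

lemma delay_term_stack:
  assumes y: "curve y" and w: "w \<in> carrier_vec q"
    and F: "\<And>i. i \<in> {0..\<nu>} \<Longrightarrow> F i \<in> carrier_mat k n"
    and G: "\<And>i. i \<in> {1..\<nu>} \<Longrightarrow> G i \<in> carrier_mat k (g_dim S i * n)" and D: "D \<in> carrier_mat k q"
    and int: "\<And>i. i \<in> {1..\<nu>} \<Longrightarrow> vec_int (Ivl S i) k (\<lambda>\<tau>. Gk i \<tau> *\<^sub>v y (t + \<tau>)) = G i *\<^sub>v Kv i (g_dim S i) (g_fun S i) y t"
  shows "delay_term S k F Gk y t + D *\<^sub>v w = aug_row S F G D *\<^sub>v curve_stack y t w"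
proof (rule eq_vecI)
  have sd: "stack_dims (\<lambda>i. y (t - r i)) (\<lambda>i. Kv i (hdim i) (hh i) y t) (\<lambda>i. Kv i (\<mu> i) (ee i) y t) w"
    using y w by (intro curve_stack_dims) auto
  have Fc: "(\<lambda>i. F i *\<^sub>v y (t - r i)) \<in> {0..\<nu>} \<rightarrow> carrier_vec k"
    using F curveD(2)[OF y] by (intro Pi_I) (meson mult_mat_vec_carrier)
  have Gc: "(\<lambda>i. vec_int (Ivl S i) k (\<lambda>\<tau>. Gk i \<tau> *\<^sub>v y (t + \<tau>))) \<in> {1..\<nu>} \<rightarrow> carrier_vec k"
    by (auto intro: carrier_vecI)
  have ac: "aug_row S F G D \<in> carrier_mat k (\<beta> S * n + q)"
    by (rule aug_row_form(1)[OF sd F G D])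
  have dc: "delay_term S k F Gk y t \<in> carrier_vec k"
    unfolding delay_term_def by (intro add_carrier_vec finsum_vec_closed Fc Gc)
  show "dim_vec (delay_term S k F Gk y t + D *\<^sub>v w) = dim_vec (aug_row S F G D *\<^sub>v curve_stack y t w)"
    using ac D by simp
  fix j assume "j < dim_vec (aug_row S F G D *\<^sub>v curve_stack y t w)"
  then have j: "j < k" using ac by simp
  have u: "unit_vec k j \<bullet> v = v $ j" if "v \<in> carrier_vec k" for v :: "real vec"
    using that j by (simp add: scalar_prod_left_unit)
  have "(aug_row S F G D *\<^sub>v curve_stack y t w) $ j = unit_vec k j \<bullet> (aug_row S F G D *\<^sub>v curve_stack y t w)"
    using ac by (intro u[symmetric] mult_mat_vec_carrier[OF ac stack_carrier[OF sd]])
  also have "\<dots> = (\<Sum>i=0..\<nu>. (F i *\<^sub>v y (t - r i)) $ j)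
      + (\<Sum>i=1..\<nu>. (G i *\<^sub>v Kv i (g_dim S i) (g_fun S i) y t) $ j) + (D *\<^sub>v w) $ j"
  proof -
    have "(\<Sum>i=0..\<nu>. unit_vec k j \<bullet> (F i *\<^sub>v y (t - r i))) = (\<Sum>i=0..\<nu>. (F i *\<^sub>v y (t - r i)) $ j)"
      using Fc by (intro sum.cong refl u) auto
    moreover have "(\<Sum>i=1..\<nu>. unit_vec k j \<bullet> (G i *\<^sub>v Kv i (g_dim S i) (g_fun S i) y t))
        = (\<Sum>i=1..\<nu>. (G i *\<^sub>v Kv i (g_dim S i) (g_fun S i) y t) $ j)"
      using G by (intro sum.cong refl u mult_mat_vec_carrier[OF G] carrier_vecI dim_Kv)
    moreover have "unit_vec k j \<bullet> (D *\<^sub>v w) = (D *\<^sub>v w) $ j"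
      by (rule u[OF mult_mat_vec_carrier[OF D w]])
    moreover have "unit_vec k j \<bullet> (aug_row S F G D *\<^sub>v curve_stack y t w) =
      (\<Sum>i=0..\<nu>. unit_vec k j \<bullet> (F i *\<^sub>v y (t - r i)))
      + (\<Sum>i=1..\<nu>. unit_vec k j \<bullet> (G i *\<^sub>v Kv i (g_dim S i) (g_fun S i) y t)) + unit_vec k j \<bullet> (D *\<^sub>v w)"
      using aug_row_form(2)[of _ _ _ w F k G D "unit_vec k j", OF sd F G D unit_vec_carrier] by (simp add: Kv_g[OF _ y])
    ultimately show ?thesis by simp
  qed
  also have "\<dots> = (delay_term S k F Gk y t + D *\<^sub>v w) $ j"
  proof -
    have 1: "(\<Sum>i=1..\<nu>. (G i *\<^sub>v Kv i (g_dim S i) (g_fun S i) y t) $ j)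
        = finsum_vec TYPE(real) k (\<lambda>i. vec_int (Ivl S i) k (\<lambda>\<tau>. Gk i \<tau> *\<^sub>v y (t + \<tau>))) {1..\<nu>} $ j"
      using int by (subst index_finsum_vec[OF _ j Gc]) auto
    have 2: "(\<Sum>i=0..\<nu>. (F i *\<^sub>v y (t - r i)) $ j) = finsum_vec TYPE(real) k (\<lambda>i. F i *\<^sub>v y (t - r i)) {0..\<nu>} $ j"
      by (subst index_finsum_vec[OF _ j Fc]) auto
    have "dim_vec (finsum_vec TYPE(real) k (\<lambda>i. vec_int (Ivl S i) k (\<lambda>\<tau>. Gk i \<tau> *\<^sub>v y (t + \<tau>))) {1..\<nu>}) = k"
      using finsum_vec_closed[OF Gc] by (rule carrier_vecD)
    then show ?thesis
      unfolding delay_term_def 1 2 using j D by simp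
  qed
  finally show "(delay_term S k F Gk y t + D *\<^sub>v w) $ j = (aug_row S F G D *\<^sub>v curve_stack y t w) $ j" ..
qed

end

section \<open>The storage functional along a curve\<close>

text \<open>Coordinatewise derivative at one time. The length is fixed for all times, because scalar
  products are expanded in coordinates at neighbouring times as well.\<close>

definition vderiv :: "nat \<Rightarrow> (real \<Rightarrow> real vec) \<Rightarrow> real vec \<Rightarrow> real \<Rightarrow> bool" where
  "vderiv k u u' t \<longleftrightarrow> (\<forall>s. dim_vec (u s) = k) \<and> dim_vec u' = k \<and>
    (\<forall>j<k. ((\<lambda>s. u s $ j) has_real_derivative u' $ j) (at t))"

lemma vderiv_append:
  assumes "vderiv k u u' t" "vderiv l v v' t"
  shows "vderiv (k + l) (\<lambda>s. u s @\<^sub>v v s) (u' @\<^sub>v v') t"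
  unfolding vderiv_def
proof (intro conjI allI impI)
  fix j assume j: "j < k + l"
  show "((\<lambda>s. (u s @\<^sub>v v s) $ j) has_real_derivative (u' @\<^sub>v v') $ j) (at t)"
    using assms j by (cases "j < k") (auto simp: vderiv_def)
qed (use assms in \<open>auto simp: vderiv_def\<close>)

lemma vderiv_vcat:
  "(\<And>i. i \<in> set is \<Longrightarrow> vderiv (k i) (u i) (u' i) t) \<Longrightarrow>
    vderiv (sum_list (map k is)) (\<lambda>s. vcat (map (\<lambda>i. u i s) is)) (vcat (map u' is)) t"
  by (induction "is") (auto intro!: vderiv_append simp: vderiv_def[of 0])

lemma vderiv_form:
  assumes u: "vderiv k u u' t" and v: "vderiv l v v' t" and M: "M \<in> carrier_mat k l"
  shows "((\<lambda>s. u s \<bullet> (M *\<^sub>v v s)) has_real_derivative u' \<bullet> (M *\<^sub>v v t) + u t \<bullet> (M *\<^sub>v v')) (at t)"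
proof -
  have d: "dim_vec (u s) = k" "dim_vec (v s) = l" "dim_vec u' = k" "dim_vec v' = l" for s
    using u v by (auto simp: vderiv_def)
  have "((\<lambda>s. \<Sum>i<k. \<Sum>j<l. M $$ (i, j) * (u s $ i * v s $ j)) has_real_derivative
      (\<Sum>i<k. \<Sum>j<l. M $$ (i, j) * (u' $ i * v t $ j + v' $ j * u t $ i))) (at t)"
    using u v by (intro DERIV_sum DERIV_cmult DERIV_mult) (auto simp: vderiv_def)
  moreover have "(\<Sum>i<k. \<Sum>j<l. M $$ (i, j) * (u' $ i * v t $ j + v' $ j * u t $ i))
      = u' \<bullet> (M *\<^sub>v v t) + u t \<bullet> (M *\<^sub>v v')"
    by (simp add: scalar_prod_mult_mat[OF M] d distrib_left sum.distrib ac_simps)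
  ultimately show ?thesis
    by (simp add: scalar_prod_mult_mat[OF M] d)
qed

definition vac :: "real \<Rightarrow> real \<Rightarrow> nat \<Rightarrow> (real \<Rightarrow> real vec) \<Rightarrow> bool" where
  "vac t0 t1 k u \<longleftrightarrow> (\<forall>s. dim_vec (u s) = k) \<and> (\<forall>j<k. abs_cont_on t0 t1 (\<lambda>s. u s $ j))"

lemma vac_append:
  assumes "vac t0 t1 k u" "vac t0 t1 l v"
  shows "vac t0 t1 (k + l) (\<lambda>s. u s @\<^sub>v v s)"
  unfolding vac_def
proof (intro conjI allI impI)
  fix j assume j: "j < k + l"
  show "abs_cont_on t0 t1 (\<lambda>s. (u s @\<^sub>v v s) $ j)"
    using assms j by (cases "j < k") (auto simp: vac_def)
qed (use assms in \<open>auto simp: vac_def\<close>)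

lemma vac_vcat:
  "(\<And>i. i \<in> set is \<Longrightarrow> vac t0 t1 (k i) (u i)) \<Longrightarrow>
    vac t0 t1 (sum_list (map k is)) (\<lambda>s. vcat (map (\<lambda>i. u i s) is))"
  by (induction "is") (auto intro!: vac_append simp: vac_def[of _ _ 0])

lemma vac_form:
  assumes u: "vac t0 t1 k u" and v: "vac t0 t1 l v" and M: "M \<in> carrier_mat k l"
  shows "abs_cont_on t0 t1 (\<lambda>s. u s \<bullet> (M *\<^sub>v v s))"
proof -
  have d: "dim_vec (u s) = k" "dim_vec (v s) = l" for s
    using u v by (auto simp: vac_def)
  have "abs_cont_on t0 t1 (\<lambda>s. \<Sum>i<k. \<Sum>j<l. M $$ (i, j) * (u s $ i * v s $ j))"
    using u v by (intro abs_cont_on_sum abs_cont_on_cmult abs_cont_on_mult) (auto simp: vac_def)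
  then show ?thesis by (simp add: scalar_prod_mult_mat[OF M] d)
qed

lemma weak_deriv_cong:
  assumes "\<And>t. t \<in> {a..b} \<Longrightarrow> F t = F' t" "\<And>t. t \<in> {a..b} \<Longrightarrow> G t = G' t" "weak_deriv a b F G"
  shows "weak_deriv a b F' G'"
proof -
  have "(LINT t|lebesgue_on {a..b}. F' t * h t) = (LINT t|lebesgue_on {a..b}. F t * h t)"
    "(LINT t|lebesgue_on {a..b}. G' t * h t) = (LINT t|lebesgue_on {a..b}. G t * h t)" for h :: "real \<Rightarrow> real"
    using assms(1,2) by (auto intro!: Bochner_Integration.integral_cong)
  then show ?thesis using assms(3) by (simp add: weak_deriv_def)
qed

section \<open>Bessel bounds and derivatives of the integral terms\<close>

context delay_system begin

text \<open>Since \<open>hh i\<close> and \<open>ee i\<close> are jointly orthonormal, a single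
  integral of the \<open>R\<close>-form bounds both contributions at once; the families are indexed
  together by a disjoint sum. The estimate for \<open>ff i\<close> serves the two-sided bounds of
  the functional.\<close>

lemma bessel_HE:
  assumes i: "i \<in> {1..\<nu>}" and y: "curve y" and R: "R \<in> carrier_mat n n"
    and psd: "\<And>v. v \<in> carrier_vec n \<Longrightarrow> v \<bullet> (R *\<^sub>v v) \<ge> 0"
  shows "Kv i (hdim i) (hh i) y t \<bullet> ((1\<^sub>m (hdim i) \<otimes>\<^sub>k R) *\<^sub>v Kv i (hdim i) (hh i) y t)
      + Kv i (\<mu> i) (ee i) y t \<bullet> ((1\<^sub>m (\<mu> i) \<otimes>\<^sub>k R) *\<^sub>v Kv i (\<mu> i) (ee i) y t)
    \<le> (LINT \<tau>|lebesgue_on (Ivl S i). y (t + \<tau>) \<bullet> (R *\<^sub>v y (t + \<tau>)))"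
    and "Kv i (d i) (ff i) y t \<bullet> ((1\<^sub>m (d i) \<otimes>\<^sub>k R) *\<^sub>v Kv i (d i) (ff i) y t)
    \<le> (LINT \<tau>|lebesgue_on (Ivl S i). y (t + \<tau>) \<bullet> (R *\<^sub>v y (t + \<tau>)))"
proof -
  note L = L2_funs[OF i]
  have x: "L2_vec {- r i..- r (i - 1)} n (\<lambda>\<tau>. y (t + \<tau>))"
    unfolding L2_vec_def using curveD(2)[OF y] by (auto intro!: continuous_L2_scalar curve_shift[OF y])
  let ?e = "case_sum (\<lambda>a \<tau>. hh i \<tau> $ a) (\<lambda>a \<tau>. ee i \<tau> $ a)"
  let ?p = "\<lambda>k. vec n (\<lambda>j. LINT \<tau>|lebesgue_on {- r i..- r (i - 1)}. ?e k \<tau> * y (t + \<tau>) $ j)"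
  have b: "(\<Sum>k\<in>{..<hdim i} <+> {..<\<mu> i}. ?p k \<bullet> (R *\<^sub>v ?p k)) \<le> (LINT \<tau>|lebesgue_on {- r i..- r (i - 1)}. y (t + \<tau>) \<bullet> (R *\<^sub>v y (t + \<tau>)))"
  proof (rule bessel_form[OF _ _ _ x R psd])
    show "L2_scalar {- r i..- r (i - 1)} (?e k)" if "k \<in> {..<hdim i} <+> {..<\<mu> i}" for k
      using that L2_vecD(2)[OF L(5)] L2_vecD(2)[OF L(6)] by (auto simp: Ivl_eq)
    show "(LINT \<tau>|lebesgue_on {- r i..- r (i - 1)}. ?e k \<tau> * ?e l \<tau>) = (if k = l then 1 else 0)"
      if "k \<in> {..<hdim i} <+> {..<\<mu> i}" "l \<in> {..<hdim i} <+> {..<\<mu> i}" for k l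
    proof (cases k; cases l)
      fix a b assume "k = Inr a" "l = Inl b"
      moreover from this that have "b < hdim i" "a < \<mu> i" by auto
      ultimately show ?thesis using orthonormal_hh_ee(4)[OF i, of b a] by (simp add: Ivl_eq mult.commute)
    qed (use that orthonormal_hh_ee(1,2,4)[OF i] in \<open>auto simp: Ivl_eq\<close>)
  qed auto
  have "(\<Sum>k\<in>{..<hdim i} <+> {..<\<mu> i}. ?p k \<bullet> (R *\<^sub>v ?p k))
      = (\<Sum>a<hdim i. ?p (Inl a) \<bullet> (R *\<^sub>v ?p (Inl a))) + (\<Sum>a<\<mu> i. ?p (Inr a) \<bullet> (R *\<^sub>v ?p (Inr a)))"
    by (subst sum.Plus) auto
  moreover have "?p (Inl a) = vec n (\<lambda>j. Kv i (hdim i) (hh i) y t $ (a * n + j))" if "a < hdim i" for a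
    using that by (auto simp: Kv_index[OF L(5) y] Ivl_eq intro!: eq_vecI)
  moreover have "?p (Inr a) = vec n (\<lambda>j. Kv i (\<mu> i) (ee i) y t $ (a * n + j))" if "a < \<mu> i" for a
    using that by (auto simp: Kv_index[OF L(6) y] Ivl_eq intro!: eq_vecI)
  ultimately show "Kv i (hdim i) (hh i) y t \<bullet> ((1\<^sub>m (hdim i) \<otimes>\<^sub>k R) *\<^sub>v Kv i (hdim i) (hh i) y t)
      + Kv i (\<mu> i) (ee i) y t \<bullet> ((1\<^sub>m (\<mu> i) \<otimes>\<^sub>k R) *\<^sub>v Kv i (\<mu> i) (ee i) y t)
    \<le> (LINT \<tau>|lebesgue_on (Ivl S i). y (t + \<tau>) \<bullet> (R *\<^sub>v y (t + \<tau>)))"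
    using b unfolding kron_one_form[OF dim_Kv R] Ivl_eq by simp
  let ?p = "\<lambda>k. vec n (\<lambda>j. LINT \<tau>|lebesgue_on {- r i..- r (i - 1)}. ff i \<tau> $ k * y (t + \<tau>) $ j)"
  have b: "(\<Sum>k\<in>{..<d i}. ?p k \<bullet> (R *\<^sub>v ?p k)) \<le> (LINT \<tau>|lebesgue_on {- r i..- r (i - 1)}. y (t + \<tau>) \<bullet> (R *\<^sub>v y (t + \<tau>)))"
    by (rule bessel_form[OF _ _ _ x R psd])
      (use L2_vecD(2)[OF L(7)] orthonormal_hh_ee(3)[OF i] in \<open>auto simp: Ivl_eq\<close>)
  moreover have "?p a = vec n (\<lambda>j. Kv i (d i) (ff i) y t $ (a * n + j))" if "a < d i" for a
    using that by (auto simp: Kv_index[OF L(7) y] Ivl_eq intro!: eq_vecI)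
  ultimately show "Kv i (d i) (ff i) y t \<bullet> ((1\<^sub>m (d i) \<otimes>\<^sub>k R) *\<^sub>v Kv i (d i) (ff i) y t)
    \<le> (LINT \<tau>|lebesgue_on (Ivl S i). y (t + \<tau>) \<bullet> (R *\<^sub>v y (t + \<tau>)))"
    unfolding kron_one_form[OF dim_Kv R] Ivl_eq by simp
qed

lemma ff_weak_deriv:
  assumes i: "i \<in> {1..\<nu>}" and a: "a < d i"
  shows "weak_deriv (- r i) (- r (i - 1)) (\<lambda>\<tau>. ff i \<tau> $ a) (\<lambda>\<tau>. (minv (Lf i) * M_mat S i *\<^sub>v h_fun S i \<tau>) $ a)"
    and "continuous_on {- r i..- r (i - 1)} (\<lambda>\<tau>. ff i \<tau> $ a)"
    and "L2_vec (Ivl S i) (d i) (\<lambda>\<tau>. minv (Lf i) * M_mat S i *\<^sub>v h_fun S i \<tau>)"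
proof -
  note L = L2_funs[OF i, unfolded Ivl_eq] and k = kerD[OF i] and m = minv_carrier(1)[OF i]
  let ?I = "{- r i..- r (i - 1)}"
  have LM: "minv (Lf i) * M_mat S i \<in> carrier_mat (d i) (hdim i)" using m k(4) by auto
  show 3: "L2_vec (Ivl S i) (d i) (\<lambda>\<tau>. minv (Lf i) * M_mat S i *\<^sub>v h_fun S i \<tau>)"
    unfolding Ivl_eq by (rule L2_vec_mult_mat[OF L(2) LM])
  have Mh: "L2_vec ?I (d i) (\<lambda>\<tau>. M_mat S i *\<^sub>v h_fun S i \<tau>)" by (rule L2_vec_mult_mat[OF L(2) k(4)])
  have f: "ff i \<tau> $ a = (\<Sum>c<d i. minv (Lf i) $$ (a, c) * f_fun S i \<tau> $ c)" if "\<tau> \<in> ?I" for \<tau>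
    using a m L2_vecD(1)[OF L(1) that] by (simp add: ff_def scalar_prod_lessThan)
  have g: "(minv (Lf i) * M_mat S i *\<^sub>v h_fun S i \<tau>) $ a = (\<Sum>c<d i. minv (Lf i) $$ (a, c) * (M_mat S i *\<^sub>v h_fun S i \<tau>) $ c)"
    if "\<tau> \<in> ?I" for \<tau>
  proof -
    have "minv (Lf i) * M_mat S i *\<^sub>v h_fun S i \<tau> = minv (Lf i) *\<^sub>v (M_mat S i *\<^sub>v h_fun S i \<tau>)"
      using L2_vecD(1)[OF L(2) that] by (intro assoc_mult_mat_vec[OF m k(4)] carrier_vecI)
    then show ?thesis using a m k(4) by (simp add: scalar_prod_lessThan)
  qed
  have "weak_deriv (- r i) (- r (i - 1)) (\<lambda>\<tau>. f_fun S i \<tau> $ c) (\<lambda>\<tau>. (M_mat S i *\<^sub>v h_fun S i \<tau>) $ c)" if "c < d i" for c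
    using k(5) that by (simp add: weak_deriv_vec_def)
  then have "weak_deriv (- r i) (- r (i - 1)) (\<lambda>\<tau>. \<Sum>c<d i. minv (Lf i) $$ (a, c) * f_fun S i \<tau> $ c)
      (\<lambda>\<tau>. \<Sum>c<d i. minv (Lf i) $$ (a, c) * (M_mat S i *\<^sub>v h_fun S i \<tau>) $ c)"
    by (intro weak_deriv_sum L2_scalar_integrable L2_vecD(2)[OF L(1)] L2_vecD(2)[OF Mh]) auto
  then show "weak_deriv (- r i) (- r (i - 1)) (\<lambda>\<tau>. ff i \<tau> $ a) (\<lambda>\<tau>. (minv (Lf i) * M_mat S i *\<^sub>v h_fun S i \<tau>) $ a)"
    by (rule weak_deriv_cong[rotated 2]) (simp_all only: f g)
  have "continuous_on ?I (\<lambda>\<tau>. \<Sum>c<d i. minv (Lf i) $$ (a, c) * f_fun S i \<tau> $ c)"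
    using k(1) by (intro continuous_intros) (auto simp: W12_vec_def)
  then show "continuous_on ?I (\<lambda>\<tau>. ff i \<tau> $ a)"
    by (rule continuous_on_eq) (simp only: f)
qed

text \<open>Each coordinate is an instance of \<open>weak_deriv_shift\<close>. The remaining
  integral has the kernel \<open>L\<^sub>f\<^sup>-\<^sup>1 M h\<close>, and
  \<open>h = L\<^sub>h hh\<close> expresses it through the integrals that occur in
  \<vartheta>.\<close>

lemma Kv_ff_deriv:
  assumes i: "i \<in> {1..\<nu>}" and y: "curve y"
  shows "vderiv (d i * n) (Kv i (d i) (ff i) y) (vkron (ff i (- r (i - 1))) (y (t - r (i - 1)))
      - vkron (ff i (- r i)) (y (t - r i))
      - ((minv (Lf i) * M_mat S i * Lh i) \<otimes>\<^sub>k 1\<^sub>m n) *\<^sub>v Kv i (hdim i) (hh i) y t) t"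
    and "vac t0 t1 (d i * n) (Kv i (d i) (ff i) y)"
proof -
  note L = L2_funs[OF i] and m = minv_carrier(1)[OF i] and k = kerD[OF i]
  let ?g = "\<lambda>\<tau>. minv (Lf i) * M_mat S i *\<^sub>v h_fun S i \<tau>"
  have lessn: "l mod n < n" "l div n < d i" "l = l div n * n + l mod n" if "l < d i * n" for l
    using that by (auto simp: div_less_of_less_mult mod_less_of_less_mult)
  have LM: "minv (Lf i) * M_mat S i * Lh i \<in> carrier_mat (d i) (hdim i)" "minv (Lf i) * M_mat S i \<in> carrier_mat (d i) (hdim i)"
    using m k(4) cholD(4)[OF i] by auto
  have K: "((minv (Lf i) * M_mat S i * Lh i) \<otimes>\<^sub>k 1\<^sub>m n) *\<^sub>v Kv i (hdim i) (hh i) y t = Kv i (d i) ?g y t"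
    unfolding Kv_left[OF L(5) y LM(1)]
  proof (rule Kv_cong)
    fix \<tau> assume "\<tau> \<in> Ivl S i"
    then show "minv (Lf i) * M_mat S i * Lh i *\<^sub>v hh i \<tau> = ?g \<tau>"
      using assoc_mult_mat_vec[OF LM(2) cholD(4)[OF i] carrier_vecI[OF L2_vecD(1)[OF L(5)]]] fun_relations(1)[OF i]
      by simp
  qed simp
  have dff: "dim_vec (ff i \<tau>) = d i" if "\<tau> \<in> Ivl S i" for \<tau> using L2_vecD(1)[OF L(7) that] .
  note ends = endpoint_in[OF i]
  show "vderiv (d i * n) (Kv i (d i) (ff i) y) (vkron (ff i (- r (i - 1))) (y (t - r (i - 1)))
      - vkron (ff i (- r i)) (y (t - r i))
      - ((minv (Lf i) * M_mat S i * Lh i) \<otimes>\<^sub>k 1\<^sub>m n) *\<^sub>v Kv i (hdim i) (hh i) y t) t"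
    unfolding vderiv_def K
  proof (intro conjI allI impI)
    fix l assume l: "l < d i * n"
    let ?a = "l div n" and ?j = "l mod n"
    note la = lessn[OF l]
    have int: "integrable (lebesgue_on {- r i..- r (i - 1)}) (\<lambda>\<tau>. ?g \<tau> $ ?a)"
      using L2_vecD(2)[OF ff_weak_deriv(3)[OF i la(2)] la(2)] by (simp add: Ivl_eq L2_scalar_integrable)
    have "((\<lambda>t. LINT \<tau>|lebesgue_on {- r i..- r (i - 1)}. ff i \<tau> $ ?a * y (t + \<tau>) $ ?j) has_real_derivative
        ff i (- r (i - 1)) $ ?a * y (t + - r (i - 1)) $ ?j - ff i (- r i) $ ?a * y (t + - r i) $ ?j
        - (LINT \<tau>|lebesgue_on {- r i..- r (i - 1)}. ?g \<tau> $ ?a * y (t + \<tau>) $ ?j)) (at t)"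
      by (rule weak_deriv_shift[OF ff_weak_deriv(1)[OF i la(2)] Ivl_less[OF i] ff_weak_deriv(2)[OF i la(2)] int curveD(3)[OF y la(1)]])
    moreover have "(\<lambda>t. Kv i (d i) (ff i) y t $ l) = (\<lambda>t. LINT \<tau>|lebesgue_on {- r i..- r (i - 1)}. ff i \<tau> $ ?a * y (t + \<tau>) $ ?j)"
      using Kv_index[OF L(7) y la(2,1)] la(3) by (simp add: Ivl_eq)
    moreover have "Kv i (d i) ?g y t $ l = (LINT \<tau>|lebesgue_on {- r i..- r (i - 1)}. ?g \<tau> $ ?a * y (t + \<tau>) $ ?j)"
      using Kv_index[OF ff_weak_deriv(3)[OF i la(2)] y la(2,1)] la(3) by (simp add: Ivl_eq)
    moreover have "(vkron (ff i (- r (i - 1))) (y (t - r (i - 1))) - vkron (ff i (- r i)) (y (t - r i)) - Kv i (d i) ?g y t) $ l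
        = ff i (- r (i - 1)) $ ?a * y (t + - r (i - 1)) $ ?j - ff i (- r i) $ ?a * y (t + - r i) $ ?j - Kv i (d i) ?g y t $ l"
      using l ends dff curveD(1)[OF y] by (simp add: vkron_def)
    ultimately show "((\<lambda>s. Kv i (d i) (ff i) y s $ l) has_real_derivative
        (vkron (ff i (- r (i - 1))) (y (t - r (i - 1))) - vkron (ff i (- r i)) (y (t - r i)) - Kv i (d i) ?g y t) $ l) (at t)"
      by (simp only:)
  qed (simp_all add: ends dff curveD(1)[OF y])
  show "vac t0 t1 (d i * n) (Kv i (d i) (ff i) y)"
    unfolding vac_def
  proof (intro conjI allI impI)
    fix l assume l: "l < d i * n"
    let ?a = "l div n" and ?j = "l mod n"
    note la = lessn[OF l]
    have int: "integrable (lebesgue_on {- r i..- r (i - 1)}) (\<lambda>\<tau>. ?g \<tau> $ ?a)"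
      using L2_vecD(2)[OF ff_weak_deriv(3)[OF i la(2)] la(2)] by (simp add: Ivl_eq L2_scalar_integrable)
    have "abs_cont_on t0 t1 (\<lambda>t. LINT \<tau>|lebesgue_on {- r i..- r (i - 1)}. ff i \<tau> $ ?a * y (t + \<tau>) $ ?j)"
      by (rule abs_cont_on_shift[OF ff_weak_deriv(1)[OF i la(2)] Ivl_less[OF i] ff_weak_deriv(2)[OF i la(2)] int curveD(3)[OF y la(1)]])
    moreover have "(\<lambda>t. Kv i (d i) (ff i) y t $ l) = (\<lambda>t. LINT \<tau>|lebesgue_on {- r i..- r (i - 1)}. ff i \<tau> $ ?a * y (t + \<tau>) $ ?j)"
      using Kv_index[OF L(7) y la(2,1)] la(3) by (simp add: Ivl_eq)
    ultimately show "abs_cont_on t0 t1 (\<lambda>s. Kv i (d i) (ff i) y s $ l)" by (simp only:)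
  qed simp
qed

definition "Yf y t = vcat (map (\<lambda>i. Kv i (d i) (ff i) y t) ix)"

lemma dim_Yf [simp]: "dim_vec (Yf y t) = d_tot S * n"
  by (simp add: Yf_def o_def sum_list_upt d_tot_def sum_distrib_right)

text \<open>\<open>ff i\<close> is a linear image of \<open>hh i\<close>: undo the normalisation by
  \<open>Lh i\<close>, select the components of \<open>f\<close>, normalise by
  \<open>Lf i\<close>.\<close>

lemma Yp_eq: "curve y \<Longrightarrow> Yp (\<lambda>i. Kv i (hdim i) (hh i) y t) = Yf y t"
  unfolding Yp_def Yf_def
proof (intro arg_cong[where f=vcat] map_cong refl)
  fix i assume y: "curve y" and "i \<in> set ix"
  then have i: "i \<in> {1..\<nu>}" by simp
  note L = L2_funs[OF i] and m = minv_carrier(1)[OF i]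
  let ?B = "row_blk [0\<^sub>m (d i) (varphi_dim S i), 1\<^sub>m (d i)]"
  have B: "?B \<in> carrier_mat (d i) (hdim i)" by (intro row_blk_carrier) (auto simp: h_dim_def)
  have mB: "minv (Lf i) * ?B \<in> carrier_mat (d i) (hdim i)" and mBL: "minv (Lf i) * ?B * Lh i \<in> carrier_mat (d i) (hdim i)"
    using m B cholD(4)[OF i] by auto
  show "((minv (Lf i) * ?B * Lh i) \<otimes>\<^sub>k 1\<^sub>m n) *\<^sub>v Kv i (hdim i) (hh i) y t = Kv i (d i) (ff i) y t"
    unfolding Kv_left[OF L(5) y mBL]
  proof (rule Kv_cong)
    fix \<tau> assume \<tau>: "\<tau> \<in> Ivl S i"
    have "minv (Lf i) * ?B * Lh i *\<^sub>v hh i \<tau> = minv (Lf i) * ?B *\<^sub>v h_fun S i \<tau>"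
      using assoc_mult_mat_vec[OF mB cholD(4)[OF i] carrier_vecI[OF L2_vecD(1)[OF L(5) \<tau>]]] fun_relations(1)[OF i \<tau>] by simp
    also have "\<dots> = minv (Lf i) *\<^sub>v f_fun S i \<tau>"
      using assoc_mult_mat_vec[OF m B carrier_vecI[OF L2_vecD(1)[OF L(2) \<tau>]]] fun_relations(3)[OF i \<tau>] by simp
    finally show "minv (Lf i) * ?B * Lh i *\<^sub>v hh i \<tau> = ff i \<tau>" by (simp add: ff_def)
  qed simp
qed

lemma Yf_deriv:
  assumes "curve y"
  shows "vderiv (d_tot S * n) (Yf y) (Yd (\<lambda>i. y (t - r i)) (\<lambda>i. Kv i (hdim i) (hh i) y t)) t"
    and "vac t0 t1 (d_tot S * n) (Yf y)"
proof -
  have s: "sum_list (map (\<lambda>i. d i * n) ix) = d_tot S * n"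
    by (simp add: sum_list_upt d_tot_def sum_distrib_right)
  show "vderiv (d_tot S * n) (Yf y) (Yd (\<lambda>i. y (t - r i)) (\<lambda>i. Kv i (hdim i) (hh i) y t)) t"
    unfolding Yf_def[abs_def] Yd_def s[symmetric] ff_def[symmetric]
    by (rule vderiv_vcat) (simp add: Kv_ff_deriv(1)[OF _ assms])
  show "vac t0 t1 (d_tot S * n) (Yf y)"
    unfolding Yf_def[abs_def] s[symmetric]
    by (rule vac_vcat) (simp add: Kv_ff_deriv(2)[OF _ assms])
qed

definition "Wf i Q R y t = (LINT \<tau>|lebesgue_on (Ivl S i). y (t + \<tau>) \<bullet> (Q *\<^sub>v y (t + \<tau>)) + (\<tau> + r i) * (y (t + \<tau>) \<bullet> (R *\<^sub>v y (t + \<tau>))))"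

lemma curve_form_continuous:
  assumes y: "curve y" and Q: "Q \<in> carrier_mat n n"
  shows "continuous_on A (\<lambda>s. y s \<bullet> (Q *\<^sub>v y s))" "continuous_on A (\<lambda>\<tau>. y (t + \<tau>) \<bullet> (Q *\<^sub>v y (t + \<tau>)))"
proof -
  have e: "y s \<bullet> (Q *\<^sub>v y s) = (\<Sum>i<n. \<Sum>j<n. Q $$ (i, j) * (y s $ i * y s $ j))" for s
    by (rule scalar_prod_mult_mat[OF Q curveD(1)[OF y] curveD(1)[OF y]])
  have c: "continuous_on A (\<lambda>s. y s $ j)" if "j < n" for A j
    using curveD(3)[OF y that] continuous_on_subset by blast
  show "continuous_on A (\<lambda>s. y s \<bullet> (Q *\<^sub>v y s))" for A
    unfolding e by (intro continuous_intros c) auto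
  show "continuous_on A (\<lambda>\<tau>. y (t + \<tau>) \<bullet> (Q *\<^sub>v y (t + \<tau>)))"
    unfolding e by (intro continuous_intros curve_shift[OF y]) auto
qed

text \<open>The weight \<open>\<tau> + r i\<close> of \<open>R\<close> vanishes at the left end of
  the interval, equals \<open>r i - r (i - 1)\<close> at the right end and has slope 1. Hence
  \<open>R\<close> contributes one boundary term and minus its integral, while the constant weight
  of \<open>Q\<close> contributes boundary terms only.\<close>

lemma Wf_deriv:
  assumes i: "i \<in> {1..\<nu>}" and y: "curve y" and Q: "Q \<in> carrier_mat n n" and R: "R \<in> carrier_mat n n"
  shows "(Wf i Q R y has_real_derivative y (t - r (i - 1)) \<bullet> (Q *\<^sub>v y (t - r (i - 1)))
      + (r i - r (i - 1)) * (y (t - r (i - 1)) \<bullet> (R *\<^sub>v y (t - r (i - 1)))) - y (t - r i) \<bullet> (Q *\<^sub>v y (t - r i))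
      - (LINT \<tau>|lebesgue_on (Ivl S i). y (t + \<tau>) \<bullet> (R *\<^sub>v y (t + \<tau>)))) (at t)"
    and "abs_cont_on t0 t1 (Wf i Q R y)"
proof -
  let ?I = "{- r i..- r (i - 1)}"
  let ?q = "\<lambda>s. y s \<bullet> (Q *\<^sub>v y s)" and ?p = "\<lambda>s. y s \<bullet> (R *\<^sub>v y s)"
  have eq: "Wf i Q R y = (\<lambda>t. (LINT \<tau>|lebesgue_on ?I. 1 * ?q (t + \<tau>)) + (LINT \<tau>|lebesgue_on ?I. (\<tau> + r i) * ?p (t + \<tau>)))"
  proof
    fix t
    have "integrable (lebesgue_on ?I) (\<lambda>\<tau>. 1 * ?q (t + \<tau>))" "integrable (lebesgue_on ?I) (\<lambda>\<tau>. (\<tau> + r i) * ?p (t + \<tau>))"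
      by (intro continuous_integrable_on_Icc continuous_intros curve_form_continuous[OF y Q] curve_form_continuous[OF y R])+
    then show "Wf i Q R y t = (LINT \<tau>|lebesgue_on ?I. 1 * ?q (t + \<tau>)) + (LINT \<tau>|lebesgue_on ?I. (\<tau> + r i) * ?p (t + \<tau>))"
      by (simp add: Wf_def Ivl_eq)
  qed
  have w1: "weak_deriv (- r i) (- r (i - 1)) (\<lambda>_. 1) (\<lambda>_. 0)"
    by (rule weak_deriv_classical) (auto intro!: derivative_eq_intros continuous_intros)
  have w2: "weak_deriv (- r i) (- r (i - 1)) (\<lambda>\<tau>. \<tau> + r i) (\<lambda>_. 1)"
    by (rule weak_deriv_classical) (auto intro!: derivative_eq_intros continuous_intros)
  have c1: "integrable (lebesgue_on ?I) (\<lambda>_. 1 :: real)" "integrable (lebesgue_on ?I) (\<lambda>_. 0 :: real)"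
    by (intro continuous_integrable_on_Icc continuous_intros)+
  have cc: "continuous_on ?I (\<lambda>_. 1 :: real)" "continuous_on ?I (\<lambda>\<tau>. \<tau> + r i)" by (intro continuous_intros)+
  note cq = curve_form_continuous(1)[OF y Q, of UNIV] and cp = curve_form_continuous(1)[OF y R, of UNIV]
  show "(Wf i Q R y has_real_derivative y (t - r (i - 1)) \<bullet> (Q *\<^sub>v y (t - r (i - 1)))
      + (r i - r (i - 1)) * (y (t - r (i - 1)) \<bullet> (R *\<^sub>v y (t - r (i - 1)))) - y (t - r i) \<bullet> (Q *\<^sub>v y (t - r i))
      - (LINT \<tau>|lebesgue_on (Ivl S i). y (t + \<tau>) \<bullet> (R *\<^sub>v y (t + \<tau>)))) (at t)"
    unfolding eq
    by (rule DERIV_cong[OF DERIV_add[OF weak_deriv_shift[OF w1 Ivl_less[OF i] cc(1) c1(2) cq]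
        weak_deriv_shift[OF w2 Ivl_less[OF i] cc(2) c1(1) cp]]]) (simp add: Ivl_eq)
  show "abs_cont_on t0 t1 (Wf i Q R y)"
    unfolding eq
    by (intro abs_cont_on_add abs_cont_on_shift[OF w1 Ivl_less[OF i] cc(1) c1(2) cq]
        abs_cont_on_shift[OF w2 Ivl_less[OF i] cc(2) c1(1) cp])
qed

end

lemma scalar_prod_self_nonneg: "v \<bullet> v \<ge> 0" for v :: "real vec"
  by (simp add: scalar_prod_lessThan sum_nonneg)

section \<open>The functional, its derivative and the dissipation inequality\<close>

context synthesis begin

text \<open>A test vector with a single nonzero block isolates one diagonal block of
  \<open>bdiag S Q\<close> or \<open>bdiag S R\<close>.\<close>

lemma psd:
  assumes i: "i \<in> {1..\<nu>}" and v: "v \<in> carrier_vec n"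
  shows "v \<bullet> (Q i *\<^sub>v v) \<ge> 0" "v \<bullet> (R i *\<^sub>v v) \<ge> 0"
proof -
  let ?u = "\<lambda>j. if j = i then v else 0\<^sub>v n"
  have d: "dim_vec (?u j) = n" for j using v by simp
  have eq: "v \<bullet> (F i *\<^sub>v v) \<ge> 0" if F: "\<And>j. j \<in> {1..\<nu>} \<Longrightarrow> F j \<in> carrier_mat n n" and pd: "pos_def (bdiag S F)" for F
  proof -
    have "vcat (map ?u ix) \<bullet> (bdiag S F *\<^sub>v vcat (map ?u ix)) = (\<Sum>j=1..\<nu>. ?u j \<bullet> (F j *\<^sub>v ?u j))"
      by (rule bdiag_form) (simp only: d F)
    also have "\<dots> = (\<Sum>j=1..\<nu>. if j = i then v \<bullet> (F i *\<^sub>v v) else 0)"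
      using F mult_mat_vec_carrier[OF F zero_carrier_vec] by (intro sum.cong) (auto intro!: scalar_prod_left_zero)
    also have "\<dots> = v \<bullet> (F i *\<^sub>v v)" using i by simp
    finally have "vcat (map ?u ix) \<bullet> (bdiag S F *\<^sub>v vcat (map ?u ix)) = v \<bullet> (F i *\<^sub>v v)" .
    moreover have "bdiag S F \<in> carrier_mat (\<nu> * n) (\<nu> * n)"
      by (rule bdiag_square[OF F]) auto
    moreover have "vcat (map ?u ix) \<in> carrier_vec (\<nu> * n)"
      by (intro carrier_vecI, simp only: dim_vec_vcat map_map o_def d) (simp add: sum_list_upt)
    ultimately show ?thesis
      using pos_def_nonneg[OF pd, of "\<nu> * n" "vcat (map ?u ix)"] by (simp del: carrier_vec_dim_vec)
  qed
  show "v \<bullet> (Q i *\<^sub>v v) \<ge> 0" "v \<bullet> (R i *\<^sub>v v) \<ge> 0"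
    by (rule eq[OF unD_carrier(4) posQ], simp, rule eq[OF unD_carrier(5) posR], simp)
qed

definition "R_reg \<eta> i = R i + \<eta> \<cdot>\<^sub>m 1\<^sub>m n"

lemma R_reg:
  assumes i: "i \<in> {1..\<nu>}"
  shows "R_reg \<eta> i \<in> carrier_mat n n"
    and "dim_vec v = n \<Longrightarrow> v \<bullet> (R_reg \<eta> i *\<^sub>v v) = v \<bullet> (R i *\<^sub>v v) + \<eta> * (v \<bullet> v)"
proof -
  note Ri = unD_carrier(5)[OF i]
  show "R_reg \<eta> i \<in> carrier_mat n n" using Ri by (simp add: R_reg_def)
  assume "dim_vec v = n"
  then have v: "v \<in> carrier_vec n" by (rule carrier_vecI)
  have "R_reg \<eta> i *\<^sub>v v = R i *\<^sub>v v + \<eta> \<cdot>\<^sub>v v"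
  proof -
    have "(\<eta> \<cdot>\<^sub>m 1\<^sub>m n) *\<^sub>v v = \<eta> \<cdot>\<^sub>v (1\<^sub>m n *\<^sub>v v)"
      using v by (intro eq_vecI) (auto simp: row_smult)
    then show ?thesis
      unfolding R_reg_def using v Ri by (subst add_mult_distrib_mat_vec[OF Ri _ v]) auto
  qed
  then show "v \<bullet> (R_reg \<eta> i *\<^sub>v v) = v \<bullet> (R i *\<^sub>v v) + \<eta> * (v \<bullet> v)"
    using scalar_prod_add_distrib[OF v mult_mat_vec_carrier[OF Ri v], of "\<eta> \<cdot>\<^sub>v v"] v by simp
qed

definition "Vf \<eta> y t = (y t @\<^sub>v Yf y t) \<bullet> (four_block_mat P1 P2 P2\<^sup>T P3 *\<^sub>v (y t @\<^sub>v Yf y t))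
  + (\<Sum>i=1..\<nu>. Wf i (Q i) (R_reg \<eta> i) y t)"

abbreviation "Yd_curve y t \<equiv> Yd (\<lambda>i. y (t - r i)) (\<lambda>i. Kv i (hdim i) (hh i) y t)"

text \<open>The velocity \<open>a\<close> is a separate argument because it exists only at almost
  every time; all other terms make sense for any continuous curve. The factor 2 reflects the
  symmetry of \<open>P1\<close> and \<open>P3\<close>.\<close>

definition "Vdot \<eta> y t a =
  2 * (a \<bullet> (P1 *\<^sub>v y t) + a \<bullet> (P2 *\<^sub>v Yf y t) + y t \<bullet> (P2 *\<^sub>v Yd_curve y t) + Yf y t \<bullet> (P3 *\<^sub>v Yd_curve y t))
  + (\<Sum>i=1..\<nu>. y (t - r (i - 1)) \<bullet> (Q i *\<^sub>v y (t - r (i - 1)))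
      + (r i - r (i - 1)) * (y (t - r (i - 1)) \<bullet> (R_reg \<eta> i *\<^sub>v y (t - r (i - 1))))
      - y (t - r i) \<bullet> (Q i *\<^sub>v y (t - r i))
      - (LINT \<tau>|lebesgue_on (Ivl S i). y (t + \<tau>) \<bullet> (R_reg \<eta> i *\<^sub>v y (t + \<tau>))))"

lemma PP_carrier: "four_block_mat P1 P2 P2\<^sup>T P3 \<in> carrier_mat (n + d_tot S * n) (n + d_tot S * n)"
  using unD_carrier(1,3) by (rule four_block_carrier_mat)

lemma Vf_deriv:
  assumes y: "curve y" and a: "vderiv n y a t"
  shows "(Vf \<eta> y has_real_derivative Vdot \<eta> y t a) (at t)"
proof -
  let ?g = "Yd_curve y t" and ?P = "four_block_mat P1 P2 P2\<^sup>T P3"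
  note Yv = Yf_deriv(1)[OF y, of t]
  have ac: "a \<in> carrier_vec n" using a by (auto simp: vderiv_def intro: carrier_vecI)
  have gc: "?g \<in> carrier_vec (d_tot S * n)" using Yv by (auto simp: vderiv_def intro: carrier_vecI)
  have yc: "y t \<in> carrier_vec n" and fc: "Yf y t \<in> carrier_vec (d_tot S * n)"
    using curveD(2)[OF y] by (auto intro: carrier_vecI)
  have P2T: "P2\<^sup>T \<in> carrier_mat (d_tot S * n) n" using unD(3) by simp
  have form: "(u @\<^sub>v v) \<bullet> (?P *\<^sub>v (u' @\<^sub>v v')) = u \<bullet> (P1 *\<^sub>v u') + u \<bullet> (P2 *\<^sub>v v') + (u' \<bullet> (P2 *\<^sub>v v) + v \<bullet> (P3 *\<^sub>v v'))"
    if c: "u \<in> carrier_vec n" "u' \<in> carrier_vec n" "v \<in> carrier_vec (d_tot S * n)" "v' \<in> carrier_vec (d_tot S * n)" for u v u' v'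
  proof -
    note m = mult_mat_vec_carrier[OF unD_carrier(1) c(2)] mult_mat_vec_carrier[OF unD(3) c(4)]
      mult_mat_vec_carrier[OF P2T c(2)] mult_mat_vec_carrier[OF unD_carrier(3) c(4)] mult_mat_vec_carrier[OF unD(3) c(3)]
    have "(u @\<^sub>v v) \<bullet> (?P *\<^sub>v (u' @\<^sub>v v')) = u \<bullet> (P1 *\<^sub>v u' + P2 *\<^sub>v v') + v \<bullet> (P2\<^sup>T *\<^sub>v u' + P3 *\<^sub>v v')"
      unfolding four_block_mat_mult_vec[OF unD_carrier(1) unD(3) P2T unD_carrier(3) c(2,4)]
      by (rule scalar_prod_append[OF c(1,3)]) (use m in auto)
    also have "v \<bullet> (P2\<^sup>T *\<^sub>v u') = u' \<bullet> (P2 *\<^sub>v v)"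
      using transpose_vec_mult_scalar[OF unD(3) c(3,2)] comm_scalar_prod[OF c(3) m(3)] by simp
    then have "v \<bullet> (P2\<^sup>T *\<^sub>v u' + P3 *\<^sub>v v') = u' \<bullet> (P2 *\<^sub>v v) + v \<bullet> (P3 *\<^sub>v v')"
      by (simp add: scalar_prod_add_distrib[OF c(3) m(3,4)])
    finally show ?thesis by (simp add: scalar_prod_add_distrib[OF c(1) m(1,2)])
  qed
  have 1: "((\<lambda>s. (y s @\<^sub>v Yf y s) \<bullet> (?P *\<^sub>v (y s @\<^sub>v Yf y s))) has_real_derivative
      (a @\<^sub>v ?g) \<bullet> (?P *\<^sub>v (y t @\<^sub>v Yf y t)) + (y t @\<^sub>v Yf y t) \<bullet> (?P *\<^sub>v (a @\<^sub>v ?g))) (at t)"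
    by (rule vderiv_form[OF vderiv_append[OF a Yv] vderiv_append[OF a Yv] PP_carrier])
  have 2: "(a @\<^sub>v ?g) \<bullet> (?P *\<^sub>v (y t @\<^sub>v Yf y t)) + (y t @\<^sub>v Yf y t) \<bullet> (?P *\<^sub>v (a @\<^sub>v ?g))
      = 2 * (a \<bullet> (P1 *\<^sub>v y t) + a \<bullet> (P2 *\<^sub>v Yf y t) + y t \<bullet> (P2 *\<^sub>v ?g) + Yf y t \<bullet> (P3 *\<^sub>v ?g))"
    unfolding form[OF ac yc gc fc] form[OF yc ac fc gc]
    using sym_mats_scalar_prod[OF unD(1) ac yc] sym_mats_scalar_prod[OF unD(4) gc fc] by simp
  have "((\<lambda>s. \<Sum>i=1..\<nu>. Wf i (Q i) (R_reg \<eta> i) y s) has_real_derivative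
      (\<Sum>i=1..\<nu>. y (t - r (i - 1)) \<bullet> (Q i *\<^sub>v y (t - r (i - 1)))
      + (r i - r (i - 1)) * (y (t - r (i - 1)) \<bullet> (R_reg \<eta> i *\<^sub>v y (t - r (i - 1))))
      - y (t - r i) \<bullet> (Q i *\<^sub>v y (t - r i))
      - (LINT \<tau>|lebesgue_on (Ivl S i). y (t + \<tau>) \<bullet> (R_reg \<eta> i *\<^sub>v y (t + \<tau>))))) (at t)"
    by (rule DERIV_sum, rule Wf_deriv(1)[OF _ y unD_carrier(4) R_reg(1)])
  note W = this
  show ?thesis
    unfolding Vf_def[abs_def] Vdot_def using DERIV_add[OF 1 W] unfolding 2 .
qed

lemma Vf_abs_cont:
  assumes y: "curve y" and ac: "\<And>j. j < n \<Longrightarrow> abs_cont_on t0 t1 (\<lambda>s. y s $ j)"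
  shows "abs_cont_on t0 t1 (Vf \<eta> y)"
proof -
  have v: "vac t0 t1 n y" using ac curveD(1)[OF y] by (simp add: vac_def)
  note c = vac_append[OF v Yf_deriv(2)[OF y, of t0 t1]]
  show ?thesis
    unfolding Vf_def[abs_def]
    by (intro abs_cont_on_add abs_cont_on_sum vac_form[OF c c PP_carrier])
      (rule Wf_deriv(2)[OF _ y unD_carrier(4) R_reg(1)])
qed

text \<open>\<open>invertible_mat\<close> provides some inverse; taking determinants shows
  \<open>det (J1_mat S) \<noteq> 0\<close>, which is what \<open>minv\<close> requires.\<close>

lemma J1_inv:
  "minv (J1_mat S) \<in> carrier_mat m m"
  "u \<in> carrier_vec m \<Longrightarrow> J1_mat S *\<^sub>v (minv (J1_mat S) *\<^sub>v u) = u"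
proof -
  obtain B where B: "J1_mat S * B = 1\<^sub>m m" "B * J1_mat S = 1\<^sub>m (dim_row B)"
    using sup supD(3) by (auto simp: supply_parameters_def invertible_mat_def inverts_mat_def)
  have "dim_col (J1_mat S * B) = m" "dim_col (B * J1_mat S) = dim_row B"
    unfolding B by simp_all
  then have Bc: "B \<in> carrier_mat m m" using supD(3) by (intro carrier_matI) simp_all
  have "det (J1_mat S) * det B = 1"
    using det_mult[OF supD(3) Bc] B(1) by simp
  then have "det (J1_mat S) \<noteq> 0" by auto
  from minv_inverts(1)[OF supD(3) this] minv_mult_vec(2)[OF supD(3) this]
  show "minv (J1_mat S) \<in> carrier_mat m m"
    "u \<in> carrier_vec m \<Longrightarrow> J1_mat S *\<^sub>v (minv (J1_mat S) *\<^sub>v u) = u" by auto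
qed

text \<open>The output part is written as the form of \<open>J\<^sub>1\<^sup>-\<^sup>1\<close> at
  \<open>J z\<close>, to be matched with the last block of the matrix inequality.\<close>

lemma supply_rate_form:
  assumes z: "z \<in> carrier_vec m" and w: "w \<in> carrier_vec q"
  shows "supply_rate S z w = (J_tilde S *\<^sub>v z) \<bullet> (minv (J1_mat S) *\<^sub>v (J_tilde S *\<^sub>v z))
      + 2 * (w \<bullet> ((J2_mat S)\<^sup>T *\<^sub>v z)) + w \<bullet> (J3_mat S *\<^sub>v w)"
proof -
  note J = supD(1) and J1 = J1_inv(1)
  have JT: "(J_tilde S)\<^sup>T \<in> carrier_mat m m" using J by simp
  have JJ: "(J_tilde S)\<^sup>T * minv (J1_mat S) \<in> carrier_mat m m" using JT J1 by auto
  have G: "(J_tilde S)\<^sup>T * minv (J1_mat S) * J_tilde S \<in> carrier_mat m m" using JJ J by auto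
  note Jz = mult_mat_vec_carrier[OF J z]
  note v = mult_mat_vec_carrier[OF J1 Jz]
  have "(J_tilde S)\<^sup>T * minv (J1_mat S) * J_tilde S *\<^sub>v z = (J_tilde S)\<^sup>T *\<^sub>v (minv (J1_mat S) *\<^sub>v (J_tilde S *\<^sub>v z))"
    unfolding assoc_mult_mat_vec[OF JJ J z] assoc_mult_mat_vec[OF JT J1 Jz] ..
  then have 1: "z \<bullet> ((J_tilde S)\<^sup>T * minv (J1_mat S) * J_tilde S *\<^sub>v z) = (J_tilde S *\<^sub>v z) \<bullet> (minv (J1_mat S) *\<^sub>v (J_tilde S *\<^sub>v z))"
    using transpose_vec_mult_scalar[OF J z v] comm_scalar_prod[OF z mult_mat_vec_carrier[OF JT v]]
      comm_scalar_prod[OF Jz v] by simp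
  have J2T: "(J2_mat S)\<^sup>T \<in> carrier_mat q m" using supD(5) by simp
  have 2: "z \<bullet> (J2_mat S *\<^sub>v w) = w \<bullet> ((J2_mat S)\<^sup>T *\<^sub>v z)"
    using transpose_vec_mult_scalar[OF supD(5) w z] comm_scalar_prod[OF w mult_mat_vec_carrier[OF J2T z]] by simp
  show ?thesis
    unfolding supply_rate_def scalar_prod_four_block_sym[OF G supD(5,7) z w] 1 2 ..
qed

text \<open>At \<open>w = 0\<close> only the output part is left, and it is negative semidefinite.
  This sign turns the dissipation inequality into decay.\<close>

lemma supply_rate_nonpos: "z \<in> carrier_vec m \<Longrightarrow> supply_rate S z (0\<^sub>v q) \<le> 0"
proof -
  assume z: "z \<in> carrier_vec m"
  have G: "(J_tilde S)\<^sup>T * minv (J1_mat S) * J_tilde S \<in> carrier_mat m m"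
    using supD(1) J1_inv(1) by auto
  have "z \<bullet> (J2_mat S *\<^sub>v 0\<^sub>v q) = 0" "(0\<^sub>v q) \<bullet> (J3_mat S *\<^sub>v 0\<^sub>v q) = 0"
    using z supD(5,7) by (simp_all add: scalar_prod_lessThan)
  then have "supply_rate S z (0\<^sub>v q) = z \<bullet> ((J_tilde S)\<^sup>T * minv (J1_mat S) * J_tilde S *\<^sub>v z)"
    unfolding supply_rate_def scalar_prod_four_block_sym[OF G supD(5,7) z zero_carrier_vec] by simp
  then show "supply_rate S z (0\<^sub>v q) \<le> 0"
    using supD(1,4) z by (simp add: neg_semidef_def)
qed

text \<open>Perturbing \<open>R\<close> creates boundary terms at exactly these states. Being
  components of the stack, they are controlled by the margin of the matrix inequality.\<close>

lemma stack_square_ge: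
  assumes sd: "stack_dims x H E w"
  shows "(\<Sum>i=1..\<nu>. x (i - 1) \<bullet> x (i - 1)) \<le> stack x H E w \<bullet> stack x H E w"
proof -
  have "(\<Sum>i=1..\<nu>. x (i - 1) \<bullet> x (i - 1)) = vcat (map (\<lambda>i. x (i - 1)) ix) \<bullet> vcat (map (\<lambda>i. x (i - 1)) ix)"
    by (subst vcat_map_scalar_prod) (simp, simp only: sum_list_upt)
  also have "\<dots> \<le> stack x H E w \<bullet> stack x H E w"
    unfolding stack_unfold(1) by (simp add: scalar_prod_append_dim scalar_prod_self_nonneg del: dim_vec_vcat)
  finally show ?thesis .
qed

lemma energy_integrable:
  assumes i: "i \<in> {1..\<nu>}" and y: "curve y" and B: "B \<in> carrier_mat n n"
  shows "integrable (lebesgue_on (Ivl S i)) (\<lambda>\<tau>. y (t + \<tau>) \<bullet> (B *\<^sub>v y (t + \<tau>)))"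
    "integrable (lebesgue_on (Ivl S i)) (\<lambda>\<tau>. y (t + \<tau>) \<bullet> y (t + \<tau>))"
proof -
  have *: "integrable (lebesgue_on (Ivl S i)) (\<lambda>\<tau>. y (t + \<tau>) \<bullet> (B *\<^sub>v y (t + \<tau>)))" if "B \<in> carrier_mat n n" for B
    unfolding Ivl_eq by (intro continuous_integrable_on_Icc curve_form_continuous[OF y that])
  from *[OF B] show "integrable (lebesgue_on (Ivl S i)) (\<lambda>\<tau>. y (t + \<tau>) \<bullet> (B *\<^sub>v y (t + \<tau>)))" .
  from *[OF one_carrier_mat] show "integrable (lebesgue_on (Ivl S i)) (\<lambda>\<tau>. y (t + \<tau>) \<bullet> y (t + \<tau>))"
    by (simp add: one_mult_mat_vec[OF curveD(2)[OF y]])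
qed

text \<open>The strict inequality leaves room to replace \<open>R i\<close> by \<open>R i + \<eta> I\<close>, which yields a decay
  rate in terms of the whole history.\<close>

lemma key_inequality:
  "\<exists>\<eta>>0. \<exists>l>0. \<forall>y t w a. curve y \<longrightarrow> w \<in> carrier_vec q \<longrightarrow> a \<in> carrier_vec n \<longrightarrow>
    X *\<^sub>v a = Pi0 *\<^sub>v curve_stack y t w \<longrightarrow>
    Vdot \<eta> y t a - supply_rate S (Sigma_bold S X V W *\<^sub>v curve_stack y t w) w \<le>
      - l * (y t \<bullet> y t) - \<eta> * (\<Sum>i=1..\<nu>. LINT \<tau>|lebesgue_on (Ivl S i). y (t + \<tau>) \<bullet> y (t + \<tau>))"
proof -
  obtain e where e: "e > 0" "\<And>v. v \<in> carrier_vec (n + (N + m)) \<Longrightarrow> v \<bullet> (lmi_mat *\<^sub>v v) \<le> - e * (v \<bullet> v)"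
    using lmi_bound by blast
  have rn: "r \<nu> \<ge> 0" using r_mono[of 0 \<nu>] sysD(6) by simp
  \<comment> \<open>The added boundary terms have the coefficients
    \<open>\<eta> * (r i - r (i - 1))\<close>; this choice keeps each of them at most
    \<open>e / 2\<close>.\<close>
  define \<eta> where "\<eta> = e / (2 * (1 + r \<nu>))"
  have h: "\<eta> > 0" and hr: "\<eta> * (r i - r (i - 1)) \<le> e / 2" if "i \<in> {1..\<nu>}" for i
  proof -
    have "i - 1 \<le> \<nu>" "i \<le> \<nu>" using that by auto
    then have "r i - r (i - 1) \<le> 1 + r \<nu>" using r_mono[of i \<nu>] r_mono[of 0 "i - 1"] sysD(6) by simp
    then have "\<eta> * (r i - r (i - 1)) \<le> \<eta> * (1 + r \<nu>)"
      using rn e(1) by (intro mult_left_mono) (auto simp: \<eta>_def)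
    also have "\<dots> = e / 2" using rn by (simp add: \<eta>_def field_simps)
    finally show "\<eta> * (r i - r (i - 1)) \<le> e / 2" .
    show "\<eta> > 0" using e(1) rn by (simp add: \<eta>_def)
  qed
  \<comment> \<open>Restated without an index: the fact above is available only for some
    \<open>i \<in> {1..\<nu>}\<close>.\<close>
  have h: "\<eta> > 0" using e(1) rn by (simp add: \<eta>_def)
  have "Vdot \<eta> y t a - supply_rate S (Sigma_bold S X V W *\<^sub>v curve_stack y t w) w \<le>
      - (e / 2) * (y t \<bullet> y t) - \<eta> * (\<Sum>i=1..\<nu>. LINT \<tau>|lebesgue_on (Ivl S i). y (t + \<tau>) \<bullet> y (t + \<tau>))"
    if y: "curve y" and w: "w \<in> carrier_vec q" and a: "a \<in> carrier_vec n"
      and Xa: "X *\<^sub>v a = Pi0 *\<^sub>v curve_stack y t w" for y t w a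
  proof -
    let ?x = "\<lambda>i. y (t - r i)" and ?H = "\<lambda>i. Kv i (hdim i) (hh i) y t" and ?E = "\<lambda>i. Kv i (\<mu> i) (ee i) y t"
    let ?th = "curve_stack y t w"
    have sd: "stack_dims ?x ?H ?E w" using y w by (intro curve_stack_dims) auto
    define z where "z = Sigma_bold S X V W *\<^sub>v ?th"
    have th: "?th \<in> carrier_vec N" by (rule stack_carrier[OF sd])
    have z: "z \<in> carrier_vec m" unfolding z_def by (rule mult_mat_vec_carrier[OF Sigma_carrier th])
    define u where "u = J_tilde S *\<^sub>v z"
    have u: "u \<in> carrier_vec m" unfolding u_def by (rule mult_mat_vec_carrier[OF supD(1) z])
    define v where "v = minv (J1_mat S) *\<^sub>v u"
    have v: "v \<in> carrier_vec m" unfolding v_def by (rule mult_mat_vec_carrier[OF J1_inv(1) u])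
    have J1v: "J1_mat S *\<^sub>v v = u" unfolding v_def by (rule J1_inv(2)[OF u])
    define xi where "xi = a @\<^sub>v (?th @\<^sub>v - v)"
    have xic: "xi \<in> carrier_vec (n + (N + m))" unfolding xi_def using a th v by (intro append_carrier_vec) auto
    have mv: "- v \<in> carrier_vec m" using v by simp
    have J1m: "J1_mat S *\<^sub>v - v = - u"
      using J1v v supD(3) by (auto intro!: eq_vecI simp: scalar_prod_lessThan sum_negf)
    \<comment> \<open>At the last block \<open>- v\<close> the mixed term gives
      \<open>- 2 (u \<bullet> v)\<close> and the \<open>J\<^sub>1\<close>-term gives
      \<open>u \<bullet> v\<close>. Their sum is minus the output part of the supply rate.\<close>
    have uv: "- v \<bullet> u = - (u \<bullet> v)" "- v \<bullet> - u = u \<bullet> v"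
      using u v by (auto simp: scalar_prod_lessThan sum_negf mult.commute)
    let ?A = "\<lambda>i. ?x (i - 1) \<bullet> (Q i *\<^sub>v ?x (i - 1)) + (r i - r (i - 1)) * (?x (i - 1) \<bullet> (R i *\<^sub>v ?x (i - 1)))"
    let ?B = "\<lambda>i. ?x i \<bullet> (Q i *\<^sub>v ?x i)"
    let ?He = "\<lambda>i. ?H i \<bullet> ((1\<^sub>m (hdim i) \<otimes>\<^sub>k R i) *\<^sub>v ?H i)" and ?Ee = "\<lambda>i. ?E i \<bullet> ((1\<^sub>m (\<mu> i) \<otimes>\<^sub>k R i) *\<^sub>v ?E i)"
    let ?L = "\<lambda>i. LINT \<tau>|lebesgue_on (Ivl S i). y (t + \<tau>) \<bullet> y (t + \<tau>)"
    let ?Rr = "\<lambda>i. LINT \<tau>|lebesgue_on (Ivl S i). y (t + \<tau>) \<bullet> (R i *\<^sub>v y (t + \<tau>))"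
    let ?X = "\<lambda>i. ?x (i - 1) \<bullet> ?x (i - 1)"
    let ?C = "a \<bullet> (P1 *\<^sub>v y t) + a \<bullet> (P2 *\<^sub>v Yf y t) + y t \<bullet> (P2 *\<^sub>v Yd_curve y t) + Yf y t \<bullet> (P3 *\<^sub>v Yd_curve y t)"
    have x0: "?x 0 = y t" using sysD(6) by simp
    have L: "xi \<bullet> (lmi_mat *\<^sub>v xi) = 2 * ?C + (\<Sum>i=1..\<nu>. ?A i) - (\<Sum>i=1..\<nu>. ?B i)
        - (\<Sum>i=1..\<nu>. ?He i) - (\<Sum>i=1..\<nu>. ?Ee i) - supply_rate S z w"
      unfolding xi_def lmi_form[OF sd a mv Xa] supply_rate_form[OF z w] z_def[symmetric] u_def[symmetric] v_def[symmetric]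
        x0 Yp_eq[OF y] J1m uv by simp
    have D: "Vdot \<eta> y t a = 2 * ?C + (\<Sum>i=1..\<nu>. ?A i) + (\<Sum>i=1..\<nu>. \<eta> * (r i - r (i - 1)) * ?X i)
        - (\<Sum>i=1..\<nu>. ?B i) - (\<Sum>i=1..\<nu>. ?Rr i) - \<eta> * (\<Sum>i=1..\<nu>. ?L i)"
    proof -
      have RL: "(LINT \<tau>|lebesgue_on (Ivl S i). y (t + \<tau>) \<bullet> (R_reg \<eta> i *\<^sub>v y (t + \<tau>))) = ?Rr i + \<eta> * ?L i" if "i \<in> {1..\<nu>}" for i
        using energy_integrable[OF that y unD_carrier(5)[OF that], of t] by (simp add: R_reg(2)[OF that curveD(1)[OF y]])
      have "(\<Sum>i=1..\<nu>. ?x (i - 1) \<bullet> (Q i *\<^sub>v ?x (i - 1)) + (r i - r (i - 1)) * (?x (i - 1) \<bullet> (R_reg \<eta> i *\<^sub>v ?x (i - 1)))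
          - ?B i - (LINT \<tau>|lebesgue_on (Ivl S i). y (t + \<tau>) \<bullet> (R_reg \<eta> i *\<^sub>v y (t + \<tau>))))
        = (\<Sum>i=1..\<nu>. ?A i + \<eta> * (r i - r (i - 1)) * ?X i - ?B i - ?Rr i - \<eta> * ?L i)"
        by (intro sum.cong[OF refl], subst RL) (simp_all add: R_reg(2) curveD(1)[OF y] distrib_left)
      then show ?thesis
        unfolding Vdot_def by (simp add: sum.distrib sum_subtractf sum_distrib_left)
    qed
    \<comment> \<open>The integral of the \<open>R\<close>-form is spent entirely on the blocks of
      \<open>hh\<close> and \<open>ee\<close>. The share of \<eta> is left over and appears as decay
      in the conclusion.\<close>
    have b: "(\<Sum>i=1..\<nu>. ?He i) + (\<Sum>i=1..\<nu>. ?Ee i) \<le> (\<Sum>i=1..\<nu>. ?Rr i)"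
      unfolding sum.distrib[symmetric] by (intro sum_mono bessel_HE(1)[OF _ y unD_carrier(5) psd(2)])
    have "(\<Sum>i=1..\<nu>. \<eta> * (r i - r (i - 1)) * ?X i) \<le> (\<Sum>i=1..\<nu>. e / 2 * ?X i)"
      by (intro sum_mono mult_right_mono hr) (auto simp: scalar_prod_self_nonneg)
    also have "\<dots> = e / 2 * (\<Sum>i=1..\<nu>. ?X i)" by (simp add: sum_distrib_left)
    finally have 1: "(\<Sum>i=1..\<nu>. \<eta> * (r i - r (i - 1)) * ?X i) \<le> e / 2 * (\<Sum>i=1..\<nu>. ?X i)" .
    have "?th \<bullet> ?th \<le> xi \<bullet> xi"
      unfolding xi_def by (simp add: scalar_prod_append_dim scalar_prod_self_nonneg)
    then have "(\<Sum>i=1..\<nu>. ?X i) \<le> xi \<bullet> xi" using stack_square_ge[OF sd] by simp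
    then have "e * (\<Sum>i=1..\<nu>. ?X i) \<le> e * (xi \<bullet> xi)" using e(1) by (intro mult_left_mono) simp_all
    then have 2: "xi \<bullet> (lmi_mat *\<^sub>v xi) \<le> - e * (\<Sum>i=1..\<nu>. ?X i)"
      using e(2)[OF xic] by simp
    \<comment> \<open>As \<open>r 0 = 0\<close>, the first summand is
      \<open>y t \<bullet> y t\<close>. The half of the margin not consumed by \<eta> bounds
      it.\<close>
    have "?X 1 \<le> (\<Sum>i=1..\<nu>. ?X i)"
      using sysD(5) by (intro member_le_sum) (auto simp: scalar_prod_self_nonneg)
    then have 3: "e / 2 * (y t \<bullet> y t) \<le> e / 2 * (\<Sum>i=1..\<nu>. ?X i)" using x0 e(1) by (intro mult_left_mono) simp_all
    show ?thesis using L D b 1 2 3 unfolding z_def[symmetric] by linarith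
  qed
  then show ?thesis using h e(1) by (intro exI[of _ \<eta>] conjI exI[of _ "e / 2"] allI impI) auto
qed

end

section \<open>Dissipativity of the closed loop\<close>

text \<open>The sum of the absolute entries is a crude but sufficient bound, with
  \<open>\<bar>x y\<bar> \<le> x\<^sup>2 + y\<^sup>2\<close> applied entrywise.\<close>

lemma scalar_prod_mult_bound:
  assumes A: "A \<in> carrier_mat k l"
  shows "\<exists>B\<ge>0. \<forall>u\<in>carrier_vec k. \<forall>v\<in>carrier_vec l. \<bar>u \<bullet> (A *\<^sub>v v)\<bar> \<le> B * (u \<bullet> u + v \<bullet> (v :: real vec))"
proof (intro exI[of _ "\<Sum>i<k. \<Sum>j<l. \<bar>A $$ (i, j)\<bar>"] conjI ballI)
  show "(\<Sum>i<k. \<Sum>j<l. \<bar>A $$ (i, j)\<bar>) \<ge> 0" by (intro sum_nonneg) auto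
  fix u v :: "real vec" assume u: "u \<in> carrier_vec k" and v: "v \<in> carrier_vec l"
  have sq: "(x $ i)\<^sup>2 \<le> x \<bullet> x" if "i < dim_vec x" for x :: "real vec" and i
    using that member_le_sum[of i "{..<dim_vec x}" "\<lambda>i. (x $ i)\<^sup>2"] by (simp add: scalar_prod_lessThan power2_eq_square)
  have *: "\<bar>u $ i * v $ j\<bar> \<le> u \<bullet> u + v \<bullet> v" if "i < k" "j < l" for i j
  proof -
    have "2 * \<bar>u $ i * v $ j\<bar> \<le> (u $ i)\<^sup>2 + (v $ j)\<^sup>2"
      using sum_squares_bound[of "\<bar>u $ i\<bar>" "\<bar>v $ j\<bar>"] by (simp add: abs_mult)
    moreover have "(u $ i)\<^sup>2 \<le> u \<bullet> u" "(v $ j)\<^sup>2 \<le> v \<bullet> v" using that u v by (auto intro: sq)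
    ultimately show ?thesis using abs_ge_zero[of "u $ i * v $ j"] by linarith
  qed
  have "\<bar>u \<bullet> (A *\<^sub>v v)\<bar> \<le> (\<Sum>i<k. \<Sum>j<l. \<bar>A $$ (i, j) * (u $ i * v $ j)\<bar>)"
    unfolding scalar_prod_mult_mat[OF A carrier_vecD[OF u] carrier_vecD[OF v]]
    by (intro order_trans[OF sum_abs] sum_mono sum_abs)
  also have "\<dots> \<le> (\<Sum>i<k. \<Sum>j<l. \<bar>A $$ (i, j)\<bar> * (u \<bullet> u + v \<bullet> v))"
    unfolding abs_mult[of "A $$ _"] by (intro sum_mono mult_left_mono *) auto
  finally show "\<bar>u \<bullet> (A *\<^sub>v v)\<bar> \<le> (\<Sum>i<k. \<Sum>j<l. \<bar>A $$ (i, j)\<bar>) * (u \<bullet> u + v \<bullet> v)"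
    by (simp add: sum_distrib_right)
qed

lemma mult_mat_vec_bound:
  assumes A: "A \<in> carrier_mat k l"
  shows "\<exists>B\<ge>0. \<forall>v\<in>carrier_vec l. (A *\<^sub>v v) \<bullet> (A *\<^sub>v v) \<le> B * (v \<bullet> (v :: real vec))"
proof -
  have AT: "A\<^sup>T \<in> carrier_mat l k" and AA: "A\<^sup>T * A \<in> carrier_mat l l" using A by auto
  obtain B where B: "B \<ge> 0" "\<And>u v. u \<in> carrier_vec l \<Longrightarrow> v \<in> carrier_vec l \<Longrightarrow> \<bar>u \<bullet> (A\<^sup>T * A *\<^sub>v v)\<bar> \<le> B * (u \<bullet> u + v \<bullet> v)"
    using scalar_prod_mult_bound[OF AA] by blast
  have "(A *\<^sub>v v) \<bullet> (A *\<^sub>v v) \<le> (2 * B) * (v \<bullet> v)" if v: "v \<in> carrier_vec l" for v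
  proof -
    note Av = mult_mat_vec_carrier[OF A v]
    have "(A *\<^sub>v v) \<bullet> (A *\<^sub>v v) = v \<bullet> (A\<^sup>T * A *\<^sub>v v)"
      using transpose_vec_mult_scalar[OF A v Av] comm_scalar_prod[OF v mult_mat_vec_carrier[OF AT Av]]
        assoc_mult_mat_vec[OF AT A v] by simp
    then show ?thesis using B(2)[OF v v] by (simp add: algebra_simps)
  qed
  then show ?thesis using B(1) by (intro exI[of _ "2 * B"]) auto
qed

lemma hist_continuous_vnorm:
  assumes "\<chi> \<in> hist b k"
  shows "continuous_on {- b..0} (\<lambda>\<theta>. vnorm (\<chi> \<theta>))"
proof -
  have c: "continuous_on {- b..0} (\<lambda>\<theta>. sqrt (\<Sum>j<k. \<chi> \<theta> $ j * \<chi> \<theta> $ j))"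
    using assms by (intro continuous_intros) (auto simp: hist_def)
  have "vnorm (\<chi> \<theta>) = sqrt (\<Sum>j<k. \<chi> \<theta> $ j * \<chi> \<theta> $ j)" if "\<theta> \<in> {- b..0}" for \<theta>
  proof -
    have "\<chi> \<theta> \<in> carrier_vec k" using assms that by (auto simp: hist_def)
    then show ?thesis by (simp add: vnorm_def scalar_prod_lessThan)
  qed
  then show ?thesis using c by (simp cong: continuous_on_cong_simp)
qed

text \<open>Continuity on a compact interval bounds the set of values; only then does the real
  supremum dominate them.\<close>

lemma hist_norm_ge:
  assumes "\<chi> \<in> hist b k" "\<theta> \<in> {- b..0}"
  shows "vnorm (\<chi> \<theta>) \<le> hist_norm b \<chi>"
proof -
  have "bdd_above ((\<lambda>\<theta>. vnorm (\<chi> \<theta>)) ` {- b..0})"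
    by (intro bounded_imp_bdd_above compact_imp_bounded compact_continuous_image
      hist_continuous_vnorm[OF assms(1)] compact_Icc)
  then show ?thesis
    unfolding hist_norm_def using assms(2) by (intro cSUP_upper)
qed

lemma abs_cont_on_cong:
  assumes e: "\<And>t. t \<in> {a..b} \<Longrightarrow> F t = G t" and F: "abs_cont_on a b F"
  shows "abs_cont_on a b G"
  unfolding abs_cont_on_def
proof (intro allI impI)
  fix \<epsilon> :: real assume "\<epsilon> > 0"
  then obtain \<delta> where d: "\<delta> > 0" "\<And>D. finite D \<Longrightarrow> (\<forall>(c, e)\<in>D. a \<le> c \<and> c \<le> e \<and> e \<le> b) \<Longrightarrow>
      pairwise (\<lambda>(c, e) (c', e'). {c<..<e} \<inter> {c'<..<e'} = {}) D \<Longrightarrow>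
      (\<Sum>(c, e)\<in>D. e - c) < \<delta> \<Longrightarrow> (\<Sum>(c, e)\<in>D. \<bar>F e - F c\<bar>) < \<epsilon>"
    using F unfolding abs_cont_on_def by blast
  show "\<exists>\<delta>>0. \<forall>D. finite D \<longrightarrow> (\<forall>(c, e)\<in>D. a \<le> c \<and> c \<le> e \<and> e \<le> b) \<longrightarrow>
      pairwise (\<lambda>(c, e) (c', e'). {c<..<e} \<inter> {c'<..<e'} = {}) D \<longrightarrow>
      (\<Sum>(c, e)\<in>D. e - c) < \<delta> \<longrightarrow> (\<Sum>(c, e)\<in>D. \<bar>G e - G c\<bar>) < \<epsilon>"
  proof (intro exI[of _ \<delta>] conjI allI impI d(1))
    fix D :: "(real \<times> real) set"
    assume D: "finite D" "\<forall>(c, e)\<in>D. a \<le> c \<and> c \<le> e \<and> e \<le> b"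
      "pairwise (\<lambda>(c, e) (c', e'). {c<..<e} \<inter> {c'<..<e'} = {}) D" "(\<Sum>(c, e)\<in>D. e - c) < \<delta>"
    have "(\<Sum>(c, e)\<in>D. \<bar>G e - G c\<bar>) = (\<Sum>(c, e)\<in>D. \<bar>F e - F c\<bar>)"
      by (intro sum.cong[OF refl]) (use D(2) in \<open>fastforce simp: e\<close>)
    then show "(\<Sum>(c, e)\<in>D. \<bar>G e - G c\<bar>) < \<epsilon>" using d(2)[OF D] by simp
  qed
qed

lemmas finsum_vec_cong =
  comm_monoid.finprod_cong'[OF comm_monoid_vec, folded finsum_vec_def, unfolded monoid_vec_simps]

text \<open>The right-hand sides read only the segment of length \<open>r \<nu>\<close> before
  \<open>t\<close>. A trajectory may therefore be exchanged for a global curve that agrees with it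
  there.\<close>

lemma (in delay_system) delay_term_cong:
  assumes y: "curve y" and F: "\<And>i. i \<in> {0..\<nu>} \<Longrightarrow> F i \<in> carrier_mat k n"
    and e: "\<And>\<theta>. \<theta> \<in> {- r \<nu>..0} \<Longrightarrow> x (t + \<theta>) = y (t + \<theta>)"
  shows "delay_term S k F G x t = delay_term S k F G y t" "delay_term S k F G y t \<in> carrier_vec k"
proof -
  have Fc: "(\<lambda>i. F i *\<^sub>v y (t - r i)) \<in> {0..\<nu>} \<rightarrow> carrier_vec k"
    using F curveD(2)[OF y] by (intro Pi_I) (meson mult_mat_vec_carrier)
  have Gc: "(\<lambda>i. vec_int (Ivl S i) k (\<lambda>\<tau>. G i \<tau> *\<^sub>v y (t + \<tau>))) \<in> {1..\<nu>} \<rightarrow> carrier_vec k"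
    by (auto intro: carrier_vecI)
  have e0: "x (t - r i) = y (t - r i)" if "i \<in> {0..\<nu>}" for i
    using e[of "- r i"] r_mono[of 0 i] r_mono[of i \<nu>] sysD(6) that by simp
  have "finsum_vec TYPE(real) k (\<lambda>i. F i *\<^sub>v x (t - r i)) {0..\<nu>} = finsum_vec TYPE(real) k (\<lambda>i. F i *\<^sub>v y (t - r i)) {0..\<nu>}"
    by (rule finsum_vec_cong[OF refl Fc]) (simp add: e0)
  moreover have "finsum_vec TYPE(real) k (\<lambda>i. vec_int (Ivl S i) k (\<lambda>\<tau>. G i \<tau> *\<^sub>v x (t + \<tau>))) {1..\<nu>}
      = finsum_vec TYPE(real) k (\<lambda>i. vec_int (Ivl S i) k (\<lambda>\<tau>. G i \<tau> *\<^sub>v y (t + \<tau>))) {1..\<nu>}"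
    by (rule finsum_vec_cong[OF refl Gc]) (unfold Ivl_eq, rule vec_int_cong, metis e Ivl_subset Ivl_eq)
  ultimately show "delay_term S k F G x t = delay_term S k F G y t"
    unfolding delay_term_def by simp
  show "delay_term S k F G y t \<in> carrier_vec k"
    unfolding delay_term_def by (intro add_carrier_vec finsum_vec_closed Fc Gc)
qed

section \<open>The closed loop in the transformed state\<close>

context synthesis begin

abbreviation "KV \<equiv> \<lambda>i. V i * minv X"
abbreviation "KW \<equiv> \<lambda>i. W i * (1\<^sub>m (g_dim S i) \<otimes>\<^sub>k minv X)"

lemma gain_carrier:
  "i \<in> {0..\<nu>} \<Longrightarrow> KV i \<in> carrier_mat p n" "i \<in> {1..\<nu>} \<Longrightarrow> KW i \<in> carrier_mat p (g_dim S i * n)"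
proof -
  have k: "1\<^sub>m (g_dim S i) \<otimes>\<^sub>k minv X \<in> carrier_mat (g_dim S i * n) (g_dim S i * n)"
    using Y0(1) by (intro carrier_matI) (simp_all add: Y0_def)
  show "i \<in> {0..\<nu>} \<Longrightarrow> KV i \<in> carrier_mat p n"
    using mult_carrier_mat[OF unD(7) Y0(1)] by (simp add: Y0_def)
  show "i \<in> {1..\<nu>} \<Longrightarrow> KW i \<in> carrier_mat p (g_dim S i * n)"
    using mult_carrier_mat[OF unD(8) k] by simp
qed

text \<open>The change of variables \<open>x = X y\<close> makes the closed loop linear in the unknowns.\<close>

lemma closed_loop:
  assumes x: "curve x" and w: "w t \<in> carrier_vec q" and y_eq: "y = (\<lambda>s. Y0 *\<^sub>v x s)"
  shows "state_rhs S KV KW w x t = Pi0 *\<^sub>v curve_stack y t (w t)"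
    and "output_rhs S KV KW w x t = Sigma_bold S X V W *\<^sub>v curve_stack y t (w t)"
proof -
  have y: "curve y" unfolding y_eq by (rule curve_mult[OF x Y0(1)])
  have Xy: "X *\<^sub>v y s = x s" for s unfolding y_eq by (rule Y0(2)[OF curveD(2)[OF x]])
  let ?tx = "curve_stack x t (w t)" and ?ty = "curve_stack y t (w t)"
  have sdx: "stack_dims (\<lambda>i. x (t - r i)) (\<lambda>i. Kv i (hdim i) (hh i) x t) (\<lambda>i. Kv i (\<mu> i) (ee i) x t) (w t)"
    and sdy: "stack_dims (\<lambda>i. y (t - r i)) (\<lambda>i. Kv i (hdim i) (hh i) y t) (\<lambda>i. Kv i (\<mu> i) (ee i) y t) (w t)"
    using x y w by (auto intro!: curve_stack_dims)
  have tx: "?tx \<in> carrier_vec N" and ty: "?ty \<in> carrier_vec N"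
    using stack_carrier[OF sdx] stack_carrier[OF sdy] by auto
  \<comment> \<open>Multiplying the integrals of \<open>y\<close> by \<open>I \<otimes> X\<close>
    gives those of \<open>x\<close>, so \<open>X_aug S X\<close> sends the stack of \<open>y\<close>
    to the stack of \<open>x\<close>.\<close>
  have K: "(1\<^sub>m k \<otimes>\<^sub>k X) *\<^sub>v Kv i k e y t = Kv i k e x t" if "L2_vec (Ivl S i) k e" for i k e
    using Kv_right[OF that y unD_carrier(2)] by (simp add: Xy)
  have m1: "map (\<lambda>i. (1\<^sub>m (hdim i) \<otimes>\<^sub>k X) *\<^sub>v Kv i (hdim i) (hh i) y t) ix = map (\<lambda>i. Kv i (hdim i) (hh i) x t) ix"
    and m2: "map (\<lambda>i. (1\<^sub>m (\<mu> i) \<otimes>\<^sub>k X) *\<^sub>v Kv i (\<mu> i) (ee i) y t) ix = map (\<lambda>i. Kv i (\<mu> i) (ee i) x t) ix"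
    by (simp_all add: K L2_funs(5,6))
  have aug: "X_aug S X *\<^sub>v ?ty = ?tx"
    using X_aug_mult(2)[OF sdy unD_carrier(2)] unfolding Xy stack_unfold(2) m1 m2 .
  note XA = X_aug_mult(1)[OF sdy unD_carrier(2)]
  have L2: "L2_mat (Ivl S i) n n (A_ker S i)" "L2_mat (Ivl S i) m n (C_ker S i)" if "i \<in> {1..\<nu>}" for i
    using sys that by (auto simp: system_matrices_def)
  have A: "delay_term S n (A_mat S) (A_ker S) x t + D1_mat S *\<^sub>v w t = A_bold S *\<^sub>v ?tx"
    unfolding A_bold_def
  proof (rule delay_term_stack[OF x w _ kerD(6) sysD(12)])
    fix i assume i: "i \<in> {1..\<nu>}"
    have "AE \<tau> in lebesgue_on (Ivl S i). A_ker S i \<tau> = A_hat S i * (col_mat (g_fun S i \<tau>) \<otimes>\<^sub>k 1\<^sub>m n)"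
      using kerD(8)[OF i] by eventually_elim simp
    then show "vec_int (Ivl S i) n (\<lambda>\<tau>. A_ker S i \<tau> *\<^sub>v x (t + \<tau>)) = A_hat S i *\<^sub>v Kv i (g_dim S i) (g_fun S i) x t"
      by (rule vec_int_kernel_AE[OF i x kerD(6)[OF i] L2(1)[OF i]])
  qed (use sysD(8) in auto)
  have C: "delay_term S m (C_mat S) (C_ker S) x t + D2_mat S *\<^sub>v w t = C_bold S *\<^sub>v ?tx"
    unfolding C_bold_def
  proof (rule delay_term_stack[OF x w _ kerD(7) sysD(13)])
    fix i assume i: "i \<in> {1..\<nu>}"
    have "AE \<tau> in lebesgue_on (Ivl S i). C_ker S i \<tau> = C_hat S i * (col_mat (g_fun S i \<tau>) \<otimes>\<^sub>k 1\<^sub>m n)"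
      using kerD(8)[OF i] by eventually_elim simp
    then show "vec_int (Ivl S i) m (\<lambda>\<tau>. C_ker S i \<tau> *\<^sub>v x (t + \<tau>)) = C_hat S i *\<^sub>v Kv i (g_dim S i) (g_fun S i) x t"
      by (rule vec_int_kernel_AE[OF i x kerD(7)[OF i] L2(2)[OF i]])
  qed (use sysD(9) in auto)
  define u where "u = control S KV KW x t"
  have u: "u \<in> carrier_vec p"
    unfolding u_def control_def by (rule delay_term_cong(2)[OF x gain_carrier(1) refl])
  have "u + 0\<^sub>m p q *\<^sub>v w t = aug_row S KV KW (0\<^sub>m p q) *\<^sub>v ?tx"
    unfolding u_def control_def
    by (rule delay_term_stack[OF x w gain_carrier zero_carrier_mat])
      (simp_all only: K_ker_def vec_int_kernel[OF _ x gain_carrier(2)])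
  \<comment> \<open>The inverse of \<open>X\<close> inside the gains turns values and integrals of
    \<open>x\<close> into those of \<open>y\<close>. The products of unknowns disappear
    here.\<close>
  also have "\<dots> = V_bold S V W *\<^sub>v ?ty"
  proof (rule scalar_prod_eqI[of _ p])
    have ac: "aug_row S KV KW (0\<^sub>m p q) \<in> carrier_mat p N"
      by (rule aug_row_form(1)[OF sdx gain_carrier zero_carrier_mat])
    show "aug_row S KV KW (0\<^sub>m p q) *\<^sub>v ?tx \<in> carrier_vec p" by (rule mult_mat_vec_carrier[OF ac tx])
    show "V_bold S V W *\<^sub>v ?ty \<in> carrier_vec p" by (rule mult_mat_vec_carrier[OF bold_carrier(3) ty])
    fix c :: "real vec" assume c: "c \<in> carrier_vec p"
    have 1: "KV i *\<^sub>v x (t - r i) = V i *\<^sub>v y (t - r i)" if "i \<in> {0..\<nu>}" for i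
      using assoc_mult_mat_vec[OF unD(7)[OF that] Y0(1) curveD(2)[OF x]] by (simp add: y_eq Y0_def)
    have 2: "KW i *\<^sub>v Kv i (g_dim S i) (g_fun S i) x t = W i *\<^sub>v Kv i (g_dim S i) (g_fun S i) y t" if i: "i \<in> {1..\<nu>}" for i
    proof -
      have k: "1\<^sub>m (g_dim S i) \<otimes>\<^sub>k Y0 \<in> carrier_mat (g_dim S i * n) (g_dim S i * n)"
        using Y0(1) by (intro carrier_matI) simp_all
      have "KW i *\<^sub>v Kv i (g_dim S i) (g_fun S i) x t = W i *\<^sub>v ((1\<^sub>m (g_dim S i) \<otimes>\<^sub>k Y0) *\<^sub>v Kv i (g_dim S i) (g_fun S i) x t)"
        unfolding Y0_def[symmetric] by (rule assoc_mult_mat_vec[OF unD(8)[OF i] k carrier_vecI[OF dim_Kv]])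
      then show ?thesis
        unfolding Kv_right[OF L2_funs(3)[OF i] x Y0(1)] y_eq .
    qed
    have "c \<bullet> (aug_row S KV KW (0\<^sub>m p q) *\<^sub>v ?tx) = (\<Sum>i=0..\<nu>. c \<bullet> (KV i *\<^sub>v x (t - r i)))
        + (\<Sum>i=1..\<nu>. c \<bullet> (KW i *\<^sub>v Kv i (g_dim S i) (g_fun S i) x t)) + c \<bullet> (0\<^sub>m p q *\<^sub>v w t)"
      using aug_row_form(2)[of _ _ _ "w t" KV p KW "0\<^sub>m p q" c, OF sdx gain_carrier zero_carrier_mat c] by (simp add: Kv_g[OF _ x])
    also have "\<dots> = (\<Sum>i=0..\<nu>. c \<bullet> (V i *\<^sub>v y (t - r i)))
        + (\<Sum>i=1..\<nu>. c \<bullet> (W i *\<^sub>v Kv i (g_dim S i) (g_fun S i) y t)) + c \<bullet> (0\<^sub>m p q *\<^sub>v w t)"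
      using 1 2 by simp
    also have "\<dots> = c \<bullet> (V_bold S V W *\<^sub>v ?ty)"
      using aug_row_form(2)[of _ _ _ "w t" V p W "0\<^sub>m p q" c, OF sdy unD(7,8) zero_carrier_mat c]
      unfolding V_bold_def by (simp add: Kv_g[OF _ y])
    finally show "c \<bullet> (aug_row S KV KW (0\<^sub>m p q) *\<^sub>v ?tx) = c \<bullet> (V_bold S V W *\<^sub>v ?ty)" .
  qed
  finally have uV: "V_bold S V W *\<^sub>v ?ty = u" using u w by simp
  \<comment> \<open>Shared by the state and the output equation, which differ only in their
    coefficient matrices.\<close>
  have comb: "(Ab * X_aug S X + Bb * V_bold S V W) *\<^sub>v ?ty = dt + Bb *\<^sub>v u + D *\<^sub>v w t"
    if c: "Ab \<in> carrier_mat k N" "Bb \<in> carrier_mat k p" "dt \<in> carrier_vec k" "D \<in> carrier_mat k q"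
      and eq: "dt + D *\<^sub>v w t = Ab *\<^sub>v ?tx" for Ab Bb dt D k
  proof -
    have "(Ab * X_aug S X + Bb * V_bold S V W) *\<^sub>v ?ty = Ab *\<^sub>v ?tx + Bb *\<^sub>v u"
      using add_mult_distrib_mat_vec[OF mult_carrier_mat[OF c(1) XA] mult_carrier_mat[OF c(2) bold_carrier(3)] ty]
        assoc_mult_mat_vec[OF c(1) XA ty] assoc_mult_mat_vec[OF c(2) bold_carrier(3) ty] aug uV by simp
    also have "\<dots> = dt + Bb *\<^sub>v u + D *\<^sub>v w t"
      unfolding eq[symmetric] using c by (intro eq_vecI) auto
    finally show ?thesis .
  qed
  show "state_rhs S KV KW w x t = Pi0 *\<^sub>v ?ty"
    unfolding Pi0_def state_rhs_def u_def[symmetric]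
    by (rule comb[OF bold_carrier(1) sysD(10) delay_term_cong(2)[OF x sysD(8) refl] sysD(12) A, symmetric]) simp
  show "output_rhs S KV KW w x t = Sigma_bold S X V W *\<^sub>v ?ty"
    unfolding Sigma_bold_def output_rhs_def u_def[symmetric]
    by (rule comb[OF bold_carrier(2) sysD(11) delay_term_cong(2)[OF x sysD(9) refl] sysD(13) C, symmetric]) simp
qed

text \<open>A trajectory is unconstrained before the initial history. Freezing it at the left end of
  the history gives a global curve with the same right-hand sides from \<open>t_init S\<close>
  on.\<close>

lemma trajectory_curve:
  assumes tr: "trajectory S KV KW \<psi> w x z" and y_eq: "y = (\<lambda>s. Y0 *\<^sub>v x (max s (t_init S - r \<nu>)))"
  shows "curve y" "s \<ge> t_init S - r \<nu> \<Longrightarrow> y s = Y0 *\<^sub>v x s" "s \<ge> t_init S - r \<nu> \<Longrightarrow> X *\<^sub>v y s = x s"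
    "j < n \<Longrightarrow> t_init S \<le> T \<Longrightarrow> abs_cont_on (t_init S) T (\<lambda>s. y s $ j)"
    "AE t in lebesgue_on {t_init S..}. t > t_init S \<and> w t \<in> carrier_vec q \<and>
      (\<exists>a. a \<in> carrier_vec n \<and> vderiv n y a t \<and> X *\<^sub>v a = Pi0 *\<^sub>v curve_stack y t (w t)) \<and>
      z t = Sigma_bold S X V W *\<^sub>v curve_stack y t (w t)"
proof -
  let ?t0 = "t_init S" and ?c = "t_init S - r \<nu>"
  have psi: "\<psi> \<in> hist (r \<nu>) n" and w: "L2_vec {?t0..} q w" and xc: "\<And>t. t \<ge> ?c \<Longrightarrow> x t \<in> carrier_vec n"
    and init: "\<And>\<theta>. \<theta> \<in> {- r \<nu>..0} \<Longrightarrow> x (?t0 + \<theta>) = \<psi> \<theta>"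
    and ac: "\<And>T k. T \<ge> ?t0 \<Longrightarrow> k < n \<Longrightarrow> abs_cont_on ?t0 T (\<lambda>t. x t $ k)"
    and ae1: "AE t in lebesgue_on {?t0..}. \<forall>k<n. ((\<lambda>s. x s $ k) has_real_derivative state_rhs S KV KW w x t $ k) (at t)"
    and ae2: "AE t in lebesgue_on {?t0..}. z t = output_rhs S KV KW w x t"
    using tr unfolding trajectory_def by blast+
  have rn: "r \<nu> \<ge> 0" using r_mono[of 0 \<nu>] sysD(6) by simp
  define xx where "xx s = x (max s ?c)" for s
  have xx: "xx s = x s" if "s \<ge> ?c" for s using that by (simp add: xx_def max_def)
  \<comment> \<open>Two sources of continuity meet at the initial time: the history on its left,
    absolute continuity on its right.\<close>
  have cont: "continuous_on UNIV (\<lambda>s. xx s $ j)" if j: "j < n" for j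
  proof -
    have "continuous_on {?c..?t0} (\<lambda>s. \<psi> (s - ?t0) $ j)"
      by (rule continuous_on_compose2[of "{- r \<nu>..0}" "\<lambda>\<theta>. \<psi> \<theta> $ j"])
        (use psi j in \<open>auto simp: hist_def intro!: continuous_intros\<close>)
    then have 1: "continuous_on {?c..?t0} (\<lambda>s. x s $ j)"
      by (rule continuous_on_eq) (use init[of "_ - ?t0"] in simp)
    have 2: "continuous_on {?c..T} (\<lambda>s. x s $ j)" if "T \<ge> ?t0" for T
    proof -
      have "continuous_on ({?c..?t0} \<union> {?t0..T}) (\<lambda>s. x s $ j)"
        by (intro continuous_on_closed_Un 1 abs_cont_on_continuous ac that j) auto
      moreover have "{?c..?t0} \<union> {?t0..T} = {?c..T}" using rn that by auto
      ultimately show ?thesis by simp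
    qed
    have "isCont (\<lambda>s. xx s $ j) s" for s
    proof -
      let ?T = "max ?t0 (s + 1)"
      have "continuous_on {..<s + 1} (\<lambda>u. x (max u ?c) $ j)"
        by (rule continuous_on_compose2[OF 2[of ?T]]) (use rn in \<open>auto intro!: continuous_intros\<close>)
      then show ?thesis
        unfolding xx_def by (simp add: continuous_on_eq_continuous_at)
    qed
    then show ?thesis by (simp add: continuous_at_imp_continuous_on)
  qed
  have cxx: "curve xx"
    unfolding curve_def using cont carrier_vecD[OF xc] by (auto simp: xx_def)
  have yx: "y = (\<lambda>s. Y0 *\<^sub>v xx s)" by (simp add: y_eq xx_def)
  show cy: "curve y" unfolding yx by (rule curve_mult[OF cxx Y0(1)])
  show "s \<ge> ?c \<Longrightarrow> y s = Y0 *\<^sub>v x s" by (simp add: yx xx)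
  show "s \<ge> ?c \<Longrightarrow> X *\<^sub>v y s = x s" using Y0(2)[OF xc] by (simp add: yx xx)
  have ydx: "y s $ j = (\<Sum>k<n. Y0 $$ (j, k) * xx s $ k)" if "j < n" for s j
    using that Y0(1) curveD(1)[OF cxx] by (simp add: yx scalar_prod_lessThan)
  show "j < n \<Longrightarrow> ?t0 \<le> T \<Longrightarrow> abs_cont_on ?t0 T (\<lambda>s. y s $ j)"
  proof -
    assume j: "j < n" and T: "?t0 \<le> T"
    have "abs_cont_on ?t0 T (\<lambda>s. xx s $ k)" if "k < n" for k
    proof -
      have "xx s = x s" if "s \<in> {?t0..T}" for s using that rn by (intro xx) simp
      then show ?thesis by (intro abs_cont_on_cong[OF _ ac[OF T that]]) simp
    qed
    then show ?thesis unfolding ydx[OF j] by (intro abs_cont_on_sum abs_cont_on_cmult) auto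
  qed
  \<comment> \<open>The initial time is a null set. At the remaining times the trajectory and its
    extension agree on an open neighbourhood, so derivatives can be transferred.\<close>
  have "{?t0} \<in> null_sets (lebesgue_on {?t0..})"
    by (subst null_sets_restrict_space) (auto simp: negligible_iff_null_sets[symmetric])
  then have "AE t in lebesgue_on {?t0..}. t \<notin> {?t0}" by (rule AE_not_in)
  with ae1 ae2 AE_space show "AE t in lebesgue_on {?t0..}. t > ?t0 \<and> w t \<in> carrier_vec q \<and>
      (\<exists>a. a \<in> carrier_vec n \<and> vderiv n y a t \<and> X *\<^sub>v a = Pi0 *\<^sub>v curve_stack y t (w t)) \<and>
      z t = Sigma_bold S X V W *\<^sub>v curve_stack y t (w t)"
  proof eventually_elim
    case (elim t)
    then have t: "t > ?t0" by (simp add: space_restrict_space)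
    have wt: "w t \<in> carrier_vec q" using w t by (simp add: L2_vec_def)
    have e: "x (t + \<theta>) = xx (t + \<theta>)" if "\<theta> \<in> {- r \<nu>..0}" for \<theta> using that t by (simp add: xx)
    have A: "A_mat S i \<in> carrier_mat n n" "C_mat S i \<in> carrier_mat m n" if "i \<in> {0..\<nu>}" for i
      using that sysD(8,9) by auto
    have dt: "delay_term S k F G x t = delay_term S k F G xx t" if "\<And>i. i \<in> {0..\<nu>} \<Longrightarrow> F i \<in> carrier_mat k n" for k F G
      by (rule delay_term_cong(1)[OF cxx that e])
    have dts: "delay_term S n (A_mat S) G x t = delay_term S n (A_mat S) G xx t"
      "delay_term S m (C_mat S) G x t = delay_term S m (C_mat S) G xx t"
      "delay_term S p KV G x t = delay_term S p KV G xx t" for G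
      by (rule dt[OF A(1)], assumption, rule dt[OF A(2)], assumption, rule dt[OF gain_carrier(1)], assumption)
    have eqs: "state_rhs S KV KW w x t = state_rhs S KV KW w xx t" "output_rhs S KV KW w x t = output_rhs S KV KW w xx t"
      unfolding state_rhs_def output_rhs_def control_def dts by simp_all
    note cl = closed_loop[where w=w and t=t, OF cxx wt yx]
    define s where "s = Pi0 *\<^sub>v curve_stack y t (w t)"
    have sc: "s \<in> carrier_vec n"
      unfolding s_def using cy wt by (intro mult_mat_vec_carrier[OF Pi0_carrier stack_carrier] curve_stack_dims) auto
    have "vderiv n y (Y0 *\<^sub>v s) t"
      unfolding vderiv_def
    proof (intro conjI allI impI)
      show "dim_vec (y s) = n" for s by (rule curveD(1)[OF cy])
      show "dim_vec (Y0 *\<^sub>v s) = n" using Y0(1) by simp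
      fix j assume j: "j < n"
      have "((\<lambda>s. xx s $ k) has_real_derivative s $ k) (at t)" if "k < n" for k
      proof -
        have "((\<lambda>s. x s $ k) has_real_derivative s $ k) (at t)"
          using elim(1) that unfolding eqs cl s_def[symmetric] by blast
        then show ?thesis
          by (rule has_field_derivative_transform_within_open[of _ _ _ "{?t0<..}"]) (use t rn in \<open>auto simp: xx\<close>)
      qed
      then have "((\<lambda>u. \<Sum>k<n. Y0 $$ (j, k) * xx u $ k) has_real_derivative (\<Sum>k<n. Y0 $$ (j, k) * s $ k)) (at t)"
        by (intro DERIV_sum DERIV_cmult) auto
      then show "((\<lambda>s. y s $ j) has_real_derivative (Y0 *\<^sub>v s) $ j) (at t)"
        unfolding ydx[OF j] using j Y0(1) sc by (simp add: scalar_prod_lessThan)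
    qed
    moreover have "X *\<^sub>v (Y0 *\<^sub>v s) = s" by (rule Y0(2)[OF sc])
    moreover have "z t = Sigma_bold S X V W *\<^sub>v curve_stack y t (w t)" using elim(2) unfolding eqs cl .
    ultimately show ?case
      using t wt mult_mat_vec_carrier[OF Y0(1) sc] unfolding s_def by blast
  qed
qed

lemma Vf_cong:
  assumes e: "\<And>\<theta>. \<theta> \<in> {- r \<nu>..0} \<Longrightarrow> y (t + \<theta>) = y' (t' + \<theta>)"
  shows "Vf \<eta> y t = Vf \<eta> y' t'"
proof -
  have e': "y (t + \<tau>) = y' (t' + \<tau>)" if "i \<in> {1..\<nu>}" "\<tau> \<in> {- r i..- r (i - 1)}" for i \<tau>
    using e[OF Ivl_subset[OF that(1)]] that(2) by (simp add: Ivl_eq)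
  have "r \<nu> \<ge> 0" using r_mono[of 0 \<nu>] sysD(6) by simp
  then have "y t = y' t'" using e[of 0] by simp
  moreover have "Yf y t = Yf y' t'"
    unfolding Yf_def by (intro arg_cong[where f=vcat] map_cong refl Kv_cong) (auto simp: Ivl_eq e')
  moreover have "Wf i Q' R' y t = Wf i Q' R' y' t'" if "i \<in> {1..\<nu>}" for i Q' R'
    unfolding Wf_def Ivl_eq using that by (intro Bochner_Integration.integral_cong) (auto simp: e')
  ultimately show ?thesis by (simp add: Vf_def)
qed

text \<open>Clamping the argument extends a history to a curve on the whole line, and
  \<open>Y0\<close> passes to the coordinates in which the matrix inequality is evaluated.\<close>

definition "storage \<eta> \<chi> = Vf \<eta> (\<lambda>s. Y0 *\<^sub>v \<chi> (max (- r \<nu>) (min s 0))) 0"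

text \<open>Smoothness of the storage functional enters as a premise: it does not involve the
  dynamics and is obtained separately from bilinearity.\<close>

lemma dissipative_closed_loop:
  assumes C1: "\<And>\<eta>. C1_functional (r \<nu>) n (storage \<eta>)"
  shows "dissipative S KV KW"
proof -
  obtain \<eta> l where h: "\<eta> > 0" "l > 0" and key: "\<And>y t w a. curve y \<Longrightarrow> w \<in> carrier_vec q \<Longrightarrow> a \<in> carrier_vec n \<Longrightarrow>
    X *\<^sub>v a = Pi0 *\<^sub>v curve_stack y t w \<Longrightarrow>
    Vdot \<eta> y t a - supply_rate S (Sigma_bold S X V W *\<^sub>v curve_stack y t w) w \<le>
      - l * (y t \<bullet> y t) - \<eta> * (\<Sum>i=1..\<nu>. LINT \<tau>|lebesgue_on (Ivl S i). y (t + \<tau>) \<bullet> y (t + \<tau>))"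
    using key_inequality by blast
  show ?thesis
    unfolding dissipative_def
  proof (intro exI[of _ "storage \<eta>"] conjI allI impI C1)
    fix \<psi> w x z assume tr: "trajectory S KV KW \<psi> w x z"
    define y where "y = (\<lambda>s. Y0 *\<^sub>v x (max s (t_init S - r \<nu>)))"
    note T = trajectory_curve[OF tr y_def]
    have eq: "storage \<eta> (\<lambda>\<theta>\<in>{- r \<nu>..0}. x (s + \<theta>)) = Vf \<eta> y s" if "s > t_init S" for s
      unfolding storage_def by (rule Vf_cong) (use T(2) that in auto)
    from T(5) show "AE t in lebesgue_on {t_init S..}. \<exists>D. ((\<lambda>s. storage \<eta> (\<lambda>\<theta>\<in>{- r \<nu>..0}. x (s + \<theta>))) has_real_derivative D) (at t) \<and>
        D - supply_rate S (z t) (w t) \<le> 0"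
    proof eventually_elim
      case (elim t)
      then obtain a where a: "a \<in> carrier_vec n" "vderiv n y a t" "X *\<^sub>v a = Pi0 *\<^sub>v curve_stack y t (w t)" by blast
      have "(Vf \<eta> y has_real_derivative Vdot \<eta> y t a) (at t)" by (rule Vf_deriv[OF T(1) a(2)])
      then have "((\<lambda>s. storage \<eta> (\<lambda>\<theta>\<in>{- r \<nu>..0}. x (s + \<theta>))) has_real_derivative Vdot \<eta> y t a) (at t)"
        by (rule has_field_derivative_transform_within_open[of _ _ _ "{t_init S<..}"]) (use elim eq in auto)
      moreover have "l * (y t \<bullet> y t) \<ge> 0" using h by (simp add: scalar_prod_self_nonneg)
      moreover have "\<eta> * (\<Sum>i=1..\<nu>. LINT \<tau>|lebesgue_on (Ivl S i). y (t + \<tau>) \<bullet> y (t + \<tau>)) \<ge> 0"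
        using h by (intro mult_nonneg_nonneg sum_nonneg Bochner_Integration.integral_nonneg) (auto simp: scalar_prod_self_nonneg)
      ultimately show ?case
        using key[OF T(1) _ a(1,3)] elim by (intro exI[of _ "Vdot \<eta> y t a"]) auto
    qed
  qed
qed

end

section \<open>Exponential stability of the closed loop\<close>

lemma hist_norm_nonneg: "b \<ge> 0 \<Longrightarrow> \<chi> \<in> hist b k \<Longrightarrow> hist_norm b \<chi> \<ge> 0"
  using hist_norm_ge[of \<chi> b k 0] scalar_prod_self_nonneg[of "\<chi> 0"]
  by (auto simp: vnorm_def intro: order_trans[rotated])

lemma hist_norm_le:
  assumes "b \<ge> 0" "\<And>\<theta>. \<theta> \<in> {- b..0} \<Longrightarrow> vnorm (\<chi> \<theta>) \<le> c"
  shows "hist_norm b \<chi> \<le> c"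
  unfolding hist_norm_def using assms by (intro cSUP_least) auto

context synthesis begin

lemma Y0_hist_bound: "\<exists>c\<ge>0. \<forall>v\<in>carrier_vec n. vnorm (Y0 *\<^sub>v v) \<le> c * vnorm v"
proof -
  obtain B where B: "B \<ge> 0" "\<And>v. v \<in> carrier_vec n \<Longrightarrow> (Y0 *\<^sub>v v) \<bullet> (Y0 *\<^sub>v v) \<le> B * (v \<bullet> v)"
    using mult_mat_vec_bound[OF Y0(1)] by blast
  have "vnorm (Y0 *\<^sub>v v) \<le> sqrt B * vnorm v" if "v \<in> carrier_vec n" for v
    unfolding vnorm_def real_sqrt_mult[symmetric] using B(2)[OF that] by simp
  then show ?thesis using B(1) by (intro exI[of _ "sqrt B"]) auto
qed

text \<open>The case \<open>R = I\<close> of Bessel's inequality, where \<open>I \<otimes> I\<close>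
  acts as the identity.\<close>

lemma kernel_vec_square:
  assumes i: "i \<in> {1..\<nu>}" and y: "curve y"
  shows "Kv i (d i) (ff i) y t \<bullet> Kv i (d i) (ff i) y t \<le> (LINT \<tau>|lebesgue_on (Ivl S i). y (t + \<tau>) \<bullet> y (t + \<tau>))"
proof -
  have 1: "1\<^sub>m n *\<^sub>v y s = y s" for s using one_mult_mat_vec[OF curveD(2)[OF y]] .
  have "(1\<^sub>m (d i) \<otimes>\<^sub>k 1\<^sub>m n) *\<^sub>v Kv i (d i) (ff i) y t = Kv i (d i) (ff i) y t"
    using Kv_right[OF L2_funs(7)[OF i] y one_carrier_mat, of t] by (simp only: 1)
  then show ?thesis
    using bessel_HE(2)[OF i y one_carrier_mat, of t] by (simp only: 1) (simp add: scalar_prod_self_nonneg)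
qed

text \<open>The decay obtained so far is measured by \<open>y t\<close> and by the energies over the
  delay intervals; this estimate converts it into decay proportional to the functional.\<close>

lemma Vf_upper:
  assumes "\<eta> \<ge> 0"
  shows "\<exists>c>0. \<forall>y t. curve y \<longrightarrow>
    Vf \<eta> y t \<le> c * (y t \<bullet> y t + (\<Sum>i=1..\<nu>. LINT \<tau>|lebesgue_on (Ivl S i). y (t + \<tau>) \<bullet> y (t + \<tau>)))"
proof -
  obtain B where B: "B \<ge> 0" "\<And>u v. u \<in> carrier_vec (n + d_tot S * n) \<Longrightarrow> v \<in> carrier_vec (n + d_tot S * n) \<Longrightarrow>
      \<bar>u \<bullet> (four_block_mat P1 P2 P2\<^sup>T P3 *\<^sub>v v)\<bar> \<le> B * (u \<bullet> u + v \<bullet> v)"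
    using scalar_prod_mult_bound[OF PP_carrier] by blast
  have "\<forall>i\<in>{1..\<nu>}. \<exists>b\<ge>0. \<forall>v\<in>carrier_vec n. \<bar>v \<bullet> (Q i *\<^sub>v v)\<bar> \<le> b * (v \<bullet> v) \<and> \<bar>v \<bullet> (R_reg \<eta> i *\<^sub>v v)\<bar> \<le> b * (v \<bullet> v)"
  proof
    fix i assume i: "i \<in> {1..\<nu>}"
    obtain b1 where b1: "b1 \<ge> 0" "\<And>u v. u \<in> carrier_vec n \<Longrightarrow> v \<in> carrier_vec n \<Longrightarrow> \<bar>u \<bullet> (Q i *\<^sub>v v)\<bar> \<le> b1 * (u \<bullet> u + v \<bullet> v)"
      using scalar_prod_mult_bound[OF unD_carrier(4)[OF i]] by blast
    obtain b2 where b2: "b2 \<ge> 0" "\<And>u v. u \<in> carrier_vec n \<Longrightarrow> v \<in> carrier_vec n \<Longrightarrow> \<bar>u \<bullet> (R_reg \<eta> i *\<^sub>v v)\<bar> \<le> b2 * (u \<bullet> u + v \<bullet> v)"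
      using scalar_prod_mult_bound[OF R_reg(1)[OF i]] by blast
    have m: "0 \<le> b1 * (v \<bullet> v)" "0 \<le> b2 * (v \<bullet> v)" for v :: "real vec" using b1(1) b2(1) by (simp_all add: scalar_prod_self_nonneg)
    have "\<bar>v \<bullet> (Q i *\<^sub>v v)\<bar> \<le> (2 * (b1 + b2)) * (v \<bullet> v) \<and> \<bar>v \<bullet> (R_reg \<eta> i *\<^sub>v v)\<bar> \<le> (2 * (b1 + b2)) * (v \<bullet> v)"
      if "v \<in> carrier_vec n" for v
      using b1(2)[OF that that] b2(2)[OF that that] m[of v] unfolding distrib_left distrib_right by linarith
    then show "\<exists>b\<ge>0. \<forall>v\<in>carrier_vec n. \<bar>v \<bullet> (Q i *\<^sub>v v)\<bar> \<le> b * (v \<bullet> v) \<and> \<bar>v \<bullet> (R_reg \<eta> i *\<^sub>v v)\<bar> \<le> b * (v \<bullet> v)"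
      using b1(1) b2(1) by (intro exI[of _ "2 * (b1 + b2)"]) auto
  qed
  then obtain b where b: "\<And>i. i \<in> {1..\<nu>} \<Longrightarrow> b i \<ge> 0" "\<And>i v. i \<in> {1..\<nu>} \<Longrightarrow> v \<in> carrier_vec n \<Longrightarrow> \<bar>v \<bullet> (Q i *\<^sub>v v)\<bar> \<le> b i * (v \<bullet> v)"
    "\<And>i v. i \<in> {1..\<nu>} \<Longrightarrow> v \<in> carrier_vec n \<Longrightarrow> \<bar>v \<bullet> (R_reg \<eta> i *\<^sub>v v)\<bar> \<le> b i * (v \<bullet> v)"
    unfolding bchoice_iff by blast
  have rn: "r \<nu> \<ge> 0" using r_mono[of 0 \<nu>] sysD(6) by simp
  \<comment> \<open>\<open>1 + r \<nu>\<close> covers the weights 1 of \<open>Q\<close> and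
    \<open>\<tau> + r i\<close> of \<open>R\<close> together; the final 1 keeps \<open>c\<close>
    positive.\<close>
  define c where "c = 2 * B + (\<Sum>i=1..\<nu>. b i * (1 + r \<nu>)) + 1"
  have bs: "b i * (1 + r \<nu>) \<le> (\<Sum>i=1..\<nu>. b i * (1 + r \<nu>))" if "i \<in> {1..\<nu>}" for i
    using that b(1) rn by (intro member_le_sum[of i _ "\<lambda>i. b i * (1 + r \<nu>)"]) auto
  have bs0: "(\<Sum>i=1..\<nu>. b i * (1 + r \<nu>)) \<ge> 0" using b(1) rn by (intro sum_nonneg) auto
  have "Vf \<eta> y t \<le> c * (y t \<bullet> y t + (\<Sum>i=1..\<nu>. LINT \<tau>|lebesgue_on (Ivl S i). y (t + \<tau>) \<bullet> y (t + \<tau>)))"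
    if y: "curve y" for y t
  proof -
    let ?L = "\<lambda>i. LINT \<tau>|lebesgue_on (Ivl S i). y (t + \<tau>) \<bullet> y (t + \<tau>)"
    have L0: "?L i \<ge> 0" for i by (intro Bochner_Integration.integral_nonneg scalar_prod_self_nonneg)
    have "Yf y t \<bullet> Yf y t = (\<Sum>i=1..\<nu>. Kv i (d i) (ff i) y t \<bullet> Kv i (d i) (ff i) y t)"
      unfolding Yf_def by (subst vcat_map_scalar_prod) (simp, simp only: sum_list_upt)
    also have "\<dots> \<le> (\<Sum>i=1..\<nu>. ?L i)" by (intro sum_mono kernel_vec_square y)
    finally have YL: "Yf y t \<bullet> Yf y t \<le> (\<Sum>i=1..\<nu>. ?L i)" .
    let ?u = "y t @\<^sub>v Yf y t"
    have u: "?u \<in> carrier_vec (n + d_tot S * n)"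
      using curveD(2)[OF y] carrier_vecI[OF dim_Yf] by (rule append_carrier_vec)
    have "?u \<bullet> ?u = y t \<bullet> y t + Yf y t \<bullet> Yf y t" by (simp add: scalar_prod_append_dim)
    then have "?u \<bullet> (four_block_mat P1 P2 P2\<^sup>T P3 *\<^sub>v ?u) \<le> 2 * B * (y t \<bullet> y t + Yf y t \<bullet> Yf y t)"
      using B(2)[OF u u] by (simp add: algebra_simps)
    also have "\<dots> \<le> 2 * B * (y t \<bullet> y t + (\<Sum>i=1..\<nu>. ?L i))"
      using YL B(1) by (intro mult_left_mono) auto
    finally have 1: "?u \<bullet> (four_block_mat P1 P2 P2\<^sup>T P3 *\<^sub>v ?u) \<le> 2 * B * (y t \<bullet> y t + (\<Sum>i=1..\<nu>. ?L i))" .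
    have W: "Wf i (Q i) (R_reg \<eta> i) y t \<le> b i * (1 + r \<nu>) * ?L i" if i: "i \<in> {1..\<nu>}" for i
    proof -
      have "Wf i (Q i) (R_reg \<eta> i) y t \<le> (LINT \<tau>|lebesgue_on (Ivl S i). (b i * (1 + r \<nu>)) * (y (t + \<tau>) \<bullet> y (t + \<tau>)))"
        unfolding Wf_def
      proof (rule integral_mono)
        show "integrable (lebesgue_on (Ivl S i)) (\<lambda>\<tau>. y (t + \<tau>) \<bullet> (Q i *\<^sub>v y (t + \<tau>)) + (\<tau> + r i) * (y (t + \<tau>) \<bullet> (R_reg \<eta> i *\<^sub>v y (t + \<tau>))))"
          unfolding Ivl_eq by (intro continuous_integrable_on_Icc continuous_intros curve_form_continuous(2)[OF y] unD_carrier(4) R_reg(1) i)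
        show "integrable (lebesgue_on (Ivl S i)) (\<lambda>\<tau>. (b i * (1 + r \<nu>)) * (y (t + \<tau>) \<bullet> y (t + \<tau>)))"
          using energy_integrable(2)[OF i y one_carrier_mat] by simp
        fix \<tau> assume "\<tau> \<in> space (lebesgue_on (Ivl S i))"
        then have \<tau>: "\<tau> \<in> Ivl S i" by (simp add: Ivl_eq)
        have ri: "0 \<le> \<tau> + r i" "\<tau> + r i \<le> r \<nu>"
          using \<tau> Ivl_subset[OF i \<tau>] r_mono[of i \<nu>] i by (auto simp: Ivl_def)
        let ?v = "y (t + \<tau>)"
        note v = curveD(2)[OF y, of "t + \<tau>"]
        have "(\<tau> + r i) * (?v \<bullet> (R_reg \<eta> i *\<^sub>v ?v)) \<le> (\<tau> + r i) * (b i * (?v \<bullet> ?v))"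
          using b(3)[OF i v] ri by (intro mult_left_mono) auto
        also have "\<dots> \<le> r \<nu> * (b i * (?v \<bullet> ?v))"
          using ri b(1)[OF i] by (intro mult_right_mono mult_nonneg_nonneg scalar_prod_self_nonneg)
        finally show "?v \<bullet> (Q i *\<^sub>v ?v) + (\<tau> + r i) * (?v \<bullet> (R_reg \<eta> i *\<^sub>v ?v)) \<le> (b i * (1 + r \<nu>)) * (?v \<bullet> ?v)"
          using b(2)[OF i v] by (simp add: algebra_simps)
      qed
      then show ?thesis by simp
    qed
    have "(\<Sum>i=1..\<nu>. Wf i (Q i) (R_reg \<eta> i) y t) \<le> (\<Sum>i=1..\<nu>. (\<Sum>i=1..\<nu>. b i * (1 + r \<nu>)) * ?L i)"
      by (intro sum_mono order_trans[OF W] mult_right_mono bs L0)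
    also have "\<dots> = (\<Sum>i=1..\<nu>. b i * (1 + r \<nu>)) * (\<Sum>i=1..\<nu>. ?L i)" by (simp only: sum_distrib_left)
    also have "\<dots> \<le> (\<Sum>i=1..\<nu>. b i * (1 + r \<nu>)) * (y t \<bullet> y t + (\<Sum>i=1..\<nu>. ?L i))"
      using bs0 by (intro mult_left_mono) (auto simp: scalar_prod_self_nonneg)
    finally have 2: "(\<Sum>i=1..\<nu>. Wf i (Q i) (R_reg \<eta> i) y t) \<le> (\<Sum>i=1..\<nu>. b i * (1 + r \<nu>)) * (y t \<bullet> y t + (\<Sum>i=1..\<nu>. ?L i))" .
    have 3: "0 \<le> y t \<bullet> y t + (\<Sum>i=1..\<nu>. ?L i)"
      by (intro add_nonneg_nonneg sum_nonneg L0 scalar_prod_self_nonneg)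
    show ?thesis
      unfolding Vf_def c_def distrib_right using 1 2 3 by (simp add: distrib_right)
  qed
  moreover have "c > 0" unfolding c_def using B(1) bs0 by simp
  ultimately show ?thesis by blast
qed

text \<open>The form of the \<open>P\<close>-blocks need not be positive by itself. By Bessel's
  inequality the \<open>Q\<close>-integrals dominate the form of \<open>I \<otimes> Q\<close> at
  \<open>Yf y t\<close>, and this is precisely the block added to \<open>P\<close> in the positivity
  hypothesis.\<close>

lemma Vf_lower:
  assumes e: "\<eta> \<ge> 0"
  shows "\<exists>c>0. \<forall>y t. curve y \<longrightarrow> y t \<bullet> y t \<le> c * Vf \<eta> y t"
proof -
  let ?PP = "four_block_mat P1 P2 P2\<^sup>T P3" and ?D = "bdiag S (\<lambda>i. 1\<^sub>m (d i) \<otimes>\<^sub>k Q i)"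
  have D: "?D \<in> carrier_mat (d_tot S * n) (d_tot S * n)"
  proof (rule bdiag_square)
    fix i assume "i \<in> {1..\<nu>}"
    then show "1\<^sub>m (d i) \<otimes>\<^sub>k Q i \<in> carrier_mat (d i * n) (d i * n)"
      using unD_carrier(4) by (intro carrier_matI) auto
  qed (simp add: d_tot_def sum_distrib_right)
  have DD: "diag_block_mat [0\<^sub>m n n, ?D] \<in> carrier_mat (n + d_tot S * n) (n + d_tot S * n)"
    using D by (intro diag_block_carrier) auto
  have "dim_row (?PP + diag_block_mat [0\<^sub>m n n, ?D]) = n + d_tot S * n"
    by (simp only: index_add_mat(2) carrier_matD(1)[OF DD])
  from pos_def_bound[OF posP this] obtain c where c: "c > 0" "\<And>u. u \<in> carrier_vec (n + d_tot S * n) \<Longrightarrow>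
      u \<bullet> u \<le> c * (u \<bullet> ((?PP + diag_block_mat [0\<^sub>m n n, ?D]) *\<^sub>v u))" by blast
  have "y t \<bullet> y t \<le> c * Vf \<eta> y t" if y: "curve y" for y t
  proof -
    let ?u = "y t @\<^sub>v Yf y t"
    have u: "?u \<in> carrier_vec (n + d_tot S * n)"
      using curveD(2)[OF y] carrier_vecI[OF dim_Yf] by (rule append_carrier_vec)
    have "diag_block_mat [0\<^sub>m n n, ?D] *\<^sub>v vcat [y t, Yf y t] = vcat (map (\<lambda>(A, u). A *\<^sub>v u) (zip [0\<^sub>m n n, ?D] [y t, Yf y t]))"
      using D by (intro diag_block_mult) (simp add: curveD(1)[OF y])
    then have Du: "diag_block_mat [0\<^sub>m n n, ?D] *\<^sub>v ?u = 0\<^sub>v n @\<^sub>v (?D *\<^sub>v Yf y t)"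
      by (simp add: curveD(1)[OF y])
    have "?u \<bullet> (diag_block_mat [0\<^sub>m n n, ?D] *\<^sub>v ?u) = Yf y t \<bullet> (?D *\<^sub>v Yf y t)"
      unfolding Du using D curveD(1)[OF y] curveD(2)[OF y] by (subst scalar_prod_append_dim) auto
    also have "\<dots> = (\<Sum>i=1..\<nu>. Kv i (d i) (ff i) y t \<bullet> ((1\<^sub>m (d i) \<otimes>\<^sub>k Q i) *\<^sub>v Kv i (d i) (ff i) y t))"
      unfolding Yf_def
    proof (rule bdiag_form)
      fix i assume "i \<in> {1..\<nu>}"
      then show "1\<^sub>m (d i) \<otimes>\<^sub>k Q i \<in> carrier_mat (dim_vec (Kv i (d i) (ff i) y t)) (dim_vec (Kv i (d i) (ff i) y t))"
        using unD_carrier(4) by (intro carrier_matI) auto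
    qed
    also have "\<dots> \<le> (\<Sum>i=1..\<nu>. Wf i (Q i) (R_reg \<eta> i) y t)"
    proof (rule sum_mono)
      fix i assume i: "i \<in> {1..\<nu>}"
      have "Kv i (d i) (ff i) y t \<bullet> ((1\<^sub>m (d i) \<otimes>\<^sub>k Q i) *\<^sub>v Kv i (d i) (ff i) y t)
          \<le> (LINT \<tau>|lebesgue_on (Ivl S i). y (t + \<tau>) \<bullet> (Q i *\<^sub>v y (t + \<tau>)))"
        by (rule bessel_HE(2)[OF i y unD_carrier(4)[OF i] psd(1)[OF i]])
      also have "\<dots> \<le> Wf i (Q i) (R_reg \<eta> i) y t"
        unfolding Wf_def
      proof (rule integral_mono)
        show "integrable (lebesgue_on (Ivl S i)) (\<lambda>\<tau>. y (t + \<tau>) \<bullet> (Q i *\<^sub>v y (t + \<tau>)))"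
          by (rule energy_integrable(1)[OF i y unD_carrier(4)[OF i]])
        show "integrable (lebesgue_on (Ivl S i)) (\<lambda>\<tau>. y (t + \<tau>) \<bullet> (Q i *\<^sub>v y (t + \<tau>)) + (\<tau> + r i) * (y (t + \<tau>) \<bullet> (R_reg \<eta> i *\<^sub>v y (t + \<tau>))))"
          unfolding Ivl_eq by (intro continuous_integrable_on_Icc continuous_intros curve_form_continuous(2)[OF y] unD_carrier(4) R_reg(1) i)
        fix \<tau> assume "\<tau> \<in> space (lebesgue_on (Ivl S i))"
        then have "0 \<le> \<tau> + r i" by (simp add: Ivl_eq)
        moreover have "0 \<le> y (t + \<tau>) \<bullet> (R_reg \<eta> i *\<^sub>v y (t + \<tau>))"
          unfolding R_reg(2)[OF i curveD(1)[OF y]] using e psd(2)[OF i curveD(2)[OF y]] by (simp add: scalar_prod_self_nonneg)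
        ultimately show "y (t + \<tau>) \<bullet> (Q i *\<^sub>v y (t + \<tau>)) \<le> y (t + \<tau>) \<bullet> (Q i *\<^sub>v y (t + \<tau>)) + (\<tau> + r i) * (y (t + \<tau>) \<bullet> (R_reg \<eta> i *\<^sub>v y (t + \<tau>)))"
          by simp
      qed
      finally show "Kv i (d i) (ff i) y t \<bullet> ((1\<^sub>m (d i) \<otimes>\<^sub>k Q i) *\<^sub>v Kv i (d i) (ff i) y t) \<le> Wf i (Q i) (R_reg \<eta> i) y t" .
    qed
    finally have 1: "?u \<bullet> (diag_block_mat [0\<^sub>m n n, ?D] *\<^sub>v ?u) \<le> (\<Sum>i=1..\<nu>. Wf i (Q i) (R_reg \<eta> i) y t)" .
    have "y t \<bullet> y t \<le> ?u \<bullet> ?u" by (simp add: scalar_prod_append_dim scalar_prod_self_nonneg)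
    also have "\<dots> \<le> c * (?u \<bullet> ((?PP + diag_block_mat [0\<^sub>m n n, ?D]) *\<^sub>v ?u))" by (rule c(2)[OF u])
    also have "?u \<bullet> ((?PP + diag_block_mat [0\<^sub>m n n, ?D]) *\<^sub>v ?u) = ?u \<bullet> (?PP *\<^sub>v ?u) + ?u \<bullet> (diag_block_mat [0\<^sub>m n n, ?D] *\<^sub>v ?u)"
      unfolding add_mult_distrib_mat_vec[OF PP_carrier DD u]
      by (rule scalar_prod_add_distrib[OF u mult_mat_vec_carrier[OF PP_carrier u] mult_mat_vec_carrier[OF DD u]])
    also have "c * (?u \<bullet> (?PP *\<^sub>v ?u) + ?u \<bullet> (diag_block_mat [0\<^sub>m n n, ?D] *\<^sub>v ?u)) \<le> c * Vf \<eta> y t"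
      unfolding Vf_def using c(1) 1 by (intro mult_left_mono) auto
    finally show ?thesis .
  qed
  then show ?thesis using c(1) by blast
qed

text \<open>The functional multiplied by \<open>exp (2 g (t - t\<^sub>0))\<close> is absolutely
  continuous with nonpositive derivative almost everywhere, hence nonincreasing. Its two-sided
  bounds translate this into norms.\<close>

lemma exp_stable_closed_loop: "exp_stable S KV KW"
proof -
  obtain \<eta> l where h: "\<eta> > 0" "l > 0" and key: "\<And>y t w a. curve y \<Longrightarrow> w \<in> carrier_vec q \<Longrightarrow> a \<in> carrier_vec n \<Longrightarrow>
    X *\<^sub>v a = Pi0 *\<^sub>v curve_stack y t w \<Longrightarrow>
    Vdot \<eta> y t a - supply_rate S (Sigma_bold S X V W *\<^sub>v curve_stack y t w) w \<le>
      - l * (y t \<bullet> y t) - \<eta> * (\<Sum>i=1..\<nu>. LINT \<tau>|lebesgue_on (Ivl S i). y (t + \<tau>) \<bullet> y (t + \<tau>))"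
    using key_inequality by blast
  from h have h0: "\<eta> \<ge> 0" by simp
  obtain C where C: "C > 0" "\<And>y t. curve y \<Longrightarrow>
    Vf \<eta> y t \<le> C * (y t \<bullet> y t + (\<Sum>i=1..\<nu>. LINT \<tau>|lebesgue_on (Ivl S i). y (t + \<tau>) \<bullet> y (t + \<tau>)))"
    using Vf_upper[OF h0] by blast
  obtain c where c: "c > 0" "\<And>y t. curve y \<Longrightarrow> y t \<bullet> y t \<le> c * Vf \<eta> y t"
    using Vf_lower[OF h0] by blast
  obtain BX where BX: "BX \<ge> 0" "\<And>v. v \<in> carrier_vec n \<Longrightarrow> (X *\<^sub>v v) \<bullet> (X *\<^sub>v v) \<le> BX * (v \<bullet> v)"
    using mult_mat_vec_bound[OF unD_carrier(2)] by blast
  obtain cy where cy: "cy \<ge> 0" "\<And>v. v \<in> carrier_vec n \<Longrightarrow> vnorm (Y0 *\<^sub>v v) \<le> cy * vnorm v"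
    using Y0_hist_bound by blast
  \<comment> \<open>The growth rate \<open>2 g\<close> of the exponential times the upper bound
    \<open>C\<close> equals \<open>min l \<eta>\<close>, so it is absorbed by both decay terms. The
    factor 2 disappears when the square root is taken.\<close>
  define g where "g = min l \<eta> / (2 * C)"
  have g: "g > 0" "2 * g * C = min l \<eta>" using h C(1) by (auto simp: g_def)
  have rn: "r \<nu> \<ge> 0" using r_mono[of 0 \<nu>] sysD(6) by simp
  \<comment> \<open>Collects the constants of the final chain: \<open>BX\<close> for
    \<open>X\<close>, \<open>c\<close> for coercivity, \<open>C\<close> with
    \<open>1 + \<nu> r\<^sub>\<nu>\<close> for the functional at the initial time, and
    \<open>cy\<close> for the inverse of \<open>X\<close>.\<close>
  define D where "D = BX * c * C * (1 + real \<nu> * r \<nu>) * cy\<^sup>2"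
  have D0: "D \<ge> 0" unfolding D_def using BX(1) c(1) C(1) rn by simp
  have main: "vnorm (x T) \<le> (sqrt D + 1) * exp (- g * (T - t_init S)) * hist_norm (r \<nu>) \<psi>"
    if tr: "trajectory S KV KW \<psi> (\<lambda>_. 0\<^sub>v q) x z" and T: "T \<ge> t_init S" for \<psi> x z T
  proof -
    let ?t0 = "t_init S"
    define y where "y = (\<lambda>s. Y0 *\<^sub>v x (max s (?t0 - r \<nu>)))"
    note TC = trajectory_curve[OF tr y_def]
    note cv = TC(1)
    let ?L = "\<lambda>t i. LINT \<tau>|lebesgue_on (Ivl S i). y (t + \<tau>) \<bullet> y (t + \<tau>)"
    let ?F = "\<lambda>t. exp (2 * g * (t - ?t0)) * Vf \<eta> y t"
    have "?F T \<le> ?F ?t0"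
    proof (rule abs_cont_on_nonincreasing[OF T])
      have "abs_cont_on ?t0 T (\<lambda>t. exp (2 * g * (t - ?t0)))"
      proof (rule abs_cont_on_deriv)
        show "((\<lambda>t. exp (2 * g * (t - ?t0))) has_real_derivative exp (2 * g * (t - ?t0)) * (2 * g)) (at t)" for t
          by (auto intro!: derivative_eq_intros)
        show "\<bar>exp (2 * g * (t - ?t0)) * (2 * g)\<bar> \<le> exp (2 * g * (T - ?t0)) * (2 * g)" if "t \<in> {?t0..T}" for t
          using that g(1) by (simp add: abs_mult)
      qed
      then show "abs_cont_on ?t0 T ?F"
        by (intro abs_cont_on_mult Vf_abs_cont[OF cv] TC(4) T)
      have "AE t in lebesgue_on {?t0..T}. t \<in> {?t0..T} \<longrightarrow> (\<exists>D\<le>0. (?F has_real_derivative D) (at t))"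
      proof -
        have "AE t in lebesgue_on {?t0..}. \<exists>D\<le>0. (?F has_real_derivative D) (at t)"
          using TC(5)
        proof eventually_elim
          case (elim t)
          then obtain a where a: "a \<in> carrier_vec n" "vderiv n y a t" "X *\<^sub>v a = Pi0 *\<^sub>v curve_stack y t (0\<^sub>v q)" by blast
          let ?z = "Sigma_bold S X V W *\<^sub>v curve_stack y t (0\<^sub>v q)"
          have "?z \<in> carrier_vec m"
            using cv by (intro mult_mat_vec_carrier[OF Sigma_carrier stack_carrier] curve_stack_dims) auto
          note k = key[OF cv zero_carrier_vec a(1,3)] supply_rate_nonpos[OF this]
          have L0: "(\<Sum>i=1..\<nu>. ?L t i) \<ge> 0"
            by (intro sum_nonneg Bochner_Integration.integral_nonneg scalar_prod_self_nonneg)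
          have "2 * g * Vf \<eta> y t \<le> 2 * g * (C * (y t \<bullet> y t + (\<Sum>i=1..\<nu>. ?L t i)))"
            using C(2)[OF cv] g(1) by (intro mult_left_mono) auto
          also have "\<dots> = min l \<eta> * (y t \<bullet> y t) + min l \<eta> * (\<Sum>i=1..\<nu>. ?L t i)"
            unfolding g(2)[symmetric] by (simp add: algebra_simps)
          also have "\<dots> \<le> l * (y t \<bullet> y t) + \<eta> * (\<Sum>i=1..\<nu>. ?L t i)"
            using L0 by (intro add_mono mult_right_mono scalar_prod_self_nonneg) auto
          finally have n: "2 * g * Vf \<eta> y t + Vdot \<eta> y t a \<le> 0" using k by linarith
          have "(?F has_real_derivative exp (2 * g * (t - ?t0)) * (2 * g) * Vf \<eta> y t + Vdot \<eta> y t a * exp (2 * g * (t - ?t0))) (at t)"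
            by (rule DERIV_mult'[THEN DERIV_cong]; (rule Vf_deriv[OF cv a(2)])?) (auto intro!: derivative_eq_intros simp: algebra_simps)
          moreover have "exp (2 * g * (t - ?t0)) * (2 * g) * Vf \<eta> y t + Vdot \<eta> y t a * exp (2 * g * (t - ?t0))
              = exp (2 * g * (t - ?t0)) * (2 * g * Vf \<eta> y t + Vdot \<eta> y t a)" by (simp add: algebra_simps)
          moreover have "\<dots> \<le> 0" using n by (simp add: mult_nonneg_nonpos)
          ultimately show ?case by (metis (no_types, lifting))
        qed
        then show ?thesis
          by (subst (asm) AE_restrict_space_iff, simp, subst AE_restrict_space_iff, simp) (auto elim: eventually_mono)
      qed
      then show "AE t in lebesgue_on {?t0..T}. \<exists>D\<le>0. (?F has_real_derivative D) (at t)"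
        using AE_space by eventually_elim simp
    qed
    then have VT: "exp (2 * g * (T - ?t0)) * Vf \<eta> y T \<le> Vf \<eta> y ?t0" by simp
    let ?H = "hist_norm (r \<nu>) \<psi>"
    have psi: "\<psi> \<in> hist (r \<nu>) n" and init: "\<And>\<theta>. \<theta> \<in> {- r \<nu>..0} \<Longrightarrow> x (?t0 + \<theta>) = \<psi> \<theta>"
      using tr unfolding trajectory_def by blast+
    have H0: "?H \<ge> 0" by (rule hist_norm_nonneg[OF rn psi])
    have yb: "y (?t0 + \<theta>) \<bullet> y (?t0 + \<theta>) \<le> (cy * ?H)\<^sup>2" if \<theta>: "\<theta> \<in> {- r \<nu>..0}" for \<theta>
    proof -
      have pc: "\<psi> \<theta> \<in> carrier_vec n" using psi \<theta> by (auto simp: hist_def)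
      have "y (?t0 + \<theta>) = Y0 *\<^sub>v \<psi> \<theta>" using TC(2)[of "?t0 + \<theta>"] \<theta> by (simp add: init)
      then have "vnorm (y (?t0 + \<theta>)) \<le> cy * vnorm (\<psi> \<theta>)" using cy(2)[OF pc] by simp
      also have "\<dots> \<le> cy * ?H" using hist_norm_ge[OF psi \<theta>] cy(1) by (rule mult_left_mono)
      finally have "(vnorm (y (?t0 + \<theta>)))\<^sup>2 \<le> (cy * ?H)\<^sup>2"
        by (intro power_mono) (simp_all add: vnorm_def scalar_prod_self_nonneg)
      then show ?thesis by (simp add: vnorm_def scalar_prod_self_nonneg)
    qed
    have L: "?L ?t0 i \<le> r \<nu> * (cy * ?H)\<^sup>2" if i: "i \<in> {1..\<nu>}" for i
    proof -
      have "?L ?t0 i \<le> (LINT \<tau>|lebesgue_on (Ivl S i). (cy * ?H)\<^sup>2)"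
      proof (rule integral_mono[OF energy_integrable(2)[OF i cv one_carrier_mat]])
        show "integrable (lebesgue_on (Ivl S i)) (\<lambda>_. (cy * ?H)\<^sup>2)"
          unfolding Ivl_eq by (intro continuous_integrable_on_Icc continuous_intros)
      qed (use yb Ivl_subset[OF i] in \<open>auto simp: Ivl_eq\<close>)
      also have "\<dots> = (r i - r (i - 1)) * (cy * ?H)\<^sup>2"
        using Ivl_less[OF i] by (simp add: Ivl_eq measure_restrict_space)
      also have "\<dots> \<le> r \<nu> * (cy * ?H)\<^sup>2"
        using r_mono[of i \<nu>] r_mono[of 0 "i - 1"] sysD(6) i diff_le_self[of i 1] by (intro mult_right_mono) (auto simp del: diff_le_self)
      finally show ?thesis .
    qed
    have "Vf \<eta> y ?t0 \<le> C * (y ?t0 \<bullet> y ?t0 + (\<Sum>i=1..\<nu>. ?L ?t0 i))" by (rule C(2)[OF cv])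
    also have "\<dots> \<le> C * ((cy * ?H)\<^sup>2 + (\<Sum>i=1..\<nu>. r \<nu> * (cy * ?H)\<^sup>2))"
      using yb[of 0] rn C(1) L by (intro mult_left_mono add_mono sum_mono) auto
    finally have V0: "Vf \<eta> y ?t0 \<le> C * (1 + real \<nu> * r \<nu>) * (cy * ?H)\<^sup>2" by (simp add: algebra_simps)
    let ?E = "exp (- g * (T - ?t0))"
    have E: "?E\<^sup>2 * exp (2 * g * (T - ?t0)) = 1"
      by (simp add: power2_eq_square mult_exp_exp algebra_simps)
    have "Vf \<eta> y T = ?E\<^sup>2 * (exp (2 * g * (T - ?t0)) * Vf \<eta> y T)"
      using E by (simp add: mult.assoc[symmetric])
    also have "\<dots> \<le> ?E\<^sup>2 * (C * (1 + real \<nu> * r \<nu>) * (cy * ?H)\<^sup>2)"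
      using order_trans[OF VT V0] by (intro mult_left_mono) auto
    finally have VT2: "Vf \<eta> y T \<le> ?E\<^sup>2 * (C * (1 + real \<nu> * r \<nu>) * (cy * ?H)\<^sup>2)" .
    have "x T \<bullet> x T \<le> BX * (y T \<bullet> y T)"
      using BX(2)[OF curveD(2)[OF cv], of T] TC(3)[of T] T rn by simp
    also have "\<dots> \<le> BX * (c * Vf \<eta> y T)" using c(2)[OF cv] BX(1) by (intro mult_left_mono)
    also have "\<dots> \<le> BX * (c * (?E\<^sup>2 * (C * (1 + real \<nu> * r \<nu>) * (cy * ?H)\<^sup>2)))"
      using VT2 BX(1) c(1) by (intro mult_left_mono) auto
    also have "\<dots> = D * (?E * ?H)\<^sup>2" by (simp add: D_def power_mult_distrib)
    finally have "sqrt (x T \<bullet> x T) \<le> sqrt (D * (?E * ?H)\<^sup>2)" by simp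
    also have "\<dots> = sqrt D * (?E * ?H)" using H0 by (simp add: real_sqrt_mult)
    also have "\<dots> \<le> (sqrt D + 1) * (?E * ?H)" using H0 by (intro mult_right_mono) auto
    finally show ?thesis by (simp add: vnorm_def mult.assoc)
  qed
  show ?thesis
    unfolding exp_stable_def
  \<comment> \<open>Adding 1 keeps the constant strictly positive even if
    \<open>D = 0\<close>.\<close>
  proof (rule exI[of _ "sqrt D + 1"], intro conjI exI[of _ g] allI impI)
    show "sqrt D + 1 > 0" using D0 by (simp add: add_nonneg_pos)
  qed (use g(1) main in auto)
qed

end

section \<open>The number of scalar unknowns\<close>

text \<open>Finitely many linear coordinates that separate points and take all prescribed values
  identify \<open>U\<close> with \<open>\<real>\<^sup>I\<close>. Surjectivity provides negatives and
  the vectors of the standard basis; independence and spanning are checked in coordinates.\<close>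

lemma dim_eq_card_coords:
  fixes U :: "(real, 'x) module" and c :: "'i \<Rightarrow> 'x \<Rightarrow> real"
  assumes I_fin: "finite I"
    and zero: "\<zero>\<^bsub>U\<^esub> \<in> carrier U" "\<And>i. i \<in> I \<Longrightarrow> c i \<zero>\<^bsub>U\<^esub> = 0"
    and add: "\<And>x y. x \<in> carrier U \<Longrightarrow> y \<in> carrier U \<Longrightarrow> x \<oplus>\<^bsub>U\<^esub> y \<in> carrier U"
      "\<And>i x y. i \<in> I \<Longrightarrow> x \<in> carrier U \<Longrightarrow> y \<in> carrier U \<Longrightarrow> c i (x \<oplus>\<^bsub>U\<^esub> y) = c i x + c i y"
    and smult: "\<And>a x. x \<in> carrier U \<Longrightarrow> a \<odot>\<^bsub>U\<^esub> x \<in> carrier U"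
      "\<And>i a x. i \<in> I \<Longrightarrow> x \<in> carrier U \<Longrightarrow> c i (a \<odot>\<^bsub>U\<^esub> x) = a * c i x"
    and inj: "\<And>x y. x \<in> carrier U \<Longrightarrow> y \<in> carrier U \<Longrightarrow> (\<And>i. i \<in> I \<Longrightarrow> c i x = c i y) \<Longrightarrow> x = y"
    and surj: "\<And>f. \<exists>x\<in>carrier U. \<forall>i\<in>I. c i x = f i"
  shows "vectorspace.dim class_ring U = card I"
proof -
  note s = zero add smult
  have cr: "carrier class_ring = (UNIV :: real set)" "add class_ring = ((+) :: real \<Rightarrow> _)" "mult class_ring = ((*) :: real \<Rightarrow> _)"
    "one class_ring = (1 :: real)" "zero class_ring = (0 :: real)"
    by (simp_all add: class_ring_simps)
  have "module class_ring U"
  proof (rule module_criteria)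
    show "cring (class_ring :: real ring)"
      using class_field field.axioms(1) domain.axioms(1) by blast
    show "\<forall>v\<in>carrier U. \<exists>neg_v\<in>carrier U. v \<oplus>\<^bsub>U\<^esub> neg_v = \<zero>\<^bsub>U\<^esub>"
    proof
      fix v assume v: "v \<in> carrier U"
      obtain u where u: "u \<in> carrier U" "\<forall>i\<in>I. c i u = - c i v" using surj[of "\<lambda>i. - c i v"] by blast
      then have "v \<oplus>\<^bsub>U\<^esub> u = \<zero>\<^bsub>U\<^esub>" using v by (intro inj) (auto simp: s)
      then show "\<exists>neg_v\<in>carrier U. v \<oplus>\<^bsub>U\<^esub> neg_v = \<zero>\<^bsub>U\<^esub>" using u(1) by blast
    qed
  qed (auto simp: s cr algebra_simps intro!: inj)
  then have vs: "vectorspace class_ring U"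
    unfolding vectorspace_def using class_field by auto
  interpret vectorspace class_ring U by (rule vs)
  have csum: "c i (finsum U f A) = (\<Sum>a\<in>A. c i (f a)) \<and> finsum U f A \<in> carrier U"
    if "finite A" "f \<in> A \<rightarrow> carrier U" "i \<in> I" for i f and A :: "'x set"
    using that by (induction A rule: finite_induct) (auto simp: s)
  obtain b where b: "\<And>j. b j \<in> carrier U" "\<And>i j. i \<in> I \<Longrightarrow> c i (b j) = (if i = j then 1 else 0)"
    using surj[of "\<lambda>i. if i = _ then 1 else 0"] by metis
  have bi: "inj_on b I"
  proof (rule inj_onI)
    fix i j assume "i \<in> I" "j \<in> I" "b i = b j"
    then show "i = j" using b(2)[of i i] b(2)[of i j] by (auto split: if_splits)
  qed
  have clc: "c i (lincomb a A) = (\<Sum>v\<in>A. a v * c i v)" "lincomb a A \<in> carrier U"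
    if A: "finite A" "A \<subseteq> b ` I" and i: "i \<in> I" for i a A
  proof -
    have m: "(\<lambda>v. a v \<odot>\<^bsub>U\<^esub> v) \<in> A \<rightarrow> carrier U" using A b(1) by (auto intro!: smult)
    have "A \<subseteq> carrier U" using A b(1) by auto
    then show "c i (lincomb a A) = (\<Sum>v\<in>A. a v * c i v)" "lincomb a A \<in> carrier U"
      using csum[OF A(1) m i] i unfolding lincomb_def by (auto simp: s intro!: sum.cong)
  qed
  have cb: "(\<Sum>v\<in>b ` J. a v * c i v) = (if i \<in> J then a (b i) else 0)" if "J \<subseteq> I" "i \<in> I" for i J a
  proof -
    have "(\<Sum>v\<in>b ` J. a v * c i v) = (\<Sum>j\<in>J. a (b j) * (if i = j then 1 else 0))"
      using that b(2) by (subst sum.reindex[OF inj_on_subset[OF bi that(1)]]) simp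
    also have "\<dots> = (\<Sum>j\<in>J. if i = j then a (b j) else 0)" by (rule sum.cong) auto
    also have "\<dots> = (if i \<in> J then a (b i) else 0)"
      using finite_subset[OF that(1) I_fin] by simp
    finally show ?thesis .
  qed
  have "basis (b ` I)"
    unfolding basis_def
  proof (intro conjI)
    show "b ` I \<subseteq> carrier U" using b(1) by auto
    show "lin_indpt (b ` I)"
    proof
      assume "lin_dep (b ` I)"
      then obtain A a v where A: "finite A" "A \<subseteq> b ` I" "lincomb a A = \<zero>\<^bsub>U\<^esub>" "v \<in> A" "a v \<noteq> 0"
        unfolding lin_dep_def cr by blast
      from A(2) obtain J where J: "J \<subseteq> I" "A = b ` J" by (meson subset_image_iff)
      from A(4) J obtain i where i: "i \<in> J" "i \<in> I" "v = b i" by auto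
      have "c i (lincomb a A) = a v"
        unfolding clc(1)[OF A(1,2) i(2)] unfolding J(2) cb[OF J(1) i(2)] using i by simp
      then show False using A(3,5) zero(2)[OF i(2)] by simp
    qed
    show "span (b ` I) = carrier U"
    proof
      show "span (b ` I) \<subseteq> carrier U" using b(1) by (intro span_is_subset2) auto
      show "carrier U \<subseteq> span (b ` I)"
      proof
        fix x assume x: "x \<in> carrier U"
        define a where "a v = c (inv_into I b v) x" for v
        have "x = lincomb a (b ` I)"
        proof (rule inj[OF x])
          show "lincomb a (b ` I) \<in> carrier U"
            \<comment> \<open>\<open>clc\<close> speaks about some index in \<open>I\<close>, hence
              the separate treatment of the empty index set.\<close>
            by (cases "I = {}") (use clc(2)[of "b ` I"] I_fin in \<open>auto simp: lincomb_def\<close>)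
          show "c i x = c i (lincomb a (b ` I))" if "i \<in> I" for i
            using clc(1)[of "b ` I" i a] cb[of I i a] that I_fin bi by (simp add: a_def)
        qed
        then show "x \<in> span (b ` I)"
          unfolding span_def cr using I_fin by blast
      qed
    qed
  qed
  then have "dim = card (b ` I)" by (rule dim_basis[OF finite_imageI[OF I_fin]])
  then show ?thesis using card_image[OF bi] by simp
qed

text \<open>\<open>E\<close> is a set of free positions: the entries there are linear coordinates of
  the matrix space \<open>M\<close>, whose zero is \<open>Z\<close>.\<close>

definition mat_coords :: "real mat set \<Rightarrow> (nat \<times> nat) set \<Rightarrow> real mat \<Rightarrow> bool" where
  "mat_coords M E Z \<longleftrightarrow> finite E \<and> Z \<in> M \<and> (\<forall>e\<in>E. Z $$ e = 0) \<and>
    (\<forall>A\<in>M. \<forall>B\<in>M. A + B \<in> M \<and> (\<forall>e\<in>E. (A + B) $$ e = A $$ e + B $$ e)) \<and>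
    (\<forall>a. \<forall>A\<in>M. a \<cdot>\<^sub>m A \<in> M \<and> (\<forall>e\<in>E. (a \<cdot>\<^sub>m A) $$ e = a * A $$ e)) \<and>
    (\<forall>A\<in>M. \<forall>B\<in>M. (\<forall>e\<in>E. A $$ e = B $$ e) \<longrightarrow> A = B) \<and> (\<forall>f. \<exists>A\<in>M. \<forall>e\<in>E. A $$ e = f e)"

lemma mat_coordsD:
  assumes m: "mat_coords M E Z"
  shows "finite E" "Z \<in> M" "e \<in> E \<Longrightarrow> Z $$ e = 0" "A \<in> M \<Longrightarrow> B \<in> M \<Longrightarrow> A + B \<in> M"
    "A \<in> M \<Longrightarrow> B \<in> M \<Longrightarrow> e \<in> E \<Longrightarrow> (A + B) $$ e = A $$ e + B $$ e"
    "A \<in> M \<Longrightarrow> a \<cdot>\<^sub>m A \<in> M" "A \<in> M \<Longrightarrow> e \<in> E \<Longrightarrow> (a \<cdot>\<^sub>m A) $$ e = a * A $$ e"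
    "A \<in> M \<Longrightarrow> B \<in> M \<Longrightarrow> \<forall>e\<in>E. A $$ e = B $$ e \<Longrightarrow> A = B" "\<exists>A\<in>M. \<forall>e\<in>E. A $$ e = f e"
  using m by (simp_all add: mat_coords_def)

lemma mat_coords_carrier: "mat_coords (carrier_mat a b) ({..<a} \<times> {..<b}) (0\<^sub>m a b)"
  unfolding mat_coords_def
proof (intro conjI allI)
  show "\<exists>A\<in>carrier_mat a b. \<forall>e\<in>{..<a} \<times> {..<b}. A $$ e = f e" for f
    by (intro bexI[of _ "mat a b f"]) auto
qed (auto intro!: eq_matI)

text \<open>The lower triangle including the diagonal, the free positions of a symmetric
  matrix.\<close>

definition tri :: "nat \<Rightarrow> (nat \<times> nat) set" where
  "tri k = (SIGMA j:{..<k}. {..j})"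

lemma card_tri: "real (card (tri k)) = real k * (real k + 1) / 2"
proof -
  have "card (tri k) = (\<Sum>j<k. Suc j)" by (simp add: tri_def)
  then show ?thesis by (induction k arbitrary: rule: nat_induct) (simp_all add: tri_def field_simps)
qed

lemma mat_coords_sym: "mat_coords (sym_mats k) (tri k) (0\<^sub>m k k)"
  unfolding mat_coords_def
proof (intro conjI allI ballI impI)
  show "finite (tri k)" by (simp add: tri_def)
  show "(0\<^sub>m k k) \<in> sym_mats k" by (simp add: sym_mats_def)
  fix A :: "real mat" assume A: "A \<in> sym_mats k"
  then have Ac: "A \<in> carrier_mat k k" and At: "A\<^sup>T = A" by (auto simp: sym_mats_def)
  show "a \<cdot>\<^sub>m A \<in> sym_mats k" for a
  proof -
    have "(a \<cdot>\<^sub>m A)\<^sup>T = a \<cdot>\<^sub>m A\<^sup>T" using Ac by (intro eq_matI) auto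
    then show ?thesis using Ac At by (simp add: sym_mats_def)
  qed
  show "(a \<cdot>\<^sub>m A) $$ e = a * A $$ e" if "e \<in> tri k" for a e using that Ac by (auto simp: tri_def)
  fix B :: "real mat" assume B: "B \<in> sym_mats k"
  then have Bc: "B \<in> carrier_mat k k" and Bt: "B\<^sup>T = B" by (auto simp: sym_mats_def)
  show "A + B \<in> sym_mats k" using Ac At Bc Bt by (simp add: sym_mats_def transpose_add)
  show "(A + B) $$ e = A $$ e + B $$ e" if "e \<in> tri k" for e using that Ac Bc by (auto simp: tri_def)
  assume eq: "\<forall>e\<in>tri k. A $$ e = B $$ e"
  have sym: "M $$ (i, j) = M $$ (j, i)" if "M \<in> carrier_mat k k" "M\<^sup>T = M" "i < k" "j < k" for M :: "real mat" and i j
  proof -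
    have "M\<^sup>T $$ (i, j) = M $$ (j, i)" using that(1,3,4) by simp
    then show ?thesis using that(2) by simp
  qed
  show "A = B"
  proof (rule eq_matI)
    fix i j assume "i < dim_row B" "j < dim_col B"
    then have ij: "i < k" "j < k" using Bc by auto
    show "A $$ (i, j) = B $$ (i, j)"
    proof (cases "j \<le> i")
      case True then show ?thesis using eq ij by (auto simp: tri_def)
    next
      case False
      then have "A $$ (j, i) = B $$ (j, i)" using eq ij by (auto simp: tri_def)
      then show ?thesis using sym[OF Ac At ij] sym[OF Bc Bt ij] by simp
    qed
  qed (use Ac Bc in auto)
next
  show "(0\<^sub>m k k) $$ e = 0" if "e \<in> tri k" for e using that by (auto simp: tri_def)
  fix f :: "nat \<times> nat \<Rightarrow> real"
  let ?A = "mat k k (\<lambda>(i, j). f (max i j, min i j))"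
  have "?A \<in> sym_mats k" by (auto simp: sym_mats_def max.commute min.commute intro!: eq_matI)
  moreover have "\<forall>e\<in>tri k. ?A $$ e = f e" by (auto simp: tri_def max_def min_def)
  ultimately show "\<exists>A\<in>sym_mats k. \<forall>e\<in>tri k. A $$ e = f e" by blast
qed

text \<open>A tuple of matrices is viewed as a family over \<open>T\<close>. Its coordinates are
  pairs of a family index and a free position, so the dimension is a sum of cardinalities.\<close>

lemma dim_matrix_family:
  fixes U :: "(real, 'x) module" and sel :: "'t \<Rightarrow> 'x \<Rightarrow> real mat"
  assumes T: "finite T" and co: "\<And>t. t \<in> T \<Longrightarrow> mat_coords (M t) (E t) (Z t)"
    and sel: "\<And>t x. t \<in> T \<Longrightarrow> x \<in> carrier U \<Longrightarrow> sel t x \<in> M t"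
    and zero: "\<zero>\<^bsub>U\<^esub> \<in> carrier U" "\<And>t. t \<in> T \<Longrightarrow> sel t \<zero>\<^bsub>U\<^esub> = Z t"
    and add: "\<And>x y. x \<in> carrier U \<Longrightarrow> y \<in> carrier U \<Longrightarrow> x \<oplus>\<^bsub>U\<^esub> y \<in> carrier U"
      "\<And>t x y. t \<in> T \<Longrightarrow> x \<in> carrier U \<Longrightarrow> y \<in> carrier U \<Longrightarrow> sel t (x \<oplus>\<^bsub>U\<^esub> y) = sel t x + sel t y"
    and smult: "\<And>a x. x \<in> carrier U \<Longrightarrow> a \<odot>\<^bsub>U\<^esub> x \<in> carrier U"
      "\<And>t a x. t \<in> T \<Longrightarrow> x \<in> carrier U \<Longrightarrow> sel t (a \<odot>\<^bsub>U\<^esub> x) = a \<cdot>\<^sub>m sel t x"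
    and inj: "\<And>x y. x \<in> carrier U \<Longrightarrow> y \<in> carrier U \<Longrightarrow> (\<And>t. t \<in> T \<Longrightarrow> sel t x = sel t y) \<Longrightarrow> x = y"
    and surj: "\<And>A. (\<And>t. t \<in> T \<Longrightarrow> A t \<in> M t) \<Longrightarrow> \<exists>x\<in>carrier U. \<forall>t\<in>T. sel t x = A t"
  shows "vectorspace.dim class_ring U = (\<Sum>t\<in>T. card (E t))"
proof -
  have fE: "\<And>t. t \<in> T \<Longrightarrow> finite (E t)" using co by (simp add: mat_coords_def)
  have "vectorspace.dim class_ring U = card (SIGMA t:T. E t)"
  proof (rule dim_eq_card_coords[where c="\<lambda>(t, e) x. sel t x $$ e"])
    show "finite (SIGMA t:T. E t)" using T fE by auto
    show "\<exists>x\<in>carrier U. \<forall>i\<in>SIGMA t:T. E t. (case i of (t, e) \<Rightarrow> \<lambda>x. sel t x $$ e) x = f i" for f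
    proof -
      have "\<forall>t\<in>T. \<exists>A\<in>M t. \<forall>e\<in>E t. A $$ e = f (t, e)"
        using mat_coordsD(9)[OF co] by simp
      then obtain A where A: "\<And>t. t \<in> T \<Longrightarrow> A t \<in> M t" "\<And>t e. t \<in> T \<Longrightarrow> e \<in> E t \<Longrightarrow> A t $$ e = f (t, e)" by metis
      from surj[OF A(1)] obtain x where "x \<in> carrier U" "\<forall>t\<in>T. sel t x = A t" by blast
      then show ?thesis using A(2) by (intro bexI[of _ x]) auto
    qed
    show "x = y" if x: "x \<in> carrier U" and y: "y \<in> carrier U"
      and eq: "\<And>i. i \<in> (SIGMA t:T. E t) \<Longrightarrow> (case i of (t, e) \<Rightarrow> \<lambda>x. sel t x $$ e) x = (case i of (t, e) \<Rightarrow> \<lambda>x. sel t x $$ e) y" for x y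
    proof (rule inj[OF x y])
      fix t assume t: "t \<in> T"
      have "\<forall>e\<in>E t. sel t x $$ e = sel t y $$ e" using eq[of "(t, _)"] t by auto
      then show "sel t x = sel t y"
        by (rule mat_coordsD(8)[OF co[OF t] sel[OF t x] sel[OF t y]])
    qed
    show "(case i of (t, e) \<Rightarrow> \<lambda>x. sel t x $$ e) \<zero>\<^bsub>U\<^esub> = 0" if "i \<in> (SIGMA t:T. E t)" for i
      using that mat_coordsD(3)[OF co] zero(2) by auto
    show "(case i of (t, e) \<Rightarrow> \<lambda>x. sel t x $$ e) (x \<oplus>\<^bsub>U\<^esub> y) =
        (case i of (t, e) \<Rightarrow> \<lambda>x. sel t x $$ e) x + (case i of (t, e) \<Rightarrow> \<lambda>x. sel t x $$ e) y"
      if "i \<in> (SIGMA t:T. E t)" "x \<in> carrier U" "y \<in> carrier U" for i x y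
      using that mat_coordsD(5)[OF co sel sel, of "fst i" x y "snd i"] add(2) by auto
    show "(case i of (t, e) \<Rightarrow> \<lambda>x. sel t x $$ e) (a \<odot>\<^bsub>U\<^esub> x) = a * (case i of (t, e) \<Rightarrow> \<lambda>x. sel t x $$ e) x"
      if "i \<in> (SIGMA t:T. E t)" "x \<in> carrier U" for i a x
      using that mat_coordsD(7)[OF co sel, of "fst i" x "snd i" a] smult(2) by auto
  qed (use zero add smult in auto)
  then show ?thesis using T fE by simp
qed

context delay_system begin

lemma card_unknowns:
  "real (num_scalar_unknowns S) =
     (0.5 * (real (d_tot S))\<^sup>2 + real (d_tot S) + real \<nu> + 1) * (real n)\<^sup>2
     + (0.5 * real (d_tot S) + real \<nu> + 1 + real (\<beta> S) * real p) * real n"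
proof -
  let ?dn = "d_tot S * n"
  \<comment> \<open>The tags 0 to 7 stand for \<open>P1\<close>, \<open>X\<close>,
    \<open>P2\<close>, \<open>P3\<close>, \<open>Q\<close>, \<open>R\<close>, \<open>V\<close>,
    \<open>W\<close>. The second index is the delay number in the four families and 0 for the single
    matrices.\<close>
  define sel :: "nat \<times> nat \<Rightarrow> real mat \<times> real mat \<times> real mat \<times> real mat \<times> (nat \<Rightarrow> real mat) \<times> (nat \<Rightarrow> real mat) \<times>
     (nat \<Rightarrow> real mat) \<times> (nat \<Rightarrow> real mat) \<Rightarrow> real mat"
    where "sel = (\<lambda>(t, k) (P1, X, P2, P3, Q, R, V, W).
      if t = 0 then P1 else if t = 1 then X else if t = 2 then P2 else if t = 3 then P3
      else if t = 4 then Q k else if t = 5 then R k else if t = 6 then V k else W k)"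
  define M where "M = (\<lambda>(t, k). if t \<in> {0, 1, 4, 5 :: nat} then sym_mats n else if t = 2 then carrier_mat n ?dn
      else if t = 3 then sym_mats ?dn else if t = 6 then carrier_mat p n else carrier_mat p (g_dim S k * n))"
  define E where "E = (\<lambda>(t, k). if t \<in> {0, 1, 4, 5 :: nat} then tri n else if t = 2 then {..<n} \<times> {..<?dn}
      else if t = 3 then tri ?dn else if t = 6 then {..<p} \<times> {..<n} else {..<p} \<times> {..<g_dim S k * n})"
  define Z :: "nat \<times> nat \<Rightarrow> real mat" where "Z = (\<lambda>(t, k). if t \<in> {0, 1, 4, 5 :: nat} then 0\<^sub>m n n else if t = 2 then 0\<^sub>m n ?dn
      else if t = 3 then 0\<^sub>m ?dn ?dn else if t = 6 then 0\<^sub>m p n else 0\<^sub>m p (g_dim S k * n))"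
  \<comment> \<open>Among the families only \<open>V\<close> starts at index 0, which belongs to the
    gain of the undelayed state.\<close>
  define T where "T = {0, 1, 2, 3} \<times> {0 :: nat} \<union> ({4, 5} \<times> {1..\<nu>} \<union> ({6} \<times> {0..\<nu>} \<union> {7 :: nat} \<times> {1..\<nu>}))"
  have sm: "A + B \<in> sym_mats k" "a \<cdot>\<^sub>m A \<in> sym_mats k" if "A \<in> sym_mats k" "B \<in> sym_mats k" for A B a k
    using mat_coordsD(4,6)[OF mat_coords_sym] that by auto
  have sz: "0\<^sub>m k k \<in> sym_mats k" for k by (simp add: sym_mats_def)
  have gs: "(\<Sum>k=1..\<nu>. p * (g_dim S k * n)) = p * (g_tot S * n)"
    by (simp add: g_tot_def sum_distrib_left sum_distrib_right)
  have "vectorspace.dim class_ring (unknowns S) = (\<Sum>t\<in>T. card (E t))"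
  proof (rule dim_matrix_family[where M=M and Z=Z and sel=sel])
    show "finite T" by (simp add: T_def)
    show "mat_coords (M t) (E t) (Z t)" for t
      by (cases t) (auto simp: M_def E_def Z_def mat_coords_sym mat_coords_carrier)
    show "sel t x \<in> M t" if "t \<in> T" "x \<in> carrier (unknowns S)" for t x
      using that by (cases x) (auto simp: T_def M_def sel_def unknowns_def)
    show "\<zero>\<^bsub>unknowns S\<^esub> \<in> carrier (unknowns S)" by (auto simp: unknowns_def sz)
    show "sel t \<zero>\<^bsub>unknowns S\<^esub> = Z t" if "t \<in> T" for t
      using that by (auto simp: T_def Z_def sel_def unknowns_def)
    show "x \<oplus>\<^bsub>unknowns S\<^esub> y \<in> carrier (unknowns S)" if "x \<in> carrier (unknowns S)" "y \<in> carrier (unknowns S)" for x y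
      using that by (cases x; cases y) (auto simp: unknowns_def Pi_iff PiE_iff intro!: sm(1))
    show "sel t (x \<oplus>\<^bsub>unknowns S\<^esub> y) = sel t x + sel t y"
      if "t \<in> T" "x \<in> carrier (unknowns S)" "y \<in> carrier (unknowns S)" for t x y
      using that by (cases x; cases y) (auto simp: T_def sel_def unknowns_def)
    show "a \<odot>\<^bsub>unknowns S\<^esub> x \<in> carrier (unknowns S)" if "x \<in> carrier (unknowns S)" for a x
      using that by (cases x) (auto simp: unknowns_def Pi_iff PiE_iff intro!: sm(2))
    show "sel t (a \<odot>\<^bsub>unknowns S\<^esub> x) = a \<cdot>\<^sub>m sel t x" if "t \<in> T" "x \<in> carrier (unknowns S)" for t a x
      using that by (cases x) (auto simp: T_def sel_def unknowns_def)
    show "x = y" if x: "x \<in> carrier (unknowns S)" and y: "y \<in> carrier (unknowns S)"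
      and eq: "\<And>t. t \<in> T \<Longrightarrow> sel t x = sel t y" for x y
    proof -
      obtain P1 X P2 P3 Q R V W where xe: "x = (P1, X, P2, P3, Q, R, V, W)" by (metis surj_pair)
      obtain P1' X' P2' P3' Q' R' V' W' where ye: "y = (P1', X', P2', P3', Q', R', V', W')" by (metis surj_pair)
      have "P1 = P1'" "X = X'" "P2 = P2'" "P3 = P3'"
        using eq[of "(0, 0)"] eq[of "(1, 0)"] eq[of "(2, 0)"] eq[of "(3, 0)"] by (simp_all add: T_def sel_def xe ye)
      \<comment> \<open>The families are extensional outside their index range; together with the
        coordinates this determines them.\<close>
      moreover have "Q = Q'"
        by (rule PiE_ext[of _ "{1..\<nu>}" "\<lambda>_. sym_mats n"]) (use x y eq[of "(4, _)"] in \<open>auto simp: xe ye unknowns_def T_def sel_def\<close>)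
      moreover have "R = R'"
        by (rule PiE_ext[of _ "{1..\<nu>}" "\<lambda>_. sym_mats n"]) (use x y eq[of "(5, _)"] in \<open>auto simp: xe ye unknowns_def T_def sel_def\<close>)
      moreover have "V = V'"
        by (rule PiE_ext[of _ "{0..\<nu>}" "\<lambda>_. carrier_mat p n"]) (use x y eq[of "(6, _)"] in \<open>auto simp: xe ye unknowns_def T_def sel_def\<close>)
      moreover have "W = W'"
        by (rule PiE_ext[of _ "{1..\<nu>}" "\<lambda>i. carrier_mat p (g_dim S i * n)"]) (use x y eq[of "(7, _)"] in \<open>auto simp: xe ye unknowns_def T_def sel_def\<close>)
      ultimately show ?thesis by (simp add: xe ye)
    qed
    show "\<exists>x\<in>carrier (unknowns S). \<forall>t\<in>T. sel t x = A t" if A: "\<And>t. t \<in> T \<Longrightarrow> A t \<in> M t" for A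
    proof (intro bexI ballI)
      let ?x = "(A (0, 0), A (1, 0), A (2, 0), A (3, 0), \<lambda>k\<in>{1..\<nu>}. A (4, k), \<lambda>k\<in>{1..\<nu>}. A (5, k), \<lambda>k\<in>{0..\<nu>}. A (6, k), \<lambda>k\<in>{1..\<nu>}. A (7, k))"
      show "sel t ?x = A t" if "t \<in> T" for t using that by (auto simp: T_def sel_def)
      have "A (0, 0) \<in> sym_mats n" "A (1, 0) \<in> sym_mats n" "A (2, 0) \<in> carrier_mat n ?dn" "A (3, 0) \<in> sym_mats ?dn"
        "\<And>k. k \<in> {1..\<nu>} \<Longrightarrow> A (4, k) \<in> sym_mats n" "\<And>k. k \<in> {1..\<nu>} \<Longrightarrow> A (5, k) \<in> sym_mats n"
        "\<And>k. k \<in> {0..\<nu>} \<Longrightarrow> A (6, k) \<in> carrier_mat p n" "\<And>k. k \<in> {1..\<nu>} \<Longrightarrow> A (7, k) \<in> carrier_mat p (g_dim S k * n)"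
        using A[of "(0, 0)"] A[of "(1, 0)"] A[of "(2, 0)"] A[of "(3, 0)"] A[of "(4, _)"] A[of "(5, _)"] A[of "(6, _)"] A[of "(7, _)"]
        by (simp_all add: T_def M_def)
      then show "?x \<in> carrier (unknowns S)" by (auto simp: unknowns_def simp del: carrier_matI)
    qed
  qed
  also have "\<dots> = (\<Sum>t\<in>{0, 1, 2, 3} \<times> {0}. card (E t)) + ((\<Sum>t\<in>{4, 5} \<times> {1..\<nu>}. card (E t))
      + ((\<Sum>t\<in>{6} \<times> {0..\<nu>}. card (E t)) + (\<Sum>t\<in>{7} \<times> {1..\<nu>}. card (E t))))"
    unfolding T_def by (subst sum.union_disjoint, force, force, force)+ simp
  also have "\<dots> = 2 * card (tri n) + n * ?dn + card (tri ?dn) + 2 * \<nu> * card (tri n) + (\<nu> + 1) * (p * n) + (\<Sum>k=1..\<nu>. p * (g_dim S k * n))"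
    unfolding sum.cartesian_product' by (simp add: E_def add_mult_distrib)
  finally have "real (num_scalar_unknowns S) = 2 * real (card (tri n)) + real (n * ?dn) + real (card (tri ?dn))
      + 2 * real \<nu> * real (card (tri n)) + (real \<nu> + 1) * (real p * real n) + real p * (real (g_tot S) * real n)"
    unfolding num_scalar_unknowns_def gs by simp
  \<comment> \<open>The pointwise gains contribute \<open>\<nu> + 1\<close> blocks of size
    \<open>p * n\<close> and the distributed gains \<open>g_tot S\<close> of them, \<beta> in
    total.\<close>
  moreover have "real (\<beta> S) = 1 + real \<nu> + real (g_tot S)" by (simp add: \<beta>_def)
  ultimately show ?thesis
    by (simp add: card_tri power2_eq_square field_simps)
qed

end

section \<open>Quadratic functionals of the history\<close>

lemma histD:
  "\<chi> \<in> hist b k \<Longrightarrow> \<theta> \<in> {- b..0} \<Longrightarrow> \<chi> \<theta> \<in> carrier_vec k"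
  "\<chi> \<in> hist b k \<Longrightarrow> \<theta> \<in> {- b..0} \<Longrightarrow> dim_vec (\<chi> \<theta>) = k"
  "\<chi> \<in> hist b k \<Longrightarrow> j < k \<Longrightarrow> continuous_on {- b..0} (\<lambda>\<theta>. \<chi> \<theta> $ j)"
  by (auto simp: hist_def PiE_iff)

lemma hist_add_apply: "\<theta> \<in> {- b..0} \<Longrightarrow> hist_add b \<chi> \<xi> \<theta> = \<chi> \<theta> + \<xi> \<theta>"
  and hist_smult_apply: "\<theta> \<in> {- b..0} \<Longrightarrow> hist_smult b a \<chi> \<theta> = a \<cdot>\<^sub>v \<chi> \<theta>"
  by (simp_all add: hist_add_def hist_smult_def)

lemma hist_coord:
  assumes "\<theta> \<in> {- b..0}" "j < k"
  shows "\<xi> \<in> hist b k \<Longrightarrow> hist_add b \<chi> \<xi> \<theta> $ j = \<chi> \<theta> $ j + \<xi> \<theta> $ j"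
    and "\<chi> \<in> hist b k \<Longrightarrow> hist_smult b a \<chi> \<theta> $ j = a * \<chi> \<theta> $ j"
  using assms histD(2)[OF _ assms(1), of \<xi> k] histD(2)[OF _ assms(1), of \<chi> k]
  by (simp_all only: hist_add_apply hist_smult_apply index_add_vec index_smult_vec)

lemma hist_closed:
  assumes "\<chi> \<in> hist b k"
  shows "\<xi> \<in> hist b k \<Longrightarrow> hist_add b \<chi> \<xi> \<in> hist b k" "hist_smult b a \<chi> \<in> hist b k"
proof -
  assume xi: "\<xi> \<in> hist b k"
  have "continuous_on {- b..0} (\<lambda>\<theta>. hist_add b \<chi> \<xi> \<theta> $ j)" if j: "j < k" for j
  proof -
    have "continuous_on {- b..0} (\<lambda>\<theta>. \<chi> \<theta> $ j + \<xi> \<theta> $ j)"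
      by (intro continuous_intros histD(3)[OF assms j] histD(3)[OF xi j])
    then show ?thesis by (rule continuous_on_eq) (simp only: hist_coord(1)[OF _ j xi])
  qed
  then show "hist_add b \<chi> \<xi> \<in> hist b k"
    using histD(1)[OF assms] histD(1)[OF xi] by (simp add: hist_def hist_add_def)
next
  have "continuous_on {- b..0} (\<lambda>\<theta>. hist_smult b a \<chi> \<theta> $ j)" if j: "j < k" for j
  proof -
    have "continuous_on {- b..0} (\<lambda>\<theta>. a * \<chi> \<theta> $ j)"
      by (intro continuous_intros histD(3)[OF assms j])
    then show ?thesis by (rule continuous_on_eq) (simp only: hist_coord(2)[OF _ j assms])
  qed
  then show "hist_smult b a \<chi> \<in> hist b k"
    using histD(1)[OF assms] by (simp add: hist_def hist_smult_def)
qed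

lemma hist_coord_le:
  assumes "\<chi> \<in> hist b k" "\<theta> \<in> {- b..0}" "j < k"
  shows "\<bar>\<chi> \<theta> $ j\<bar> \<le> hist_norm b \<chi>"
proof -
  have "(\<chi> \<theta> $ j)\<^sup>2 \<le> \<chi> \<theta> \<bullet> \<chi> \<theta>"
    using assms(3) histD(2)[OF assms(1,2)] member_le_sum[of j "{..<k}" "\<lambda>i. (\<chi> \<theta> $ i)\<^sup>2"]
    by (simp add: scalar_prod_lessThan power2_eq_square)
  then have "\<bar>\<chi> \<theta> $ j\<bar> \<le> vnorm (\<chi> \<theta>)"
    unfolding vnorm_def by (intro real_le_rsqrt) simp
  then show ?thesis using hist_norm_ge[OF assms(1,2)] by simp
qed

text \<open>Passes to a nonnegative constant, whose sign \<open>bounded_functional\<close> leaves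
  open; this is what the product estimates below multiply.\<close>

lemma bounded_functionalD:
  assumes L: "bounded_functional b k L" and b: "b \<ge> 0"
  shows "\<exists>B\<ge>0. \<forall>\<chi>\<in>hist b k. \<bar>L \<chi>\<bar> \<le> B * hist_norm b \<chi>"
proof -
  obtain B where B: "\<forall>\<chi>\<in>hist b k. \<bar>L \<chi>\<bar> \<le> B * hist_norm b \<chi>"
    using L unfolding bounded_functional_def by blast
  have "\<bar>L \<chi>\<bar> \<le> \<bar>B\<bar> * hist_norm b \<chi>" if "\<chi> \<in> hist b k" for \<chi>
    using B that mult_right_mono[OF abs_ge_self[of B] hist_norm_nonneg[OF b that]] by fastforce
  then show ?thesis by (intro exI[of _ "\<bar>B\<bar>"]) auto
qed

lemma bounded_functional_linear:
  assumes "bounded_functional b k L"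
  shows "\<chi> \<in> hist b k \<Longrightarrow> \<xi> \<in> hist b k \<Longrightarrow> L (hist_add b \<chi> \<xi>) = L \<chi> + L \<xi>"
    "\<chi> \<in> hist b k \<Longrightarrow> L (hist_smult b a \<chi>) = a * L \<chi>"
  using assms by (simp_all add: bounded_functional_def)

lemma bounded_functional_cong:
  assumes L: "bounded_functional b k L" and e: "\<And>\<chi>. \<chi> \<in> hist b k \<Longrightarrow> L' \<chi> = L \<chi>"
  shows "bounded_functional b k L'"
  using L unfolding bounded_functional_def by (simp add: e hist_closed)

lemma bounded_functional_eval:
  assumes "\<theta> \<in> {- b..0}" "j < k"
  shows "bounded_functional b k (\<lambda>\<chi>. \<chi> \<theta> $ j)"
  unfolding bounded_functional_def
  using hist_coord[OF assms] hist_coord_le[OF _ assms] by (auto intro!: exI[of _ 1])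

text \<open>On a compact interval square integrability implies integrability, and
  \<open>\<integral> \<bar>e\<bar>\<close> bounds the functional in the sup norm.\<close>

lemma bounded_functional_integral:
  assumes e: "L2_scalar {u..v} e" and uv: "{u..v} \<subseteq> {- b..0}" and j: "j < k"
  shows "bounded_functional b k (\<lambda>\<chi>. LINT \<tau>|lebesgue_on {u..v}. e \<tau> * \<chi> \<tau> $ j)"
proof -
  have c: "continuous_on {u..v} (\<lambda>\<theta>. \<chi> \<theta> $ j)" if "\<chi> \<in> hist b k" for \<chi>
    using continuous_on_subset[OF histD(3)[OF that j] uv] .
  have ei: "integrable (lebesgue_on {u..v}) e" by (rule L2_scalar_integrable[OF e])
  have int: "integrable (lebesgue_on {u..v}) (\<lambda>\<tau>. e \<tau> * \<chi> \<tau> $ j)" if "\<chi> \<in> hist b k" for \<chi>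
    by (rule integrable_mult_continuous[OF ei c[OF that]])
  show ?thesis
    unfolding bounded_functional_def
  proof (intro conjI ballI allI)
    fix \<chi> assume chi: "\<chi> \<in> hist b k"
    show "(LINT \<tau>|lebesgue_on {u..v}. e \<tau> * hist_smult b a \<chi> \<tau> $ j) = a * (LINT \<tau>|lebesgue_on {u..v}. e \<tau> * \<chi> \<tau> $ j)" for a
      unfolding Bochner_Integration.integral_mult_right_zero[symmetric]
      by (rule Bochner_Integration.integral_cong[OF refl]) (use uv hist_coord(2)[OF _ j chi] in auto)
    fix \<xi> assume xi: "\<xi> \<in> hist b k"
    show "(LINT \<tau>|lebesgue_on {u..v}. e \<tau> * hist_add b \<chi> \<xi> \<tau> $ j)
        = (LINT \<tau>|lebesgue_on {u..v}. e \<tau> * \<chi> \<tau> $ j) + (LINT \<tau>|lebesgue_on {u..v}. e \<tau> * \<xi> \<tau> $ j)"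
      unfolding Bochner_Integration.integral_add[OF int[OF chi] int[OF xi], symmetric]
      by (rule Bochner_Integration.integral_cong[OF refl]) (use uv hist_coord(1)[OF _ j xi] in \<open>auto simp: distrib_left\<close>)
  next
    have "\<bar>LINT \<tau>|lebesgue_on {u..v}. e \<tau> * \<chi> \<tau> $ j\<bar> \<le> (LINT \<tau>|lebesgue_on {u..v}. \<bar>e \<tau>\<bar>) * hist_norm b \<chi>"
      if chi: "\<chi> \<in> hist b k" for \<chi>
    proof -
      have "\<bar>LINT \<tau>|lebesgue_on {u..v}. e \<tau> * \<chi> \<tau> $ j\<bar> \<le> (LINT \<tau>|lebesgue_on {u..v}. \<bar>e \<tau> * \<chi> \<tau> $ j\<bar>)"
        by (rule integral_abs_bound)
      also have "\<dots> \<le> (LINT \<tau>|lebesgue_on {u..v}. \<bar>e \<tau>\<bar> * hist_norm b \<chi>)"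
      proof (rule integral_mono)
        show "integrable (lebesgue_on {u..v}) (\<lambda>\<tau>. \<bar>e \<tau> * \<chi> \<tau> $ j\<bar>)"
          by (rule integrable_abs[OF int[OF chi]])
        show "integrable (lebesgue_on {u..v}) (\<lambda>\<tau>. \<bar>e \<tau>\<bar> * hist_norm b \<chi>)" using ei by simp
        show "\<bar>e \<tau> * \<chi> \<tau> $ j\<bar> \<le> \<bar>e \<tau>\<bar> * hist_norm b \<chi>" if "\<tau> \<in> space (lebesgue_on {u..v})" for \<tau>
          unfolding abs_mult using that uv by (intro mult_left_mono hist_coord_le[OF chi _ j]) auto
      qed
      finally show ?thesis by simp
    qed
    then show "\<exists>B. \<forall>\<chi>\<in>hist b k. \<bar>LINT \<tau>|lebesgue_on {u..v}. e \<tau> * \<chi> \<tau> $ j\<bar> \<le> B * hist_norm b \<chi>"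
      by blast
  qed
qed

definition bounded_bilinear_form :: "real \<Rightarrow> nat \<Rightarrow> ((real \<Rightarrow> real vec) \<Rightarrow> (real \<Rightarrow> real vec) \<Rightarrow> real) \<Rightarrow> bool" where
  "bounded_bilinear_form b k B \<longleftrightarrow>
    (\<forall>\<chi>\<in>hist b k. \<forall>\<xi>\<in>hist b k. \<forall>\<omega>\<in>hist b k.
      B (hist_add b \<chi> \<xi>) \<omega> = B \<chi> \<omega> + B \<xi> \<omega> \<and> B \<omega> (hist_add b \<chi> \<xi>) = B \<omega> \<chi> + B \<omega> \<xi>) \<and>
    (\<forall>a. \<forall>\<chi>\<in>hist b k. \<forall>\<omega>\<in>hist b k. B (hist_smult b a \<chi>) \<omega> = a * B \<chi> \<omega> \<and> B \<omega> (hist_smult b a \<chi>) = a * B \<omega> \<chi>) \<and>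
    (\<exists>C\<ge>0. \<forall>\<chi>\<in>hist b k. \<forall>\<omega>\<in>hist b k. \<bar>B \<chi> \<omega>\<bar> \<le> C * (hist_norm b \<chi> * hist_norm b \<omega>))"

lemma bounded_bilinear_formD:
  assumes B: "bounded_bilinear_form b k B"
  shows "\<chi> \<in> hist b k \<Longrightarrow> \<xi> \<in> hist b k \<Longrightarrow> \<omega> \<in> hist b k \<Longrightarrow> B (hist_add b \<chi> \<xi>) \<omega> = B \<chi> \<omega> + B \<xi> \<omega>"
    "\<chi> \<in> hist b k \<Longrightarrow> \<xi> \<in> hist b k \<Longrightarrow> \<omega> \<in> hist b k \<Longrightarrow> B \<omega> (hist_add b \<chi> \<xi>) = B \<omega> \<chi> + B \<omega> \<xi>"
    "\<chi> \<in> hist b k \<Longrightarrow> \<omega> \<in> hist b k \<Longrightarrow> B (hist_smult b a \<chi>) \<omega> = a * B \<chi> \<omega>"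
    "\<chi> \<in> hist b k \<Longrightarrow> \<omega> \<in> hist b k \<Longrightarrow> B \<omega> (hist_smult b a \<chi>) = a * B \<omega> \<chi>"
    "\<exists>C\<ge>0. \<forall>\<chi>\<in>hist b k. \<forall>\<omega>\<in>hist b k. \<bar>B \<chi> \<omega>\<bar> \<le> C * (hist_norm b \<chi> * hist_norm b \<omega>)"
  using B by (simp_all add: bounded_bilinear_form_def)

lemma bounded_bilinear_form_add:
  assumes "b \<ge> 0" "bounded_bilinear_form b k B" "bounded_bilinear_form b k B'"
  shows "bounded_bilinear_form b k (\<lambda>\<chi> \<omega>. B \<chi> \<omega> + B' \<chi> \<omega>)"
proof -
  obtain C C' where C: "C \<ge> 0" "C' \<ge> 0" "\<And>\<chi> \<omega>. \<chi> \<in> hist b k \<Longrightarrow> \<omega> \<in> hist b k \<Longrightarrow> \<bar>B \<chi> \<omega>\<bar> \<le> C * (hist_norm b \<chi> * hist_norm b \<omega>)"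
    "\<And>\<chi> \<omega>. \<chi> \<in> hist b k \<Longrightarrow> \<omega> \<in> hist b k \<Longrightarrow> \<bar>B' \<chi> \<omega>\<bar> \<le> C' * (hist_norm b \<chi> * hist_norm b \<omega>)"
    using bounded_bilinear_formD(5)[OF assms(2)] bounded_bilinear_formD(5)[OF assms(3)] by metis
  have "\<bar>B \<chi> \<omega> + B' \<chi> \<omega>\<bar> \<le> (C + C') * (hist_norm b \<chi> * hist_norm b \<omega>)"
    if "\<chi> \<in> hist b k" "\<omega> \<in> hist b k" for \<chi> \<omega>
    using C(3,4)[OF that] unfolding distrib_right by linarith
  then have "\<exists>C\<ge>0. \<forall>\<chi>\<in>hist b k. \<forall>\<omega>\<in>hist b k. \<bar>B \<chi> \<omega> + B' \<chi> \<omega>\<bar> \<le> C * (hist_norm b \<chi> * hist_norm b \<omega>)"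
    using C(1,2) by (intro exI[of _ "C + C'"]) auto
  then show ?thesis
    using bounded_bilinear_formD[OF assms(2)] bounded_bilinear_formD[OF assms(3)]
    unfolding bounded_bilinear_form_def[of _ _ "\<lambda>\<chi> \<omega>. B \<chi> \<omega> + B' \<chi> \<omega>"] by (simp add: algebra_simps)
qed

lemma bounded_bilinear_form_zero: "bounded_bilinear_form b k (\<lambda>\<chi> \<omega>. 0)"
  by (auto simp: bounded_bilinear_form_def)

lemma bounded_bilinear_form_sum:
  assumes "b \<ge> 0"
  shows "finite I \<Longrightarrow> (\<And>i. i \<in> I \<Longrightarrow> bounded_bilinear_form b k (B i)) \<Longrightarrow>
    bounded_bilinear_form b k (\<lambda>\<chi> \<omega>. \<Sum>i\<in>I. B i \<chi> \<omega>)"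
proof (induction I rule: finite_induct)
  case (insert i I)
  then have "bounded_bilinear_form b k (\<lambda>\<chi> \<omega>. B i \<chi> \<omega> + (\<Sum>i\<in>I. B i \<chi> \<omega>))"
    by (intro bounded_bilinear_form_add[OF assms]) auto
  with insert(1,2) show ?case by simp
qed (simp add: bounded_bilinear_form_zero)

lemma bounded_bilinear_form_prod:
  assumes b: "b \<ge> 0" and L: "bounded_functional b k L" and L': "bounded_functional b k L'"
  shows "bounded_bilinear_form b k (\<lambda>\<chi> \<omega>. a * (L \<chi> * L' \<omega>))"
proof -
  obtain C C' where C: "C \<ge> 0" "C' \<ge> 0" "\<And>\<chi>. \<chi> \<in> hist b k \<Longrightarrow> \<bar>L \<chi>\<bar> \<le> C * hist_norm b \<chi>"
    "\<And>\<chi>. \<chi> \<in> hist b k \<Longrightarrow> \<bar>L' \<chi>\<bar> \<le> C' * hist_norm b \<chi>"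
    using bounded_functionalD[OF L b] bounded_functionalD[OF L' b] by blast
  have "\<bar>a * (L \<chi> * L' \<omega>)\<bar> \<le> (\<bar>a\<bar> * (C * C')) * (hist_norm b \<chi> * hist_norm b \<omega>)"
    if "\<chi> \<in> hist b k" "\<omega> \<in> hist b k" for \<chi> \<omega>
  proof -
    have "\<bar>L \<chi>\<bar> * \<bar>L' \<omega>\<bar> \<le> (C * hist_norm b \<chi>) * (C' * hist_norm b \<omega>)"
      using C hist_norm_nonneg[OF b] that by (intro mult_mono) auto
    then have "\<bar>a\<bar> * (\<bar>L \<chi>\<bar> * \<bar>L' \<omega>\<bar>) \<le> \<bar>a\<bar> * ((C * hist_norm b \<chi>) * (C' * hist_norm b \<omega>))"
      by (rule mult_left_mono) simp
    then show ?thesis by (simp add: abs_mult ac_simps)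
  qed
  then have "\<exists>D\<ge>0. \<forall>\<chi>\<in>hist b k. \<forall>\<omega>\<in>hist b k. \<bar>a * (L \<chi> * L' \<omega>)\<bar> \<le> D * (hist_norm b \<chi> * hist_norm b \<omega>)"
    using C(1,2) by (intro exI[of _ "\<bar>a\<bar> * (C * C')"]) auto
  moreover have "L (hist_add b \<chi> \<xi>) = L \<chi> + L \<xi>" "L' (hist_add b \<chi> \<xi>) = L' \<chi> + L' \<xi>"
    if "\<chi> \<in> hist b k" "\<xi> \<in> hist b k" for \<chi> \<xi>
    using L L' that unfolding bounded_functional_def by blast+
  moreover have "L (hist_smult b a \<chi>) = a * L \<chi>" "L' (hist_smult b a \<chi>) = a * L' \<chi>"
    if "\<chi> \<in> hist b k" for \<chi> a
    using L L' that unfolding bounded_functional_def by blast+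
  ultimately show ?thesis
    unfolding bounded_bilinear_form_def by (simp add: algebra_simps)
qed

text \<open>Freezing one argument leaves a functional with a continuous kernel, which gives
  linearity in each slot. The joint bound is estimated directly.\<close>

lemma bounded_bilinear_form_integral:
  assumes b: "b \<ge> 0" and g: "continuous_on {u..v} g" and uv: "{u..v} \<subseteq> {- b..0}" and j: "j < k" and l: "l < k"
  shows "bounded_bilinear_form b k (\<lambda>\<chi> \<omega>. LINT \<tau>|lebesgue_on {u..v}. g \<tau> * (\<chi> \<tau> $ j * \<omega> \<tau> $ l))"
proof -
  have c: "continuous_on {u..v} (\<lambda>\<theta>. \<chi> \<theta> $ j)" if "\<chi> \<in> hist b k" "j < k" for \<chi> j
    using continuous_on_subset[OF histD(3)[OF that] uv] .
  have lin: "bounded_functional b k (\<lambda>\<omega>. LINT \<tau>|lebesgue_on {u..v}. (g \<tau> * \<chi> \<tau> $ j) * \<omega> \<tau> $ l)"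
    if "\<chi> \<in> hist b k" "j < k" "l < k" for \<chi> j l
    by (intro bounded_functional_integral continuous_L2_scalar continuous_intros g c uv that)
  have sw: "(LINT \<tau>|lebesgue_on {u..v}. g \<tau> * (\<chi> \<tau> $ j * \<omega> \<tau> $ l)) = (LINT \<tau>|lebesgue_on {u..v}. (g \<tau> * \<omega> \<tau> $ l) * \<chi> \<tau> $ j)"
    "(LINT \<tau>|lebesgue_on {u..v}. g \<tau> * (\<chi> \<tau> $ j * \<omega> \<tau> $ l)) = (LINT \<tau>|lebesgue_on {u..v}. (g \<tau> * \<chi> \<tau> $ j) * \<omega> \<tau> $ l)" for \<chi> \<omega>
    by (intro Bochner_Integration.integral_cong refl; simp add: ac_simps)+
  have gi: "integrable (lebesgue_on {u..v}) (\<lambda>\<tau>. \<bar>g \<tau>\<bar>)"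
    by (intro continuous_integrable_on_Icc continuous_intros g)
  have "\<bar>LINT \<tau>|lebesgue_on {u..v}. g \<tau> * (\<chi> \<tau> $ j * \<omega> \<tau> $ l)\<bar> \<le> (LINT \<tau>|lebesgue_on {u..v}. \<bar>g \<tau>\<bar>) * (hist_norm b \<chi> * hist_norm b \<omega>)"
    if h: "\<chi> \<in> hist b k" "\<omega> \<in> hist b k" for \<chi> \<omega>
  proof -
    have "\<bar>LINT \<tau>|lebesgue_on {u..v}. g \<tau> * (\<chi> \<tau> $ j * \<omega> \<tau> $ l)\<bar> \<le> (LINT \<tau>|lebesgue_on {u..v}. \<bar>g \<tau> * (\<chi> \<tau> $ j * \<omega> \<tau> $ l)\<bar>)"
      by (rule integral_abs_bound)
    also have "\<dots> \<le> (LINT \<tau>|lebesgue_on {u..v}. \<bar>g \<tau>\<bar> * (hist_norm b \<chi> * hist_norm b \<omega>))"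
    proof (rule integral_mono)
      show "integrable (lebesgue_on {u..v}) (\<lambda>\<tau>. \<bar>g \<tau> * (\<chi> \<tau> $ j * \<omega> \<tau> $ l)\<bar>)"
        by (intro continuous_integrable_on_Icc continuous_intros g c h j l)
      show "integrable (lebesgue_on {u..v}) (\<lambda>\<tau>. \<bar>g \<tau>\<bar> * (hist_norm b \<chi> * hist_norm b \<omega>))" using gi by simp
      fix \<tau> assume "\<tau> \<in> space (lebesgue_on {u..v})"
      then have "\<tau> \<in> {- b..0}" using uv by auto
      then have "\<bar>\<chi> \<tau> $ j\<bar> * \<bar>\<omega> \<tau> $ l\<bar> \<le> hist_norm b \<chi> * hist_norm b \<omega>"
        using hist_coord_le[OF h(1) _ j] hist_coord_le[OF h(2) _ l] hist_norm_nonneg[OF b h(1)] by (intro mult_mono) auto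
      then show "\<bar>g \<tau> * (\<chi> \<tau> $ j * \<omega> \<tau> $ l)\<bar> \<le> \<bar>g \<tau>\<bar> * (hist_norm b \<chi> * hist_norm b \<omega>)"
        unfolding abs_mult by (rule mult_left_mono) simp
    qed
    finally show ?thesis by simp
  qed
  moreover have "(LINT \<tau>|lebesgue_on {u..v}. \<bar>g \<tau>\<bar>) \<ge> 0" by simp
  ultimately have ex: "\<exists>C\<ge>0. \<forall>\<chi>\<in>hist b k. \<forall>\<omega>\<in>hist b k.
      \<bar>LINT \<tau>|lebesgue_on {u..v}. g \<tau> * (\<chi> \<tau> $ j * \<omega> \<tau> $ l)\<bar> \<le> C * (hist_norm b \<chi> * hist_norm b \<omega>)" by blast
  have l1: "bounded_functional b k (\<lambda>\<chi>. LINT \<tau>|lebesgue_on {u..v}. g \<tau> * (\<chi> \<tau> $ j * \<omega> \<tau> $ l))"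
    if "\<omega> \<in> hist b k" for \<omega> by (rule bounded_functional_cong[OF lin[OF that l j] sw(1)])
  have l2: "bounded_functional b k (\<lambda>\<omega>. LINT \<tau>|lebesgue_on {u..v}. g \<tau> * (\<chi> \<tau> $ j * \<omega> \<tau> $ l))"
    if "\<chi> \<in> hist b k" for \<chi> by (rule bounded_functional_cong[OF lin[OF that j l] sw(2)])
  show ?thesis
    unfolding bounded_bilinear_form_def
    using bounded_functional_linear[OF l1] bounded_functional_linear[OF l2] ex by simp
qed

text \<open>The derivative at \<chi> is \<open>B \<chi> \<xi> + B \<xi> \<chi>\<close>, symmetrised
  since \<open>B\<close> may be nonsymmetric. The remainder \<open>B \<xi> \<xi>\<close> is of
  second order, and the derivative depends linearly and boundedly on \<chi>.\<close>

lemma C1_functional_bilinear: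
  assumes b: "b \<ge> 0" and B: "bounded_bilinear_form b k B" and v: "\<And>\<chi>. \<chi> \<in> hist b k \<Longrightarrow> v \<chi> = B \<chi> \<chi>"
  shows "C1_functional b k v"
proof -
  obtain C where C: "C \<ge> 0" "\<And>\<chi> \<omega>. \<chi> \<in> hist b k \<Longrightarrow> \<omega> \<in> hist b k \<Longrightarrow> \<bar>B \<chi> \<omega>\<bar> \<le> C * (hist_norm b \<chi> * hist_norm b \<omega>)"
    using B unfolding bounded_bilinear_form_def by blast
  have a1: "B (hist_add b \<chi> \<xi>) \<omega> = B \<chi> \<omega> + B \<xi> \<omega>" "B \<omega> (hist_add b \<chi> \<xi>) = B \<omega> \<chi> + B \<omega> \<xi>"
    if "\<chi> \<in> hist b k" "\<xi> \<in> hist b k" "\<omega> \<in> hist b k" for \<chi> \<xi> \<omega>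
    using B that unfolding bounded_bilinear_form_def by blast+
  have s1: "B (hist_smult b a \<chi>) \<omega> = a * B \<chi> \<omega>" "B \<omega> (hist_smult b a \<chi>) = a * B \<omega> \<chi>"
    if "\<chi> \<in> hist b k" "\<omega> \<in> hist b k" for a \<chi> \<omega>
    using B that unfolding bounded_bilinear_form_def by blast+
  have D: "\<bar>B \<chi> \<xi> + B \<xi> \<chi>\<bar> \<le> (2 * C * hist_norm b \<chi>) * hist_norm b \<xi>" if "\<chi> \<in> hist b k" "\<xi> \<in> hist b k" for \<chi> \<xi>
    using C(2)[OF that] C(2)[OF that(2,1)] by (simp add: algebra_simps)
  \<comment> \<open>The denominator \<open>2 * C + 1\<close> is positive even when
    \<open>C = 0\<close>.\<close>
  have small: "2 * C * hist_norm b \<omega> \<le> \<epsilon>" if "hist_norm b \<omega> < \<epsilon> / (2 * C + 1)" "\<omega> \<in> hist b k" for \<omega> \<epsilon>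
  proof -
    have "(2 * C + 1) * hist_norm b \<omega> < \<epsilon>" using that(1) C(1) by (simp add: field_simps)
    then show ?thesis using hist_norm_nonneg[OF b that(2)] by (simp add: algebra_simps)
  qed
  show ?thesis
    unfolding C1_functional_def
  proof (intro exI[of _ "\<lambda>\<chi> \<xi>. B \<chi> \<xi> + B \<xi> \<chi>"] conjI ballI allI impI)
    fix \<chi> assume chi: "\<chi> \<in> hist b k"
    show "bounded_functional b k (\<lambda>\<xi>. B \<chi> \<xi> + B \<xi> \<chi>)"
      unfolding bounded_functional_def using D[OF chi]
      by (auto simp: a1 s1 chi algebra_simps intro!: exI[of _ "2 * C * hist_norm b \<chi>"])
    fix \<epsilon> :: real assume e: "\<epsilon> > 0"
    have d: "\<epsilon> / (2 * C + 1) > 0" using e C(1) by simp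
    show "\<exists>\<delta>>0. \<forall>\<xi>\<in>hist b k. hist_norm b \<xi> < \<delta> \<longrightarrow>
        \<bar>v (hist_add b \<chi> \<xi>) - v \<chi> - (B \<chi> \<xi> + B \<xi> \<chi>)\<bar> \<le> \<epsilon> * hist_norm b \<xi>"
    proof (intro exI[of _ "\<epsilon> / (2 * C + 1)"] conjI ballI impI d)
      fix \<xi> assume xi: "\<xi> \<in> hist b k" and s: "hist_norm b \<xi> < \<epsilon> / (2 * C + 1)"
      have "v (hist_add b \<chi> \<xi>) - v \<chi> - (B \<chi> \<xi> + B \<xi> \<chi>) = B \<xi> \<xi>"
        by (simp add: v chi xi a1 hist_closed)
      moreover have "\<bar>B \<xi> \<xi>\<bar> \<le> 2 * C * hist_norm b \<xi> * hist_norm b \<xi>"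
        using D[OF xi xi] by simp
      moreover have "2 * C * hist_norm b \<xi> * hist_norm b \<xi> \<le> \<epsilon> * hist_norm b \<xi>"
        by (rule mult_right_mono[OF small[OF s xi] hist_norm_nonneg[OF b xi]])
      ultimately show "\<bar>v (hist_add b \<chi> \<xi>) - v \<chi> - (B \<chi> \<xi> + B \<xi> \<chi>)\<bar> \<le> \<epsilon> * hist_norm b \<xi>" by simp
    qed
    show "\<exists>\<delta>>0. \<forall>\<omega>\<in>hist b k. hist_norm b \<omega> < \<delta> \<longrightarrow> (\<forall>\<xi>\<in>hist b k.
        \<bar>B (hist_add b \<chi> \<omega>) \<xi> + B \<xi> (hist_add b \<chi> \<omega>) - (B \<chi> \<xi> + B \<xi> \<chi>)\<bar> \<le> \<epsilon> * hist_norm b \<xi>)"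
    proof (intro exI[of _ "\<epsilon> / (2 * C + 1)"] conjI ballI impI d)
      fix \<omega> \<xi> assume om: "\<omega> \<in> hist b k" and s: "hist_norm b \<omega> < \<epsilon> / (2 * C + 1)" and xi: "\<xi> \<in> hist b k"
      have "B (hist_add b \<chi> \<omega>) \<xi> + B \<xi> (hist_add b \<chi> \<omega>) - (B \<chi> \<xi> + B \<xi> \<chi>) = B \<omega> \<xi> + B \<xi> \<omega>"
        by (simp add: chi xi om a1)
      moreover have "2 * C * hist_norm b \<omega> * hist_norm b \<xi> \<le> \<epsilon> * hist_norm b \<xi>"
        by (rule mult_right_mono[OF small[OF s om] hist_norm_nonneg[OF b xi]])
      ultimately show "\<bar>B (hist_add b \<chi> \<omega>) \<xi> + B \<xi> (hist_add b \<chi> \<omega>) - (B \<chi> \<xi> + B \<xi> \<chi>)\<bar> \<le> \<epsilon> * hist_norm b \<xi>"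
        using D[OF om xi] by simp
    qed
  qed
qed

lemma bounded_functional_vcat:
  assumes b: "\<And>i. i \<in> set is \<Longrightarrow> (\<forall>\<chi>\<in>hist c k. dim_vec (u i \<chi>) = l i) \<and> (\<forall>j<l i. bounded_functional c k (\<lambda>\<chi>. u i \<chi> $ j))"
  shows "j < sum_list (map l is) \<Longrightarrow> bounded_functional c k (\<lambda>\<chi>. vcat (map (\<lambda>i. u i \<chi>) is) $ j)"
  using b
proof (induction "is" arbitrary: j)
  case (Cons i "is")
  have d: "dim_vec (u i \<chi>) = l i" "sum_list (map (\<lambda>i. dim_vec (u i \<chi>)) is) = sum_list (map l is)" if "\<chi> \<in> hist c k" for \<chi>
    using Cons.prems(2) that by (auto intro!: arg_cong[where f=sum_list])
  show ?case
  proof (cases "j < l i")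
    case True
    then have "bounded_functional c k (\<lambda>\<chi>. u i \<chi> $ j)" using Cons.prems(2) by auto
    then show ?thesis by (rule bounded_functional_cong) (use True Cons.prems(1) d in \<open>simp add: o_def\<close>)
  next
    case False
    then have "bounded_functional c k (\<lambda>\<chi>. vcat (map (\<lambda>i. u i \<chi>) is) $ (j - l i))"
      using Cons.prems by (intro Cons.IH) auto
    then show ?thesis by (rule bounded_functional_cong) (use False Cons.prems(1) d in \<open>simp add: o_def\<close>)
  qed
qed simp

section \<open>The storage functional as a bounded quadratic functional\<close>

context synthesis begin

text \<open>At time 0 the functional is a form in the vector \<open>U \<chi>\<close>, whose entries
  are bounded linear functionals, plus integrals of products of coordinates of \<chi>. Inserting two
  histories instead of one gives the bilinear form.\<close>

lemma Vf_bilinear: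
  "\<exists>B. bounded_bilinear_form (r \<nu>) n B \<and>
    (\<forall>\<chi>\<in>hist (r \<nu>) n. Vf \<eta> (\<lambda>s. \<chi> (max (- r \<nu>) (min s 0))) 0 = B \<chi> \<chi>)"
proof -
  have rn: "r \<nu> \<ge> 0" using r_mono[of 0 \<nu>] sysD(6) by simp
  define ext where "ext \<chi> s = \<chi> (max (- r \<nu>) (min s 0))" for \<chi> :: "real \<Rightarrow> real vec" and s :: real
  have ext: "ext \<chi> \<theta> = \<chi> \<theta>" if "\<theta> \<in> {- r \<nu>..0}" for \<chi> \<theta> using that by (simp add: ext_def)
  have cext: "curve (ext \<chi>)" if chi: "\<chi> \<in> hist (r \<nu>) n" for \<chi>
    unfolding curve_def
  proof (intro conjI allI impI)
    show "dim_vec (ext \<chi> s) = n" for s unfolding ext_def by (rule histD(2)[OF chi]) (use rn in auto)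
    show "continuous_on UNIV (\<lambda>s. ext \<chi> s $ j)" if "j < n" for j
      unfolding ext_def
      by (rule continuous_on_compose2[OF histD(3)[OF chi that]]) (use rn in \<open>auto intro!: continuous_intros\<close>)
  qed
  have sub: "{- r i..- r (i - 1)} \<subseteq> {- r \<nu>..0}" if "i \<in> {1..\<nu>}" for i
    using Ivl_subset[OF that] by (auto simp only: Ivl_eq)
  let ?K = "n + d_tot S * n"
  let ?P = "four_block_mat P1 P2 P2\<^sup>T P3"
  define U where "U \<chi> = ext \<chi> 0 @\<^sub>v Yf (ext \<chi>) 0" for \<chi>
  have dU: "dim_vec (U \<chi>) = ?K" if "\<chi> \<in> hist (r \<nu>) n" for \<chi> using curveD(1)[OF cext[OF that]] by (simp add: U_def)
  have bY: "bounded_functional (r \<nu>) n (\<lambda>\<chi>. Yf (ext \<chi>) 0 $ j)" if j: "j < d_tot S * n" for j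
    unfolding Yf_def
  proof (rule bounded_functional_vcat[where l="\<lambda>i. d i * n"])
    show "j < sum_list (map (\<lambda>i. d i * n) ix)" using j by (simp add: sum_list_upt d_tot_def sum_distrib_right)
    fix i assume "i \<in> set ix"
    then have i: "i \<in> {1..\<nu>}" by simp
    show "(\<forall>\<chi>\<in>hist (r \<nu>) n. dim_vec (Kv i (d i) (ff i) (ext \<chi>) 0) = d i * n) \<and>
        (\<forall>j<d i * n. bounded_functional (r \<nu>) n (\<lambda>\<chi>. Kv i (d i) (ff i) (ext \<chi>) 0 $ j))"
    proof (intro conjI ballI allI impI)
      fix j assume "j < d i * n"
      then have ll: "j div n < d i" "j mod n < n" "j = j div n * n + j mod n"
        by (auto simp: div_less_of_less_mult mod_less_of_less_mult)
      have "bounded_functional (r \<nu>) n (\<lambda>\<chi>. LINT \<tau>|lebesgue_on {- r i..- r (i - 1)}. ff i \<tau> $ (j div n) * \<chi> \<tau> $ (j mod n))"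
        using L2_vecD(2)[OF L2_funs(7)[OF i] ll(1)] sub[OF i] ll(2)
        by (intro bounded_functional_integral) (simp_all only: Ivl_eq)
      then show "bounded_functional (r \<nu>) n (\<lambda>\<chi>. Kv i (d i) (ff i) (ext \<chi>) 0 $ j)"
      proof (rule bounded_functional_cong)
        fix \<chi> assume chi: "\<chi> \<in> hist (r \<nu>) n"
        have "Kv i (d i) (ff i) (ext \<chi>) 0 $ j = (LINT \<tau>|lebesgue_on {- r i..- r (i - 1)}. ff i \<tau> $ (j div n) * ext \<chi> (0 + \<tau>) $ (j mod n))"
          using Kv_index[OF L2_funs(7)[OF i] cext[OF chi] ll(1,2)] ll(3) by (simp only: Ivl_eq)
        also have "\<dots> = (LINT \<tau>|lebesgue_on {- r i..- r (i - 1)}. ff i \<tau> $ (j div n) * \<chi> \<tau> $ (j mod n))"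
          by (rule Bochner_Integration.integral_cong[OF refl]) (use sub[OF i] in \<open>auto simp: ext subset_iff\<close>)
        finally show "Kv i (d i) (ff i) (ext \<chi>) 0 $ j = (LINT \<tau>|lebesgue_on {- r i..- r (i - 1)}. ff i \<tau> $ (j div n) * \<chi> \<tau> $ (j mod n))" .
      qed
    qed simp
  qed
  have bU: "bounded_functional (r \<nu>) n (\<lambda>\<chi>. U \<chi> $ j)" if j: "j < ?K" for j
  proof (cases "j < n")
    case True
    have "bounded_functional (r \<nu>) n (\<lambda>\<chi>. \<chi> 0 $ j)" by (rule bounded_functional_eval[OF _ True]) (use rn in simp)
    then show ?thesis
      by (rule bounded_functional_cong) (use True rn ext[of 0] histD(2)[of _ "r \<nu>" n 0] in \<open>simp add: U_def\<close>)
  next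
    case False
    then have "bounded_functional (r \<nu>) n (\<lambda>\<chi>. Yf (ext \<chi>) 0 $ (j - n))" using j by (intro bY) auto
    then show ?thesis
      by (rule bounded_functional_cong) (use False j curveD(1)[OF cext] in \<open>simp add: U_def\<close>)
  qed
  have "bounded_bilinear_form (r \<nu>) n (\<lambda>\<chi> \<omega>. \<Sum>i<?K. \<Sum>j<?K. ?P $$ (i, j) * (U \<chi> $ i * U \<omega> $ j))"
    by (intro bounded_bilinear_form_sum[OF rn] finite_lessThan bounded_bilinear_form_prod[OF rn] bU) simp_all
  moreover have "bounded_bilinear_form (r \<nu>) n (\<lambda>\<chi> \<omega>. \<Sum>i=1..\<nu>. \<Sum>j<n. \<Sum>l<n.
      LINT \<tau>|lebesgue_on {- r i..- r (i - 1)}. (Q i $$ (j, l) + (\<tau> + r i) * R_reg \<eta> i $$ (j, l)) * (\<chi> \<tau> $ j * \<omega> \<tau> $ l))"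
    by (intro bounded_bilinear_form_sum[OF rn] finite_lessThan finite_atLeastAtMost
        bounded_bilinear_form_integral[OF rn] sub) (auto intro!: continuous_intros)
  ultimately have "bounded_bilinear_form (r \<nu>) n (\<lambda>\<chi> \<omega>. (\<Sum>i<?K. \<Sum>j<?K. ?P $$ (i, j) * (U \<chi> $ i * U \<omega> $ j))
    + (\<Sum>i=1..\<nu>. \<Sum>j<n. \<Sum>l<n.
      LINT \<tau>|lebesgue_on {- r i..- r (i - 1)}. (Q i $$ (j, l) + (\<tau> + r i) * R_reg \<eta> i $$ (j, l)) * (\<chi> \<tau> $ j * \<omega> \<tau> $ l)))"
    by (rule bounded_bilinear_form_add[OF rn])
  moreover have "Vf \<eta> (ext \<chi>) 0 = (\<Sum>i<?K. \<Sum>j<?K. ?P $$ (i, j) * (U \<chi> $ i * U \<chi> $ j))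
    + (\<Sum>i=1..\<nu>. \<Sum>j<n. \<Sum>l<n.
      LINT \<tau>|lebesgue_on {- r i..- r (i - 1)}. (Q i $$ (j, l) + (\<tau> + r i) * R_reg \<eta> i $$ (j, l)) * (\<chi> \<tau> $ j * \<chi> \<tau> $ l))"
    if chi: "\<chi> \<in> hist (r \<nu>) n" for \<chi>
  proof -
    have W: "Wf i (Q i) (R_reg \<eta> i) (ext \<chi>) 0 = (\<Sum>j<n. \<Sum>l<n.
        LINT \<tau>|lebesgue_on {- r i..- r (i - 1)}. (Q i $$ (j, l) + (\<tau> + r i) * R_reg \<eta> i $$ (j, l)) * (\<chi> \<tau> $ j * \<chi> \<tau> $ l))"
      if i: "i \<in> {1..\<nu>}" for i
    proof -
      have c: "continuous_on {- r i..- r (i - 1)} (\<lambda>\<tau>. \<chi> \<tau> $ j)" if "j < n" for j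
        by (rule continuous_on_subset[OF histD(3)[OF chi that] sub[OF i]])
      have "Wf i (Q i) (R_reg \<eta> i) (ext \<chi>) 0 = (LINT \<tau>|lebesgue_on {- r i..- r (i - 1)}.
          (\<Sum>j<n. \<Sum>l<n. (Q i $$ (j, l) + (\<tau> + r i) * R_reg \<eta> i $$ (j, l)) * (\<chi> \<tau> $ j * \<chi> \<tau> $ l)))"
        unfolding Wf_def Ivl_eq
      proof (rule Bochner_Integration.integral_cong[OF refl])
        fix \<tau> assume "\<tau> \<in> space (lebesgue_on {- r i..- r (i - 1)})"
        then have \<tau>: "\<tau> \<in> {- r \<nu>..0}" using sub[OF i] by (simp add: subset_iff)
        note dm = histD(2)[OF chi \<tau>]
        show "ext \<chi> (0 + \<tau>) \<bullet> (Q i *\<^sub>v ext \<chi> (0 + \<tau>)) + (\<tau> + r i) * (ext \<chi> (0 + \<tau>) \<bullet> (R_reg \<eta> i *\<^sub>v ext \<chi> (0 + \<tau>)))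
            = (\<Sum>j<n. \<Sum>l<n. (Q i $$ (j, l) + (\<tau> + r i) * R_reg \<eta> i $$ (j, l)) * (\<chi> \<tau> $ j * \<chi> \<tau> $ l))"
          unfolding add_0 ext[OF \<tau>] scalar_prod_mult_mat[OF unD_carrier(4)[OF i] dm dm] scalar_prod_mult_mat[OF R_reg(1)[OF i] dm dm]
          by (simp add: sum_distrib_left sum.distrib distrib_right mult.assoc)
      qed
      also have "\<dots> = (\<Sum>j<n. \<Sum>l<n.
        LINT \<tau>|lebesgue_on {- r i..- r (i - 1)}. (Q i $$ (j, l) + (\<tau> + r i) * R_reg \<eta> i $$ (j, l)) * (\<chi> \<tau> $ j * \<chi> \<tau> $ l))"
        by (intro LINT_double_sum continuous_integrable_on_Icc continuous_intros c) simp_all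
      finally show ?thesis .
    qed
    show ?thesis
      unfolding Vf_def U_def[symmetric] scalar_prod_mult_mat[OF PP_carrier dU[OF chi] dU[OF chi]]
      by (simp add: W)
  qed
  ultimately show ?thesis unfolding ext_def[abs_def] by blast
qed

text \<open>Multiplication by \<open>Y0\<close> is a bounded linear map of histories; composing both
  slots with it preserves bounded bilinear forms.\<close>

lemma storage_C1: "C1_functional (r \<nu>) n (storage \<eta>)"
proof -
  have rn: "r \<nu> \<ge> 0" using r_mono[of 0 \<nu>] sysD(6) by simp
  obtain B where B: "bounded_bilinear_form (r \<nu>) n B"
    "\<And>\<chi>. \<chi> \<in> hist (r \<nu>) n \<Longrightarrow> Vf \<eta> (\<lambda>s. \<chi> (max (- r \<nu>) (min s 0))) 0 = B \<chi> \<chi>"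
    using Vf_bilinear by blast
  obtain c where c: "c \<ge> 0" "\<And>v. v \<in> carrier_vec n \<Longrightarrow> vnorm (Y0 *\<^sub>v v) \<le> c * vnorm v"
    using Y0_hist_bound by blast
  \<comment> \<open>The restriction makes the result extensional, as membership in
    \<open>hist\<close> demands.\<close>
  define Y where "Y \<chi> = (\<lambda>\<theta>\<in>{- r \<nu>..0}. Y0 *\<^sub>v \<chi> \<theta>)" for \<chi>
  have Yin: "Y \<chi> \<in> hist (r \<nu>) n" if chi: "\<chi> \<in> hist (r \<nu>) n" for \<chi>
  proof -
    have "continuous_on {- r \<nu>..0} (\<lambda>\<theta>. Y \<chi> \<theta> $ j)" if j: "j < n" for j
    proof -
      have "continuous_on {- r \<nu>..0} (\<lambda>\<theta>. \<Sum>k<n. Y0 $$ (j, k) * \<chi> \<theta> $ k)"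
        by (intro continuous_intros histD(3)[OF chi]) simp
      then show ?thesis
        by (rule continuous_on_eq) (use j Y0(1) histD(2)[OF chi] in \<open>simp add: Y_def scalar_prod_lessThan\<close>)
    qed
    then show ?thesis
      using mult_mat_vec_carrier[OF Y0(1) histD(1)[OF chi]] by (simp add: hist_def Y_def)
  qed
  have Yn: "hist_norm (r \<nu>) (Y \<chi>) \<le> c * hist_norm (r \<nu>) \<chi>" if chi: "\<chi> \<in> hist (r \<nu>) n" for \<chi>
  proof (rule hist_norm_le[OF rn])
    fix \<theta> assume \<theta>: "\<theta> \<in> {- r \<nu>..0}"
    show "vnorm (Y \<chi> \<theta>) \<le> c * hist_norm (r \<nu>) \<chi>"
      using c(2)[OF histD(1)[OF chi \<theta>]] mult_left_mono[OF hist_norm_ge[OF chi \<theta>] c(1)] \<theta> by (simp add: Y_def)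
  qed
  have Ya: "Y (hist_add (r \<nu>) \<chi> \<xi>) = hist_add (r \<nu>) (Y \<chi>) (Y \<xi>)" if "\<chi> \<in> hist (r \<nu>) n" "\<xi> \<in> hist (r \<nu>) n" for \<chi> \<xi>
    using mult_add_distrib_mat_vec[OF Y0(1) histD(1)[OF that(1)] histD(1)[OF that(2)]]
    by (auto simp: Y_def hist_add_def fun_eq_iff)
  have Ys: "Y (hist_smult (r \<nu>) a \<chi>) = hist_smult (r \<nu>) a (Y \<chi>)" if "\<chi> \<in> hist (r \<nu>) n" for \<chi> a
    using mult_mat_vec[OF Y0(1) histD(1)[OF that]]
    by (auto simp: Y_def hist_smult_def fun_eq_iff)
  obtain C where C: "C \<ge> 0" "\<And>\<chi> \<omega>. \<chi> \<in> hist (r \<nu>) n \<Longrightarrow> \<omega> \<in> hist (r \<nu>) n \<Longrightarrow> \<bar>B \<chi> \<omega>\<bar> \<le> C * (hist_norm (r \<nu>) \<chi> * hist_norm (r \<nu>) \<omega>)"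
    using B(1) unfolding bounded_bilinear_form_def by blast
  have bnd: "\<bar>B (Y \<chi>) (Y \<omega>)\<bar> \<le> (C * (c * c)) * (hist_norm (r \<nu>) \<chi> * hist_norm (r \<nu>) \<omega>)"
    if "\<chi> \<in> hist (r \<nu>) n" "\<omega> \<in> hist (r \<nu>) n" for \<chi> \<omega>
  proof -
    have "hist_norm (r \<nu>) (Y \<chi>) * hist_norm (r \<nu>) (Y \<omega>) \<le> (c * hist_norm (r \<nu>) \<chi>) * (c * hist_norm (r \<nu>) \<omega>)"
      using that c(1) hist_norm_nonneg[OF rn] Yin by (intro mult_mono Yn) (auto intro!: mult_nonneg_nonneg)
    then have "C * (hist_norm (r \<nu>) (Y \<chi>) * hist_norm (r \<nu>) (Y \<omega>)) \<le> C * ((c * hist_norm (r \<nu>) \<chi>) * (c * hist_norm (r \<nu>) \<omega>))"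
      using C(1) by (rule mult_left_mono)
    then show ?thesis using C(2)[OF Yin[OF that(1)] Yin[OF that(2)]] by (simp add: ac_simps)
  qed
  have BY: "bounded_bilinear_form (r \<nu>) n (\<lambda>\<chi> \<omega>. B (Y \<chi>) (Y \<omega>))"
    unfolding bounded_bilinear_form_def
  proof (intro conjI ballI allI)
    show "\<exists>C\<ge>0. \<forall>\<chi>\<in>hist (r \<nu>) n. \<forall>\<omega>\<in>hist (r \<nu>) n. \<bar>B (Y \<chi>) (Y \<omega>)\<bar> \<le> C * (hist_norm (r \<nu>) \<chi> * hist_norm (r \<nu>) \<omega>)"
      using bnd C(1) c(1) by (intro exI[of _ "C * (c * c)"]) auto
  qed (use B(1) Yin Ya Ys in \<open>simp_all add: bounded_bilinear_form_def\<close>)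
  show ?thesis
  proof (rule C1_functional_bilinear[OF rn BY])
    fix \<chi> assume chi: "\<chi> \<in> hist (r \<nu>) n"
    have "(\<lambda>s. Y0 *\<^sub>v \<chi> (max (- r \<nu>) (min s 0))) = (\<lambda>s. Y \<chi> (max (- r \<nu>) (min s 0)))"
      using rn by (auto simp: Y_def)
    then show "storage \<eta> \<chi> = B (Y \<chi>) (Y \<chi>)"
      unfolding storage_def using B(2)[OF Yin[OF chi]] by simp
  qed
qed

end

theorem theorem4:
  fixes S :: delay_data and \<alpha> :: "nat \<Rightarrow> real"
  assumes "system_matrices S"
    and "kernel_decomposition S"
    and "cholesky_factors S"
    and "supply_parameters S"
  shows
    "(\<forall>P1 X P2 P3 Q R V W.
        (P1, X, P2, P3, Q, R, V, W) \<in> carrier (unknowns S) \<longrightarrow>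
        pos_def (four_block_mat P1 P2 P2\<^sup>T P3
          + diag_block_mat [0\<^sub>m (dim_x S) (dim_x S), bdiag S (\<lambda>i. 1\<^sub>m (f_dim S i) \<otimes>\<^sub>k Q i)]) \<longrightarrow>
        pos_def (bdiag S Q) \<longrightarrow>
        pos_def (bdiag S R) \<longrightarrow>
        neg_def (Sy (col_blk ([1\<^sub>m (dim_x S)] @ map (\<lambda>i. \<alpha> i \<cdot>\<^sub>m 1\<^sub>m (dim_x S)) [1..<Suc (\<beta> S)]
                        @ [0\<^sub>m (dim_w S + dim_z S) (dim_x S)])
                     * row_blk [- X, Pi_bold S X V W])
          + four_block_mat (0\<^sub>m (dim_x S) (dim_x S)) (P_bold S P1 P2) (P_bold S P1 P2)\<^sup>T
              (\<Phi> S P2 P3 Q R (Sigma_bold S X V W))) \<longrightarrow>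
        dissipative S (\<lambda>i. V i * minv X) (\<lambda>i. W i * (1\<^sub>m (g_dim S i) \<otimes>\<^sub>k minv X)) \<and>
        exp_stable S (\<lambda>i. V i * minv X) (\<lambda>i. W i * (1\<^sub>m (g_dim S i) \<otimes>\<^sub>k minv X)))
     \<and> real (num_scalar_unknowns S) =
         (0.5 * (real (d_tot S))\<^sup>2 + real (d_tot S) + real (num_delays S) + 1) * (real (dim_x S))\<^sup>2
         + (0.5 * real (d_tot S) + real (num_delays S) + 1 + real (\<beta> S) * real (dim_u S))
             * real (dim_x S)"
proof -
  have S: "delay_system S" using assms by unfold_locales
  show ?thesis
  proof (intro conjI allI impI)
    fix P1 X P2 P3 Q R V W
    assume "(P1, X, P2, P3, Q, R, V, W) \<in> carrier (unknowns S)"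
      "pos_def (four_block_mat P1 P2 P2\<^sup>T P3
          + diag_block_mat [0\<^sub>m (dim_x S) (dim_x S), bdiag S (\<lambda>i. 1\<^sub>m (f_dim S i) \<otimes>\<^sub>k Q i)])"
      "pos_def (bdiag S Q)" "pos_def (bdiag S R)"
      "neg_def (Sy (col_blk ([1\<^sub>m (dim_x S)] @ map (\<lambda>i. \<alpha> i \<cdot>\<^sub>m 1\<^sub>m (dim_x S)) [1..<Suc (\<beta> S)]
                        @ [0\<^sub>m (dim_w S + dim_z S) (dim_x S)])
                     * row_blk [- X, Pi_bold S X V W])
          + four_block_mat (0\<^sub>m (dim_x S) (dim_x S)) (P_bold S P1 P2) (P_bold S P1 P2)\<^sup>T
              (\<Phi> S P2 P3 Q R (Sigma_bold S X V W)))"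
    with S have "synthesis S \<alpha> P1 X P2 P3 Q R V W"
      unfolding synthesis_def synthesis_axioms_def by blast
    then interpret synthesis S \<alpha> P1 X P2 P3 Q R V W .
    show "dissipative S (\<lambda>i. V i * minv X) (\<lambda>i. W i * (1\<^sub>m (g_dim S i) \<otimes>\<^sub>k minv X))"
      by (rule dissipative_closed_loop[OF storage_C1])
    show "exp_stable S (\<lambda>i. V i * minv X) (\<lambda>i. W i * (1\<^sub>m (g_dim S i) \<otimes>\<^sub>k minv X))"
      by (rule exp_stable_closed_loop)
  qed (rule delay_system.card_unknowns[OF S])
qed

end
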